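(* Let $n\geq3$. Fix $\tau\in\mathcal I_n$ and an initial quantitative pinching constant $\alpha_0^{\mathrm{in}}>0$. There exist surgery parameters $B>1$ and $0<\delta_0<1$, and constants $\varepsilon_b>0$, $k_b\geq2$, $L_b\geq40$, $r_b>0$, together with $0<\alpha_0^*\leq\alpha_0^{\mathrm{in}}$ and $c_b>0$, depending only on $n$, $\tau$, $\alpha_0^{\mathrm{in}}$, and the fixed standard cap, with the following property. Suppose that a standard replacement is performed in $\mathbb H^{n+1}$ on an $(\varepsilon,k,L)$-neck of radius $r$ satisfying $$\varepsilon\leq\varepsilon_b,\qquad k\geq k_b,\qquad L\geq L_b,\qquad r\leq r_b,$$ and suppose that on the incoming neck the reduced pinching inequality $$P_{ij}^{(\tau)}\geq\alpha_0^*H|\lambda_p-\lambda_q|$$ holds for every $i\neq j$ and all $p,q$. Then every changed point after surgery satisfies $$\widetilde P_{ij}^{(\tau)}\geq\alpha_0^*\widetilde H|\widetilde\lambda_p-\widetilde\lambda_q|$$ for every $i\neq j$ and all $p,q$. Moreover, $$\widetilde P_{ij}^{(\tau)}\geq c_br^{-2},\qquad \widetilde H\geq c_br^{-1}$$ throughout the changed region. Here tildes denote the quantities of the hypersurface after surgery.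
   Context: The ambient space is hyperbolic space $\mathbb H^{n+1}$ of sectional curvature $-1$. For a two-sided immersed hypersurface $M$ with unit normal $\nu$ and induced metric $g$: $h_{ij}=\bar g(\bar\nabla_{\partial_i}\nu,\partial_j)$, $\lambda_1,\dots,\lambda_n$ are the principal curvatures, $H=\sum_i\lambda_i$ (the normal is chosen so that $H>0$), and $P_{ij}^{(\tau)}=H(\lambda_i+\lambda_j)-\lambda_i^2-\lambda_j^2-\tau\lambda_i\lambda_j-(2(n-1)-\tau)$ for $i\neq j$. Let $\mathcal I_3=[0,2)$, $\mathcal I_n=[0,2]$ for $n\geq4$. **Necks.** A point $p\in M$ is the center of an $(\varepsilon,k,L)$-neck of radius $r$ if there are an embedding $N:\mathbb S^{n-1}\times(-L,L)\to M$ and $\omega_0$ with $N(\omega_0,0)=p$ such that, after pulling $X\circ N$ back by $\exp_{X(p)}^{-1}$, rescaling lengths by $r^{-1}$, and applying a Euclidean rigid motion, the resulting immersion is $\varepsilon$-close in $C^k$ to the standard cylinder $\mathbb S^{n-1}(1)\times(-L,L)\subset\mathbb R^{n+1}$. All necks used for surgery are normal, i.e. parametrized in the canonical Hamilton/Huisken–Sinestrari form: each cross section $\Sigma_z=N(\mathbb S^{n-1}\times\{z\})$ has constant mean curvature in $(M,g)$; $N$ restricted to each standard sphere $\mathbb S^{n-1}\times\{z\}$ is harmonic into $\Sigma_z$ (and, if $n=3$, the center of mass of the pulled-back metric on $\mathbb S^2\subset\mathbb R^3$ is the origin); the $g$-volume of $\mathbb S^{n-1}\times[v,w]$ equals $|\mathbb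 S^{n-1}|\int_v^wr(z)^n\,dz$ where $|\Sigma_z|=|\mathbb S^{n-1}|r(z)^{n-1}$; and $\int_{\mathbb S^{n-1}\times\{z\}}\bar g(V,U)\,d\bar\mu=0$ for every Killing field $V$ of the round sphere, where $\bar g$ is the standard cylinder metric and $U$ is the $g$-unit normal field of $\Sigma_z$ in the neck. **Standard replacement (Huisken–Sinestrari standard surgery) with parameters $B,\delta_0$ and a fixed standard cap.** Given a normal neck of radius $r$ with $L\geq40$, pull it back to the tangent space at its center by the exponential map. Cut along the central slice $s=0$ and on each half use $z=40-|s|\in(0,40]$. Points with $z\leq10$ are unchanged. For $z>10$ put $u(z)=r\exp(-B/(z-10))$ and replace $N(\omega,z)$ by $\widetilde N(\omega,z)=N(\omega,z)-\delta_0u(z)\nu(\omega,z)$. On $z\in[20,30]$ interpolate, using a fixed nonincreasing cutoff (equal to $1$ for $z\leq20$ and $0$ for $z\geq30$), between $\widetilde N$ and the rotationally symmetric hypersurface obtained by applying the same bending to the straight round cylinder best approximating the neck at its central slice. On $z\in[30,40]$ close this rotationally symmetric hypersurface off smoothly by the fixed rotationally symmetric strictly convex cap (rescaled to size $r$). Then map back to $\mathbb H^{n+1}$ by the exponential map. The changed region is the set of points of the new hypersurface with $z>10$. *)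

theory Defs
  imports "HOL-Analysis.Analysis"
begin

text \<open>
  Conventions. The dimension is \<open>n = DIM('a)\<close>, so that \<open>sphere 0 1 :: 'a set\<close> is the
  sphere of dimension \<open>n - 1\<close> and \<open>'a \<times> real\<close> is Euclidean space of dimension \<open>n + 1\<close>.
  Hyperbolic space of dimension \<open>n + 1\<close> is the upper sheet of the hyperboloid in the Lorentzian
  space \<open>('a \<times> real) \<times> real\<close>.

  A hypersurface is given by a map \<open>X\<close> on a parameter space \<open>'p\<close>, together with a
  function \<open>T\<close> assigning to every parameter the tangent space of the parameter domain. Two
  parameter domains occur: discs in \<open>'a\<close>, with \<open>T = (\<lambda>_. UNIV)\<close>, and the cylinder
  \<open>sphere 0 1 \<times> {-L<..<L}\<close> inside \<open>'a \<times> real\<close>. Maps on the cylinder are differentiated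
  after extending them to be constant along the rays of \<open>'a\<close>; for tangential directions this
  is the intrinsic derivative.
\<close>

subsection \<open>Derivatives and smooth maps\<close>

definition D :: "('p::real_normed_vector \<Rightarrow> 'v::real_normed_vector) \<Rightarrow> 'p \<Rightarrow> 'p \<Rightarrow> 'v" where
  "D f x v = frechet_derivative f (at x) v"

fun iter_D :: "('p::real_normed_vector \<Rightarrow> 'v::real_normed_vector) \<Rightarrow> 'p list \<Rightarrow> 'p \<Rightarrow> 'v" where
  "iter_D f [] = f"
| "iter_D f (v # vs) = (\<lambda>x. D (iter_D f vs) x v)"

text \<open>For open \<open>S\<close> this is the class of infinitely differentiable maps.\<close>

definition smooth_on :: "'p::real_normed_vector set \<Rightarrow> ('p \<Rightarrow> 'v::real_normed_vector) \<Rightarrow> bool" where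
  "smooth_on S f \<longleftrightarrow> (\<forall>vs. \<forall>x\<in>S. iter_D f vs differentiable (at x))"

definition radial :: "('a::real_normed_vector \<times> real \<Rightarrow> 'v) \<Rightarrow> 'a \<times> real \<Rightarrow> 'v" where
  "radial f = (\<lambda>(x, s). f (x /\<^sub>R norm x, s))"

subsection \<open>Hyperbolic space\<close>

definition lor :: "'b::real_inner \<times> real \<Rightarrow> 'b \<times> real \<Rightarrow> real" where
  "lor v w = fst v \<bullet> fst w - snd v * snd w"

definition hyp :: "('b::real_inner \<times> real) set" where
  "hyp = {p. lor p p = -1 \<and> snd p > 0}"

definition htangent :: "'b::real_inner \<times> real \<Rightarrow> ('b \<times> real) set" where
  "htangent p = {v. lor p v = 0}"

definition hexp :: "'b::real_inner \<times> real \<Rightarrow> 'b \<times> real \<Rightarrow> 'b \<times> real" where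
  "hexp p v = (let t = sqrt (lor v v) in cosh t *\<^sub>R p + (sinh t / t) *\<^sub>R v)"

definition hlog :: "'b::real_inner \<times> real \<Rightarrow> 'b \<times> real \<Rightarrow> 'b \<times> real" where
  "hlog p q = (THE v. v \<in> htangent p \<and> hexp p v = q)"

subsection \<open>Curvature of hypersurfaces\<close>

text \<open>
  The ambient metric is a bilinear form \<open>b\<close> on a vector space: \<open>lor\<close> on the tangent spaces of the
  hyperboloid, \<open>lor\<close> on one fixed (Euclidean) tangent space \<open>htangent p\<close>, or the standard inner
  product. The ambient covariant derivative of a field along \<open>X\<close> is the ambient-tangential part
  of its flat derivative. Since \<open>D X x w\<close> is tangent to the ambient space, the normal part
  drops out of \<open>second_form\<close>.
\<close>

definition first_form ::
  "('v \<Rightarrow> 'v \<Rightarrow> real) \<Rightarrow> ('p::real_normed_vector \<Rightarrow> 'v::real_normed_vector) \<Rightarrow> 'p \<Rightarrow> 'p \<Rightarrow> 'p \<Rightarrow> real" where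
  "first_form b X x v w = b (D X x v) (D X x w)"

definition second_form ::
  "('v \<Rightarrow> 'v \<Rightarrow> real) \<Rightarrow> ('p::real_normed_vector \<Rightarrow> 'v::real_normed_vector) \<Rightarrow> ('p \<Rightarrow> 'v) \<Rightarrow> 'p \<Rightarrow> 'p \<Rightarrow> 'p \<Rightarrow> real" where
  "second_form b X \<nu> x v w = b (D \<nu> x v) (D X x w)"

text \<open>\<open>A x\<close> is the ambient tangent space at \<open>X x\<close>.\<close>

definition unit_normal_field ::
  "('v \<Rightarrow> 'v \<Rightarrow> real) \<Rightarrow> 'p set \<Rightarrow> ('p \<Rightarrow> 'p set) \<Rightarrow> ('p \<Rightarrow> 'v set)
    \<Rightarrow> ('p::real_normed_vector \<Rightarrow> 'v::real_normed_vector) \<Rightarrow> ('p \<Rightarrow> 'v) \<Rightarrow> bool" where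
  "unit_normal_field b S T A X \<nu> \<longleftrightarrow>
    (\<forall>x\<in>S. X differentiable (at x) \<and> inj_on (D X x) (T x) \<and>
       \<nu> differentiable (at x) \<and> \<nu> x \<in> A x \<and> b (\<nu> x) (\<nu> x) = 1 \<and>
       (\<forall>v\<in>T x. b (\<nu> x) (D X x v) = 0))"

definition orthonormal_frame :: "('p \<Rightarrow> 'p \<Rightarrow> real) \<Rightarrow> 'p set \<Rightarrow> nat \<Rightarrow> (nat \<Rightarrow> 'p) \<Rightarrow> bool" where
  "orthonormal_frame g V m e \<longleftrightarrow>
    (\<forall>i<m. e i \<in> V) \<and> (\<forall>i<m. \<forall>j<m. g (e i) (e j) = (if i = j then 1 else 0))"

text \<open>\<open>lam 0, \<dots>, lam (m - 1)\<close> are the principal curvatures at \<open>x\<close>, with multiplicity and in some order.\<close>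

definition principal_curvatures ::
  "('v \<Rightarrow> 'v \<Rightarrow> real) \<Rightarrow> ('p \<Rightarrow> 'p set) \<Rightarrow> ('p::real_normed_vector \<Rightarrow> 'v::real_normed_vector)
    \<Rightarrow> ('p \<Rightarrow> 'v) \<Rightarrow> 'p \<Rightarrow> nat \<Rightarrow> (nat \<Rightarrow> real) \<Rightarrow> bool" where
  "principal_curvatures b T X \<nu> x m lam \<longleftrightarrow>
    (\<exists>e. orthonormal_frame (first_form b X x) (T x) m e \<and>
       (\<forall>i<m. \<forall>j<m. second_form b X \<nu> x (e i) (e j) = (if i = j then lam i else 0)))"

definition mean_curv :: "nat \<Rightarrow> (nat \<Rightarrow> real) \<Rightarrow> real" where
  "mean_curv n lam = (\<Sum>i<n. lam i)"

definition P :: "nat \<Rightarrow> real \<Rightarrow> (nat \<Rightarrow> real) \<Rightarrow> nat \<Rightarrow> nat \<Rightarrow> real" where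
  "P n \<tau> lam i j = mean_curv n lam * (lam i + lam j) - (lam i)\<^sup>2 - (lam j)\<^sup>2
     - \<tau> * lam i * lam j - (2 * (real n - 1) - \<tau>)"

definition pinched :: "nat \<Rightarrow> real \<Rightarrow> real \<Rightarrow> (nat \<Rightarrow> real) \<Rightarrow> bool" where
  "pinched n \<tau> \<alpha> lam \<longleftrightarrow>
    (\<forall>i<n. \<forall>j<n. i \<noteq> j \<longrightarrow>
      (\<forall>p<n. \<forall>q<n. P n \<tau> lam i j \<ge> \<alpha> * mean_curv n lam * \<bar>lam p - lam q\<bar>))"

definition tau_range :: "nat \<Rightarrow> real set" where
  "tau_range n = (if n = 3 then {0..<2} else {0..2})"

subsection \<open>Geometry of cylinders and their cross sections\<close>

definition cyl :: "real \<Rightarrow> ('a::euclidean_space \<times> real) set" where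
  "cyl L = sphere 0 1 \<times> {-L<..<L}"

definition cyl_tangent :: "'a::euclidean_space \<times> real \<Rightarrow> ('a \<times> real) set" where
  "cyl_tangent x = {v. fst v \<bullet> fst x = 0}"

definition slice_tangent :: "'a::euclidean_space \<times> real \<Rightarrow> ('a \<times> real) set" where
  "slice_tangent x = {v. fst v \<bullet> fst x = 0 \<and> snd v = 0}"

text \<open>
  Integration over the unit sphere with respect to its standard measure, in polar coordinates:
  the measure of a subset of the sphere is \<open>DIM('a)\<close> times the volume of the cone over it.
\<close>

definition sphere_integral :: "('a::euclidean_space \<Rightarrow> 'v::euclidean_space) \<Rightarrow> 'v" where
  "sphere_integral f = real DIM('a) *\<^sub>R integral (ball 0 1) (\<lambda>x. f (x /\<^sub>R norm x))"

definition sphere_area :: "'a::euclidean_space itself \<Rightarrow> real" where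
  "sphere_area _ = sphere_integral (\<lambda>\<omega>::'a. 1)"

definition gram_det :: "nat \<Rightarrow> (nat \<Rightarrow> nat \<Rightarrow> real) \<Rightarrow> real" where
  "gram_det m G = (\<Sum>\<pi> | \<pi> permutes {..<m}. of_int (sign \<pi>) * (\<Prod>i<m. G i (\<pi> i)))"

text \<open>
  Density at \<open>x\<close> of the volume induced by \<open>X\<close> on the \<open>m\<close>-dimensional tangent space
  \<open>T x\<close>, relative to the volume of the standard inner product.
\<close>

definition vol_density ::
  "('p \<Rightarrow> 'p set) \<Rightarrow> nat \<Rightarrow> ('p::real_inner \<Rightarrow> 'b::real_inner \<times> real) \<Rightarrow> 'p \<Rightarrow> real" where
  "vol_density T m X x = (THE J. \<exists>e. orthonormal_frame (\<bullet>) (T x) m e \<and>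
     J = sqrt (gram_det m (\<lambda>i j. first_form lor X x (e i) (e j))))"

definition slice_density :: "('a::euclidean_space \<times> real \<Rightarrow> 'b::real_inner \<times> real) \<Rightarrow> 'a \<times> real \<Rightarrow> real" where
  "slice_density = vol_density slice_tangent (DIM('a) - 1)"

text \<open>
  The unit normal of the cross section inside the hypersurface \<open>X\<close>, pointing to increasing \<open>s\<close>:
  as a tangent vector of the cylinder, and as an ambient vector.
\<close>

definition slice_normal ::
  "('a::euclidean_space \<times> real \<Rightarrow> 'b::real_inner \<times> real) \<Rightarrow> 'a \<times> real \<Rightarrow> 'a \<times> real" where
  "slice_normal X x = (THE u. u \<in> cyl_tangent x \<and> snd u > 0 \<and> first_form lor X x u u = 1 \<and>
     (\<forall>v\<in>slice_tangent x. first_form lor X x u v = 0))"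

definition slice_normal_vec ::
  "('a::euclidean_space \<times> real \<Rightarrow> 'b::real_inner \<times> real) \<Rightarrow> 'a \<times> real \<Rightarrow> 'b \<times> real" where
  "slice_normal_vec X x = D X x (slice_normal X x)"

definition slice_mean_curvature ::
  "('a::euclidean_space \<times> real \<Rightarrow> 'b::real_inner \<times> real) \<Rightarrow> 'a \<times> real \<Rightarrow> real" where
  "slice_mean_curvature X x = (THE h. \<exists>e.
     orthonormal_frame (first_form lor X x) (slice_tangent x) (DIM('a) - 1) e \<and>
     h = (\<Sum>i<DIM('a) - 1. second_form lor X (radial (slice_normal_vec X)) x (e i) (e i)))"

definition killing_on_sphere :: "('a::euclidean_space \<Rightarrow> 'a) \<Rightarrow> bool" where
  "killing_on_sphere V \<longleftrightarrow>
    (let V' = (\<lambda>x. V (x /\<^sub>R norm x)) in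
      smooth_on (- {0}) V' \<and>
      (\<forall>\<omega>\<in>sphere 0 1. V \<omega> \<bullet> \<omega> = 0 \<and>
        (\<forall>v w. v \<bullet> \<omega> = 0 \<and> w \<bullet> \<omega> = 0 \<longrightarrow> D V' \<omega> v \<bullet> w + D V' \<omega> w \<bullet> v = 0)))"

definition mean_radius ::
  "('a::euclidean_space \<times> real \<Rightarrow> 'b::real_inner \<times> real) \<Rightarrow> real \<Rightarrow> real" where
  "mean_radius X z =
     root (DIM('a) - 1) (sphere_integral (\<lambda>\<omega>. slice_density X (\<omega>, z)) / sphere_area TYPE('a))"

subsection \<open>Necks\<close>

text \<open>
  \<open>N\<close> is the composition of the embedding of the cylinder into the hypersurface with the
  immersion of the hypersurface into hyperbolic space; \<open>\<nu>\<close> is the unit normal along it, chosen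
  so that the mean curvature is positive.
\<close>

definition immersed_cylinder ::
  "real \<Rightarrow> ('a::euclidean_space \<times> real \<Rightarrow> ('a \<times> real) \<times> real)
    \<Rightarrow> ('a \<times> real \<Rightarrow> ('a \<times> real) \<times> real) \<Rightarrow> bool" where
  "immersed_cylinder L N \<nu> \<longleftrightarrow>
     N ` cyl L \<subseteq> hyp \<and>
     smooth_on ((- {0}) \<times> {-L<..<L}) (radial N) \<and>
     unit_normal_field lor (cyl L) cyl_tangent (\<lambda>x. htangent (N x)) (radial N) (radial \<nu>) \<and>
     (\<forall>x\<in>cyl L. \<forall>lam. principal_curvatures lor cyl_tangent (radial N) (radial \<nu>) x DIM('a) lam
        \<longrightarrow> mean_curv DIM('a) lam > 0)"

text \<open>
  The linear isometry \<open>R\<close> from the tangent space at the center to \<open>'a \<times> real\<close> and the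
  translation by \<open>a\<close> form the rigid motion. Closeness bounds all covariant derivatives up to
  order \<open>k\<close> of the difference to the standard inclusion of the cylinder, expressed through the
  derivatives of the radial extension.
\<close>

definition neck_at ::
  "'a::euclidean_space \<Rightarrow> real \<Rightarrow> nat \<Rightarrow> real \<Rightarrow> real \<Rightarrow> ('a \<times> real \<Rightarrow> ('a \<times> real) \<times> real) \<Rightarrow> bool" where
  "neck_at \<omega>\<^sub>0 \<epsilon> k L r N \<longleftrightarrow>
     0 < \<epsilon> \<and> 0 < L \<and> 0 < r \<and> \<omega>\<^sub>0 \<in> sphere 0 1 \<and>
     (let p = N (\<omega>\<^sub>0, 0) in
      \<exists>R a. linear R \<and> (\<forall>v\<in>htangent p. \<forall>w\<in>htangent p. R v \<bullet> R w = lor v w) \<and>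
        (\<forall>x\<in>cyl L. \<forall>vs. length vs \<le> k \<and> (\<forall>v\<in>set vs. norm v \<le> 1) \<longrightarrow>
           norm (iter_D (radial (\<lambda>x. a + R (hlog p (N x) /\<^sub>R r) - x)) vs x) \<le> \<epsilon>))"

text \<open>
  The tension field of the restriction of \<open>N\<close> to a standard sphere, as a map into the cross
  section, is the tangential part of the componentwise Laplacian of the sphere, and the latter
  is the flat Laplacian of the radial extension. The metric \<open>g\<close> is the one induced by \<open>N\<close>.
\<close>

definition normal_neck ::
  "real \<Rightarrow> ('a::euclidean_space \<times> real \<Rightarrow> ('a \<times> real) \<times> real) \<Rightarrow> bool" where
  "normal_neck L N \<longleftrightarrow> (let X = radial N in
     (\<forall>z\<in>{-L<..<L}. \<exists>c. \<forall>\<omega>\<in>sphere 0 1. slice_mean_curvature X (\<omega>, z) = c) \<and>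
     (\<forall>x\<in>cyl L. \<forall>v\<in>slice_tangent x.
        lor (\<Sum>i\<in>Basis. iter_D X [(i, 0), (i, 0)] x) (D X x v) = 0) \<and>
     (DIM('a) = 3 \<longrightarrow>
        (\<forall>z\<in>{-L<..<L}. sphere_integral (\<lambda>\<omega>. slice_density X (\<omega>, z) *\<^sub>R \<omega>) = 0)) \<and>
     (\<forall>v w. -L < v \<and> v \<le> w \<and> w < L \<longrightarrow>
        integral {v..w} (\<lambda>z. sphere_integral (\<lambda>\<omega>. vol_density cyl_tangent DIM('a) X (\<omega>, z)))
          = sphere_area TYPE('a) * integral {v..w} (\<lambda>z. mean_radius X z ^ DIM('a))) \<and>
     (\<forall>z\<in>{-L<..<L}. \<forall>V. killing_on_sphere V \<longrightarrow>
        sphere_integral (\<lambda>\<omega>. V \<omega> \<bullet> fst (slice_normal X (\<omega>, z))) = 0))"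

subsection \<open>Standard replacement\<close>

definition cutoff :: "(real \<Rightarrow> real) \<Rightarrow> bool" where
  "cutoff \<phi> \<longleftrightarrow> smooth_on UNIV \<phi> \<and> antimono \<phi> \<and> (\<forall>z\<le>20. \<phi> z = 1) \<and> (\<forall>z\<ge>30. \<phi> z = 0)"

definition bend :: "real \<Rightarrow> real \<Rightarrow> real" where
  "bend B z = (if z \<le> 10 then 0 else exp (- B / (z - 10)))"

text \<open>
  Generating curve (distance from the axis, position along the axis), at unit scale, of the bent
  straight cylinder for \<open>z \<le> 30\<close>, continued by the cap \<open>\<gamma>\<close> for \<open>30 < z \<le> 40\<close>. The
  hypersurface of revolution, with its pole at \<open>z = 40\<close>, is parametrized by the disc of radius
  \<open>40\<close>, where \<open>z = 40 - norm y\<close>.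
\<close>

definition profile :: "real \<Rightarrow> real \<Rightarrow> (real \<Rightarrow> real \<times> real) \<Rightarrow> real \<Rightarrow> real \<times> real" where
  "profile B \<delta> \<gamma> z = (if z \<le> 30 then (1 - \<delta> * bend B z, z) else \<gamma> z)"

definition revolve :: "(real \<Rightarrow> real \<times> real) \<Rightarrow> 'a::euclidean_space \<Rightarrow> 'a \<times> real" where
  "revolve c y = (fst (c (40 - norm y)) *\<^sub>R (y /\<^sub>R norm y), snd (c (40 - norm y)))"

text \<open>
  \<open>\<gamma>\<close> closes the bent cylinder off smoothly by a strictly convex cap contained in its half
  of the neck.
\<close>

definition closes_off :: "'a::euclidean_space itself \<Rightarrow> real \<Rightarrow> real \<Rightarrow> (real \<Rightarrow> real \<times> real) \<Rightarrow> bool" where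
  "closes_off _ B \<delta> \<gamma> \<longleftrightarrow>
     (\<forall>z. 30 < z \<and> z < 40 \<longrightarrow> fst (\<gamma> z) > 0) \<and> fst (\<gamma> 40) = 0 \<and>
     (\<forall>z. 30 < z \<and> z \<le> 40 \<longrightarrow> snd (\<gamma> z) \<le> 40) \<and>
     (let K = (revolve (profile B \<delta> \<gamma>) :: 'a \<Rightarrow> 'a \<times> real) in
       smooth_on (ball 0 40) K \<and>
       (\<exists>\<nu>. unit_normal_field (\<bullet>) (cball 0 10) (\<lambda>_. UNIV) (\<lambda>_. UNIV) K \<nu> \<and>
         (\<forall>y\<in>cball 0 10. \<forall>v. v \<noteq> 0 \<longrightarrow> second_form (\<bullet>) K \<nu> y v v > 0)))"

text \<open>
  A smooth strictly convex cap has to match all derivatives of the bent cylinder at \<open>z = 30\<close>,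
  so a fixed choice of standard cap assigns a cap to each pair of parameters, for all large
  \<open>B\<close> and small \<open>\<delta>\<close>.
\<close>

definition standard_cap :: "'a::euclidean_space itself \<Rightarrow> (real \<Rightarrow> real \<Rightarrow> real \<Rightarrow> real \<times> real) \<Rightarrow> bool" where
  "standard_cap T cap \<longleftrightarrow>
     (\<exists>B\<^sub>1 \<delta>\<^sub>1. 0 < \<delta>\<^sub>1 \<and> (\<forall>B \<delta>. B\<^sub>1 \<le> B \<and> 0 < \<delta> \<and> \<delta> \<le> \<delta>\<^sub>1 \<longrightarrow> closes_off T B \<delta> (cap B \<delta>)))"

text \<open>
  \<open>W\<close> is the neck in the tangent space at its center \<open>p\<close>. The approximating cylinder
  \<open>(\<omega>, s) \<mapsto> c + r A (\<omega>, s)\<close> has the radius of the neck; its axis passes through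
  the center of mass of the central slice and is parallel to the average of the unit normal of
  that slice. The remaining rotation is the one that best fits the parametrization of the
  slice in the square mean. All averages use the induced metric.
\<close>

definition cylinder_frame ::
  "('a::euclidean_space \<times> real) \<times> real \<Rightarrow> ('a \<times> real \<Rightarrow> ('a \<times> real) \<times> real)
    \<Rightarrow> ('a \<times> real \<Rightarrow> ('a \<times> real) \<times> real) \<Rightarrow> bool" where
  "cylinder_frame p W A \<longleftrightarrow>
     linear A \<and> range A \<subseteq> htangent p \<and> (\<forall>v w. lor (A v) (A w) = v \<bullet> w) \<and>
     (let m = sphere_integral (\<lambda>\<omega>. slice_density (radial W) (\<omega>, 0) *\<^sub>R slice_normal_vec (radial W) (\<omega>, 0))
      in m \<noteq> 0 \<and> A (0, 1) = m /\<^sub>R sqrt (lor m m))"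

definition slice_center ::
  "('a::euclidean_space \<times> real \<Rightarrow> ('a \<times> real) \<times> real) \<Rightarrow> ('a \<times> real) \<times> real" where
  "slice_center W = sphere_integral (\<lambda>\<omega>. slice_density (radial W) (\<omega>, 0) *\<^sub>R W (\<omega>, 0))
     /\<^sub>R sphere_integral (\<lambda>\<omega>. slice_density (radial W) (\<omega>, 0))"

definition fit_error ::
  "real \<Rightarrow> ('a::euclidean_space \<times> real \<Rightarrow> ('a \<times> real) \<times> real)
    \<Rightarrow> ('a \<times> real \<Rightarrow> ('a \<times> real) \<times> real) \<Rightarrow> real" where
  "fit_error r W A = sphere_integral (\<lambda>\<omega>.
     let d = W (\<omega>, 0) - (slice_center W + r *\<^sub>R A (\<omega>, 0)) in slice_density (radial W) (\<omega>, 0) * lor d d)"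

definition best_cylinder ::
  "('a::euclidean_space \<times> real) \<times> real \<Rightarrow> real \<Rightarrow> ('a \<times> real \<Rightarrow> ('a \<times> real) \<times> real)
    \<Rightarrow> ('a \<times> real \<Rightarrow> ('a \<times> real) \<times> real) \<Rightarrow> bool" where
  "best_cylinder p r W A \<longleftrightarrow> cylinder_frame p W A \<and>
     (\<forall>A'. cylinder_frame p W A' \<longrightarrow> fit_error r W A \<le> fit_error r W A')"

text \<open>
  After surgery the half \<open>\<sigma> s > 0\<close> of the neck, \<open>\<sigma> = 1\<close> or \<open>\<sigma> = -1\<close>, is closed off to a
  disc, which \<open>F \<sigma>\<close> parametrizes over \<open>ball 0 40\<close>. The neck coordinates of
  \<open>y \<noteq> 0\<close> are \<open>\<omega> = y / norm y\<close> and \<open>s = \<sigma> norm y\<close>, hence \<open>z = 40 - norm y\<close>; the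
  pole of the cap is \<open>y = 0\<close>. Here \<open>bent\<close> is the bent neck and \<open>model\<close> the bent
  straight cylinder with its cap. The normal \<open>\<nu>'\<close> used for bending is the one in the Euclidean
  tangent space with positive mean curvature, that is, the outward one.
\<close>

definition standard_replacement ::
  "real \<Rightarrow> real \<Rightarrow> (real \<Rightarrow> real) \<Rightarrow> (real \<Rightarrow> real \<times> real) \<Rightarrow> 'a::euclidean_space \<Rightarrow> real \<Rightarrow> real
    \<Rightarrow> ('a \<times> real \<Rightarrow> ('a \<times> real) \<times> real) \<Rightarrow> (real \<Rightarrow> 'a \<Rightarrow> ('a \<times> real) \<times> real) \<Rightarrow> bool" where
  "standard_replacement B \<delta> \<phi> \<gamma> \<omega>\<^sub>0 L r N F \<longleftrightarrow>
     40 \<le> L \<and> normal_neck L N \<and>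
     (let p = N (\<omega>\<^sub>0, 0); W = (\<lambda>x. hlog p (N x)) in
      \<exists>\<nu>' A.
        unit_normal_field lor (cyl L) cyl_tangent (\<lambda>_. htangent p) (radial W) (radial \<nu>') \<and>
        (\<forall>x\<in>cyl L. \<forall>lam. principal_curvatures lor cyl_tangent (radial W) (radial \<nu>') x DIM('a) lam
           \<longrightarrow> mean_curv DIM('a) lam > 0) \<and>
        best_cylinder p r W A \<and>
        (\<forall>\<sigma>\<in>{1, -1}. \<forall>y\<in>ball 0 40. F \<sigma> y = hexp p
           (let z = 40 - norm y;
                x = (y /\<^sub>R norm y, \<sigma> * norm y);
                bent = W x - (\<delta> * (r * bend B z)) *\<^sub>R \<nu>' x;
                m = revolve (profile B \<delta> \<gamma>) y;
                model = slice_center W + r *\<^sub>R A (fst m, \<sigma> * (40 - snd m))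
            in if z \<le> 20 then bent
               else if z \<le> 30 then \<phi> z *\<^sub>R bent + (1 - \<phi> z) *\<^sub>R model
               else model)))"

text \<open>The changed points, those with \<open>z > 10\<close>, in the disc coordinate.\<close>

definition changed_region :: "'a::euclidean_space set" where
  "changed_region = {y. norm y < 40 \<and> 40 - norm y > 10}"

end

theory Submission
 imports "Jordan_Normal_Form.Determinant" Defs
begin

text \<open>
 At the scale of its radius a thin neck is close to a round cylinder: \<open>n - 1\<close> principal curvatures are
 close to one and the last one is close to zero. There the quantities \<open>P\<close> are bounded below, even if
 one curvature is slightly negative. The surgery replaces the neck by a small perturbation of a surface
 that consists of such a cylinder and a strictly convex cap, and on the cap all principal curvatures are
 bounded below. Since the ambient curvature contributes only a bounded term to \<open>P\<close>, it is
 negligible against \<open>r\<close> to the power \<open>-2\<close>, and the pinching inequality holds with a small constant,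
 which may be chosen last (lemma \<open>pinching_at_scale\<close>). The geometric work is to show that the new
 surface is close in \<open>C\<^sup>2\<close> to the comparison surface and that this suffices.

 First, a hypersurface of size \<open>r\<close> in hyperbolic space is compared with its preimage in the tangent
 space, scaled by the inverse of \<open>r\<close>. In the hyperboloid model the exponential map is
 entire, and at scale \<open>r\<close> it differs from the inclusion of the tangent space by a relative error of
 order \<open>r\<close>. Hence normals and both fundamental forms are Euclidean up to \<open>O(r)\<close>
 (\<open>forms_close\<close>, \<open>principal_frame\<close>).

 Second, the approximating cylinder in the definition of the surgery has to be close to the neck. Its
 center and its axis are averages over the central slice and can be estimated directly. Its rotation minimizes
 a mean square error, which is compared with that of a competitor obtained from two reflections (\<open>shift_small\<close>, \<open>axis_close\<close>, \<open>rotation_close\<close>).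

 Third, two comparison surfaces are used. Where the neck is only bent and interpolated, the new
 surface is the standard cylinder plus an error of size \<open>O(\<epsilon> + \<delta>)\<close>, because bending with
 parameter \<open>\<delta>\<close> is itself a small perturbation (\<open>annulus_error\<close>, \<open>near_cylinder\<close>). On the
 cap it is an isometric image of the fixed cap, and compactness gives all constants (\<open>cap_data\<close>,
 \<open>near_cap\<close>). The constants of the cap depend on \<open>\<delta>\<close>, so those of the cylinder are chosen first,
 then \<open>\<delta>\<close>, then the constants of the cap, and finally the bounds for the neck error and the radius. On the
 sphere where the cap begins the normals of both surfaces point to the same side, since there the parallel
 sphere curves towards the axis (\<open>cap_boundary_normal\<close>); this gives one normal field on the whole disc
 (\<open>global_normal\<close>, \<open>glue_regions\<close>).
\<close>

(* The dot denotes the inner product throughout. *)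
no_notation Matrix.scalar_prod (infix "\<bullet>" 70)
hide_const (open) Matrix.orthogonal Matrix.vec Matrix.dim_vec Matrix.mat Matrix.unit_vec Matrix.diag_mat
hide_fact (open) Matrix.orthogonal_def

section \<open>Finite differentiability and pointwise derivative bounds\<close>

text \<open>The derivative along \<open>w\<close>, differentiated once more.\<close>

abbreviation D2 :: "('p::real_normed_vector => 'v::real_normed_vector) => 'p => 'p => 'p => 'v" where
 "D2 f w \<equiv> D (\<lambda>z. D f z w)"

lemma D_eq: "(f has_derivative f') (at x) ==> D f x = f'"
 using frechet_derivative_at[of f f' x] by (auto simp: D_def fun_eq_iff)

lemma D_works: "f differentiable (at x) ==> (f has_derivative D f x) (at x)"
proof -
 assume "f differentiable (at x)"
 moreover have "D f x = frechet_derivative f (at x)" by (auto simp: D_def fun_eq_iff)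
 ultimately show ?thesis using frechet_derivative_works[of f "at x"] by simp
qed

lemma D_linear: "f differentiable (at x) ==> linear (D f x)"
 using D_works has_derivative_linear by blast

lemma D_cong:
 assumes "open S" "x \<in> S" "\<And>y. y \<in> S ==> f y = g y"
 shows "D f x = D g x"
proof -
 have "(f has_derivative f') (at x) = (g has_derivative f') (at x)" for f'
  using has_derivative_transform_within_open[OF _ assms(1,2), where f=f and g=g and f'=f' and t=UNIV]
   has_derivative_transform_within_open[OF _ assms(1,2), where f=g and g=f and f'=f' and t=UNIV] assms(3) by auto
 thus ?thesis by (auto simp: D_def frechet_derivative_def fun_eq_iff)
qed

lemma differentiable_cong_open:
 assumes "open S" "x \<in> S" "\<And>y. y \<in> S ==> f y = g y" "f differentiable (at x)"
 shows "g differentiable (at x)"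
 using assms has_derivative_transform_within_open[OF _ assms(1,2), where f=f and g=g and t=UNIV]
 unfolding differentiable_def by blast

lemma D_expand:
 fixes f :: "'p::euclidean_space => 'v::real_normed_vector"
 assumes "f differentiable (at x)"
 shows "D f x v = (\<Sum>b\<in>Basis. (v \<bullet> b) *\<^sub>R D f x b)"
proof -
 interpret linear "D f x" using D_linear[OF assms] .
 have "D f x v = D f x (\<Sum>b\<in>Basis. (v \<bullet> b) *\<^sub>R b)" by (simp add: euclidean_representation)
 also have "\<dots> = (\<Sum>b\<in>Basis. (v \<bullet> b) *\<^sub>R D f x b)" by (simp add: sum scale)
 finally show ?thesis .
qed

lemma D_compose:
 assumes "f differentiable (at x)" "g differentiable (at (f x))"
 shows "D (\<lambda>y. g (f y)) x v = D g (f x) (D f x v)"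
  and "(\<lambda>y. g (f y)) differentiable (at x)"
proof -
 have *: "((\<lambda>y. g (f y)) has_derivative (\<lambda>v. D g (f x) (D f x v))) (at x)"
  using has_derivative_compose[OF D_works[OF assms(1)] D_works[OF assms(2)]] .
 show "D (\<lambda>y. g (f y)) x v = D g (f x) (D f x v)" using D_eq[OF *] by simp
 show "(\<lambda>y. g (f y)) differentiable (at x)" using * by (auto simp: differentiable_def)
qed

lemma D_bilinear:
 assumes "bounded_bilinear pr" "f differentiable (at x)" "g differentiable (at x)"
 shows "D (\<lambda>y. pr (f y) (g y)) x v = pr (f x) (D g x v) + pr (D f x v) (g x)"
  and "(\<lambda>y. pr (f y) (g y)) differentiable (at x)"
proof -
 have *: "((\<lambda>y. pr (f y) (g y)) has_derivative (\<lambda>v. pr (f x) (D g x v) + pr (D f x v) (g x))) (at x)"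
  using bounded_bilinear.FDERIV[OF assms(1) D_works[OF assms(2)] D_works[OF assms(3)]] .
 show "D (\<lambda>y. pr (f y) (g y)) x v = pr (f x) (D g x v) + pr (D f x v) (g x)"
  using D_eq[OF *] by simp
 show "(\<lambda>y. pr (f y) (g y)) differentiable (at x)" using * by (auto simp: differentiable_def)
qed

lemma D_add:
 assumes "f differentiable (at x)" "g differentiable (at x)"
 shows "D (\<lambda>y. f y + g y) x v = D f x v + D g x v"
 using D_eq[OF has_derivative_add[OF D_works[OF assms(1)] D_works[OF assms(2)]]] by simp

lemma D_bounded_linear:
 assumes "bounded_linear L" "f differentiable (at x)"
 shows "D (\<lambda>y. L (f y)) x v = L (D f x v)" and "(\<lambda>y. L (f y)) differentiable (at x)"
proof -
 have *: "((\<lambda>y. L (f y)) has_derivative (\<lambda>v. L (D f x v))) (at x)"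
  using bounded_linear.has_derivative[OF assms(1) D_works[OF assms(2)]] .
 show "D (\<lambda>y. L (f y)) x v = L (D f x v)" using D_eq[OF *] by simp
 show "(\<lambda>y. L (f y)) differentiable (at x)" using * by (auto simp: differentiable_def)
qed

lemma D_const [simp]: "D (\<lambda>y. c) x v = 0"
 using D_eq[OF has_derivative_const[of c "at x"]] by simp

lemma D_of_linear: "bounded_linear L ==> D L x v = L v"
 using D_eq[OF bounded_linear_imp_has_derivative] by metis

text \<open>Derivatives are taken along the standard basis only, which keeps the codomain fixed along
 the recursion and determines all directional derivatives by linearity.\<close>

primrec Ck :: "nat => 'p::euclidean_space set => ('p => 'v::real_normed_vector) => bool" where
 "Ck 0 S f = True"
| "Ck (Suc k) S f = ((\<forall>x\<in>S. f differentiable (at x)) \<and> (\<forall>b\<in>Basis. Ck k S (\<lambda>x. D f x b)))"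

primrec bd :: "nat => ('p::euclidean_space => 'v::real_normed_vector) => 'p => real => bool" where
 "bd 0 f x M = (norm (f x) \<le> M)"
| "bd (Suc k) f x M = (norm (f x) \<le> M \<and> (\<forall>b\<in>Basis. bd k (\<lambda>x. D f x b) x M))"

lemma Ck_diff: "Ck (Suc k) S f ==> x \<in> S ==> f differentiable (at x)"
 by simp

lemma Ck_continuous: "Ck (Suc k) S f ==> continuous_on S f"
 by (auto intro!: continuous_at_imp_continuous_on differentiable_imp_continuous_within)

lemma Ck_subset: "Ck k S f ==> T \<subseteq> S ==> Ck k T f"
 by (induction k arbitrary: f) auto

lemma Ck_Suc_D: "Ck (Suc k) S f ==> Ck k S f"
 by (induction k arbitrary: f) auto

lemma Ck_mono: "Ck k S f ==> j \<le> k ==> Ck j S f"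
proof (induction k)
 case (Suc k)
 thus ?case using Ck_Suc_D[OF Suc.prems(1)] by (cases "j = Suc k") (auto simp del: Ck.simps)
qed simp

lemma Ck_cong:
 assumes "open S" "Ck k S f" "\<And>x. x \<in> S ==> f x = g x"
 shows "Ck k S g"
 using assms(2,3)
proof (induction k arbitrary: f g)
 case (Suc k)
 show ?case
 proof (simp, intro conjI ballI)
  fix x assume "x \<in> S"
  thus "g differentiable (at x)"
   using differentiable_cong_open[OF assms(1), of x f g] Suc.prems by auto
 next
  fix b :: 'a assume b: "b \<in> Basis"
  have "Ck k S (\<lambda>x. D f x b)" using Suc.prems b by simp
  moreover have "D f x b = D g x b" if "x \<in> S" for x
   using D_cong[OF assms(1) that Suc.prems(2)] by simp
  ultimately show "Ck k S (\<lambda>x. D g x b)" by (rule Suc.IH)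
 qed
qed auto

lemma Ck_const: "Ck k S (\<lambda>x. c)"
 by (induction k arbitrary: c) auto

lemma Ck_blin:
 assumes "open S" "bounded_linear L" "Ck k S f"
 shows "Ck k S (\<lambda>x. L (f x))"
 using assms(3)
proof (induction k arbitrary: f)
 case (Suc k)
 have "Ck k S (\<lambda>x. D (\<lambda>x. L (f x)) x b)" if b: "b \<in> Basis" for b
 proof (rule Ck_cong[OF assms(1)])
  show "Ck k S (\<lambda>x. L (D f x b))" using Suc.prems b by (intro Suc.IH) auto
  show "L (D f y b) = D (\<lambda>x. L (f x)) y b" if "y \<in> S" for y
   using D_bounded_linear(1)[OF assms(2), of f y b] Suc.prems that by simp
 qed
 moreover have "(\<lambda>x. L (f x)) differentiable (at x)" if "x \<in> S" for x
  using D_bounded_linear(2)[OF assms(2), of f x] Suc.prems that by simp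
 ultimately show ?case by simp
qed simp

lemma Ck_of_linear: "bounded_linear L ==> Ck k S L"
 by (cases k) (auto simp: D_of_linear Ck_const bounded_linear_imp_differentiable)

lemma Ck_add:
 assumes "open S" "Ck k S f" "Ck k S g"
 shows "Ck k S (\<lambda>x. f x + g x)"
 using assms(2,3)
proof (induction k arbitrary: f g)
 case (Suc k)
 have "Ck k S (\<lambda>x. D (\<lambda>x. f x + g x) x b)" if b: "b \<in> Basis" for b
 proof (rule Ck_cong[OF assms(1)])
  show "Ck k S (\<lambda>x. D f x b + D g x b)" using Suc.prems b by (intro Suc.IH) auto
  show "D f y b + D g y b = D (\<lambda>x. f x + g x) y b" if "y \<in> S" for y
   using D_add[of f y g b] Suc.prems that by simp
 qed
 thus ?case using Suc.prems by auto
qed auto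

lemma Ck_uminus:
 assumes "open S" "Ck k S f"
 shows "Ck k S (\<lambda>x. - f x)"
 by (rule Ck_blin[OF assms(1) bounded_linear_minus[OF bounded_linear_ident] assms(2)])

lemma Ck_diff_fun:
 assumes "open S" "Ck k S f" "Ck k S g"
 shows "Ck k S (\<lambda>x. f x - g x)"
 unfolding diff_conv_add_uminus by (rule Ck_add[OF assms(1,2) Ck_uminus[OF assms(1,3)]])

lemma Ck_sum: "open S ==> (\<And>i. i \<in> I ==> Ck k S (f i)) ==> Ck k S (\<lambda>x. \<Sum>i\<in>I. f i x)"
proof (induction I rule: infinite_finite_induct)
 case (insert i I)
 have "Ck k S (\<lambda>x. f i x + (\<Sum>i\<in>I. f i x))"
  using insert.prems insert.IH by (intro Ck_add) auto
 thus ?case using insert.hyps by simp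
qed (simp_all add: Ck_const)

lemma Ck_bilinear:
 assumes "open S" "bounded_bilinear pr" "Ck k S f" "Ck k S g"
 shows "Ck k S (\<lambda>x. pr (f x) (g x))"
 using assms(3,4)
proof (induction k arbitrary: f g)
 case (Suc k)
 have df: "f differentiable (at x)" and dg: "g differentiable (at x)" if "x \<in> S" for x
  using Suc.prems that by simp_all
 have "Ck k S (\<lambda>x. D (\<lambda>x. pr (f x) (g x)) x b)" if b: "b \<in> Basis" for b
 proof (rule Ck_cong[OF assms(1)])
  have "Ck k S (\<lambda>x. D f x b)" "Ck k S (\<lambda>x. D g x b)" using Suc.prems b by simp_all
  thus "Ck k S (\<lambda>x. pr (f x) (D g x b) + pr (D f x b) (g x))"
   by (intro Ck_add[OF assms(1)] Suc.IH Ck_Suc_D[OF Suc.prems(1)] Ck_Suc_D[OF Suc.prems(2)])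
  show "pr (f x) (D g x b) + pr (D f x b) (g x) = D (\<lambda>x. pr (f x) (g x)) x b" if "x \<in> S" for x
   using D_bilinear(1)[OF assms(2) df[OF that] dg[OF that], of b] by simp
 qed
 thus ?case using D_bilinear(2)[OF assms(2) df dg] by simp
qed simp

lemmas Ck_scaleR = Ck_bilinear[OF _ bounded_bilinear_scaleR]
lemmas Ck_inner = Ck_bilinear[OF _ bounded_bilinear_inner]
lemmas Ck_mult = Ck_bilinear[OF _ bounded_bilinear_mult]

lemma Ck_D:
 assumes "open S" "Ck (Suc k) S f"
 shows "Ck k S (\<lambda>x. D f x v)"
proof (rule Ck_cong[OF assms(1)])
 show "Ck k S (\<lambda>x. \<Sum>b\<in>Basis. (v \<bullet> b) *\<^sub>R D f x b)"
  using assms(2) by (intro Ck_sum[OF assms(1)] Ck_scaleR[OF assms(1)] Ck_const) auto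
qed (use assms D_expand[of f _ v] in auto)

lemma Ck_compose:
 fixes f :: "'p::euclidean_space => 'q::euclidean_space"
 assumes "open S" "Ck k S f" "Ck k T g" "\<And>x. x \<in> S ==> f x \<in> T"
 shows "Ck k S (\<lambda>x. g (f x))"
 using assms(2,3)
proof (induction k arbitrary: g)
 case (Suc k)
 have dg: "g differentiable (at (f x))" if "x \<in> S" for x using Suc.prems assms(4) that by auto
 have "Ck k S (\<lambda>x. D (\<lambda>x. g (f x)) x b)" if b: "b \<in> Basis" for b
 proof (rule Ck_cong[OF assms(1)])
  have "Ck k S (\<lambda>x. D g (f x) c)" if "c \<in> Basis" for c
   using Suc.IH[of "\<lambda>z. D g z c"] Suc.prems that Ck_Suc_D[OF Suc.prems(1)] by auto
  thus "Ck k S (\<lambda>x. \<Sum>c\<in>Basis. (D f x b \<bullet> c) *\<^sub>R D g (f x) c)"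
   using Suc.prems b by (intro Ck_sum[OF assms(1)] Ck_scaleR[OF assms(1)] Ck_inner[OF assms(1)] Ck_const) auto
 next
  fix x assume x: "x \<in> S"
  hence "f differentiable (at x)" using Suc.prems by auto
  thus "(\<Sum>c\<in>Basis. (D f x b \<bullet> c) *\<^sub>R D g (f x) c) = D (\<lambda>x. g (f x)) x b"
   using D_compose(1)[of f x g b] D_expand[of g "f x" "D f x b"] dg[OF x] by metis
 qed
 thus ?case using Suc.prems D_compose(2)[of f _ g] dg by simp
qed auto

lemma Ck_Pair:
 assumes "open S" "Ck k S f" "Ck k S g"
 shows "Ck k S (\<lambda>x. (f x, g x))"
proof -
 have "bounded_linear (\<lambda>v. (v, 0))" "bounded_linear (\<lambda>v. (0, v))"
  by (auto intro: bounded_linear_Pair bounded_linear_ident bounded_linear_zero)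
 hence "Ck k S (\<lambda>x. (f x, 0) + (0, g x))"
  by (intro Ck_add[OF assms(1)] Ck_blin[OF assms(1) _ assms(2)] Ck_blin[OF assms(1) _ assms(3)])
 thus ?thesis by simp
qed

lemma Ck_fst: "open S ==> Ck k S f ==> Ck k S (\<lambda>x. fst (f x))"
 using Ck_blin[OF _ bounded_linear_fst] .
lemma Ck_real:
 fixes g g' :: "real => 'v::real_normed_vector"
 assumes "open S" "\<And>x. x \<in> S ==> (g has_vector_derivative g' x) (at x)" "Ck k S g'"
 shows "Ck (Suc k) S g"
proof -
 have 1: "(g has_derivative (\<lambda>h. h *\<^sub>R g' x)) (at x)" if "x \<in> S" for x
  using assms(2)[OF that] by (simp add: has_vector_derivative_def)
 have "D g x 1 = g' x" if "x \<in> S" for x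
  using D_eq[OF 1[OF that]] by simp
 hence "Ck k S (\<lambda>x. D g x 1)"
  using Ck_cong[OF assms(1,3), of "\<lambda>x. D g x 1"] by simp
 thus ?thesis using 1 by (auto simp: differentiable_def)
qed

lemma Ck_real_field:
 fixes g g' :: "real => real"
 assumes "open S" "\<And>x. x \<in> S ==> (g has_real_derivative g' x) (at x)" "Ck k S g'"
 shows "Ck (Suc k) S g"
 by (rule Ck_real[OF assms(1) _ assms(3)]) (simp add: has_real_derivative_iff_has_vector_derivative[symmetric] assms(2))

lemma Ck_inverse: "Ck k (- {0::real}) inverse"
proof (induction k)
 case (Suc k)
 have o: "open (- {0::real})" by (simp add: open_Compl)
 have "Ck k (- {0::real}) (\<lambda>x. - (inverse x * inverse x))"
  by (rule Ck_uminus[OF o Ck_mult[OF o Suc Suc]])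
 moreover have "(inverse has_real_derivative - (inverse x * inverse x)) (at x)" if "x \<in> - {0}" for x :: real
  using DERIV_inverse[of x] that by (simp add: power2_eq_square)
 ultimately show ?case by (intro Ck_real_field[OF o, of inverse]) auto
qed simp

lemma Ck_inv_compose:
 fixes f :: "'p::euclidean_space => real"
 assumes "open S" "Ck k S f" "\<And>x. x \<in> S ==> f x \<noteq> 0"
 shows "Ck k S (\<lambda>x. inverse (f x))"
 using Ck_compose[OF assms(1,2) Ck_inverse] assms(3) by simp

lemma Ck_sqrt: "Ck k {0<..} sqrt"
proof (induction k)
 case (Suc k)
 have o: "open ({0<..} :: real set)" by simp
 have "Ck k {0<..} (\<lambda>x. inverse (sqrt x))"
  by (rule Ck_inv_compose[OF o Suc]) simp
 hence c: "Ck k {0<..} (\<lambda>x. inverse (sqrt x) * (1/2))"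
  by (rule Ck_mult[OF o _ Ck_const])
 show ?case
 proof (rule Ck_real_field[OF o _ c])
  show "(sqrt has_real_derivative inverse (sqrt x) * (1/2)) (at x)" if "x \<in> {0<..}" for x
   using DERIV_real_sqrt[of x] that by simp
 qed
qed simp

lemma Ck_exp: "Ck k UNIV (exp :: real => real)"
proof (induction k)
 case (Suc k)
 show ?case by (rule Ck_real_field[OF open_UNIV _ Suc]) (rule DERIV_exp)
qed simp

lemma Ck_norm: "Ck k (- {0}) (norm :: 'p::euclidean_space => real)"
proof -
 have "Ck k (- {0}) (\<lambda>x::'p. sqrt (x \<bullet> x))"
  by (rule Ck_compose[where T = "{0<..}" and g = sqrt])
   (auto intro!: Ck_sqrt Ck_inner Ck_of_linear[OF bounded_linear_ident] simp: open_Compl)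
 thus ?thesis by (simp add: norm_eq_sqrt_inner[abs_def])
qed

lemma Ck_unit: "Ck k (- {0}) (\<lambda>y::'p::euclidean_space. y /\<^sub>R norm y)"
proof -
 have o: "open (- {0::'p})" by (simp add: open_Compl)
 show ?thesis
  by (rule Ck_scaleR[OF o Ck_inv_compose[OF o Ck_norm] Ck_of_linear[OF bounded_linear_ident]]) simp
qed

lemma iter_D_snoc: "iter_D f (vs @ [v]) = iter_D (\<lambda>x. D f x v) vs"
 by (induction vs) auto

lemma smooth_on_Ck:
 assumes "smooth_on S f" shows "Ck k S f"
 using assms
proof (induction k arbitrary: f)
 case (Suc k)
 have "smooth_on S (\<lambda>x. D f x b)" for b
  unfolding smooth_on_def
 proof (intro allI ballI)
  fix vs x assume "x \<in> S"
  thus "iter_D (\<lambda>x. D f x b) vs differentiable (at x)"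
   using Suc.prems[unfolded smooth_on_def, rule_format, of x "vs @ [b]"] by (simp add: iter_D_snoc)
 qed
 moreover have "x \<in> S ==> f differentiable (at x)" for x
  using Suc.prems[unfolded smooth_on_def, rule_format, of x "[]"] by simp
 ultimately show ?case using Suc.IH by auto
qed auto

lemma bd_iter_D:
 assumes "\<And>vs. length vs \<le> k ==> set vs \<subseteq> Basis ==> norm (iter_D f vs x) \<le> e"
 shows "bd k f x e"
 using assms
proof (induction k arbitrary: f)
 case 0
 thus ?case using 0[of "[]"] by simp
next
 case (Suc k)
 have "bd k (\<lambda>x. D f x b) x e" if b: "b \<in> Basis" for b
 proof (rule Suc.IH)
  fix vs :: "'a list" assume "length vs \<le> k" "set vs \<subseteq> Basis"
  thus "norm (iter_D (\<lambda>x. D f x b) vs x) \<le> e"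
   using Suc.prems[of "vs @ [b]"] b by (simp add: iter_D_snoc)
 qed
 thus ?case using Suc.prems[of "[]"] by simp
qed

lemma bd_norm: "bd k f x M ==> norm (f x) \<le> M"
 by (cases k) auto

lemma bd_nonneg: "bd k f x M ==> 0 \<le> M"
 using bd_norm norm_ge_zero order_trans by blast

lemma bd_mono: "bd k f x M ==> M \<le> M' ==> bd k f x M'"
 by (induction k arbitrary: f) (auto intro: order_trans)

lemma bd_le: "bd k f x M ==> j \<le> k ==> bd j f x M"
proof (induction k arbitrary: j f)
 case (Suc k)
 thus ?case by (cases j) auto
qed auto

lemma bd_cong:
 assumes "open S" "x \<in> S" "bd k f x M" "\<And>y. y \<in> S ==> f y = g y"
 shows "bd k g x M"
 using assms(3,4)
proof (induction k arbitrary: f g)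
 case (Suc k)
 have "bd k (\<lambda>x. D g x b) x M" if "b \<in> Basis" for b
 proof (rule Suc.IH)
  show "bd k (\<lambda>x. D f x b) x M" using Suc.prems that by simp
  show "D f y b = D g y b" if "y \<in> S" for y
   using D_cong[OF assms(1) that Suc.prems(2)] by simp
 qed
 thus ?case using Suc.prems assms(2) by auto
qed (use assms in auto)

lemma bd_zero: "0 \<le> M ==> bd k (\<lambda>x. 0) x M"
 by (induction k) simp_all

lemma bd_const: "norm c \<le> M ==> bd k (\<lambda>x. c) x M"
 by (cases k) (auto intro!: bd_zero intro: order_trans[OF norm_ge_zero])

lemma bd_blin:
 assumes "open S" "x \<in> S" "bounded_linear L" "\<And>v. norm (L v) \<le> K * norm v" "0 \<le> K"
  and "Ck k S f" "bd k f x M"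
 shows "bd k (\<lambda>x. L (f x)) x (K * M)"
 using assms(6,7)
proof (induction k arbitrary: f)
 case 0
 thus ?case using assms(4)[of "f x"] assms(5) by (auto intro: order_trans mult_left_mono)
next
 case (Suc k)
 have "bd k (\<lambda>x. D (\<lambda>x. L (f x)) x b) x (K * M)" if b: "b \<in> Basis" for b
 proof (rule bd_cong[OF assms(1,2)])
  show "bd k (\<lambda>x. L (D f x b)) x (K * M)" using Suc.prems b by (intro Suc.IH) auto
  show "L (D f y b) = D (\<lambda>x. L (f x)) y b" if "y \<in> S" for y
   using D_bounded_linear(1)[OF assms(3), of f y b] Suc.prems that by simp
 qed
 moreover have "norm (L (f x)) \<le> K * M"
  using Suc.prems assms(4)[of "f x"] assms(5) by (auto intro: order_trans mult_left_mono)
 ultimately show ?case by auto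
qed

lemma bd_add:
 assumes "open S" "x \<in> S" "Ck k S f" "Ck k S g" "bd k f x M" "bd k g x M'"
 shows "bd k (\<lambda>x. f x + g x) x (M + M')"
 using assms(3-)
proof (induction k arbitrary: f g)
 case 0
 thus ?case by (auto intro: norm_triangle_le)
next
 case (Suc k)
 have "bd k (\<lambda>x. D (\<lambda>x. f x + g x) x b) x (M + M')" if b: "b \<in> Basis" for b
 proof (rule bd_cong[OF assms(1,2)])
  show "bd k (\<lambda>x. D f x b + D g x b) x (M + M')" using Suc.prems b by (intro Suc.IH) auto
  show "D f y b + D g y b = D (\<lambda>x. f x + g x) y b" if "y \<in> S" for y
   using D_add[of f y g b] Suc.prems that by simp
 qed
 moreover have "norm (f x + g x) \<le> M + M'" using Suc.prems by (auto intro: norm_triangle_le)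
 ultimately show ?case by auto
qed

lemma bd_uminus:
 assumes "open S" "x \<in> S" "Ck k S f" "bd k f x M"
 shows "bd k (\<lambda>x. - f x) x M"
 using bd_blin[OF assms(1,2) _ _ _ assms(3,4), of uminus 1]
 by (simp add: bounded_linear_minus bounded_linear_ident)

lemma bd_diff:
 assumes "open S" "x \<in> S" "Ck k S f" "Ck k S g" "bd k f x M" "bd k g x M'"
 shows "bd k (\<lambda>x. f x - g x) x (M + M')"
 using bd_add[OF assms(1-3) Ck_uminus[OF assms(1,4)] assms(5) bd_uminus[OF assms(1,2,4,6)]] by simp

lemma bd_sum:
 assumes "open S" "x \<in> S" "finite I" "\<And>i. i \<in> I ==> Ck k S (f i)" "\<And>i. i \<in> I ==> bd k (f i) x M"
 shows "bd k (\<lambda>x. \<Sum>i\<in>I. f i x) x (real (card I) * M)"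
 using assms(3-)
proof (induction I)
 case empty
 thus ?case by (simp add: bd_const)
next
 case (insert i I)
 have "bd k (\<lambda>x. f i x + (\<Sum>i\<in>I. f i x)) x (M + real (card I) * M)"
  using insert by (intro bd_add[OF assms(1,2)] Ck_sum[OF assms(1)]) auto
 thus ?case using insert by (simp add: algebra_simps)
qed

lemma bd_bilinear:
 assumes "open S" "x \<in> S" "bounded_bilinear pr" "\<And>a b. norm (pr a b) \<le> norm a * norm b"
  and "Ck k S f" "Ck k S g" "bd k f x M" "bd k g x M'"
 shows "bd k (\<lambda>x. pr (f x) (g x)) x (2 ^ k * (M * M'))"
 using assms(5-)
proof (induction k arbitrary: f g)
 case 0
 hence "norm (f x) * norm (g x) \<le> M * M'"
  by (intro mult_mono) (auto intro: order_trans[OF norm_ge_zero])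
 thus ?case using assms(4)[of "f x" "g x"] by auto
next
 case (Suc k)
 have M: "0 \<le> M" "0 \<le> M'" using Suc.prems bd_nonneg by blast+
 have "norm (f x) * norm (g x) \<le> M * M'"
  using Suc.prems M by (intro mult_mono) auto
 hence n: "norm (pr (f x) (g x)) \<le> M * M'"
  using assms(4)[of "f x" "g x"] by linarith
 have "1 * (M * M') \<le> 2 ^ Suc k * (M * M')"
  using M by (intro mult_right_mono mult_nonneg_nonneg) (auto simp del: power_Suc)
 hence 1: "norm (pr (f x) (g x)) \<le> 2 ^ Suc k * (M * M')" using n by simp
 have "bd k (\<lambda>x. D (\<lambda>x. pr (f x) (g x)) x b) x (2 ^ Suc k * (M * M'))" if b: "b \<in> Basis" for b
 proof (rule bd_cong[OF assms(1,2)])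
  have "bd k (\<lambda>x. pr (f x) (D g x b) + pr (D f x b) (g x)) x (2 ^ k * (M * M') + 2 ^ k * (M * M'))"
   using Suc.prems b Ck_Suc_D[OF Suc.prems(1)] Ck_Suc_D[OF Suc.prems(2)]
    bd_le[OF Suc.prems(3), of k] bd_le[OF Suc.prems(4), of k]
   by (intro bd_add[OF assms(1,2)] Suc.IH Ck_bilinear[OF assms(1,3)]) auto
  thus "bd k (\<lambda>x. pr (f x) (D g x b) + pr (D f x b) (g x)) x (2 ^ Suc k * (M * M'))"
   by (simp add: algebra_simps)
 qed (use Suc.prems in \<open>auto simp: D_bilinear(1)[OF assms(3)]\<close>)
 with 1 show ?case by auto
qed

lemma bd_scaleR:
 assumes "open S" "x \<in> S" "Ck k S f" "Ck k S g" "bd k f x M" "bd k g x M'"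
 shows "bd k (\<lambda>x. f x *\<^sub>R g x) x (2 ^ k * (M * M'))"
 using bd_bilinear[OF assms(1,2) bounded_bilinear_scaleR _ assms(3-)] by simp

lemma bd_inner_const:
 assumes "open S" "x \<in> S" "Ck k S f" "bd k f x M" "norm c \<le> 1"
 shows "bd k (\<lambda>x. f x \<bullet> c) x M"
proof -
 have "norm (v \<bullet> c) \<le> 1 * norm v" for v
  using Cauchy_Schwarz_ineq2[of v c] assms(5) mult_left_mono[OF assms(5), of "norm v"] by auto
 thus ?thesis
  using bd_blin[OF assms(1,2) bounded_linear_inner_left _ _ assms(3,4), of c 1] by simp
qed

text \<open>The bound is linear in the outer function: composing with a fixed chart keeps small
 functions small.\<close>

lemma bd_compose:
 assumes "0 \<le> M"
 shows "\<exists>C\<ge>1. \<forall>(f :: 'p::euclidean_space => 'q::euclidean_space) (g :: 'q => 'v::real_normed_vector) S T x e.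
  open S \<and> Ck k S f \<and> Ck k T g \<and> (\<forall>x\<in>S. f x \<in> T) \<and> x \<in> S \<and> bd k f x M \<and> bd k g (f x) e
  --> bd k (\<lambda>x. g (f x)) x (C * e)"
proof (induction k)
 case 0
 show ?case by (rule exI[of _ 1]) auto
next
 case (Suc k)
 then obtain C where C: "C \<ge> 1" and CC0: "\<forall>(f :: 'p => 'q) (g :: 'q => 'v) S T x e.
  open S \<and> Ck k S f \<and> Ck k T g \<and> (\<forall>x\<in>S. f x \<in> T) \<and> x \<in> S \<and> bd k f x M \<and> bd k g (f x) e
  --> bd k (\<lambda>x. g (f x)) x (C * e)" by (elim exE conjE) (rule that)
 have CC: "bd k (\<lambda>x. g (f x)) x (C * e)"
  if "open S" "Ck k S f" "Ck k T g" "\<forall>x\<in>S. f x \<in> T" "x \<in> S" "bd k f x M" "bd k g (f x) e"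
  for f :: "'p => 'q" and g :: "'q => 'v" and S T x e
  by (rule CC0[rule_format, OF conjI[OF that(1) conjI[OF that(2) conjI[OF that(3) conjI[OF that(4)
    conjI[OF that(5) conjI[OF that(6,7)]]]]]]])
 define C' where "C' = real DIM('q) * (2 ^ k * (M * C)) + 1"
 have "0 \<le> real DIM('q) * (2 ^ k * (M * C))" using C assms by auto
 hence C'1: "C' \<ge> 1" by (auto simp: C'_def)
 show ?case
 proof (rule exI[of _ C'], intro conjI allI impI C'1, elim conjE)
  fix f :: "'p => 'q" and g :: "'q => 'v" and S T x e
  assume S: "open S" and f: "Ck (Suc k) S f" and g: "Ck (Suc k) T g" and T: "\<forall>x\<in>S. f x \<in> T"
   and x: "x \<in> S" and bf: "bd (Suc k) f x M" and bg: "bd (Suc k) g (f x) e"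
  have e: "0 \<le> e" using bg bd_nonneg by blast
  have f': "Ck k S f" and bf': "bd k f x M" using f bf by (auto intro: Ck_Suc_D bd_le simp del: Ck.simps bd.simps)
  have dg: "g differentiable (at (f x))" if "x \<in> S" for x using g T that by auto
  have "bd k (\<lambda>x. D (\<lambda>x. g (f x)) x b) x (C' * e)" if b: "b \<in> Basis" for b
  proof (rule bd_cong[OF S x])
   have s: "bd k (\<lambda>x. \<Sum>c\<in>Basis. (D f x b \<bullet> c) *\<^sub>R D g (f x) c) x (real DIM('q) * (2 ^ k * (M * (C * e))))"
   proof (rule bd_sum[OF S x finite_Basis])
    fix c :: 'q assume c: "c \<in> Basis"
    have 1: "Ck k S (\<lambda>x. D f x b \<bullet> c)" using f b by (intro Ck_inner[OF S] Ck_const) auto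
    have gc: "Ck k T (\<lambda>z. D g z c)" using g c by auto
    have 2: "Ck k S (\<lambda>x. D g (f x) c)" using Ck_compose[OF S f' gc] T by auto
    show "Ck k S (\<lambda>x. (D f x b \<bullet> c) *\<^sub>R D g (f x) c)" using Ck_scaleR[OF S 1 2] .
    have 3: "bd k (\<lambda>x. D f x b \<bullet> c) x M"
     using f bf b c by (intro bd_inner_const[OF S x]) auto
    have 4: "bd k (\<lambda>x. D g (f x) c) x (C * e)"
     using CC[OF S f' gc T x bf'] bg c by auto
    show "bd k (\<lambda>x. (D f x b \<bullet> c) *\<^sub>R D g (f x) c) x (2 ^ k * (M * (C * e)))"
     using bd_scaleR[OF S x 1 2 3 4] .
   qed
   have "real DIM('q) * (2 ^ k * (M * (C * e))) \<le> C' * e"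
    using e by (simp add: C'_def algebra_simps)
   with s show "bd k (\<lambda>x. \<Sum>c\<in>Basis. (D f x b \<bullet> c) *\<^sub>R D g (f x) c) x (C' * e)" by (rule bd_mono)
  next
   fix x assume x: "x \<in> S"
   hence "f differentiable (at x)" using f by auto
   thus "(\<Sum>c\<in>Basis. (D f x b \<bullet> c) *\<^sub>R D g (f x) c) = D (\<lambda>x. g (f x)) x b"
    using D_compose(1)[of f x g b] D_expand[of g "f x" "D f x b"] dg[OF x] by metis
  qed
  moreover have "e \<le> C' * e" using mult_right_mono[OF C'1 e] by simp
  hence "norm (g (f x)) \<le> C' * e" using bg by auto
  ultimately show "bd (Suc k) (\<lambda>x. g (f x)) x (C' * e)" by auto
 qed
qed

lemma bd_compact:
 fixes f :: "'p::euclidean_space => 'v::real_normed_vector"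
 assumes "compact K" "K \<subseteq> S" "Ck (Suc k) S f"
 shows "\<exists>M\<ge>0. \<forall>x\<in>K. bd k f x M"
 using assms(3)
proof (induction k arbitrary: f)
 case 0
 have "compact (f ` K)"
  using compact_continuous_image[OF continuous_on_subset[OF Ck_continuous[OF 0] assms(2)] assms(1)] .
 then obtain M where "\<forall>y\<in>f ` K. norm y \<le> M" using compact_imp_bounded bounded_iff by blast
 thus ?case by (intro exI[of _ "max 0 M"]) fastforce
next
 case (Suc k)
 have "\<forall>b\<in>Basis. \<exists>M\<ge>0. \<forall>x\<in>K. bd k (\<lambda>x. D f x b) x M" using Suc by auto
 then obtain m where m: "\<And>b. b \<in> Basis ==> m b \<ge> 0 \<and> (\<forall>x\<in>K. bd k (\<lambda>x. D f x b) x (m b))" by metis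
 obtain M0 where M0: "M0 \<ge> 0" "\<forall>x\<in>K. bd k f x M0" using Suc.IH[OF Ck_Suc_D[OF Suc.prems]] by blast
 define M where "M = M0 + sum m Basis"
 have s: "m b \<le> M" if "b \<in> Basis" for b
  using member_le_sum[of b Basis m] m M0 that by (auto simp: M_def)
 have "sum m Basis \<ge> 0" using m by (simp add: sum_nonneg)
 hence "M0 \<le> M" by (simp add: M_def)
 hence "\<forall>x\<in>K. norm (f x) \<le> M" using M0 bd_norm by (meson order_trans)
 moreover have "bd k (\<lambda>x. D f x b) x M" if "b \<in> Basis" "x \<in> K" for b x
  by (rule bd_mono[OF _ s[OF that(1)]]) (use m[OF that(1)] that(2) in simp)
 ultimately show ?case using M0 \<open>M0 \<le> M\<close> by (intro exI[of _ M]) auto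
qed

text \<open>The derivatives vanish on the open set and are continuous.\<close>

lemma bd_zero_closure:
 assumes "open S" "Ck (Suc k) S f" "open U" "U \<subseteq> S" "\<And>y. y \<in> U ==> f y = 0" "x \<in> S" "x \<in> closure U"
 shows "bd k f x 0"
proof -
 have z: "g x = 0" if "continuous_on S g" "\<And>y. y \<in> U ==> g y = 0" for g :: "'a => 'b"
 proof -
  obtain u where u: "\<And>n. u n \<in> U" "u \<longlonglongrightarrow> x" using assms(7) closure_sequential by blast
  have "(\<lambda>n. g (u n)) \<longlonglongrightarrow> g x"
   using assms(4,6) u(1)
   by (intro continuous_on_tendsto_compose[OF that(1) u(2)] always_eventually) auto
  moreover have "(\<lambda>n. g (u n)) = (\<lambda>n. 0)" using that(2) u(1) by auto
  ultimately show ?thesis using LIMSEQ_unique tendsto_const by metis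
 qed
 show ?thesis using assms(2,5)
 proof (induction k arbitrary: f)
  case 0
  thus ?case using z[OF Ck_continuous[OF 0(1)]] by auto
 next
  case (Suc k)
  have "D f y b = 0" if "y \<in> U" for y b
   using D_cong[OF assms(3) that, of f "\<lambda>_. 0"] Suc.prems(2) by simp
  hence "bd k (\<lambda>x. D f x b) x 0" if "b \<in> Basis" for b
   using Suc.IH[of "\<lambda>x. D f x b"] Suc.prems that by auto
  thus ?case using z[OF Ck_continuous[OF Suc.prems(1)]] Suc.prems by auto
 qed
qed

lemma bd_D_norm:
 fixes f :: "'p::euclidean_space => 'v::real_normed_vector"
 assumes "f differentiable (at x)" "\<And>b. b \<in> Basis ==> norm (D f x b) \<le> M"
 shows "norm (D f x v) \<le> real DIM('p) * M * norm v"
proof -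
 have "norm (D f x v) \<le> (\<Sum>b\<in>Basis. norm ((v \<bullet> b) *\<^sub>R D f x b))"
  unfolding D_expand[OF assms(1), of v] by (rule norm_sum)
 also have "\<dots> \<le> (\<Sum>b\<in>(Basis::'p set). norm v * M)"
  using assms(2) by (intro sum_mono) (auto intro!: mult_mono simp: Basis_le_norm)
 finally show ?thesis by (simp add: algebra_simps)
qed

section \<open>Regularity of solutions of linear systems\<close>

text \<open>At a zero of one factor of a product, continuity of the other factor is enough.\<close>

lemma has_derivative_vanishing_factor:
 fixes \<xi> h :: "'p::euclidean_space => 'v::real_inner"
 assumes "isCont \<xi> x" "(h has_derivative h') (at x)" "h x = 0"
 shows "((\<lambda>y. \<xi> y \<bullet> h y) has_derivative (\<lambda>v. \<xi> x \<bullet> h' v)) (at x)"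
proof -
 have bl: "bounded_linear h'" using assms(2) has_derivative_bounded_linear by blast
 then obtain K where K: "\<And>v. norm (h' v) \<le> norm v * K" using bounded_linear.bounded by blast
 have r: "((\<lambda>y. norm (h y - h x - h' (y - x)) / norm (y - x)) \<longlongrightarrow> 0) (at x)"
  using assms(2) by (simp add: has_derivative_iff_norm)
 have z: "((\<lambda>y. (\<xi> y - \<xi> x) \<bullet> h y) has_derivative (\<lambda>v. 0)) (at x)"
  unfolding has_derivative_iff_norm
 proof (intro conjI)
  show "((\<lambda>y. norm ((\<xi> y - \<xi> x) \<bullet> h y - (\<xi> x - \<xi> x) \<bullet> h x - 0) / norm (y - x)) \<longlongrightarrow> 0) (at x)"
  proof (rule Lim_null_comparison)
   show "((\<lambda>y. norm (\<xi> y - \<xi> x) * (K + norm (h y - h x - h' (y - x)) / norm (y - x))) \<longlongrightarrow> 0) (at x)"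
   proof -
    have "((\<lambda>y. norm (\<xi> y - \<xi> x)) \<longlongrightarrow> 0) (at x)"
     using assms(1) by (simp add: isCont_def LIM_zero tendsto_norm_zero)
    from tendsto_mult[OF this tendsto_add[OF tendsto_const[of K] r]] show ?thesis by simp
   qed
   show "\<forall>\<^sub>F y in at x. norm (norm ((\<xi> y - \<xi> x) \<bullet> h y - (\<xi> x - \<xi> x) \<bullet> h x - 0) / norm (y - x))
     \<le> norm (\<xi> y - \<xi> x) * (K + norm (h y - h x - h' (y - x)) / norm (y - x))"
    unfolding eventually_at_filter
   proof (rule always_eventually, intro allI impI)
    fix y assume "y \<noteq> x"
    hence p: "norm (y - x) > 0" by simp
    have "norm (h y) \<le> norm (h' (y - x)) + norm (h y - h x - h' (y - x))"
     using norm_triangle_sub[of "h y" "h' (y - x)"] assms(3) by simp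
    also have "\<dots> \<le> norm (y - x) * K + norm (h y - h x - h' (y - x))" using K by simp
    also have "\<dots> = (K + norm (h y - h x - h' (y - x)) / norm (y - x)) * norm (y - x)"
     using p by (simp add: field_simps)
    finally have hb: "norm (h y) \<le> (K + norm (h y - h x - h' (y - x)) / norm (y - x)) * norm (y - x)" .
    have "\<bar>(\<xi> y - \<xi> x) \<bullet> h y\<bar> \<le> norm (\<xi> y - \<xi> x) * norm (h y)" by (rule Cauchy_Schwarz_ineq2)
    also have "\<dots> \<le> norm (\<xi> y - \<xi> x) * ((K + norm (h y - h x - h' (y - x)) / norm (y - x)) * norm (y - x))"
     by (rule mult_left_mono[OF hb]) simp
    finally show "norm (norm ((\<xi> y - \<xi> x) \<bullet> h y - (\<xi> x - \<xi> x) \<bullet> h x - 0) / norm (y - x))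
     \<le> norm (\<xi> y - \<xi> x) * (K + norm (h y - h x - h' (y - x)) / norm (y - x))"
     using p by (simp add: pos_divide_le_eq mult.assoc)
   qed
  qed
 qed auto
 have "((\<lambda>y. \<xi> x \<bullet> h y + (\<xi> y - \<xi> x) \<bullet> h y) has_derivative (\<lambda>v. \<xi> x \<bullet> h' v + 0)) (at x)"
  by (rule has_derivative_add[OF has_derivative_inner_right[OF assms(2)] z])
 thus ?thesis by (simp add: inner_diff_left)
qed

text \<open>The frame operator of a spanning family is injective, hence invertible.\<close>

lemma inverse_of_frame:
 fixes q :: "'j => 'v::euclidean_space"
 assumes "finite J" "\<And>\<zeta>. (\<And>j. j \<in> J ==> \<zeta> \<bullet> q j = 0) ==> \<zeta> = 0"
 shows "\<exists>\<Lambda>. linear \<Lambda> \<and> (\<forall>\<zeta>. \<Lambda> (\<Sum>j\<in>J. (\<zeta> \<bullet> q j) *\<^sub>R q j) = \<zeta>)"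
proof -
 define G where "G \<zeta> = (\<Sum>j\<in>J. (\<zeta> \<bullet> q j) *\<^sub>R q j)" for \<zeta>
 have lin: "linear G"
  unfolding G_def by (intro linear_compose_sum ballI linear_compose_scale_right)
   (auto intro!: linearI simp: inner_add_left scaleR_add_left)
 have "\<zeta> = 0" if "G \<zeta> = 0" for \<zeta>
 proof -
  have "0 = \<zeta> \<bullet> G \<zeta>" using that by simp
  also have "\<dots> = (\<Sum>j\<in>J. (\<zeta> \<bullet> q j)\<^sup>2)" by (simp add: G_def inner_sum_right power2_eq_square)
  finally have "\<forall>j\<in>J. (\<zeta> \<bullet> q j)\<^sup>2 = 0"
   using sum_nonneg_eq_0_iff[OF assms(1), of "\<lambda>j. (\<zeta> \<bullet> q j)\<^sup>2"] by simp
  thus ?thesis using assms(2)[of \<zeta>] by simp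
 qed
 hence "inj G" using linear_injective_0[OF lin] by blast
 then obtain g where "linear g" "g \<circ> G = id" using linear_injective_left_inverse[OF lin] by blast
 thus ?thesis unfolding G_def by (intro exI[of _ g]) (auto simp: fun_eq_iff)
qed

text \<open>Move the variation of the coefficients to the right-hand side. With the inverse of the frame operator at
 \<open>x\<close> the equations become a fixed point identity for \<open>\<xi>\<close>. It first bounds \<open>\<xi>\<close> near \<open>x\<close>, then
 shows continuity, and finally differentiability.\<close>

lemma solve_differentiable:
 fixes \<xi> :: "'p::euclidean_space => 'v::euclidean_space"
 assumes J: "finite J" and S: "open S" "x \<in> S"
  and q: "\<And>j. j \<in> J ==> q j differentiable (at x)"
  and \<rho>: "\<And>j. j \<in> J ==> \<rho> j differentiable (at x)"
  and eq: "\<And>y j. y \<in> S ==> j \<in> J ==> \<xi> y \<bullet> q j y = \<rho> j y"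
  and nd: "\<And>\<zeta>. (\<And>j. j \<in> J ==> \<zeta> \<bullet> q j x = 0) ==> \<zeta> = 0"
 shows "\<xi> differentiable (at x)"
proof -
 have "\<exists>\<Lambda>. linear \<Lambda> \<and> (\<forall>\<zeta>. \<Lambda> (\<Sum>j\<in>J. (\<zeta> \<bullet> q j x) *\<^sub>R q j x) = \<zeta>)"
  by (rule inverse_of_frame[OF J]) (rule nd)
 then obtain \<Lambda> where lin: "linear \<Lambda>" and \<Lambda>: "\<And>\<zeta>. \<Lambda> (\<Sum>j\<in>J. (\<zeta> \<bullet> q j x) *\<^sub>R q j x) = \<zeta>"
  by (elim exE conjE) (rule that, auto)
 have bl: "bounded_linear \<Lambda>" using lin linear_conv_bounded_linear by blast
 obtain B where B: "B > 0" "\<And>v. norm (\<Lambda> v) \<le> norm v * B" using bounded_linear.pos_bounded[OF bl] by blast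
 let ?s = "\<lambda>y. \<Sum>j\<in>J. (\<rho> j y - \<xi> y \<bullet> (q j y - q j x)) *\<^sub>R q j x"
 have rep: "\<xi> y = \<Lambda> (?s y)" if "y \<in> S" for y
 proof -
  have "?s y = (\<Sum>j\<in>J. (\<xi> y \<bullet> q j x) *\<^sub>R q j x)"
   using eq[OF that] by (intro sum.cong) (auto simp: inner_diff_right)
  thus ?thesis using \<Lambda> by simp
 qed
 have evS: "\<forall>\<^sub>F y in at x. y \<in> S" using S eventually_at_in_open' by blast
 have cq: "(\<lambda>y. q j y) \<midarrow>x\<rightarrow> q j x" if "j \<in> J" for j
  using differentiable_imp_continuous_within[OF q[OF that]] by (simp add: continuous_within)
 have c\<rho>: "(\<lambda>y. \<rho> j y) \<midarrow>x\<rightarrow> \<rho> j x" if "j \<in> J" for j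
  using differentiable_imp_continuous_within[OF \<rho>[OF that]] by (simp add: continuous_within)
 have t1: "((\<lambda>y. \<Sum>j\<in>J. norm (q j y - q j x) * norm (q j x)) \<longlongrightarrow> (\<Sum>j\<in>J. norm (q j x - q j x) * norm (q j x))) (at x)"
  by (intro tendsto_intros cq)
 have t2: "((\<lambda>y. \<Sum>j\<in>J. \<bar>\<rho> j y\<bar> * norm (q j x)) \<longlongrightarrow> (\<Sum>j\<in>J. \<bar>\<rho> j x\<bar> * norm (q j x))) (at x)"
  by (intro tendsto_intros c\<rho>)
 define M where "M = (\<Sum>j\<in>J. \<bar>\<rho> j x\<bar> * norm (q j x)) + 1"
 have e1: "\<forall>\<^sub>F y in at x. (\<Sum>j\<in>J. norm (q j y - q j x) * norm (q j x)) < 1 / (2 * B)"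
  using order_tendstoD(2)[OF t1] B by simp
 have e2: "\<forall>\<^sub>F y in at x. (\<Sum>j\<in>J. \<bar>\<rho> j y\<bar> * norm (q j x)) < M"
  using order_tendstoD(2)[OF t2] by (simp add: M_def)
 have bdd: "\<forall>\<^sub>F y in at x. norm (\<xi> y) \<le> 2 * B * M"
  using e1 e2 evS
 proof eventually_elim
  case (elim y)
  have "norm (?s y)
    \<le> (\<Sum>j\<in>J. \<bar>\<rho> j y\<bar> * norm (q j x) + norm (\<xi> y) * (norm (q j y - q j x) * norm (q j x)))"
  proof (rule sum_norm_le)
   fix j assume "j \<in> J"
   have "\<bar>\<rho> j y - \<xi> y \<bullet> (q j y - q j x)\<bar> \<le> \<bar>\<rho> j y\<bar> + norm (\<xi> y) * norm (q j y - q j x)"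
    using Cauchy_Schwarz_ineq2[of "\<xi> y" "q j y - q j x"] by linarith
   hence "\<bar>\<rho> j y - \<xi> y \<bullet> (q j y - q j x)\<bar> * norm (q j x) \<le> (\<bar>\<rho> j y\<bar> + norm (\<xi> y) * norm (q j y - q j x)) * norm (q j x)"
    by (rule mult_right_mono) simp
   thus "norm ((\<rho> j y - \<xi> y \<bullet> (q j y - q j x)) *\<^sub>R q j x) \<le> \<bar>\<rho> j y\<bar> * norm (q j x) + norm (\<xi> y) * (norm (q j y - q j x) * norm (q j x))"
    by (simp only: norm_scaleR distrib_right mult.assoc)
  qed
  also have "\<dots> = (\<Sum>j\<in>J. \<bar>\<rho> j y\<bar> * norm (q j x)) + norm (\<xi> y) * (\<Sum>j\<in>J. norm (q j y - q j x) * norm (q j x))"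
   by (simp add: sum.distrib sum_distrib_left)
  also have "\<dots> \<le> M + norm (\<xi> y) * (1 / (2 * B))"
   using elim by (intro add_mono mult_left_mono) auto
  finally have n: "norm (?s y) \<le> M + norm (\<xi> y) * (1 / (2 * B))" .
  have "norm (\<xi> y) \<le> norm (?s y) * B"
   by (subst rep[OF elim(3)]) (rule B(2))
  also have "\<dots> \<le> (M + norm (\<xi> y) * (1 / (2 * B))) * B" using n B(1) by (intro mult_right_mono) auto
  also have "\<dots> = M * B + norm (\<xi> y) / 2" using B(1) by (simp add: field_simps)
  finally have "norm (\<xi> y) \<le> 2 * (M * B)" by linarith
  thus ?case by (simp add: mult_ac)
 qed
 have prod0: "(\<lambda>y. \<xi> y \<bullet> (q j y - q j x)) \<midarrow>x\<rightarrow> 0" if "j \<in> J" for j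
 proof (rule Lim_null_comparison)
  show "\<forall>\<^sub>F y in at x. norm (\<xi> y \<bullet> (q j y - q j x)) \<le> 2 * B * M * norm (q j y - q j x)"
   using bdd
  proof eventually_elim
   case (elim y)
   thus ?case using Cauchy_Schwarz_ineq2[of "\<xi> y" "q j y - q j x"]
     mult_right_mono[OF elim, of "norm (q j y - q j x)"] by simp
  qed
  have "(\<lambda>y. 2 * B * M * norm (q j y - q j x)) \<midarrow>x\<rightarrow> 2 * B * M * norm (q j x - q j x)"
   by (intro tendsto_intros cq that)
  thus "(\<lambda>y. 2 * B * M * norm (q j y - q j x)) \<midarrow>x\<rightarrow> 0" by simp
 qed
 have "(\<lambda>y. \<Lambda> (?s y)) \<midarrow>x\<rightarrow> \<Lambda> (\<Sum>j\<in>J. (\<rho> j x - 0) *\<^sub>R q j x)"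
  by (intro bounded_linear.tendsto[OF bl] tendsto_intros c\<rho> prod0)
 moreover have "\<Lambda> (\<Sum>j\<in>J. (\<rho> j x - 0) *\<^sub>R q j x) = \<xi> x" using rep[OF S(2)] by simp
 ultimately have "(\<lambda>y. \<Lambda> (?s y)) \<midarrow>x\<rightarrow> \<xi> x" by simp
 moreover have "\<forall>\<^sub>F y in at x. \<Lambda> (?s y) = \<xi> y"
  using evS by eventually_elim (use rep in auto)
 ultimately have cont: "isCont \<xi> x" using Lim_transform_eventually isCont_def by blast
 have d: "((\<lambda>y. \<Lambda> (?s y)) has_derivative
   (\<lambda>v. \<Lambda> (\<Sum>j\<in>J. (D (\<rho> j) x v - \<xi> x \<bullet> D (q j) x v) *\<^sub>R q j x))) (at x)"
 proof (intro bounded_linear.has_derivative[OF bl] has_derivative_sum has_derivative_scaleR_left has_derivative_diff D_works \<rho>)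
  fix j assume j: "j \<in> J"
  have "((\<lambda>y. q j y - q j x) has_derivative (\<lambda>v. D (q j) x v - 0)) (at x)"
   by (intro has_derivative_diff D_works q j has_derivative_const)
  hence "((\<lambda>y. q j y - q j x) has_derivative D (q j) x) (at x)" by simp
  from has_derivative_vanishing_factor[OF cont this]
  show "((\<lambda>y. \<xi> y \<bullet> (q j y - q j x)) has_derivative (\<lambda>v. \<xi> x \<bullet> D (q j) x v)) (at x)" by simp
 qed
 have "(\<xi> has_derivative (\<lambda>v. \<Lambda> (\<Sum>j\<in>J. (D (\<rho> j) x v - \<xi> x \<bullet> D (q j) x v) *\<^sub>R q j x))) (at x)"
  by (rule has_derivative_transform_within_open[OF d S]) (use rep in auto)
 thus ?thesis by (auto simp: differentiable_def)
qed

text \<open>The inverse of the frame operator at \<open>x\<close> bounds every vector by its products with the family, and a small change of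
 the family changes these products little.\<close>

lemma frame_stable:
 fixes q :: "'j => 'p::euclidean_space => 'v::euclidean_space"
 assumes J: "finite J" and q: "\<And>j. j \<in> J ==> isCont (q j) x"
  and nd: "\<And>\<zeta>. (\<And>j. j \<in> J ==> \<zeta> \<bullet> q j x = 0) ==> \<zeta> = 0"
 shows "\<exists>T. open T \<and> x \<in> T \<and> (\<forall>z\<in>T. \<forall>\<zeta>. (\<forall>j\<in>J. \<zeta> \<bullet> q j z = 0) --> \<zeta> = 0)"
proof -
 have "\<exists>\<Lambda>. linear \<Lambda> \<and> (\<forall>\<zeta>. \<Lambda> (\<Sum>j\<in>J. (\<zeta> \<bullet> q j x) *\<^sub>R q j x) = \<zeta>)"
  by (rule inverse_of_frame[OF J]) (rule nd)
 then obtain \<Lambda> where lin: "linear \<Lambda>" and \<Lambda>: "\<And>\<zeta>. \<Lambda> (\<Sum>j\<in>J. (\<zeta> \<bullet> q j x) *\<^sub>R q j x) = \<zeta>"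
  by (elim exE conjE) (rule that, auto)
 have bl: "bounded_linear \<Lambda>" using lin linear_conv_bounded_linear by blast
 obtain B where B: "B > 0" "\<And>v. norm (\<Lambda> v) \<le> norm v * B" using bounded_linear.pos_bounded[OF bl] by blast
 have "((\<lambda>z. \<Sum>j\<in>J. norm (q j z - q j x) * norm (q j x)) \<longlongrightarrow> (\<Sum>j\<in>J. norm (q j x - q j x) * norm (q j x))) (nhds x)"
  by (intro tendsto_intros q[unfolded isCont_def tendsto_at_iff_tendsto_nhds])
 from order_tendstoD(2)[OF this, of "1 / B"]
 have "\<forall>\<^sub>F z in nhds x. (\<Sum>j\<in>J. norm (q j z - q j x) * norm (q j x)) < 1 / B"
  using B(1) by simp
 then obtain T where T: "open T" "x \<in> T" "\<And>z. z \<in> T ==> (\<Sum>j\<in>J. norm (q j z - q j x) * norm (q j x)) < 1 / B"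
  unfolding eventually_nhds by blast
 have "\<zeta> = 0" if z: "z \<in> T" and 0: "\<forall>j\<in>J. \<zeta> \<bullet> q j z = 0" for z \<zeta>
 proof (rule ccontr)
  assume "\<zeta> \<noteq> 0"
  have "norm (\<Sum>j\<in>J. (\<zeta> \<bullet> q j x) *\<^sub>R q j x) \<le> (\<Sum>j\<in>J. norm \<zeta> * (norm (q j z - q j x) * norm (q j x)))"
  proof (rule sum_norm_le)
   fix j assume j: "j \<in> J"
   have "\<bar>\<zeta> \<bullet> q j x\<bar> = \<bar>\<zeta> \<bullet> (q j z - q j x)\<bar>" using 0 j by (simp add: inner_diff_right)
   also have "\<dots> \<le> norm \<zeta> * norm (q j z - q j x)" by (rule Cauchy_Schwarz_ineq2)
   finally have "\<bar>\<zeta> \<bullet> q j x\<bar> * norm (q j x) \<le> norm \<zeta> * norm (q j z - q j x) * norm (q j x)"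
    by (rule mult_right_mono) simp
   thus "norm ((\<zeta> \<bullet> q j x) *\<^sub>R q j x) \<le> norm \<zeta> * (norm (q j z - q j x) * norm (q j x))"
    by (simp only: norm_scaleR mult.assoc)
  qed
  also have "\<dots> = norm \<zeta> * (\<Sum>j\<in>J. norm (q j z - q j x) * norm (q j x))" by (simp add: sum_distrib_left)
  also have "\<dots> < norm \<zeta> * (1 / B)" using T(3)[OF z] \<open>\<zeta> \<noteq> 0\<close> by (intro mult_strict_left_mono) auto
  finally have n: "norm (\<Sum>j\<in>J. (\<zeta> \<bullet> q j x) *\<^sub>R q j x) < norm \<zeta> * (1 / B)" .
  have "norm \<zeta> \<le> norm (\<Sum>j\<in>J. (\<zeta> \<bullet> q j x) *\<^sub>R q j x) * B" using B(2) \<Lambda>[of \<zeta>] by metis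
  also have "\<dots> < norm \<zeta> * (1 / B) * B" using n B(1) by (intro mult_strict_right_mono) auto
  finally show False using B(1) by simp
 qed
 with T show ?thesis by blast
qed

text \<open>The derivatives of the solution solve a system with the same coefficients.\<close>

lemma solve_Ck:
 fixes \<xi> :: "'p::euclidean_space => 'v::euclidean_space"
 assumes J: "finite J" and S: "open S"
  and q: "\<And>j. j \<in> J ==> Ck k S (q j)"
  and \<rho>: "\<And>j. j \<in> J ==> Ck k S (\<rho> j)"
  and eq: "\<And>y j. y \<in> S ==> j \<in> J ==> \<xi> y \<bullet> q j y = \<rho> j y"
  and nd: "\<And>y \<zeta>. y \<in> S ==> (\<And>j. j \<in> J ==> \<zeta> \<bullet> q j y = 0) ==> \<zeta> = 0"
 shows "Ck k S \<xi>"
 using q \<rho> eq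
proof (induction k arbitrary: \<xi> \<rho>)
 case (Suc k)
 have d: "\<xi> differentiable (at x)" if x: "x \<in> S" for x
  by (rule solve_differentiable[OF J S x, of q \<rho>]) (use Suc.prems x nd in auto)
 have ck: "Ck k S \<xi>" by (rule Suc.IH[where \<rho> = \<rho>]) (use Suc.prems Ck_Suc_D in blast)+
 have "Ck k S (\<lambda>x. D \<xi> x b)" if b: "b \<in> Basis" for b
 proof (rule Suc.IH)
  show "Ck k S (q j)" if "j \<in> J" for j using Ck_Suc_D[OF Suc.prems(1)[OF that]] .
  show "Ck k S (\<lambda>x. D (\<rho> j) x b - \<xi> x \<bullet> D (q j) x b)" if "j \<in> J" for j
   using Suc.prems(1)[OF that] Suc.prems(2)[OF that] b
   by (intro Ck_diff_fun[OF S] Ck_inner[OF S ck]) auto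
  show "D \<xi> y b \<bullet> q j y = D (\<rho> j) y b - \<xi> y \<bullet> D (q j) y b" if y: "y \<in> S" and j: "j \<in> J" for y j
  proof -
   have dq: "q j differentiable (at y)" using Suc.prems(1)[OF j] y by simp
   have "D (\<lambda>y. \<xi> y \<bullet> q j y) y b = D (\<rho> j) y b"
    using D_cong[OF S y, of "\<lambda>y. \<xi> y \<bullet> q j y" "\<rho> j"] Suc.prems(3)[OF _ j] by simp
   thus ?thesis using D_bilinear(1)[OF bounded_bilinear_inner d[OF y] dq, of b] by simp
  qed
 qed
 thus ?case using d by simp
qed simp

section \<open>The exponential map of hyperbolic space\<close>

lemma powser_Ck:
 fixes c :: "nat => real"
 assumes "\<And>x. summable (\<lambda>n. c n * x ^ n)"
 shows "Ck k UNIV (\<lambda>x. \<Sum>n. c n * x ^ n)"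
 using assms
proof (induction k arbitrary: c)
 case (Suc k)
 show ?case
 proof (rule Ck_real_field[OF open_UNIV])
  show "((\<lambda>x. \<Sum>n. c n * x ^ n) has_real_derivative (\<Sum>n. diffs c n * x ^ n)) (at x)" for x
   by (rule termdiffs_strong_converges_everywhere[OF Suc.prems])
  show "Ck k UNIV (\<lambda>x. \<Sum>n. diffs c n * x ^ n)"
   by (rule Suc.IH) (rule termdiff_converges_all[OF Suc.prems])
 qed
qed simp

text \<open>The entire functions with \<open>shc (t\<^sup>2) = sinh t / t\<close> and \<open>chc (t\<^sup>2) = cosh t\<close>; they make the
 smoothness of the exponential map at the origin visible.\<close>

definition shc :: "real => real" where "shc x = (\<Sum>n. inverse (fact (2 * n + 1)) * x ^ n)"
definition chc :: "real => real" where "chc x = (\<Sum>n. inverse (fact (2 * n)) * x ^ n)"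
definition shc' :: "real => real" where "shc' x = (\<Sum>n. diffs (\<lambda>n. inverse (fact (2 * n + 1))) n * x ^ n)"

lemma summable_fact_powser:
 assumes "\<And>n. n \<le> g n"
 shows "summable (\<lambda>n. inverse (fact (g n)) * (x::real) ^ n)"
proof (rule summable_comparison_test'[where g = "\<lambda>n. inverse (fact n) * \<bar>x\<bar> ^ n" and N = 0])
 show "summable (\<lambda>n. inverse (fact n) * \<bar>x\<bar> ^ n)" using summable_exp[of "\<bar>x\<bar>"] .
 fix n :: nat
 have "(fact n :: real) \<le> fact (g n)" by (rule fact_mono) (rule assms)
 hence "inverse (fact (g n)) \<le> (inverse (fact n) :: real)" by (intro le_imp_inverse_le) auto
 thus "norm (inverse (fact (g n)) * x ^ n) \<le> inverse (fact n) * \<bar>x\<bar> ^ n"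
  by (auto simp: abs_mult power_abs intro!: mult_right_mono)
qed

lemma shc_summable: "summable (\<lambda>n. inverse (fact (2 * n + 1)) * (x::real) ^ n)"
 by (rule summable_fact_powser) simp
lemma chc_summable: "summable (\<lambda>n. inverse (fact (2 * n)) * (x::real) ^ n)"
 by (rule summable_fact_powser) simp

lemma shc_Ck: "Ck k UNIV shc"
 unfolding shc_def[abs_def] by (rule powser_Ck[OF shc_summable])
lemma chc_Ck: "Ck k UNIV chc"
 unfolding chc_def[abs_def] by (rule powser_Ck[OF chc_summable])
lemma shc'_Ck: "Ck k UNIV shc'"
 unfolding shc'_def[abs_def] by (rule powser_Ck[OF termdiff_converges_all[OF shc_summable]])

lemma shc_deriv: "(shc has_real_derivative shc' x) (at x)"
 unfolding shc_def[abs_def] shc'_def by (rule termdiffs_strong_converges_everywhere[OF shc_summable])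

lemma shc_pos: "0 \<le> x ==> 1 \<le> shc x"
 using sum_le_suminf[OF shc_summable, of "{0}" x] by (simp add: shc_def)

lemma shc'_nonneg: "0 \<le> x ==> 0 \<le> shc' x"
 unfolding shc'_def
 by (rule suminf_nonneg[OF termdiff_converges_all[OF shc_summable]]) (auto simp: diffs_def)

lemma shc_0 [simp]: "shc 0 = 1"
 using powser_zero[of "\<lambda>n. inverse (fact (2 * n + 1)) :: real"] by (simp add: shc_def)
lemma chc_0 [simp]: "chc 0 = 1"
 using powser_zero[of "\<lambda>n. inverse (fact (2 * n)) :: real"] by (simp add: chc_def)

lemma chc_square: "chc (t\<^sup>2) = cosh t"
proof -
 have "(\<lambda>n. (\<lambda>n. if even n then t ^ n /\<^sub>R fact n else 0) (2 * n)) sums cosh t"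
  by (subst sums_mono_reindex) (auto simp: strict_mono_def cosh_converges elim!: evenE)
 hence "(\<lambda>n. inverse (fact (2 * n)) * (t\<^sup>2) ^ n) sums cosh t"
  by (simp add: power_mult)
 thus ?thesis unfolding chc_def using sums_unique by metis
qed

lemma shc_square: "shc (t\<^sup>2) * t = sinh t"
proof -
 have "(\<lambda>n. (\<lambda>n. if even n then 0 else t ^ n /\<^sub>R fact n) (2 * n + 1)) sums sinh t"
  by (subst sums_mono_reindex) (auto simp: strict_mono_def sinh_converges elim!: oddE)
 moreover have "(\<lambda>n. if even n then 0 else t ^ n /\<^sub>R fact n) (2 * n + 1)
   = inverse (fact (2 * n + 1)) * (t\<^sup>2) ^ n * t" for n
 proof -
  have "t ^ (2 * n + 1) = (t\<^sup>2) ^ n * t" by (simp add: power_mult)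
  thus ?thesis by (simp del: fact_Suc)
 qed
 ultimately have "(\<lambda>n. inverse (fact (2 * n + 1)) * (t\<^sup>2) ^ n * t) sums sinh t" by (simp only:)
 moreover have "(\<lambda>n. inverse (fact (2 * n + 1)) * (t\<^sup>2) ^ n * t) sums (shc (t\<^sup>2) * t)"
  unfolding shc_def by (intro sums_mult2 summable_sums shc_summable)
 ultimately show ?thesis using sums_unique2 by blast
qed

definition exp0 :: "'v::real_inner => 'v" where "exp0 V = shc (V \<bullet> V) *\<^sub>R V"
definition expm :: "'v::real_inner => 'v \<times> real" where "expm V = (exp0 V, chc (V \<bullet> V))"

lemma fst_expm [simp]: "fst (expm V) = exp0 V" by (simp add: expm_def)

lemma exp0_Ck: "Ck k UNIV (exp0 :: 'v::euclidean_space => 'v)"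
proof -
 have i: "Ck k UNIV (\<lambda>V::'v. V \<bullet> V)"
  by (intro Ck_inner open_UNIV Ck_of_linear[OF bounded_linear_ident])
 show ?thesis unfolding exp0_def[abs_def]
  by (intro Ck_scaleR[OF open_UNIV Ck_compose[OF open_UNIV i shc_Ck]] Ck_of_linear[OF bounded_linear_ident]) simp
qed

lemma expm_Ck: "Ck k UNIV (expm :: 'v::euclidean_space => 'v \<times> real)"
proof -
 have i: "Ck k UNIV (\<lambda>V::'v. V \<bullet> V)"
  by (intro Ck_inner open_UNIV Ck_of_linear[OF bounded_linear_ident])
 show ?thesis unfolding expm_def[abs_def]
  by (intro Ck_Pair[OF open_UNIV exp0_Ck Ck_compose[OF open_UNIV i chc_Ck]]) simp
qed

lemma expm_0: "expm 0 = (0, 1)" by (simp add: expm_def exp0_def)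

lemma expm_has_derivative_0: "D expm (0::'v::euclidean_space) \<xi> = (\<xi>, 0)"
proof -
 have d: "(chc has_real_derivative (\<Sum>n. diffs (\<lambda>n. inverse (fact (2 * n))) n * x ^ n)) (at x)" for x
  unfolding chc_def[abs_def] by (rule termdiffs_strong_converges_everywhere[OF chc_summable])
 have i: "((\<lambda>V::'v. V \<bullet> V) has_derivative (\<lambda>\<xi>. 0)) (at 0)"
  using has_derivative_inner[OF has_derivative_ident has_derivative_ident, of "0::'v" UNIV] by simp
 have 1: "((\<lambda>V::'v. shc (V \<bullet> V)) has_derivative (\<lambda>\<xi>. 0)) (at 0)"
  using has_derivative_compose[OF i, of shc "\<lambda>h. h * shc' 0"] shc_deriv[of 0]
  by (simp add: has_field_derivative_def mult_commute_abs)
 have 2: "((\<lambda>V::'v. chc (V \<bullet> V)) has_derivative (\<lambda>\<xi>. 0)) (at 0)"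
  using has_derivative_compose[OF i, of chc] d[of 0] by (fastforce simp: has_field_derivative_def)
 have "(expm has_derivative (\<lambda>\<xi>::'v. (shc (0 \<bullet> (0::'v)) *\<^sub>R \<xi> + 0 *\<^sub>R 0, 0))) (at 0)"
  unfolding expm_def[abs_def] exp0_def
  by (intro has_derivative_Pair has_derivative_scaleR 1 2 has_derivative_ident)
 from D_eq[OF this] show ?thesis by simp
qed

lemma exp0_D:
 fixes V :: "'p::euclidean_space => 'v::euclidean_space"
 assumes "V differentiable (at x)"
 shows "D (\<lambda>y. exp0 (V y)) x b
  = shc (V x \<bullet> V x) *\<^sub>R D V x b + (2 * shc' (V x \<bullet> V x) * (V x \<bullet> D V x b)) *\<^sub>R V x"
proof -
 note dV = D_works[OF assms]
 have i: "((\<lambda>y. V y \<bullet> V y) has_derivative (\<lambda>b. V x \<bullet> D V x b + D V x b \<bullet> V x)) (at x)"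
  by (rule has_derivative_inner[OF dV dV])
 have 1: "((\<lambda>y. shc (V y \<bullet> V y)) has_derivative (\<lambda>b. shc' (V x \<bullet> V x) * (V x \<bullet> D V x b + D V x b \<bullet> V x))) (at x)"
  using has_derivative_compose[OF i, of shc "(*) (shc' (V x \<bullet> V x))"] shc_deriv[of "V x \<bullet> V x"]
  by (simp add: has_field_derivative_def)
 have "((\<lambda>y. exp0 (V y)) has_derivative (\<lambda>b. shc (V x \<bullet> V x) *\<^sub>R D V x b
   + (shc' (V x \<bullet> V x) * (V x \<bullet> D V x b + D V x b \<bullet> V x)) *\<^sub>R V x)) (at x)"
  unfolding exp0_def by (rule has_derivative_scaleR[OF 1 dV])
 from D_eq[OF this] show ?thesis by (simp add: inner_commute)
qed

text \<open>A differentiable map is as smooth as its image under the normal coordinate part of the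
 exponential map: differentiating the image gives a uniquely solvable linear system for the
 derivative, so that smoothness of the logarithm never has to be established.\<close>

lemma exp0_regularity:
 fixes V :: "'p::euclidean_space => 'v::euclidean_space"
 assumes S: "open S" and dV: "\<And>x. x \<in> S ==> V differentiable (at x)"
  and E: "Ck k S (\<lambda>x. exp0 (V x))"
 shows "Ck k S V"
 using E
proof (induction k)
 case (Suc k)
 have V: "Ck k S V" using Suc Ck_Suc_D by blast
 have VV: "Ck k S (\<lambda>x. V x \<bullet> V x)" by (rule Ck_inner[OF S V V])
 define q where "q c x = shc (V x \<bullet> V x) *\<^sub>R c + (2 * shc' (V x \<bullet> V x) * (V x \<bullet> c)) *\<^sub>R V x" for c x
 have q: "Ck k S (q c)" for c
  unfolding q_def[abs_def]
  by (intro Ck_add[OF S] Ck_scaleR[OF S] Ck_mult[OF S] Ck_inner[OF S] Ck_const V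
    Ck_compose[OF S VV shc_Ck] Ck_compose[OF S VV shc'_Ck]) simp_all
 have "Ck k S (\<lambda>x. D V x b)" if b: "b \<in> Basis" for b
 proof (rule solve_Ck[OF finite_Basis S, where q = q])
  show "Ck k S (q c)" for c by (rule q)
  show "Ck k S (\<lambda>x. D (\<lambda>x. exp0 (V x)) x b \<bullet> c)" for c
   using Suc.prems b by (intro Ck_inner[OF S] Ck_const) simp
  show "D V y b \<bullet> q c y = D (\<lambda>x. exp0 (V x)) y b \<bullet> c" if "y \<in> S" for y c
   unfolding exp0_D[OF dV[OF that]] q_def by (simp add: inner_add_left inner_add_right inner_commute)
  show "\<zeta> = 0" if "y \<in> S" and z: "\<And>c. c \<in> Basis ==> \<zeta> \<bullet> q c y = 0" for y \<zeta>
  proof -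
   define w where "w = shc (V y \<bullet> V y) *\<^sub>R \<zeta> + (2 * shc' (V y \<bullet> V y) * (V y \<bullet> \<zeta>)) *\<^sub>R V y"
   have "w \<bullet> c = 0" if "c \<in> Basis" for c
    using z[OF that] by (simp add: w_def q_def inner_add_left inner_add_right inner_commute mult_ac)
   hence "w = 0" by (simp add: euclidean_eq_iff[of w 0])
   hence "0 = w \<bullet> \<zeta>" by simp
   also have "\<dots> = shc (V y \<bullet> V y) * (\<zeta> \<bullet> \<zeta>) + 2 * shc' (V y \<bullet> V y) * (V y \<bullet> \<zeta>)\<^sup>2"
    by (simp add: w_def inner_add_left power2_eq_square)
   finally have e: "shc (V y \<bullet> V y) * (\<zeta> \<bullet> \<zeta>) + 2 * shc' (V y \<bullet> V y) * (V y \<bullet> \<zeta>)\<^sup>2 = 0" by simp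
   have "0 \<le> 2 * shc' (V y \<bullet> V y) * (V y \<bullet> \<zeta>)\<^sup>2"
    using shc'_nonneg[of "V y \<bullet> V y"] by simp
   moreover have "\<zeta> \<bullet> \<zeta> \<le> shc (V y \<bullet> V y) * (\<zeta> \<bullet> \<zeta>)"
    using mult_right_mono[OF shc_pos[of "V y \<bullet> V y"], of "\<zeta> \<bullet> \<zeta>"] by simp
   ultimately have "\<zeta> \<bullet> \<zeta> \<le> 0" using e by linarith
   thus ?thesis using inner_gt_zero_iff[of \<zeta>] by fastforce
  qed
 qed
 thus ?case using dV by simp
qed simp

definition flip :: "'b::real_inner \<times> real => 'b \<times> real" where "flip w = (fst w, - snd w)"

lemma lor_flip: "lor v w = v \<bullet> flip w"
 by (simp add: lor_def flip_def inner_prod_def)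

lemma flip_blin: "bounded_linear (flip :: 'b::real_inner \<times> real => _)"
 unfolding flip_def[abs_def]
 by (intro bounded_linear_Pair bounded_linear_fst bounded_linear_minus bounded_linear_snd)

lemma norm_flip [simp]: "norm (flip w) = norm w"
 by (simp add: flip_def norm_Pair norm_prod_def)

lemma flip_eq_0 [simp]: "flip w = 0 \<longleftrightarrow> w = 0"
 by (auto simp: flip_def prod_eq_iff)

lemma lor_le: "\<bar>lor v w\<bar> \<le> norm v * norm w"
 using Cauchy_Schwarz_ineq2[of v "flip w"] by (simp add: lor_flip)

lemma lor_add_left: "lor (u + v) w = lor u w + lor v w"
 and lor_add_right: "lor w (u + v) = lor w u + lor w v"
 and lor_diff_left: "lor (u - v) w = lor u w - lor v w"
 and lor_diff_right: "lor w (u - v) = lor w u - lor w v"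
 and lor_scale_left: "lor (a *\<^sub>R v) w = a * lor v w"
 and lor_scale_right: "lor w (a *\<^sub>R v) = a * lor w v"
 and lor_zero: "lor 0 w = 0" "lor w 0 = 0"
 by (simp_all add: lor_def inner_simps algebra_simps)

lemma lor_commute: "lor v w = lor w v"
 by (simp add: lor_def inner_commute mult.commute)

lemmas lor_simps = lor_add_left lor_add_right lor_diff_left lor_diff_right lor_scale_left lor_scale_right lor_zero

lemma lor_bb: "bounded_bilinear (lor :: 'b::real_inner \<times> real => _)"
proof
 show "\<exists>K. \<forall>a b :: 'b \<times> real. norm (lor a b) \<le> norm a * norm b * K"
  by (rule exI[of _ 1]) (simp add: lor_le)
qed (simp_all add: lor_simps)

lemma hyp_D:
 assumes "p \<in> hyp"
 shows "(snd p)\<^sup>2 = 1 + fst p \<bullet> fst p" "1 \<le> snd p" "lor p p = -1"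
proof -
 show 1: "(snd p)\<^sup>2 = 1 + fst p \<bullet> fst p" and "lor p p = -1"
  using assms by (auto simp: hyp_def lor_def power2_eq_square)
 have "1\<^sup>2 \<le> (snd p)\<^sup>2" using 1 inner_ge_zero[of "fst p"] by simp
 thus "1 \<le> snd p" by (rule power2_le_imp_le) (use assms in \<open>simp add: hyp_def\<close>)
qed

text \<open>The tangent spaces of the hyperboloid are spacelike.\<close>

lemma lor_pos:
 assumes "p \<in> hyp" "lor v p = 0" "v \<noteq> 0"
 shows "lor v v > 0"
proof -
 define s where "s = snd p"
 have s: "s\<^sup>2 = 1 + fst p \<bullet> fst p" "1 \<le> s" using hyp_D[OF assms(1)] by (auto simp: s_def)
 have e: "fst v \<bullet> fst p = snd v * s" using assms(2) by (simp add: lor_def s_def)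
 have "(snd v * s)\<^sup>2 \<le> (fst v \<bullet> fst v) * (fst p \<bullet> fst p)"
  using Cauchy_Schwarz_ineq[of "fst v" "fst p"] e by simp
 hence c: "(snd v)\<^sup>2 * s\<^sup>2 \<le> (fst v \<bullet> fst v) * (s\<^sup>2 - 1)"
  using s by (simp add: power_mult_distrib)
 have sp: "s\<^sup>2 > 0" using s(2) by simp
 have "fst v \<bullet> fst v > 0"
 proof (rule ccontr)
  assume "\<not> fst v \<bullet> fst v > 0"
  hence f: "fst v = 0" by simp
  hence "(snd v)\<^sup>2 * s\<^sup>2 \<le> 0" using c by simp
  hence "snd v = 0" using sp by (simp add: mult_le_0_iff)
  with f assms(3) show False by (simp add: prod_eq_iff)
 qed
 moreover have "(fst v \<bullet> fst v) \<le> (fst v \<bullet> fst v - (snd v)\<^sup>2) * s\<^sup>2"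
  using c by (simp add: algebra_simps)
 ultimately have "0 < (fst v \<bullet> fst v - (snd v)\<^sup>2) * s\<^sup>2" by linarith
 thus ?thesis using sp by (simp add: lor_def power2_eq_square zero_less_mult_iff)
qed

text \<open>The reversed Cauchy-Schwarz inequality.\<close>

lemma lor_hyp_ge_1:
 assumes "p \<in> hyp" "q \<in> hyp"
 shows "1 \<le> - lor p q"
proof -
 define s t where "s = snd p" and "t = snd q"
 have s: "s\<^sup>2 = 1 + fst p \<bullet> fst p" "1 \<le> s" and t: "t\<^sup>2 = 1 + fst q \<bullet> fst q" "1 \<le> t"
  using hyp_D[OF assms(1)] hyp_D[OF assms(2)] by (auto simp: s_def t_def)
 have "(fst p \<bullet> fst q)\<^sup>2 \<le> (s\<^sup>2 - 1) * (t\<^sup>2 - 1)"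
  using Cauchy_Schwarz_ineq[of "fst p" "fst q"] s t by simp
 also have "\<dots> = (s * t - 1)\<^sup>2 - (s - t)\<^sup>2" by (simp add: power2_eq_square algebra_simps)
 also have "\<dots> \<le> (s * t - 1)\<^sup>2" by simp
 finally have "(fst p \<bullet> fst q)\<^sup>2 \<le> (s * t - 1)\<^sup>2" .
 moreover have "1 * 1 \<le> s * t" using s t by (intro mult_mono) auto
 ultimately have "fst p \<bullet> fst q \<le> s * t - 1" by (auto intro: power2_le_imp_le)
 thus ?thesis by (simp add: lor_def s_def t_def)
qed

lemma hexp_lor:
 assumes "p \<in> hyp" "v \<in> htangent p"
 shows "lor p (hexp p v) = - cosh (sqrt (lor v v))"
 using assms hyp_D(3)[OF assms(1)] by (simp add: hexp_def Let_def lor_simps htangent_def)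

text \<open>The tangential part of \<open>q\<close> at \<open>p\<close>, rescaled to the hyperbolic distance, is the logarithm; this
 resolves the definite description.\<close>

lemma hlog_exp:
 assumes p: "p \<in> hyp" and q: "q \<in> hyp"
 shows "hlog p q \<in> htangent p" "hexp p (hlog p q) = q"
proof -
 define c where "c = - lor p q"
 have c1: "1 \<le> c" using lor_hyp_ge_1[OF p q] by (simp add: c_def)
 define u where "u = q - c *\<^sub>R p"
 have ut: "lor p u = 0" using hyp_D(3)[OF p] by (simp add: u_def c_def lor_simps)
 have uu: "lor u u = c\<^sup>2 - 1"
  using hyp_D(3)[OF p] hyp_D(3)[OF q] lor_commute[of q p]
  by (simp add: u_def lor_simps power2_eq_square algebra_simps c_def)
 define t where "t = arcosh c"
 have t: "cosh t = c" "0 \<le> t" using c1 by (auto simp: t_def cosh_arcosh_real)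
 have ex: "\<exists>v. v \<in> htangent p \<and> hexp p v = q"
 proof (cases "c = 1")
  case True
  hence "u = 0" using lor_pos[OF p, of u] ut uu lor_commute[of u p] by auto
  hence "q = p" using True by (simp add: u_def)
  thus ?thesis by (intro exI[of _ 0]) (auto simp: htangent_def hexp_def lor_simps)
 next
  case False
  hence "t \<noteq> 0" using t by auto
  hence tp: "t > 0" using t by simp
  hence sp: "sinh t > 0" by simp
  have "c\<^sup>2 - 1 = (sinh t)\<^sup>2" using t hyperbolic_pythagoras[of t] by simp
  hence l: "lor ((t / sinh t) *\<^sub>R u) ((t / sinh t) *\<^sub>R u) = t\<^sup>2"
   using uu sp by (simp add: lor_simps power2_eq_square field_simps)
  have "hexp p ((t / sinh t) *\<^sub>R u) = c *\<^sub>R p + u"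
   using tp sp t by (simp add: hexp_def Let_def l)
  thus ?thesis using ut by (intro exI[of _ "(t / sinh t) *\<^sub>R u"]) (auto simp: htangent_def lor_simps u_def)
 qed
 have un: "v = w" if v: "v \<in> htangent p" "hexp p v = q" and w: "w \<in> htangent p" "hexp p w = q" for v w
 proof -
  have nn: "0 \<le> lor v v" if "v \<in> htangent p" for v
   using lor_pos[OF p, of v] that lor_commute[of v p] by (cases "v = 0") (auto simp: htangent_def lor_simps)
  have z: "v = 0" if "v \<in> htangent p" "lor v v = 0" for v
   using lor_pos[OF p, of v] that lor_commute[of v p] by (auto simp: htangent_def)
  have "cosh (sqrt (lor v v)) = cosh (sqrt (lor w w))"
   using hexp_lor[OF p v(1)] hexp_lor[OF p w(1)] v w by simp
  hence st: "sqrt (lor v v) = sqrt (lor w w)"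
   using cosh_real_nonneg_le_iff nn v(1) w(1) by (intro antisym) (auto simp: cosh_real_nonneg_le_iff)
  show ?thesis
  proof (cases "lor v v = 0")
   case True
   hence "lor w w = 0" using st by simp
   thus ?thesis using True z[OF v(1)] z[OF w(1)] by simp
  next
   case False
   hence "sqrt (lor v v) > 0" using nn[OF v(1)] by simp
   hence k: "sinh (sqrt (lor v v)) / sqrt (lor v v) \<noteq> 0" by simp
   have "hexp p v = hexp p w" using v(2) w(2) by simp
   hence "(sinh (sqrt (lor v v)) / sqrt (lor v v)) *\<^sub>R v = (sinh (sqrt (lor v v)) / sqrt (lor v v)) *\<^sub>R w"
    unfolding hexp_def Let_def st[symmetric] by (simp only: add_left_cancel)
   thus ?thesis using k by (simp only: scaleR_cancel_left) blast
  qed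
 qed
 have "\<exists>!v. v \<in> htangent p \<and> hexp p v = q" using ex un by blast
 from theI'[OF this] show "hlog p q \<in> htangent p" "hexp p (hlog p q) = q" by (auto simp: hlog_def)
qed

text \<open>A linear isometry of one tangent space extends to a Lorentz transformation, which takes the
 exponential map at \<open>p\<close> to the one in standard position.\<close>

definition lchart :: "('b::real_inner \<times> real => 'b) => 'b \<times> real => 'b \<times> real => 'b \<times> real" where
 "lchart R p v = (R (v + lor p v *\<^sub>R p), - lor p v)"

definition tangent_isometry :: "('b::real_inner \<times> real => 'b) => 'b \<times> real => bool" where
 "tangent_isometry R p \<longleftrightarrow> p \<in> hyp \<and> linear R \<and> (\<forall>v\<in>htangent p. \<forall>w\<in>htangent p. R v \<bullet> R w = lor v w)"

lemma lchart_linear: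
 assumes "tangent_isometry R p" shows "linear (lchart R p)"
proof -
 have l: "linear R" using assms by (simp add: tangent_isometry_def)
 show ?thesis
 proof (rule linearI)
  fix v w :: "'a \<times> real" and a :: real
  have e: "v + w + (lor p v + lor p w) *\<^sub>R p = (v + lor p v *\<^sub>R p) + (w + lor p w *\<^sub>R p)"
   by (simp add: scaleR_add_left)
  show "lchart R p (v + w) = lchart R p v + lchart R p w"
   unfolding lchart_def lor_simps e by (simp add: linear_add[OF l])
  have e: "a *\<^sub>R v + (a * lor p v) *\<^sub>R p = a *\<^sub>R (v + lor p v *\<^sub>R p)"
   by (simp add: scaleR_add_right)
  show "lchart R p (a *\<^sub>R v) = a *\<^sub>R lchart R p v"
   unfolding lchart_def lor_simps e by (simp add: linear_scale[OF l])
 qed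
qed

lemma lchart_lor:
 assumes "tangent_isometry R p" shows "lor (lchart R p v) (lchart R p w) = lor v w"
proof -
 have p: "lor p p = -1" using assms hyp_D(3)[of p] by (simp add: tangent_isometry_def)
 have t: "v + lor p v *\<^sub>R p \<in> htangent p" for v by (simp add: htangent_def lor_simps p)
 have "R (v + lor p v *\<^sub>R p) \<bullet> R (w + lor p w *\<^sub>R p) = lor (v + lor p v *\<^sub>R p) (w + lor p w *\<^sub>R p)"
  using assms t by (simp add: tangent_isometry_def)
 also have "\<dots> = lor v w + lor p v * lor p w"
  using lor_commute[of v p] by (simp add: lor_simps p)
 finally show ?thesis by (simp add: lchart_def lor_def[of "(_, _)"])
qed

lemma lchart_inj:
 assumes "tangent_isometry R p" shows "inj (lchart R p)"
proof -
 have "v = 0" if "lchart R p v = 0" for v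
 proof -
  have "lor p v = 0" using that by (simp add: lchart_def zero_prod_def)
  moreover have "lor v v = 0" using lchart_lor[OF assms, of v v] that by (simp add: lor_simps)
  ultimately show ?thesis
   using lor_pos[of p v] assms lor_commute[of p v] by (auto simp: tangent_isometry_def)
 qed
 thus ?thesis using linear_injective_0[OF lchart_linear[OF assms]] by blast
qed

lemma lchart_hexp:
 assumes "tangent_isometry R p" "v \<in> htangent p"
 shows "lchart R p (hexp p v) = expm (R v)"
proof -
 have l: "linear R" and pp: "lor p p = -1" using assms hyp_D(3)[of p] by (simp_all add: tangent_isometry_def)
 have pv: "lor p v = 0" using assms(2) by (simp add: htangent_def)
 have nv: "lor v v = R v \<bullet> R v" using assms by (simp add: tangent_isometry_def)
 define t where "t = sqrt (lor v v)"
 have t2: "t\<^sup>2 = R v \<bullet> R v" using nv by (simp add: t_def)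
 have s: "(sinh t / t) *\<^sub>R R v = shc (t\<^sup>2) *\<^sub>R R v"
 proof (cases "t = 0")
  case True thus ?thesis using t2 by simp
 next
  case False thus ?thesis using shc_square[of t] by (simp add: field_simps)
 qed
 have "hexp p v + lor p (hexp p v) *\<^sub>R p = (sinh t / t) *\<^sub>R v"
  by (simp add: hexp_def Let_def t_def[symmetric] lor_simps pv pp)
 moreover have "- lor p (hexp p v) = chc (t\<^sup>2)"
  by (simp add: hexp_def Let_def t_def[symmetric] lor_simps pv pp chc_square)
 ultimately show ?thesis
  using s by (simp add: lchart_def expm_def exp0_def linear_scale[OF l] t2)
qed

lemma expm_hyp: "expm V \<in> hyp"
proof -
 define t where "t = norm V"
 have t: "V \<bullet> V = t\<^sup>2" by (simp add: t_def power2_norm_eq_inner)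
 have "exp0 V \<bullet> exp0 V = (shc (t\<^sup>2) * t)\<^sup>2"
  unfolding exp0_def t by (simp add: power_mult_distrib power2_eq_square flip: power2_norm_eq_inner t_def)
 hence "lor (expm V) (expm V) = (sinh t)\<^sup>2 - (cosh t)\<^sup>2"
  unfolding lor_def expm_def t fst_conv snd_conv shc_square chc_square by (simp add: power2_eq_square)
 moreover have "snd (expm V) = cosh t" by (simp add: expm_def t chc_square)
 ultimately show ?thesis using hyperbolic_pythagoras[of t] by (simp add: hyp_def)
qed

text \<open>The exponential map is smooth with derivative the inclusion at the origin.\<close>

lemma expm_bounds:
 "\<exists>C\<ge>1. \<forall>V::'v::euclidean_space. norm V \<le> 1 -->
  (\<forall>\<xi>. norm (D expm V \<xi> - (\<xi>, 0)) \<le> C * norm V * norm \<xi>) \<and>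
  (\<forall>b\<in>Basis. \<forall>\<zeta>. norm (D2 expm b V \<zeta>) \<le> C * norm \<zeta>) \<and>
  norm (fst (expm V)) \<le> C * norm V"
proof -
 have "\<exists>M\<ge>0. \<forall>V\<in>cball 0 1. bd 2 (expm :: 'v => _) V M"
  by (rule bd_compact[OF compact_cball subset_UNIV expm_Ck])
 then obtain M where M: "M \<ge> 0" "\<And>V::'v. norm V \<le> 1 ==> bd 2 expm V M" by auto
 have e2: "Ck 2 UNIV (expm :: 'v => _)" by (rule expm_Ck)
 have d1: "(expm :: 'v => _) differentiable (at z)" for z using e2 by (simp add: numeral_2_eq_2)
 have d2: "(\<lambda>z::'v. D expm z b) differentiable (at z)" if "b \<in> Basis" for b z
  using e2 that by (simp add: numeral_2_eq_2)
 define C1 where "C1 = real DIM('v) * M"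
 have C1: "C1 \<ge> 0" using M by (simp add: C1_def)
 have s: "norm (D2 expm b V \<zeta>) \<le> C1 * norm \<zeta>" if "norm V \<le> 1" "b \<in> Basis" for V b and \<zeta> :: 'v
  unfolding C1_def using M(2)[OF that(1)] that(2)
  by (intro bd_D_norm[OF d2[OF that(2)]]) (auto simp: numeral_2_eq_2)
 define C where "C = real DIM('v) * C1 + C1 + M + 1"
 have f1: "norm (D expm V \<xi> - (\<xi>, 0)) \<le> real DIM('v) * C1 * norm V * norm \<xi>" if V: "norm V \<le> 1" for V \<xi> :: 'v
 proof -
  have b: "norm (D expm V b - D expm 0 b) \<le> C1 * norm V" if b: "b \<in> Basis" for b
  proof -
   have "norm (D expm V b - D expm 0 b) \<le> C1 * norm (V - 0)"
   proof (rule differentiable_bound[where S = "cball 0 1" and f = "\<lambda>z. D expm z b" and f' = "\<lambda>z. D2 expm b z"])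
    fix z :: 'v assume z: "z \<in> cball 0 1"
    show "((\<lambda>z. D expm z b) has_derivative D2 expm b z) (at z within cball 0 1)"
     using D_works[OF d2[OF b, of z]] has_derivative_at_withinI by blast
    show "onorm (D2 expm b z) \<le> C1"
     using z C1 by (intro onorm_le s b) auto
   qed (use V in auto)
   thus ?thesis by simp
  qed
  have "D expm V \<xi> - D expm 0 \<xi> = (\<Sum>b\<in>Basis. (\<xi> \<bullet> b) *\<^sub>R (D expm V b - D expm 0 b))"
   by (simp add: D_expand[OF d1, of V \<xi>] D_expand[OF d1, of 0 \<xi>] scaleR_diff_right sum_subtractf)
  also have "norm \<dots> \<le> (\<Sum>b\<in>(Basis::'v set). norm \<xi> * (C1 * norm V))"
  proof (rule sum_norm_le)
   fix c :: 'v assume c: "c \<in> Basis"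
   have "\<bar>\<xi> \<bullet> c\<bar> * norm (D expm V c - D expm 0 c) \<le> norm \<xi> * (C1 * norm V)"
    using b[OF c] Basis_le_norm[OF c, of \<xi>] by (intro mult_mono) auto
   thus "norm ((\<xi> \<bullet> c) *\<^sub>R (D expm V c - D expm 0 c)) \<le> norm \<xi> * (C1 * norm V)" by simp
  qed
  finally show ?thesis by (simp add: expm_has_derivative_0 mult_ac)
 qed
 have f3: "norm (fst (expm V)) \<le> (real DIM('v) * C1 + M + 1) * norm V" if V: "norm V \<le> 1" for V :: 'v
 proof -
  have "norm (expm V - expm 0) \<le> (real DIM('v) * C1 + 1) * norm (V - 0)"
  proof (rule differentiable_bound[where S = "cball 0 1" and f = expm and f' = "\<lambda>z. D expm z"])
   fix z :: 'v assume z: "z \<in> cball 0 1"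
   show "(expm has_derivative D expm z) (at z within cball 0 1)"
    using D_works[OF d1] has_derivative_at_withinI by blast
   have "norm (D expm z \<xi>) \<le> (real DIM('v) * C1 + 1) * norm \<xi>" for \<xi>
   proof -
    have "norm (D expm z \<xi>) \<le> norm (D expm z \<xi> - (\<xi>, 0)) + norm (\<xi>, 0::real)"
     using norm_triangle_sub[of "D expm z \<xi>" "(\<xi>, 0)"] by linarith
    also have "\<dots> \<le> real DIM('v) * C1 * norm z * norm \<xi> + norm \<xi>" using f1[of z \<xi>] z by (simp add: norm_Pair)
    also have "\<dots> \<le> real DIM('v) * C1 * 1 * norm \<xi> + norm \<xi>"
     using z C1 by (intro add_mono mult_right_mono mult_left_mono) auto
    finally show ?thesis by (simp add: algebra_simps)
   qed
   thus "onorm (D expm z) \<le> real DIM('v) * C1 + 1" using C1 by (intro onorm_le) auto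
  qed (use V in auto)
  moreover have "norm (fst (expm V - expm 0)) \<le> norm (expm V - expm 0)"
   using norm_fst_le[of "fst (expm V - expm 0)" "snd (expm V - expm 0)"] unfolding prod.collapse .
  moreover have "fst (expm V - expm 0) = fst (expm V)" by (simp add: expm_0)
  ultimately have "norm (fst (expm V)) \<le> (real DIM('v) * C1 + 1) * norm V" by simp
  also have "\<dots> \<le> (real DIM('v) * C1 + M + 1) * norm V" using M by (intro mult_right_mono) auto
  finally show ?thesis .
 qed
 have "C \<ge> 1" using C1 M by (simp add: C_def)
 moreover have "norm (D expm V \<xi> - (\<xi>, 0)) \<le> C * norm V * norm \<xi>" if "norm V \<le> 1" for V \<xi> :: 'v
  using f1[OF that, of \<xi>] C1 M by (intro order_trans[OF f1[OF that]] mult_right_mono) (auto simp: C_def)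
 moreover have "norm (D2 expm b V \<zeta>) \<le> C * norm \<zeta>" if "norm V \<le> 1" "b \<in> Basis" for V b and \<zeta> :: 'v
  using C1 M by (intro order_trans[OF s[OF that]] mult_right_mono) (auto simp: C_def)
 moreover have "norm (fst (expm V)) \<le> C * norm V" if "norm V \<le> 1" for V :: 'v
  using C1 M by (intro order_trans[OF f3[OF that]] mult_right_mono) (auto simp: C_def)
 ultimately show ?thesis by (intro exI[of _ C]) auto
qed

section \<open>Small hypersurfaces of hyperbolic space\<close>

text \<open>The hypersurface with rescaled preimage \<open>U\<close> in the tangent space, in Lorentzian coordinates centered
 at the base point.\<close>

abbreviation hsurf :: "real => ('a => 'v::real_inner) => 'a => 'v \<times> real" where
 "hsurf r U \<equiv> \<lambda>z. expm (r *\<^sub>R U z)"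

definition bounded_jet :: "real => ('a::euclidean_space => 'v::euclidean_space) => 'a => bool" where
 "bounded_jet K U y \<longleftrightarrow> (\<exists>S. open S \<and> y \<in> S \<and> Ck 2 S U) \<and> norm (U y) \<le> K \<and>
  (\<forall>v. norm (D U y v) \<le> K * norm v) \<and>
  (\<forall>v w. norm (D2 U w y v) \<le> K * norm v * norm w)"

lemma Ck2_differentiable:
 assumes "open S" "Ck 2 S U" "y \<in> S"
 shows "U differentiable (at y)" "(\<lambda>z. D U z w) differentiable (at y)"
proof -
 show "U differentiable (at y)" using assms by (simp add: numeral_2_eq_2)
 have "Ck 1 S (\<lambda>z. D U z w)" using Ck_D[OF assms(1), of 1 U w] assms(2) by (simp only: numeral_2_eq_2 One_nat_def)
 thus "(\<lambda>z. D U z w) differentiable (at y)" using assms(3) by simp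
qed

lemma expm_scaled_Ck: "open S ==> Ck k S U ==> Ck k S (hsurf r U)"
 for U :: "'a::euclidean_space => 'v::euclidean_space"
 by (rule Ck_compose[OF _ _ expm_Ck]) (auto intro: Ck_scaleR Ck_const)

text \<open>The hypersurface agrees with its preimage in the tangent space to relative order \<open>r\<close>, including second derivatives.\<close>

definition jet_close :: "real => real => ('a::euclidean_space => 'v::euclidean_space) => 'a => bool" where
 "jet_close C r U y \<longleftrightarrow> norm (fst (expm (r *\<^sub>R U y))) \<le> C * r \<and>
  (\<forall>v. norm (D (hsurf r U) y v - r *\<^sub>R (D U y v, 0)) \<le> C * r\<^sup>2 * norm v) \<and>
  (\<forall>v w. norm (D2 (hsurf r U) w y v - r *\<^sub>R (D2 U w y v, 0)) \<le> C * r\<^sup>2 * norm v * norm w)"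

lemma expm_jet:
 assumes K: "K \<ge> 1"
 shows "\<exists>C\<ge>1. \<forall>(U :: 'a::euclidean_space => 'v::euclidean_space) y r. bounded_jet K U y \<and> 0 < r \<and> r * K \<le> 1 --> jet_close C r U y"
proof -
 obtain C where C1: "C \<ge> 1" and C: "\<forall>V::'v. norm V \<le> 1 -->
  (\<forall>\<xi>. norm (D expm V \<xi> - (\<xi>, 0)) \<le> C * norm V * norm \<xi>) \<and>
  (\<forall>b\<in>Basis. \<forall>\<zeta>. norm (D2 expm b V \<zeta>) \<le> C * norm \<zeta>) \<and>
  norm (fst (expm V)) \<le> C * norm V" using expm_bounds by blast
 define C' where "C' = (real DIM('v) + 1) * C * K\<^sup>2"
 have K2: "K \<le> K\<^sup>2" "1 \<le> K\<^sup>2" using K by (auto simp: power2_eq_square intro: mult_left_le order_trans)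
 have "1 \<le> C * K\<^sup>2" using C1 K2 mult_mono[of 1 C 1 "K\<^sup>2"] by auto
 hence CC: "C * K\<^sup>2 \<le> C'" "1 \<le> C'" using mult_right_mono[of 1 "real DIM('v) + 1" "C * K\<^sup>2"] by (auto simp: C'_def mult.assoc)
 have CK: "C * K \<le> C'" using CC(1) mult_left_mono[OF K2(1), of C] C1 by linarith
 show ?thesis unfolding jet_close_def
 proof (intro exI[of _ C'] conjI CC allI impI)
  fix U :: "'a => 'v" and y :: 'a and r :: real
  assume A: "bounded_jet K U y \<and> 0 < r \<and> r * K \<le> 1"
  then obtain S where S: "open S" "y \<in> S" "Ck 2 S U" unfolding bounded_jet_def by blast
  have r: "0 < r" "r * K \<le> 1" using A by auto
  have U0: "norm (U y) \<le> K" and U1: "\<And>v. norm (D U y v) \<le> K * norm v"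
   and U2: "\<And>v w. norm (D2 U w y v) \<le> K * norm v * norm w"
   using A unfolding bounded_jet_def by blast+
  define V where "V z = r *\<^sub>R U z" for z
  have dU: "U differentiable (at z)" if "z \<in> S" for z using Ck2_differentiable(1)[OF S(1,3) that] .
  have dV: "V differentiable (at z)" if "z \<in> S" for z unfolding V_def
   using D_bounded_linear(2)[OF bounded_linear_scaleR_right dU[OF that]] .
  have DV: "D V z v = r *\<^sub>R D U z v" if "z \<in> S" for z v unfolding V_def
   using D_bounded_linear(1)[OF bounded_linear_scaleR_right dU[OF that]] .
  have e2: "Ck 2 UNIV (expm :: 'v => _)" by (rule expm_Ck)
  have d1: "(expm :: 'v => _) differentiable (at z)" for z
   using Ck2_differentiable(1)[OF open_UNIV e2, of z] by simp
  have d2: "(\<lambda>z::'v. D expm z b) differentiable (at z)" for b z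
   using Ck2_differentiable(2)[OF open_UNIV e2, of z] by simp
  have nV: "norm (V y) \<le> r * K" using U0 r by (simp add: V_def)
  hence nV1: "norm (V y) \<le> 1" using r by linarith
  note CV = C[rule_format, OF nV1]
  show "norm (fst (expm (r *\<^sub>R U y))) \<le> C' * r"
  proof -
   have "norm (fst (expm (V y))) \<le> C * norm (V y)" using CV by blast
   also have "\<dots> \<le> C * (r * K)" using C1 nV by (intro mult_left_mono) auto
   also have "\<dots> = (C * K) * r" by simp
   also have "\<dots> \<le> C' * r" using CK r by (intro mult_right_mono) auto
   finally show ?thesis by (simp add: V_def)
  qed
  have DF: "D (\<lambda>z. expm (V z)) z v = r *\<^sub>R D expm (V z) (D U z v)" if "z \<in> S" for z v
   using D_compose(1)[OF dV[OF that] d1] DV[OF that] linear_scale[OF D_linear[OF d1]] by metis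
  show "norm (D (hsurf r U) y v - r *\<^sub>R (D U y v, 0)) \<le> C' * r\<^sup>2 * norm v" for v
  proof -
   have "D (\<lambda>z. expm (V z)) y v - r *\<^sub>R (D U y v, 0) = r *\<^sub>R (D expm (V y) (D U y v) - (D U y v, 0))"
    unfolding DF[OF S(2)] by (simp add: scaleR_diff_right)
   hence "norm (D (\<lambda>z. expm (V z)) y v - r *\<^sub>R (D U y v, 0)) = r * norm (D expm (V y) (D U y v) - (D U y v, 0))"
    using r by simp
   also have "\<dots> \<le> r * (C * norm (V y) * norm (D U y v))" using CV r by (intro mult_left_mono) auto
   also have "\<dots> \<le> r * (C * (r * K) * (K * norm v))"
    using C1 r K nV U1 by (intro mult_left_mono mult_mono) auto
   also have "\<dots> = (C * K\<^sup>2) * (r\<^sup>2 * norm v)" by (simp add: power2_eq_square)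
   also have "\<dots> \<le> C' * (r\<^sup>2 * norm v)" using CC by (intro mult_right_mono) auto
   finally show ?thesis by (simp add: V_def)
  qed
  show "norm (D2 (hsurf r U) w y v - r *\<^sub>R (D2 U w y v, 0)) \<le> C' * r\<^sup>2 * norm v * norm w" for v w
  proof -
   define a where "a z = D U z w" for z
   have da: "a differentiable (at y)" unfolding a_def using Ck2_differentiable(2)[OF S(1,3,2)] .
   have dab: "(\<lambda>z. a z \<bullet> b) differentiable (at y)" for b
    by (rule D_bounded_linear(2)[OF bounded_linear_inner_left da])
   have deb: "(\<lambda>z. D expm (V z) b) differentiable (at y)" for b
    by (rule D_compose(2)[OF dV[OF S(2)] d2])
   have DFw: "D (\<lambda>z. expm (V z)) z w = r *\<^sub>R (\<Sum>b\<in>Basis. (a z \<bullet> b) *\<^sub>R D expm (V z) b)" if "z \<in> S" for z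
    unfolding DF[OF that] a_def using D_expand[OF d1, of "V z" "D U z w"] by simp
   have h: "((\<lambda>z. r *\<^sub>R (\<Sum>b\<in>Basis. (a z \<bullet> b) *\<^sub>R D expm (V z) b)) has_derivative
     (\<lambda>v. r *\<^sub>R (\<Sum>b\<in>Basis. (a y \<bullet> b) *\<^sub>R D (\<lambda>z. D expm (V z) b) y v + (D a y v \<bullet> b) *\<^sub>R D expm (V y) b))) (at y)"
    using D_works[OF dab] D_works[OF deb] D_works[OF da]
    by (intro has_derivative_scaleR_right has_derivative_sum has_derivative_scaleR has_derivative_inner_left) auto
   have "D (\<lambda>z. D (\<lambda>z. expm (V z)) z w) y v
     = D (\<lambda>z. r *\<^sub>R (\<Sum>b\<in>Basis. (a z \<bullet> b) *\<^sub>R D expm (V z) b)) y v"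
    by (rule arg_cong[OF D_cong[OF S(1,2)], of _ _ "\<lambda>f. f v"]) (rule DFw)
   also have "\<dots> = r *\<^sub>R (\<Sum>b\<in>Basis. (a y \<bullet> b) *\<^sub>R D (\<lambda>z. D expm (V z) b) y v + (D a y v \<bullet> b) *\<^sub>R D expm (V y) b)"
    using D_eq[OF h] by simp
   also have "\<dots> = r *\<^sub>R ((\<Sum>b\<in>Basis. (a y \<bullet> b) *\<^sub>R D2 expm b (V y) (r *\<^sub>R D U y v)) + D expm (V y) (D a y v))"
    by (simp add: sum.distrib D_expand[OF d1, of "V y" "D a y v"] D_compose(1)[OF dV[OF S(2)] d2] DV[OF S(2)])
   finally have e: "D (\<lambda>z. D (\<lambda>z. expm (V z)) z w) y v - r *\<^sub>R (D a y v, 0)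
    = r *\<^sub>R ((\<Sum>b\<in>Basis. (a y \<bullet> b) *\<^sub>R D2 expm b (V y) (r *\<^sub>R D U y v)) + (D expm (V y) (D a y v) - (D a y v, 0)))"
    by (simp add: scaleR_diff_right scaleR_add_right)
   have s: "norm (\<Sum>b\<in>Basis. (a y \<bullet> b) *\<^sub>R D2 expm b (V y) (r *\<^sub>R D U y v))
     \<le> (\<Sum>b\<in>(Basis::'v set). (K * norm w) * (C * (r * (K * norm v))))"
   proof (rule sum_norm_le)
    fix b :: 'v assume b: "b \<in> Basis"
    have "\<bar>a y \<bullet> b\<bar> \<le> K * norm w" using Basis_le_norm[OF b, of "a y"] U1[of w] by (simp add: a_def)
    moreover have "norm (D2 expm b (V y) (r *\<^sub>R D U y v)) \<le> C * norm (r *\<^sub>R D U y v)" using CV b by blast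
    moreover have "C * norm (r *\<^sub>R D U y v) \<le> C * (r * (K * norm v))" using U1[of v] C1 r by simp
    ultimately have "\<bar>a y \<bullet> b\<bar> * norm (D2 expm b (V y) (r *\<^sub>R D U y v)) \<le> (K * norm w) * (C * (r * (K * norm v)))"
     using K by (intro mult_mono) auto
    thus "norm ((a y \<bullet> b) *\<^sub>R D2 expm b (V y) (r *\<^sub>R D U y v)) \<le> (K * norm w) * (C * (r * (K * norm v)))" by simp
   qed
   have t: "norm (D expm (V y) (D a y v) - (D a y v, 0)) \<le> C * (r * K) * (K * norm v * norm w)"
   proof -
    have "norm (D expm (V y) (D a y v) - (D a y v, 0)) \<le> C * norm (V y) * norm (D a y v)" using CV by blast
    also have "\<dots> \<le> C * (r * K) * (K * norm v * norm w)"
     using C1 r K nV U2[of w v] by (intro mult_mono) (auto simp: a_def[abs_def])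
    finally show ?thesis .
   qed
   have "norm (D (\<lambda>z. D (\<lambda>z. expm (V z)) z w) y v - r *\<^sub>R (D a y v, 0))
     \<le> r * ((\<Sum>b\<in>(Basis::'v set). (K * norm w) * (C * (r * (K * norm v)))) + C * (r * K) * (K * norm v * norm w))"
    unfolding e norm_scaleR
    using mult_left_mono[OF norm_triangle_le[OF add_mono[OF s t]], of r] r by simp
   also have "\<dots> = C' * r\<^sup>2 * norm v * norm w" by (simp add: C'_def power2_eq_square algebra_simps)
   finally show ?thesis by (simp add: a_def[abs_def] V_def)
  qed
 qed
qed

text \<open>A quantitative way to say that \<open>U\<close> is an immersion and \<open>n\<close> a unit vector away from its tangent space.\<close>

definition transversal :: "real => ('a::euclidean_space => 'a \<times> real) => 'a => 'a \<times> real => bool" where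
 "transversal c U y n \<longleftrightarrow> norm n = 1 \<and> (\<forall>v t. c * norm (v, t) \<le> norm (D U y v + t *\<^sub>R n))"

text \<open>Transversality bounds the inverse of a linear map; this is the same bound for the inverse of its adjoint.\<close>

lemma transversal_dual:
 fixes U :: "'a::euclidean_space => 'a \<times> real"
 assumes t: "transversal c U y n" and c: "0 < c" and d: "U differentiable (at y)"
  and a1: "\<And>v. \<bar>a \<bullet> D U y v\<bar> \<le> \<alpha> * norm v" and a2: "\<bar>a \<bullet> n\<bar> \<le> \<beta>" and nn: "0 \<le> \<alpha>" "0 \<le> \<beta>"
 shows "norm a \<le> (\<alpha> + \<beta>) / c"
proof -
 define M where "M q = D U y (fst q) + snd q *\<^sub>R n" for q :: "'a \<times> real"
 have lin: "linear M"
  unfolding M_def using D_linear[OF d]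
  by (intro linearI) (simp_all add: linear_add linear_scale algebra_simps)
 have lb: "c * norm q \<le> norm (M q)" for q
  using t unfolding transversal_def M_def by (metis prod.collapse)
 hence "M q = 0 ==> q = 0" for q using c by (metis mult_le_0_iff norm_eq_zero norm_le_zero_iff not_less)
 hence "inj M" using linear_injective_0[OF lin] by blast
 hence "surj M" using linear_injective_imp_surjective[OF lin] by blast
 then obtain q where q: "a = M q" by blast
 have f: "norm (fst q) \<le> norm q" "\<bar>snd q\<bar> \<le> norm q"
  using norm_fst_le[of "fst q" "snd q"] norm_snd_le[of "snd q" "fst q"] by auto
 have "norm a * norm a = a \<bullet> D U y (fst q) + snd q * (a \<bullet> n)"
 proof -
  have "norm a * norm a = a \<bullet> M q" using q power2_norm_eq_inner[of a] by (simp add: power2_eq_square)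
  thus ?thesis by (simp add: M_def inner_add_right)
 qed
 also have "\<dots> \<le> \<alpha> * norm (fst q) + \<bar>snd q\<bar> * \<beta>"
 proof -
  have "\<bar>snd q * (a \<bullet> n)\<bar> \<le> \<bar>snd q\<bar> * \<beta>" using a2 by (simp add: abs_mult mult_left_mono)
  thus ?thesis using a1[of "fst q"] by linarith
 qed
 also have "\<dots> \<le> \<alpha> * norm q + norm q * \<beta>" using f nn by (intro add_mono mult_left_mono mult_right_mono) auto
 also have "\<dots> = (\<alpha> + \<beta>) * norm q" by (simp add: algebra_simps)
 also have "\<dots> \<le> (\<alpha> + \<beta>) * (norm a / c)"
  using lb[of q] q c nn by (intro mult_left_mono) (auto simp: field_simps)
 finally have "norm a * norm a \<le> ((\<alpha> + \<beta>) / c) * norm a" by simp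
 thus ?thesis
  using nn c mult_right_le_imp_le[of "norm a" "norm a" "(\<alpha> + \<beta>) / c"] by (cases "a = 0") auto
qed

text \<open>Vectors normal to the hypersurface inside the hyperboloid: the position vector is normal to the
 hyperboloid itself.\<close>

definition hnormal :: "('p::real_normed_vector => 'b::euclidean_space \<times> real) => 'p => 'b \<times> real => bool" where
 "hnormal F y \<nu> \<longleftrightarrow> lor \<nu> (F y) = 0 \<and> (\<forall>v. lor \<nu> (D F y v) = 0)"

text \<open>Orthogonality to the position vector, which is almost vertical, makes the timelike component small; the remaining
 equations are then almost Euclidean.\<close>

lemma hnormal_almost_euclidean:
 assumes K: "K \<ge> 1"
 shows "\<exists>C\<ge>1. \<forall>(U :: 'a::euclidean_space => 'a \<times> real) y r a b.
  bounded_jet K U y \<and> 0 < r \<and> r * C \<le> 1 \<and> hnormal (hsurf r U) y (a, b) -->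
  \<bar>b\<bar> \<le> C * r * norm a \<and> (\<forall>v. \<bar>a \<bullet> D U y v\<bar> \<le> C * r * norm a * norm v)"
proof -
 obtain C where C1: "C \<ge> 1" and C: "\<forall>(U :: 'a => 'a \<times> real) y r. bounded_jet K U y \<and> 0 < r \<and> r * K \<le> 1 --> jet_close C r U y"
  using expm_jet[OF K] by blast
 define C' where "C' = 2 * C * K"
 have CK: "C \<le> C * K" "K \<le> C * K" using C1 K by (simp_all add: mult_le_cancel_left1)
 have C'1: "1 \<le> C'" "K \<le> C'" "2 * C \<le> C'" using CK C1 K unfolding C'_def by linarith+
 show ?thesis
 proof (rule exI[of _ C'], intro conjI C'1(1) allI impI; elim conjE)
  fix U :: "'a => 'a \<times> real" and y r a b
  assume bj: "bounded_jet K U y" and r: "0 < r" and rC: "r * C' \<le> 1" and N: "hnormal (hsurf r U) y (a, b)"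
  have rK: "r * K \<le> 1" using mult_left_mono[OF C'1(2), of r] r rC by linarith
  have CC: "norm (fst (expm (r *\<^sub>R U y))) \<le> C * r"
    "\<And>v. norm (D (hsurf r U) y v - r *\<^sub>R (D U y v, 0)) \<le> C * r\<^sup>2 * norm v"
   using C bj r rK unfolding jet_close_def by blast+
  define F where "F = expm (r *\<^sub>R U y)"
  have s: "1 \<le> snd F" using hyp_D(2)[OF expm_hyp] by (simp add: F_def)
  have "a \<bullet> fst F = b * snd F" using N by (simp add: hnormal_def lor_def F_def)
  hence "\<bar>b\<bar> * snd F = \<bar>a \<bullet> fst F\<bar>" using s by (simp add: abs_mult)
  also have "\<dots> \<le> norm a * (C * r)"
   using Cauchy_Schwarz_ineq2[of a "fst F"] CC(1) mult_left_mono[OF CC(1), of "norm a"] by (simp add: F_def)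
  finally have b1: "\<bar>b\<bar> \<le> C * r * norm a" using mult_left_mono[OF s, of "\<bar>b\<bar>"] by (simp add: mult_ac)
  have "C * r \<le> C' * r" using C'1(3) C1 r by (intro mult_right_mono) auto
  hence "C * r * norm a \<le> C' * r * norm a" by (rule mult_right_mono) simp
  with b1 show "\<bar>b\<bar> \<le> C' * r * norm a" by linarith
  have Cr: "C * r \<le> 1" using \<open>C * r \<le> C' * r\<close> rC by (simp add: mult.commute)
  hence "\<bar>b\<bar> \<le> norm a" using b1 mult_right_mono[OF Cr, of "norm a"] by simp
  hence nab: "norm (a, b) \<le> 2 * norm a" using norm_Pair_le[of a b] by simp
  fix v
  have "lor (a, b) (D (hsurf r U) y v) = 0" using N by (simp add: hnormal_def)
  hence "lor (a, b) (D (hsurf r U) y v - r *\<^sub>R (D U y v, 0)) = - (r * (a \<bullet> D U y v))"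
   by (simp add: lor_diff_right lor_scale_right) (simp add: lor_def)
  hence "r * \<bar>a \<bullet> D U y v\<bar> \<le> norm (a, b) * norm (D (hsurf r U) y v - r *\<^sub>R (D U y v, 0))"
   using lor_le[of "(a, b)" "D (hsurf r U) y v - r *\<^sub>R (D U y v, 0)"] r by (simp add: abs_mult)
  also have "\<dots> \<le> (2 * norm a) * (C * r\<^sup>2 * norm v)" using nab CC(2)[of v] by (intro mult_mono) auto
  also have "\<dots> = r * (2 * C * (r * norm a * norm v))" by (simp add: power2_eq_square)
  finally have "\<bar>a \<bullet> D U y v\<bar> \<le> 2 * C * (r * norm a * norm v)" using r by simp
  also have "\<dots> \<le> C' * (r * norm a * norm v)" using C'1(3) r by (intro mult_right_mono) auto
  finally show "\<bar>a \<bullet> D U y v\<bar> \<le> C' * r * norm a * norm v" by (simp add: mult.assoc)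
 qed
qed

definition almost_normal :: "real => ('a::euclidean_space => 'a \<times> real) => 'a => 'a \<times> real => bool" where
 "almost_normal \<eta> U y n \<longleftrightarrow> (\<forall>v. \<bar>n \<bullet> D U y v\<bar> \<le> \<eta> * norm v)"

lemma bounded_jet_differentiable: "bounded_jet K U y ==> U differentiable (at y)"
 unfolding bounded_jet_def using Ck2_differentiable(1) by blast

text \<open>A normal and \<open>n\<close> are both almost orthogonal to the tangent space, so by transversality they are almost parallel.\<close>

lemma hnormal_close:
 assumes K: "K \<ge> 1" and c: "0 < c" "c \<le> 1"
 shows "\<exists>C\<ge>1. \<forall>(U :: 'a::euclidean_space => 'a \<times> real) y n r \<eta> \<nu>.
  bounded_jet K U y \<and> transversal c U y n \<and> almost_normal \<eta> U y n \<and> 0 < r \<and> 0 \<le> \<eta> \<and> (r + \<eta>) * C \<le> 1 \<and>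
  hnormal (hsurf r U) y \<nu> -->
   (fst \<nu> \<bullet> n = 0 --> \<nu> = 0) \<and>
   (lor \<nu> \<nu> = 1 \<and> fst \<nu> \<bullet> n > 0 --> norm (\<nu> - (n, 0)) \<le> C * (r + \<eta>))"
proof -
 obtain C where C1: "C \<ge> 1" and C: "\<forall>(U :: 'a => 'a \<times> real) y r a b.
  bounded_jet K U y \<and> 0 < r \<and> r * C \<le> 1 \<and> hnormal (hsurf r U) y (a, b) -->
  \<bar>b\<bar> \<le> C * r * norm a \<and> (\<forall>v. \<bar>a \<bullet> D U y v\<bar> \<le> C * r * norm a * norm v)"
  using hnormal_almost_euclidean[OF K] by blast
 define C' where "C' = 8 * C / c"
 have "8 * C * c \<le> 8 * C * 1" using c C1 by (intro mult_left_mono) auto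
 hence C'8: "8 * C \<le> C'" using c by (simp add: C'_def pos_le_divide_eq)
 hence C'1: "1 \<le> C'" using C1 by linarith
 show ?thesis
 proof (rule exI[of _ C'], intro conjI C'1 allI impI; elim conjE)
  fix U :: "'a => 'a \<times> real" and y n r \<eta> \<nu>
  assume bj: "bounded_jet K U y" and tr: "transversal c U y n" and an: "almost_normal \<eta> U y n"
   and r: "0 < r" and \<eta>: "0 \<le> \<eta>" and rC: "(r + \<eta>) * C' \<le> 1" and N: "hnormal (hsurf r U) y \<nu>"
  obtain a b where ab: "\<nu> = (a, b)" by (cases \<nu>)
  have n1: "norm n = 1" using tr by (simp add: transversal_def)
  define x where "x = C * r"
  have x0: "0 < x" using C1 r by (simp add: x_def)
  have re: "(r + \<eta>) * (8 * C) \<le> c"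
  proof -
   have "(r + \<eta>) * C' * c \<le> 1 * c" using rC c by (intro mult_right_mono) auto
   thus ?thesis using c by (simp add: C'_def)
  qed
  have q: "8 * (C * (r + \<eta>)) \<le> c" "0 \<le> C * (r + \<eta>)" using re C1 r \<eta> by (simp_all add: mult_ac)
  have "0 \<le> C * \<eta>" using C1 \<eta> by simp
  moreover have e: "C * (r + \<eta>) = x + C * \<eta>" by (simp add: x_def algebra_simps)
  ultimately have xc: "8 * x \<le> c" using q by linarith
  have rC1: "r * C \<le> 1" using xc c by (simp add: x_def mult.commute)
  have b: "\<bar>b\<bar> \<le> x * norm a" and aD: "\<bar>a \<bullet> D U y v\<bar> \<le> x * norm a * norm v" for v
   using C bj r rC1 N unfolding ab x_def by blast+
  note dU = bounded_jet_differentiable[OF bj]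
  show "\<nu> = 0" if "fst \<nu> \<bullet> n = 0"
  proof -
   have "norm a \<le> (x * norm a + 0) / c"
    by (rule transversal_dual[OF tr c(1) dU aD]) (use that ab x0 in auto)
   also have "\<dots> \<le> (c / 8) * norm a / c"
   proof (rule divide_right_mono)
    have "x * norm a \<le> (c / 8) * norm a" by (rule mult_right_mono) (use xc in auto)
    thus "x * norm a + 0 \<le> (c / 8) * norm a" by simp
   qed (use c in simp)
   finally have "a = 0" using c by simp
   thus ?thesis using b ab by (simp add: zero_prod_def)
  qed
  assume l1: "lor \<nu> \<nu> = 1" and pos: "0 < fst \<nu> \<bullet> n"
  have aa: "norm a * norm a = 1 + b\<^sup>2"
   using l1 power2_norm_eq_inner[of a] by (simp add: ab lor_def power2_eq_square)
  have "x \<le> 1 / 2" using xc c by linarith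
  hence "x * norm a \<le> (1 / 2) * norm a" by (rule mult_right_mono) simp
  hence "\<bar>b\<bar> \<le> norm a / 2" using b by linarith
  hence "b\<^sup>2 \<le> (norm a / 2)\<^sup>2" by (metis abs_ge_zero power2_abs power_mono)
  hence "norm a * norm a \<le> 2" using aa by (simp add: power2_eq_square)
  hence a2: "norm a \<le> 2" using mult_mono[of 2 "norm a" 2 "norm a"] by linarith
  have b2: "\<bar>b\<bar> \<le> 2 * x" using b mult_left_mono[OF a2, of x] x0 by linarith
  define s where "s = a \<bullet> n"
  define a' where "a' = a - s *\<^sub>R n"
  have s0: "0 < s" using pos by (simp add: s_def ab)
  have nn: "n \<bullet> n = 1" using n1 by (simp add: norm_eq_1)
  have a'n: "a' \<bullet> n = 0" by (simp add: a'_def s_def inner_diff_left nn)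
  have s2: "s \<le> 2" using Cauchy_Schwarz_ineq2[of a n] n1 a2 by (simp add: s_def)
  have "norm a' \<le> (2 * x + 2 * \<eta> + 0) / c"
  proof (rule transversal_dual[OF tr c(1) dU])
   fix v
   have "\<bar>a' \<bullet> D U y v\<bar> \<le> \<bar>a \<bullet> D U y v\<bar> + s * \<bar>n \<bullet> D U y v\<bar>"
    using abs_triangle_ineq4[of "a \<bullet> D U y v" "s * (n \<bullet> D U y v)"] s0 by (simp add: a'_def inner_diff_left abs_mult)
   also have "\<dots> \<le> x * 2 * norm v + 2 * (\<eta> * norm v)"
   proof (rule add_mono)
    have "x * norm a * norm v \<le> x * 2 * norm v" using a2 x0 by (intro mult_right_mono mult_left_mono) auto
    thus "\<bar>a \<bullet> D U y v\<bar> \<le> x * 2 * norm v" using aD[of v] by linarith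
    show "s * \<bar>n \<bullet> D U y v\<bar> \<le> 2 * (\<eta> * norm v)"
     using an s0 s2 \<eta> unfolding almost_normal_def by (intro mult_mono) auto
   qed
   finally show "\<bar>a' \<bullet> D U y v\<bar> \<le> (2 * x + 2 * \<eta>) * norm v" by (simp add: algebra_simps)
  qed (use a'n x0 \<eta> in auto)
  moreover have "2 * x + 2 * \<eta> \<le> 2 * (C * (r + \<eta>))"
   using mult_right_mono[OF C1 \<eta>] by (simp add: x_def algebra_simps)
  ultimately have a'1: "norm a' \<le> 2 * (C * (r + \<eta>)) / c" using c by (simp add: divide_right_mono order_trans)
  also have "\<dots> \<le> 1"
  proof -
   have "2 * (C * (r + \<eta>)) \<le> 1 * c" using q by linarith
   thus ?thesis using c by (simp only: pos_divide_le_eq)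
  qed
  finally have a'le: "norm a' \<le> 1" .
  have pyth: "norm a * norm a = s\<^sup>2 + norm a' * norm a'"
  proof -
   have "(a' + s *\<^sub>R n) \<bullet> (a' + s *\<^sub>R n) = a' \<bullet> a' + s\<^sup>2"
    by (simp add: inner_add_left inner_add_right a'n inner_commute[of n a'] nn power2_eq_square)
   moreover have "a' + s *\<^sub>R n = a" by (simp add: a'_def)
   ultimately have "a \<bullet> a = a' \<bullet> a' + s\<^sup>2" by simp
   thus ?thesis using power2_norm_eq_inner[of a] power2_norm_eq_inner[of a'] by (simp add: power2_eq_square)
  qed
  have "\<bar>s - 1\<bar> \<le> \<bar>s - 1\<bar> * (s + 1)" using s0 mult_left_mono[of 1 "s + 1" "\<bar>s - 1\<bar>"] by simp
  also have "\<dots> = \<bar>s\<^sup>2 - 1\<bar>"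
  proof -
   have "s\<^sup>2 - 1 = (s - 1) * (s + 1)" by (simp add: power2_eq_square algebra_simps)
   thus ?thesis using s0 by (simp add: abs_mult)
  qed
  also have "\<dots> \<le> b\<^sup>2 + norm a' * norm a'"
  proof -
   have "s\<^sup>2 - 1 = b\<^sup>2 - norm a' * norm a'" using pyth aa by linarith
   thus ?thesis using zero_le_power2[of b] mult_nonneg_nonneg[of "norm a'" "norm a'"] by (simp add: abs_le_iff)
  qed
  also have "\<dots> \<le> 2 * x + norm a'"
  proof (rule add_mono)
   have "\<bar>b\<bar> * \<bar>b\<bar> \<le> (2 * x) * 1" using b2 xc c x0 by (intro mult_mono) auto
   thus "b\<^sup>2 \<le> 2 * x" by (simp add: power2_eq_square)
   show "norm a' * norm a' \<le> norm a'" using a'le mult_left_mono[OF a'le, of "norm a'"] by simp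
  qed
  finally have s1: "\<bar>s - 1\<bar> \<le> 2 * x + norm a'" .
  have "norm (\<nu> - (n, 0)) = norm (a - n, b)" by (simp add: ab)
  also have "\<dots> \<le> norm (a - n) + \<bar>b\<bar>" using norm_Pair_le[of "a - n" b] by simp
  also have "a - n = a' + (s - 1) *\<^sub>R n" by (simp add: a'_def algebra_simps)
  also have "norm (a' + (s - 1) *\<^sub>R n) \<le> norm a' + \<bar>s - 1\<bar>" using norm_triangle_ineq[of a' "(s - 1) *\<^sub>R n"] n1 by simp
  also have "norm a' + \<bar>s - 1\<bar> + \<bar>b\<bar> \<le> 4 * (C * (r + \<eta>)) / c + 4 * x" using s1 b2 a'1 by simp
  also have "4 * x \<le> 4 * (C * (r + \<eta>)) / c"
  proof -
   have "x * c \<le> x * 1" using c x0 by (intro mult_left_mono) auto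
   also have "\<dots> \<le> C * (r + \<eta>)" using C1 \<eta> by (simp add: x_def algebra_simps)
   finally show ?thesis using c by (simp add: pos_le_divide_eq)
  qed
  finally show "norm (\<nu> - (n, 0)) \<le> C' * (r + \<eta>)" by (simp add: C'_def)
 qed
qed

definition jet_ok :: "real => real => real => ('a::euclidean_space => 'a \<times> real) => 'a => 'a \<times> real => bool" where
 "jet_ok K c \<eta> U y n \<longleftrightarrow> bounded_jet K U y \<and> transversal c U y n \<and> almost_normal \<eta> U y n"

text \<open>The vector \<open>n\<close> selects one of the two unit normals.\<close>

definition good_normal :: "('a::euclidean_space => ('a \<times> real) \<times> real) => 'a => 'a \<times> real => ('a \<times> real) \<times> real => bool" where
 "good_normal F y n \<nu> \<longleftrightarrow> lor \<nu> \<nu> = 1 \<and> hnormal F y \<nu> \<and> fst \<nu> \<bullet> n > 0"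

text \<open>The Euclidean first form of \<open>U\<close>, the vector \<open>n\<close> and the second form with respect to \<open>n\<close> approximate
 the corresponding quantities of the hypersurface.\<close>

definition close_forms :: "real => real => real => ('a::euclidean_space => 'a \<times> real) => 'a => 'a \<times> real => bool" where
 "close_forms C r \<eta> U y n \<longleftrightarrow>
  (\<forall>v w. \<bar>lor (D (hsurf r U) y v) (D (hsurf r U) y w) / r\<^sup>2 - D U y v \<bullet> D U y w\<bar> \<le> C * r * (norm v * norm w)) \<and>
  (\<forall>\<nu>. hnormal (hsurf r U) y \<nu> --> (fst \<nu> \<bullet> n = 0 --> \<nu> = 0) \<and>
   (lor \<nu> \<nu> = 1 \<and> fst \<nu> \<bullet> n > 0 --> norm (\<nu> - (n, 0)) \<le> C * (r + \<eta>) \<and>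
   (\<forall>v w. \<bar>lor \<nu> (D2 (hsurf r U) w y v) / r - n \<bullet> D2 U w y v\<bar>
    \<le> C * (r + \<eta>) * (norm v * norm w))))"

lemma close_formsD:
 assumes "close_forms C r \<eta> U y n"
 shows "\<bar>lor (D (hsurf r U) y v) (D (hsurf r U) y w) / r\<^sup>2 - D U y v \<bullet> D U y w\<bar> \<le> C * r * (norm v * norm w)"
  and "hnormal (hsurf r U) y \<nu> ==> fst \<nu> \<bullet> n = 0 ==> \<nu> = 0"
  and "good_normal (hsurf r U) y n \<nu> ==> norm (\<nu> - (n, 0)) \<le> C * (r + \<eta>)"
  and "good_normal (hsurf r U) y n \<nu> ==>
   \<bar>lor \<nu> (D2 (hsurf r U) w y v) / r - n \<bullet> D2 U w y v\<bar> \<le> C * (r + \<eta>) * (norm v * norm w)"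
 using assms unfolding close_forms_def good_normal_def by blast+

text \<open>Insert the expansion of the jet of the exponential map and of the normal into the Lorentzian expressions for both
 forms; after division by the scale all error terms are of order \<open>r + \<eta>\<close>.\<close>

lemma forms_close:
 assumes K: "K \<ge> 1" and c: "0 < c" "c \<le> 1"
 shows "\<exists>C\<ge>1. \<forall>(U :: 'a::euclidean_space => 'a \<times> real) y n r \<eta>.
  jet_ok K c \<eta> U y n \<and> 0 < r \<and> 0 \<le> \<eta> \<and> (r + \<eta>) * C \<le> 1 --> close_forms C r \<eta> U y n"
proof -
 obtain C1 where C1: "C1 \<ge> 1" and E: "\<forall>(U :: 'a => 'a \<times> real) y r. bounded_jet K U y \<and> 0 < r \<and> r * K \<le> 1 --> jet_close C1 r U y"
  using expm_jet[OF K] by blast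
 obtain C2 where C2: "C2 \<ge> 1" and N: "\<forall>(U :: 'a::euclidean_space => 'a \<times> real) y n r \<eta> \<nu>.
  bounded_jet K U y \<and> transversal c U y n \<and> almost_normal \<eta> U y n \<and> 0 < r \<and> 0 \<le> \<eta> \<and> (r + \<eta>) * C2 \<le> 1 \<and>
  hnormal (hsurf r U) y \<nu> -->
   (fst \<nu> \<bullet> n = 0 --> \<nu> = 0) \<and>
   (lor \<nu> \<nu> = 1 \<and> fst \<nu> \<bullet> n > 0 --> norm (\<nu> - (n, 0)) \<le> C2 * (r + \<eta>))"
  using hnormal_close[OF K c] by blast
 define C where "C = 2 * K * C1 + C1 * C1 + C2 * K + 2 * C1 + K + C2"
 have p: "0 \<le> K * C1" "0 \<le> C1 * C1" "0 \<le> C2 * K" using C1 C2 K by auto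
 have CC: "1 \<le> C" "K \<le> C" "C2 \<le> C" "2 * K * C1 + C1 * C1 \<le> C" "C2 * K + 2 * C1 \<le> C"
  using p C1 C2 K unfolding C_def by linarith+
 show ?thesis unfolding jet_ok_def close_forms_def
 proof (rule exI[of _ C], intro conjI CC(1) allI impI; elim conjE)
  fix U :: "'a => 'a \<times> real" and y n r \<eta>
  assume bj: "bounded_jet K U y" and tr: "transversal c U y n" and an: "almost_normal \<eta> U y n"
   and r: "0 < r" and \<eta>: "0 \<le> \<eta>" and rC: "(r + \<eta>) * C \<le> 1"
  have sm: "(r + \<eta>) * a \<le> 1" if "a \<le> C" for a
   using mult_left_mono[OF that, of "r + \<eta>"] r \<eta> rC by linarith
  have "0 \<le> \<eta> * K" using \<eta> K by simp
  hence rK: "r * K \<le> 1" using sm[OF CC(2)] unfolding distrib_right by linarith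
  have r1: "r \<le> 1" using sm[OF CC(1)] \<eta> by simp
  have U1: "norm (D U y v) \<le> K * norm v" and U2: "norm (D2 U w y v) \<le> K * norm v * norm w" for v w
   using bj unfolding bounded_jet_def by blast+
  define F where "F z = expm (r *\<^sub>R U z)" for z
  have F1: "norm (D F y v - r *\<^sub>R (D U y v, 0)) \<le> C1 * r\<^sup>2 * norm v"
   and F2: "norm (D2 F w y v - r *\<^sub>R (D2 U w y v, 0)) \<le> C1 * r\<^sup>2 * norm v * norm w" for v w
   using E bj r rK unfolding F_def jet_close_def by blast+
  show "\<bar>lor (D (hsurf r U) y v) (D (hsurf r U) y w) / r\<^sup>2 - D U y v \<bullet> D U y w\<bar>
    \<le> C * r * (norm v * norm w)" for v w
  proof -
   define ev ew where "ev = D F y v - r *\<^sub>R (D U y v, 0)" and "ew = D F y w - r *\<^sub>R (D U y w, 0)"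
   have eq: "D F y v = r *\<^sub>R (D U y v, 0) + ev" "D F y w = r *\<^sub>R (D U y w, 0) + ew" by (simp_all add: ev_def ew_def)
   have "lor (D F y v) (D F y w) - r\<^sup>2 * (D U y v \<bullet> D U y w)
     = r * lor (D U y v, 0) ew + r * lor ev (D U y w, 0) + lor ev ew"
    unfolding eq by (simp add: lor_simps) (simp add: lor_def power2_eq_square)
   also have "\<bar>\<dots>\<bar> \<le> r * \<bar>lor (D U y v, 0) ew\<bar> + r * \<bar>lor ev (D U y w, 0)\<bar> + \<bar>lor ev ew\<bar>"
    using r abs_triangle_ineq[of "r * lor (D U y v, 0) ew + r * lor ev (D U y w, 0)" "lor ev ew"]
     abs_triangle_ineq[of "r * lor (D U y v, 0) ew" "r * lor ev (D U y w, 0)"] by (simp add: abs_mult)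
   also have "\<dots> \<le> r * (K * norm v * (C1 * r\<^sup>2 * norm w)) + r * (C1 * r\<^sup>2 * norm v * (K * norm w)) + (C1 * r\<^sup>2 * norm v) * (C1 * r\<^sup>2 * norm w)"
   proof (intro add_mono mult_left_mono)
    have "\<bar>lor (D U y v, 0) ew\<bar> \<le> norm (D U y v) * norm ew" using lor_le[of "(D U y v, 0)" ew] by (simp add: norm_Pair)
    also have "\<dots> \<le> (K * norm v) * (C1 * r\<^sup>2 * norm w)" using U1 F1 K by (intro mult_mono) (auto simp: ew_def)
    finally show "\<bar>lor (D U y v, 0) ew\<bar> \<le> K * norm v * (C1 * r\<^sup>2 * norm w)" by simp
    have "\<bar>lor ev (D U y w, 0)\<bar> \<le> norm ev * norm (D U y w)" using lor_le[of ev "(D U y w, 0)"] by (simp add: norm_Pair)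
    also have "\<dots> \<le> (C1 * r\<^sup>2 * norm v) * (K * norm w)" using U1 F1 C1 by (intro mult_mono) (auto simp: ev_def)
    finally show "\<bar>lor ev (D U y w, 0)\<bar> \<le> C1 * r\<^sup>2 * norm v * (K * norm w)" .
    have "\<bar>lor ev ew\<bar> \<le> norm ev * norm ew" by (rule lor_le)
    also have "\<dots> \<le> (C1 * r\<^sup>2 * norm v) * (C1 * r\<^sup>2 * norm w)" using F1 C1 by (intro mult_mono) (auto simp: ev_def ew_def)
    finally show "\<bar>lor ev ew\<bar> \<le> (C1 * r\<^sup>2 * norm v) * (C1 * r\<^sup>2 * norm w)" .
   qed (use r in auto)
   also have "\<dots> = r\<^sup>2 * ((2 * K * C1 + C1 * C1 * r) * (r * (norm v * norm w)))"
    by (simp add: power2_eq_square algebra_simps)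
   also have "\<dots> \<le> r\<^sup>2 * (C * (r * (norm v * norm w)))"
   proof (intro mult_left_mono mult_right_mono)
    have "C1 * C1 * r \<le> C1 * C1 * 1" using r1 C1 by (intro mult_left_mono) auto
    thus "2 * K * C1 + C1 * C1 * r \<le> C" using CC(4) by linarith
   qed (use r in auto)
   finally have "\<bar>lor (D F y v) (D F y w) - r\<^sup>2 * (D U y v \<bullet> D U y w)\<bar> / r\<^sup>2 \<le> C * (r * (norm v * norm w))"
    using r by (simp add: pos_divide_le_eq mult.commute)
   moreover have "\<bar>lor (D F y v) (D F y w) - r\<^sup>2 * (D U y v \<bullet> D U y w)\<bar> / r\<^sup>2 = \<bar>lor (D F y v) (D F y w) / r\<^sup>2 - D U y v \<bullet> D U y w\<bar>"
   proof -
    have "lor (D F y v) (D F y w) / r\<^sup>2 - D U y v \<bullet> D U y w = (lor (D F y v) (D F y w) - r\<^sup>2 * (D U y v \<bullet> D U y w)) / r\<^sup>2"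
     using r by (simp add: diff_divide_distrib)
    thus ?thesis by (simp add: abs_divide)
   qed
   ultimately show ?thesis by (simp add: F_def[abs_def] mult.assoc)
  qed
  fix \<nu> assume hn: "hnormal (hsurf r U) y \<nu>"
  note NN = N[rule_format, OF conjI[OF bj conjI[OF tr conjI[OF an conjI[OF r conjI[OF \<eta> conjI[OF sm[OF CC(3)] hn]]]]]]]
  show "\<nu> = 0" if "fst \<nu> \<bullet> n = 0" using NN that by blast
  assume l: "lor \<nu> \<nu> = 1" "0 < fst \<nu> \<bullet> n"
  have nu: "norm (\<nu> - (n, 0)) \<le> C2 * (r + \<eta>)" using NN l by blast
  have le: "C2 * (r + \<eta>) \<le> C * (r + \<eta>)" using CC r \<eta> by (intro mult_right_mono) auto
  show "norm (\<nu> - (n, 0)) \<le> C * (r + \<eta>)" using nu le by linarith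
  have n1: "norm n = 1" using tr by (simp add: transversal_def)
  have nu2: "norm \<nu> \<le> 2"
   using norm_triangle_sub[of \<nu> "(n, 0)"] nu sm[OF CC(3)] n1 by (simp add: norm_Pair mult.commute)
  show "\<bar>lor \<nu> (D2 (hsurf r U) w y v) / r - n \<bullet> D2 U w y v\<bar>
    \<le> C * (r + \<eta>) * (norm v * norm w)" for v w
  proof -
   define d2 where "d2 = D2 U w y v"
   define e where "e = D2 F w y v - r *\<^sub>R (d2, 0)"
   have eq: "D2 F w y v = r *\<^sub>R (d2, 0) + e" by (simp add: e_def)
   have "lor \<nu> (D2 F w y v) / r = fst \<nu> \<bullet> d2 + lor \<nu> e / r"
    unfolding eq using r by (simp add: lor_simps add_divide_distrib) (simp add: lor_def)
   hence "lor \<nu> (D2 F w y v) / r - n \<bullet> d2 = fst (\<nu> - (n, 0)) \<bullet> d2 + lor \<nu> e / r"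
    by (simp add: inner_diff_left)
   also have "\<bar>\<dots>\<bar> \<le> \<bar>fst (\<nu> - (n, 0)) \<bullet> d2\<bar> + \<bar>lor \<nu> e\<bar> / r"
    using r abs_triangle_ineq[of "fst (\<nu> - (n, 0)) \<bullet> d2" "lor \<nu> e / r"] by (simp add: abs_divide)
   also have "\<dots> \<le> (C2 * (r + \<eta>)) * (K * norm v * norm w) + (2 * (C1 * r\<^sup>2 * norm v * norm w)) / r"
   proof (intro add_mono divide_right_mono)
    have "\<bar>fst (\<nu> - (n, 0)) \<bullet> d2\<bar> \<le> norm (fst (\<nu> - (n, 0))) * norm d2" by (rule Cauchy_Schwarz_ineq2)
    also have "\<dots> \<le> (C2 * (r + \<eta>)) * (K * norm v * norm w)"
     using nu U2[of w v] norm_fst_le[of "fst (\<nu> - (n, 0))" "snd (\<nu> - (n, 0))"] C2 r \<eta>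
     by (intro mult_mono) (auto simp: d2_def simp del: fst_diff snd_diff)
    finally show "\<bar>fst (\<nu> - (n, 0)) \<bullet> d2\<bar> \<le> (C2 * (r + \<eta>)) * (K * norm v * norm w)" .
    have "\<bar>lor \<nu> e\<bar> \<le> norm \<nu> * norm e" by (rule lor_le)
    also have "\<dots> \<le> 2 * (C1 * r\<^sup>2 * norm v * norm w)" using nu2 F2[of w v] by (intro mult_mono) (auto simp: e_def d2_def)
    finally show "\<bar>lor \<nu> e\<bar> \<le> 2 * (C1 * r\<^sup>2 * norm v * norm w)" .
   qed (use r in auto)
   also have "\<dots> = (C2 * K * (r + \<eta>) + 2 * C1 * r) * (norm v * norm w)"
    using r by (simp add: power2_eq_square algebra_simps)
   also have "\<dots> \<le> (C * (r + \<eta>)) * (norm v * norm w)"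
   proof (rule mult_right_mono)
    have "C2 * K * (r + \<eta>) + 2 * C1 * r \<le> (C2 * K + 2 * C1) * (r + \<eta>)" using C1 \<eta> by (simp add: algebra_simps)
    also have "\<dots> \<le> C * (r + \<eta>)" using CC r \<eta> by (intro mult_right_mono) auto
    finally show "C2 * K * (r + \<eta>) + 2 * C1 * r \<le> C * (r + \<eta>)" .
   qed auto
   finally show ?thesis by (simp add: F_def[abs_def] d2_def)
  qed
 qed
qed

lemma hnormal_scale_diff:
 "hnormal F y \<mu> ==> hnormal F y \<mu>' ==> hnormal F y (s *\<^sub>R \<mu> - t *\<^sub>R \<mu>')"
 by (simp add: hnormal_def lor_simps)

text \<open>A normal exists by counting dimensions. Normalizing it by its product with \<open>n\<close> makes it the solution of a linear
 system, hence differentiable.\<close>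

lemma local_normal:
 fixes U :: "'a::euclidean_space => 'a \<times> real"
 assumes S: "open S" "y \<in> S" and U: "Ck 2 S U" and F: "F = (hsurf r U)"
  and nd: "\<And>\<nu>. hnormal F y \<nu> ==> fst \<nu> \<bullet> n = 0 ==> \<nu> = 0"
 shows "\<exists>T \<nu>. open T \<and> y \<in> T \<and> \<nu> differentiable (at y) \<and> fst (\<nu> y) \<bullet> n > 0 \<and>
  (\<forall>z\<in>T. lor (\<nu> z) (\<nu> z) = 1 \<and> hnormal F z (\<nu> z))"
proof -
 have F2: "Ck 2 S F" unfolding F by (rule expm_scaled_Ck[OF S(1) U])
 note dF = Ck2_differentiable(1)[OF S(1) F2] and dDF = Ck2_differentiable(2)[OF S(1) F2]
 define J :: "('a + bool) set" where "J = Inl ` Basis \<union> {Inr True, Inr False}"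
 define q where "q j z = (case j of Inl b => flip (D F z b) | Inr x => if x then flip (F z) else (n, 0))" for j z
 define \<rho> :: "'a + bool => 'a => real" where "\<rho> j z = (if j = Inr False then 1 else 0)" for j z
 have fJ: "finite J" by (simp add: J_def)
 have dq: "q j differentiable (at y)" for j
 proof (cases j)
  case (Inl b)
  thus ?thesis unfolding q_def using D_bounded_linear(2)[OF flip_blin dDF[OF S(2), of b]] by simp
 next
  case (Inr x)
  thus ?thesis unfolding q_def using D_bounded_linear(2)[OF flip_blin dF[OF S(2)]] by (cases x) simp_all
 qed
 have hn: "hnormal F z \<zeta>" if z: "z \<in> S" and o: "\<And>b. b \<in> Basis ==> \<zeta> \<bullet> q (Inl b) z = 0" "\<zeta> \<bullet> q (Inr True) z = 0" for z \<zeta>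
 proof -
  have "lor \<zeta> (D F z b) = 0" if "b \<in> Basis" for b using o(1)[OF that] by (simp add: q_def lor_flip)
  hence "lor \<zeta> (D F z v) = 0" for v
   unfolding D_expand[OF dF[OF z], of v] by (simp add: bounded_bilinear.sum_right[OF lor_bb] lor_scale_right)
  thus ?thesis using o(2) by (simp add: hnormal_def q_def lor_flip)
 qed
 have ndq: "\<zeta> = 0" if "\<And>j. j \<in> J ==> \<zeta> \<bullet> q j y = 0" for \<zeta>
 proof (rule nd)
  show "hnormal F y \<zeta>" by (rule hn[OF S(2)]) (use that in \<open>auto simp: J_def\<close>)
  show "fst \<zeta> \<bullet> n = 0" using that[of "Inr False"] by (simp add: J_def q_def inner_prod_def)
 qed
 have "\<exists>T. open T \<and> y \<in> T \<and> (\<forall>z\<in>T. \<forall>\<zeta>. (\<forall>j\<in>J. \<zeta> \<bullet> q j z = 0) --> \<zeta> = 0)"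
  by (rule frame_stable[OF fJ differentiable_imp_continuous_within[OF dq] ndq])
 then obtain T0 where T0: "open T0" "y \<in> T0" "\<And>z \<zeta>. z \<in> T0 ==> (\<And>j. j \<in> J ==> \<zeta> \<bullet> q j z = 0) ==> \<zeta> = 0"
  by blast
 define T where "T = T0 \<inter> S"
 have T: "open T" "y \<in> T" using T0 S by (auto simp: T_def)
 have ex: "\<exists>\<zeta>. \<forall>j\<in>J. \<zeta> \<bullet> q j z = \<rho> j z" if z: "z \<in> T" for z
 proof -
  define A where "A = insert (q (Inr True) z) ((\<lambda>b. q (Inl b) z) ` (Basis :: 'a set))"
  \<comment> \<open>Counting dimensions: the tangent space and the position vector leave one direction free.\<close>
  have "dim A \<le> card A" by (rule dim_le_card') (simp add: A_def)
  also have "card A \<le> Suc (card ((\<lambda>b. q (Inl b) z) ` (Basis :: 'a set)))"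
   unfolding A_def by (rule card_insert_le_m1) (auto simp: card_insert_if)
  also have "\<dots> \<le> Suc DIM('a)" by (simp add: card_image_le)
  also have "\<dots> < DIM(('a \<times> real) \<times> real)" by simp
  finally obtain x where x: "x \<noteq> 0" "\<And>w. w \<in> span A ==> orthogonal x w"
   using orthogonal_to_subspace_exists by blast
  have o: "x \<bullet> q (Inl b) z = 0" if "b \<in> Basis" for b
   using x(2)[of "q (Inl b) z"] that by (auto simp: A_def orthogonal_def span_base)
  have o': "x \<bullet> q (Inr True) z = 0"
   using x(2)[of "q (Inr True) z"] by (auto simp: A_def orthogonal_def span_base)
  have ne: "x \<bullet> q (Inr False) z \<noteq> 0"
  proof
   assume e: "x \<bullet> q (Inr False) z = 0"
   have "x = 0" by (rule T0(3)[of z]) (use z o o' e in \<open>auto simp: T_def J_def\<close>)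
   with x show False by simp
  qed
  show ?thesis
   by (rule exI[of _ "x /\<^sub>R (x \<bullet> q (Inr False) z)"]) (use o o' ne in \<open>auto simp: J_def \<rho>_def\<close>)
 qed
 define \<xi> where "\<xi> z = (SOME \<zeta>. \<forall>j\<in>J. \<zeta> \<bullet> q j z = \<rho> j z)" for z
 have \<xi>: "\<xi> z \<bullet> q j z = \<rho> j z" if "z \<in> T" "j \<in> J" for z j
  using someI_ex[OF ex[OF that(1)]] that(2) unfolding \<xi>_def by blast
 have d\<xi>: "\<xi> differentiable (at y)"
 proof (rule solve_differentiable[OF fJ T, of q \<rho>])
  show "\<rho> j differentiable (at y)" for j unfolding \<rho>_def[abs_def] by simp
 qed (use dq \<xi> ndq in auto)
 have hn\<xi>: "hnormal F z (\<xi> z)" if z: "z \<in> T" for z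
  by (rule hn) (use z \<xi>[OF z] in \<open>auto simp: T_def J_def \<rho>_def\<close>)
 have fn: "fst (\<xi> z) \<bullet> n = 1" if z: "z \<in> T" for z
  using \<xi>[OF z, of "Inr False"] by (simp add: J_def q_def \<rho>_def inner_prod_def)
 have pos: "lor (\<xi> z) (\<xi> z) > 0" if z: "z \<in> T" for z
 proof (rule lor_pos[of "F z"])
  show "F z \<in> hyp" by (simp add: F expm_hyp)
  show "lor (\<xi> z) (F z) = 0" using hn\<xi>[OF z] by (simp add: hnormal_def)
  show "\<xi> z \<noteq> 0" using fn[OF z] by auto
 qed
 define \<nu> where "\<nu> z = inverse (sqrt (lor (\<xi> z) (\<xi> z))) *\<^sub>R \<xi> z" for z
 have dl: "(\<lambda>z. lor (\<xi> z) (\<xi> z)) differentiable (at y)"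
  by (rule D_bilinear(2)[OF lor_bb d\<xi> d\<xi>])
 have ds: "(sqrt :: real => real) differentiable (at x)" if "x > 0" for x
  using DERIV_real_sqrt[OF that] real_differentiable_def by blast
 have "(\<lambda>z. sqrt (lor (\<xi> z) (\<xi> z))) differentiable (at y)"
  by (rule D_compose(2)[OF dl ds[OF pos[OF T(2)]]])
 hence "(\<lambda>z. inverse (sqrt (lor (\<xi> z) (\<xi> z)))) differentiable (at y)"
  using pos[OF T(2)] by (intro differentiable_inverse) auto
 hence d\<nu>: "\<nu> differentiable (at y)"
  unfolding \<nu>_def[abs_def] using d\<xi> by (intro differentiable_scaleR)
 have "lor (\<nu> z) (\<nu> z) = 1 \<and> hnormal F z (\<nu> z)" if z: "z \<in> T" for z
  using pos[OF z] hn\<xi>[OF z] by (auto simp: \<nu>_def lor_simps hnormal_def field_simps)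
 moreover have "fst (\<nu> y) \<bullet> n > 0" using fn[OF T(2)] pos[OF T(2)] by (simp add: \<nu>_def)
 ultimately show ?thesis using T d\<nu> by blast
qed

text \<open>The reference normals may jump as long as neighbouring ones stay on the same side; this
 is what allows different comparison surfaces in different regions.\<close>

lemma global_normal:
 fixes U :: "'a::euclidean_space => 'a \<times> real"
 assumes S: "open S" and U: "Ck 2 S U" and F: "F = (hsurf r U)"
  and nd': "\<And>y \<nu>. y \<in> S ==> hnormal F y \<nu> ==> fst \<nu> \<bullet> n y = 0 ==> \<nu> = 0"
  and nn: "\<And>y. y \<in> S ==> norm (n y) \<le> 1"
  and side: "\<And>y \<nu>. y \<in> S ==> good_normal F y (n y) \<nu> ==>
   \<exists>\<theta>>0. \<exists>T. open T \<and> y \<in> T \<and> (\<forall>z\<in>T. z \<in> S --> \<theta> \<le> fst \<nu> \<bullet> n z)"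
 shows "\<exists>\<nu>. \<forall>y\<in>S. \<nu> differentiable (at y) \<and> good_normal F y (n y) (\<nu> y)"
proof -
 have uniq: "\<mu> = \<mu>'" if y: "y \<in> S" and g: "good_normal F y (n y) \<mu>" "good_normal F y (n y) \<mu>'" for y \<mu> \<mu>'
 proof -
  define s t where "s = fst \<mu> \<bullet> n y" and "t = fst \<mu>' \<bullet> n y"
  have st: "s > 0" "t > 0" using g by (auto simp: s_def t_def good_normal_def)
  have "t *\<^sub>R \<mu> - s *\<^sub>R \<mu>' = 0"
  proof (rule nd'[OF y])
   show "hnormal F y (t *\<^sub>R \<mu> - s *\<^sub>R \<mu>')" using g by (intro hnormal_scale_diff) (auto simp: good_normal_def)
   show "fst (t *\<^sub>R \<mu> - s *\<^sub>R \<mu>') \<bullet> n y = 0" by (simp add: inner_diff_left s_def t_def)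
  qed
  hence e: "t *\<^sub>R \<mu> = s *\<^sub>R \<mu>'" by simp
  hence "lor (t *\<^sub>R \<mu>) (t *\<^sub>R \<mu>) = lor (s *\<^sub>R \<mu>') (s *\<^sub>R \<mu>')" by simp
  hence "t\<^sup>2 = s\<^sup>2" using g by (simp add: lor_simps good_normal_def power2_eq_square)
  hence "t = s" using st power2_eq_imp_eq[of t s] by simp
  thus ?thesis using e st by simp
 qed
 have loc: "\<exists>T \<nu>. open T \<and> y \<in> T \<and> \<nu> differentiable (at y) \<and> (\<forall>z\<in>T. z \<in> S \<and> good_normal F z (n z) (\<nu> z))" if y: "y \<in> S" for y
 proof -
  have "\<exists>T \<nu>. open T \<and> y \<in> T \<and> \<nu> differentiable (at y) \<and> fst (\<nu> y) \<bullet> n y > 0 \<and>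
    (\<forall>z\<in>T. lor (\<nu> z) (\<nu> z) = 1 \<and> hnormal F z (\<nu> z))"
   by (rule local_normal[OF S y U F]) (rule nd'[OF y])
  then obtain T1 \<nu> where T1: "open T1" "y \<in> T1" and d: "\<nu> differentiable (at y)" and p: "fst (\<nu> y) \<bullet> n y > 0"
   and u: "\<And>z. z \<in> T1 ==> lor (\<nu> z) (\<nu> z) = 1 \<and> hnormal F z (\<nu> z)"
   by blast
  obtain \<theta> T3 where \<theta>: "0 < \<theta>" and T3: "open T3" "y \<in> T3" "\<And>z. z \<in> T3 ==> z \<in> S ==> \<theta> \<le> fst (\<nu> y) \<bullet> n z"
  proof -
   have "good_normal F y (n y) (\<nu> y)" using p u[OF T1(2)] by (simp add: good_normal_def)
   from side[OF y this] that show thesis by metis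
  qed
  have "isCont \<nu> y" using d differentiable_imp_continuous_within by blast
  hence "(\<nu> \<longlongrightarrow> \<nu> y) (nhds y)" unfolding isCont_def tendsto_at_iff_tendsto_nhds .
  from tendstoD[OF this \<theta>]
  obtain T2 where T2: "open T2" "y \<in> T2" "\<And>z. z \<in> T2 ==> dist (\<nu> z) (\<nu> y) < \<theta>"
   unfolding eventually_nhds by blast
  have "good_normal F z (n z) (\<nu> z)" if z: "z \<in> T1" "z \<in> T2" "z \<in> T3" "z \<in> S" for z
  proof -
   have "norm (fst (\<nu> z - \<nu> y)) < \<theta>"
    using T2(3)[OF z(2)] norm_fst_le[of "fst (\<nu> z - \<nu> y)" "snd (\<nu> z - \<nu> y)"] unfolding prod.collapse dist_norm by linarith
   hence "\<bar>(fst (\<nu> z) - fst (\<nu> y)) \<bullet> n z\<bar> < \<theta>"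
    using Cauchy_Schwarz_ineq2[of "fst (\<nu> z) - fst (\<nu> y)" "n z"]
     mult_left_mono[OF nn[OF z(4)], of "norm (fst (\<nu> z - \<nu> y))"] by simp
   hence "fst (\<nu> z) \<bullet> n z > 0" using T3(3)[OF z(3,4)] by (simp add: inner_diff_left abs_less_iff)
   thus ?thesis using u[OF z(1)] by (simp add: good_normal_def)
  qed
  thus ?thesis using T1 T2 T3 S y d by (intro exI[of _ "T1 \<inter> T2 \<inter> T3 \<inter> S"] exI[of _ \<nu>]) auto
 qed
 define \<nu> where "\<nu> y = (SOME \<mu>. good_normal F y (n y) \<mu>)" for y
 have g: "good_normal F y (n y) (\<nu> y)" if "y \<in> S" for y
  using loc[OF that] unfolding \<nu>_def by (metis someI_ex)
 have "\<nu> differentiable (at y)" if y: "y \<in> S" for y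
 proof -
  obtain T \<mu> where T: "open T" "y \<in> T" and d: "\<mu> differentiable (at y)"
   and gd: "\<And>z. z \<in> T ==> z \<in> S \<and> good_normal F z (n z) (\<mu> z)" using loc[OF y] by blast
  show ?thesis
   by (rule differentiable_cong_open[OF T _ d]) (use gd g uniq in blast)
 qed
 thus ?thesis using g by blast
qed

text \<open>The data of a hypersurface with a unit normal on the side of \<open>n\<close> and its principal curvatures at one point.\<close>

definition surface_curvatures :: "'a set => ('a::euclidean_space => ('a \<times> real) \<times> real) => 'a \<times> real
  => ('a => ('a \<times> real) \<times> real) => 'a => nat => (nat => real) => bool" where
 "surface_curvatures S F n \<nu> y m lam \<longleftrightarrow> \<nu> differentiable (at y) \<and> (\<forall>z\<in>S. hnormal F z (\<nu> z)) \<and>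
  good_normal F y n (\<nu> y) \<and> principal_curvatures lor (\<lambda>_. UNIV) F \<nu> y m lam"

text \<open>A frame that is orthonormal up to \<open>a\<close> and diagonalizes the Euclidean second form up to \<open>b\<close>.\<close>

definition almost_principal :: "real => real => real => real => ('a::euclidean_space => 'a \<times> real) => 'a => 'a \<times> real
  => nat => (nat => real) => (nat => 'a) => bool" where
 "almost_principal K c a b U y n m l e \<longleftrightarrow> (\<forall>i<m. norm (e i) \<le> 2 / c \<and> 1 / (2 * K) \<le> norm (e i) \<and>
  (\<forall>j<m. \<bar>D U y (e i) \<bullet> D U y (e j) - (if i = j then 1 else 0)\<bar> \<le> a \<and>
   \<bar>- (n \<bullet> D2 U (e j) y (e i)) - (if i = j then l i else 0)\<bar> \<le> b))"

text \<open>The principal frame, rescaled by \<open>r\<close>. Curvature estimates thus become statements about two Euclidean forms.\<close>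

lemma principal_frame:
 assumes K: "K \<ge> 1" and c: "0 < c" "c \<le> 1"
 shows "\<exists>C\<ge>1. \<forall>(U :: 'a::euclidean_space => 'a \<times> real) S n r \<eta> \<nu> y m lam. open S \<and> y \<in> S \<and> Ck 2 S U \<and>
  jet_ok K c \<eta> U y n \<and> 0 < r \<and> 0 \<le> \<eta> \<and> (r + \<eta>) * C \<le> 1 \<and> surface_curvatures S (hsurf r U) n \<nu> y m lam -->
  inj (D (hsurf r U) y) \<and> (\<exists>e. almost_principal K c (C * r) (C * (r + \<eta>)) U y n m (\<lambda>i. r * lam i) e)"
proof -
 obtain C0 where C0: "C0 \<ge> 1" and cf: "\<And>(U :: 'a::euclidean_space => 'a \<times> real) y n r \<eta>.
  jet_ok K c \<eta> U y n ==> 0 < r ==> 0 \<le> \<eta> ==> (r + \<eta>) * C0 \<le> 1 ==> close_forms C0 r \<eta> U y n"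
  using forms_close[OF K c] by metis
 define C where "C = 4 * C0 / c\<^sup>2"
 have c2: "0 < c\<^sup>2" "c\<^sup>2 \<le> 1" using c by (auto simp: power_le_one)
 have "4 * C0 * c\<^sup>2 \<le> 4 * C0 * 1" using c2 C0 by (intro mult_left_mono) auto
 hence C4: "4 * C0 \<le> C" using c2 by (simp add: C_def pos_le_divide_eq)
 hence C1: "1 \<le> C" using C0 by linarith
 show ?thesis unfolding surface_curvatures_def almost_principal_def
 proof (rule exI[of _ C], intro conjI C1 allI impI; elim conjE)
  fix U :: "'a => 'a \<times> real" and S and n :: "'a \<times> real" and r \<eta> \<nu> y m lam
  assume S: "open S" and y: "y \<in> S" and U: "Ck 2 S U" and jo: "jet_ok K c \<eta> U y n" and r: "0 < r" and \<eta>: "0 \<le> \<eta>"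
   and rC: "(r + \<eta>) * C \<le> 1" and d\<nu>: "\<nu> differentiable (at y)"
   and hn: "\<forall>z\<in>S. hnormal (hsurf r U) z (\<nu> z)" and gd: "good_normal (hsurf r U) y n (\<nu> y)"
   and pc: "principal_curvatures lor (\<lambda>_. UNIV) (hsurf r U) \<nu> y m lam"
  define F where "F = (hsurf r U)"
  have F2: "Ck 2 S F" unfolding F_def by (rule expm_scaled_Ck[OF S U])
  note dF = Ck2_differentiable(1)[OF S F2] and dDF = Ck2_differentiable(2)[OF S F2]
  have sm: "(r + \<eta>) * (4 * C0) \<le> c\<^sup>2"
  proof -
   have "(r + \<eta>) * C * c\<^sup>2 \<le> 1 * c\<^sup>2" using rC c2 by (intro mult_right_mono) auto
   thus ?thesis using c2 by (simp add: C_def)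
  qed
  have "4 * ((r + \<eta>) * C0) \<le> c\<^sup>2" using sm by (simp only: mult_ac)
  moreover have "0 \<le> (r + \<eta>) * C0" using r \<eta> C0 by simp
  ultimately have sm1: "(r + \<eta>) * C0 \<le> 1" using c2 by linarith
  have "0 \<le> \<eta> * C0" using \<eta> C0 by simp
  hence rC0: "C0 * r \<le> c\<^sup>2 / 4" using sm by (simp add: algebra_simps)
  have G: "\<bar>lor (D F y v) (D F y w) / r\<^sup>2 - D U y v \<bullet> D U y w\<bar> \<le> C0 * r * (norm v * norm w)" for v w
   using close_formsD(1)[OF cf[OF jo r \<eta> sm1]] by (simp add: F_def)
  have H: "\<bar>lor (\<nu> y) (D2 F w y v) / r - n \<bullet> D2 U w y v\<bar> \<le> C0 * (r + \<eta>) * (norm v * norm w)" for v w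
   using close_formsD(4)[OF cf[OF jo r \<eta> sm1] gd] by (simp add: F_def)
  have lo: "c\<^sup>2 * (norm v)\<^sup>2 \<le> D U y v \<bullet> D U y v" for v
  proof -
   have "c * norm (v, 0::real) \<le> norm (D U y v + 0 *\<^sub>R n)" using jo unfolding jet_ok_def transversal_def by blast
   hence "(c * norm v)\<^sup>2 \<le> (norm (D U y v))\<^sup>2" using c by (intro power_mono) (auto simp: norm_Pair)
   thus ?thesis by (simp add: power_mult_distrib power2_norm_eq_inner)
  qed
  have up: "D U y v \<bullet> D U y v \<le> K\<^sup>2 * (norm v)\<^sup>2" for v
  proof -
   have "norm (D U y v) \<le> K * norm v" using jo unfolding jet_ok_def bounded_jet_def by blast
   hence "(norm (D U y v))\<^sup>2 \<le> (K * norm v)\<^sup>2" by (intro power_mono) auto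
   thus ?thesis by (simp add: power_mult_distrib power2_norm_eq_inner)
  qed
  have lin: "linear (D F y)" using D_linear[OF dF[OF y]] .
  show "inj (D (hsurf r U) y)"
  proof -
   have "v = 0" if "D F y v = 0" for v
   proof (rule ccontr)
    assume "v \<noteq> 0"
    hence p: "(norm v)\<^sup>2 > 0" by simp
    have "D U y v \<bullet> D U y v \<le> C0 * r * (norm v)\<^sup>2" using G[of v v] that by (simp add: lor_zero power2_eq_square)
    also have "\<dots> \<le> c\<^sup>2 / 4 * (norm v)\<^sup>2" using rC0 by (intro mult_right_mono) auto
    finally have "c\<^sup>2 * (norm v)\<^sup>2 \<le> c\<^sup>2 / 4 * (norm v)\<^sup>2" using lo[of v] by linarith
    moreover have "0 < c\<^sup>2 * (norm v)\<^sup>2" using p c2 by (intro mult_pos_pos)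
    ultimately show False by linarith
   qed
   hence "inj (D F y)" using linear_injective_0[OF lin] by blast
   thus ?thesis by (simp add: F_def)
  qed
  obtain e0 where fr: "orthonormal_frame (first_form lor F y) UNIV m e0"
   and sf: "\<And>i j. i < m ==> j < m ==> second_form lor F \<nu> y (e0 i) (e0 j) = (if i = j then lam i else 0)"
   using pc unfolding principal_curvatures_def F_def by blast
  define e where "e i = r *\<^sub>R e0 i" for i
  have g1: "lor (D F y (e i)) (D F y (e j)) / r\<^sup>2 = (if i = j then 1 else 0)" if "i < m" "j < m" for i j
  proof -
   have "lor (D F y (e0 i)) (D F y (e0 j)) = (if i = j then 1 else 0)"
    using fr that unfolding orthonormal_frame_def first_form_def by blast
   thus ?thesis using r by (simp add: e_def linear_scale[OF lin] lor_simps power2_eq_square)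
  qed
  have h1: "- (lor (\<nu> y) (D2 F (e j) y (e i)) / r) = (if i = j then r * lam i else 0)" if ij: "i < m" "j < m" for i j
  proof -
   \<comment> \<open>Differentiate the orthogonality of the normal and a tangent vector field.\<close>
   have "D (\<lambda>z. lor (\<nu> z) (D F z (e0 j))) y (e0 i) = 0"
    using D_cong[OF S y, of "\<lambda>z. lor (\<nu> z) (D F z (e0 j))" "\<lambda>_. 0"] hn by (simp add: hnormal_def F_def)
   hence s0: "lor (\<nu> y) (D2 F (e0 j) y (e0 i)) = - second_form lor F \<nu> y (e0 i) (e0 j)"
    using D_bilinear(1)[OF lor_bb d\<nu> dDF[OF y], of "e0 j" "e0 i"] by (simp add: second_form_def)
   have "D2 F (e j) y (e i) = D (\<lambda>z. r *\<^sub>R D F z (e0 j)) y (e i)"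
    by (rule arg_cong[OF D_cong[OF S y], of _ _ "\<lambda>f. f (e i)"])
     (use D_linear[OF dF] in \<open>simp add: e_def linear_scale\<close>)
   also have "\<dots> = r *\<^sub>R (r *\<^sub>R D2 F (e0 j) y (e0 i))"
    using D_bounded_linear(1)[OF bounded_linear_scaleR_right dDF[OF y]] linear_scale[OF D_linear[OF dDF[OF y]]]
    by (simp add: e_def)
   finally show ?thesis using s0 sf[OF ij] r by (simp add: lor_simps)
  qed
  have ne: "norm (e i) \<le> 2 / c \<and> 1 / (2 * K) \<le> norm (e i)" if i: "i < m" for i
  proof -
   have a: "\<bar>1 - D U y (e i) \<bullet> D U y (e i)\<bar> \<le> C0 * r * (norm (e i))\<^sup>2"
    using G[of "e i" "e i"] unfolding g1[OF i i] by (simp add: power2_eq_square)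
   have b: "C0 * r * (norm (e i))\<^sup>2 \<le> c\<^sup>2 / 4 * (norm (e i))\<^sup>2" using rC0 by (intro mult_right_mono) auto
   have "c\<^sup>2 * (norm (e i))\<^sup>2 \<le> 1 + c\<^sup>2 / 4 * (norm (e i))\<^sup>2" using a b lo[of "e i"] by linarith
   hence "(c * norm (e i))\<^sup>2 \<le> 2\<^sup>2" unfolding power_mult_distrib by simp
   hence "c * norm (e i) \<le> 2" by (rule power2_le_imp_le) simp
   hence 1: "norm (e i) \<le> 2 / c" using c by (simp add: pos_le_divide_eq mult.commute)
   have "c\<^sup>2 / 4 \<le> K\<^sup>2" using c2 one_le_power[OF K, of 2] by linarith
   hence "c\<^sup>2 / 4 * (norm (e i))\<^sup>2 \<le> K\<^sup>2 * (norm (e i))\<^sup>2" by (rule mult_right_mono) simp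
   hence "1 \<le> 2 * (K\<^sup>2 * (norm (e i))\<^sup>2)" using a b up[of "e i"] by linarith
   moreover have "(0::real) \<le> K\<^sup>2 * (norm (e i))\<^sup>2" by simp
   ultimately have "1\<^sup>2 \<le> (2 * (K * norm (e i)))\<^sup>2" unfolding power_mult_distrib by simp
   hence "1 \<le> 2 * (K * norm (e i))" by (rule power2_le_imp_le) (use K in simp)
   hence "1 / (2 * K) \<le> norm (e i)" using K by (simp add: pos_divide_le_eq mult_ac)
   with 1 show ?thesis by simp
  qed
  have ee: "norm (e i) * norm (e j) \<le> 4 / c\<^sup>2" if "i < m" "j < m" for i j
   using mult_mono[of "norm (e i)" "2 / c" "norm (e j)" "2 / c"] ne that c by (simp add: power2_eq_square)
  have fin: "C0 * t * (norm (e i) * norm (e j)) \<le> C * t" if "i < m" "j < m" "0 \<le> t" for i j t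
  proof -
   have "C0 * t * (norm (e i) * norm (e j)) \<le> C0 * t * (4 / c\<^sup>2)" using ee[OF that(1,2)] C0 that(3) by (intro mult_left_mono) auto
   thus ?thesis by (simp add: C_def mult_ac)
  qed
  show "\<exists>e. \<forall>i<m. norm (e i) \<le> 2 / c \<and> 1 / (2 * K) \<le> norm (e i) \<and>
   (\<forall>j<m. \<bar>D U y (e i) \<bullet> D U y (e j) - (if i = j then 1 else 0)\<bar> \<le> C * r \<and>
    \<bar>- (n \<bullet> D2 U (e j) y (e i)) - (if i = j then r * lam i else 0)\<bar> \<le> C * (r + \<eta>))"
  proof (intro exI[of _ e] allI impI conjI)
   fix i assume i: "i < m"
   show "norm (e i) \<le> 2 / c" "1 / (2 * K) \<le> norm (e i)" using ne[OF i] by auto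
   fix j assume j: "j < m"
   show "\<bar>D U y (e i) \<bullet> D U y (e j) - (if i = j then 1 else 0)\<bar> \<le> C * r"
    using G[of "e i" "e j"] fin[OF i j, of r] r unfolding g1[OF i j] by linarith
   show "\<bar>- (n \<bullet> D2 U (e j) y (e i)) - (if i = j then r * lam i else 0)\<bar> \<le> C * (r + \<eta>)"
    using H[of "e j" "e i"] fin[OF i j, of "r + \<eta>"] r \<eta> unfolding h1[OF i j, symmetric] by linarith
  qed
 qed
qed

section \<open>Pinching of almost two-convex curvatures\<close>

lemma sum_all_but_one:
 fixes l :: "nat => real"
 assumes "finite A" "k0 \<in> A" "\<And>k. k \<in> A ==> - \<eta> \<le> l k" "\<And>k j. k \<in> A ==> j \<in> A ==> k \<noteq> j ==> c0 \<le> l k \<or> c0 \<le> l j" "0 \<le> \<eta>" "0 \<le> c0"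
 shows "(real (card A) - 1) * c0 - \<eta> \<le> sum l A"
proof -
 have "\<exists>k1\<in>A. \<forall>k\<in>A - {k1}. c0 \<le> l k"
 proof (cases "\<exists>k\<in>A. l k < c0")
  case True
  then obtain k1 where "k1 \<in> A" "l k1 < c0" by blast
  thus ?thesis using assms(4) by (intro bexI[of _ k1]) force+
 next
  case False
  thus ?thesis using assms(2) by (intro bexI[of _ k0]) (auto simp: not_less)
 qed
 then obtain k1 where k1: "k1 \<in> A" "\<And>k. k \<in> A - {k1} ==> c0 \<le> l k" by blast
 have "sum l A = l k1 + sum l (A - {k1})" using k1 assms(1) by (simp add: sum.remove)
 moreover have "real (card (A - {k1})) * c0 \<le> sum l (A - {k1})"
  using sum_mono[of "A - {k1}" "\<lambda>_. c0" l] k1 by simp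
 moreover have "real (card (A - {k1})) = real (card A) - 1"
 proof -
  have "1 \<le> card A" using k1 assms(1) by (auto simp: Suc_le_eq card_gt_0_iff)
  thus ?thesis using k1 assms(1) by (simp add: of_nat_diff card_Diff_singleton)
 qed
 ultimately show ?thesis using assms(3)[OF k1(1)] by simp
qed

definition almost_two_convex :: "real => real => real => nat => (nat => real) => bool" where
 "almost_two_convex \<eta> L c n l \<longleftrightarrow> (\<forall>i<n. - \<eta> \<le> l i \<and> l i \<le> L) \<and> (\<forall>i<n. \<forall>j<n. i \<noteq> j --> c \<le> l i \<or> c \<le> l j)"

definition pinched_at_scale :: "nat => real => real => real => (nat => real) => bool" where
 "pinched_at_scale n \<tau> \<kappa> r lam \<longleftrightarrow> (\<forall>\<alpha>. 0 < \<alpha> \<and> \<alpha> \<le> \<kappa> --> pinched n \<tau> \<alpha> lam) \<and> \<kappa> / r \<le> mean_curv n lam \<and>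
  (\<forall>i<n. \<forall>j<n. i \<noteq> j --> \<kappa> / r\<^sup>2 \<le> P n \<tau> lam i j)"

text \<open>All principal curvatures but at most one are bounded below by a positive constant, and the
 remaining one is almost nonnegative. In dimension three the two large curvatures can be the only
 contribution, which is why \<open>\<tau> < 2\<close> is needed there.\<close>

lemma pinching_algebra:
 assumes n: "3 \<le> n" and \<tau>: "\<tau> \<in> tau_range n" and c0: "0 < c0" "c0 \<le> L"
 shows "\<exists>\<eta>>0. \<exists>\<kappa>>0. \<eta> \<le> L \<and> (\<forall>l. almost_two_convex \<eta> L c0 n l -->
  \<kappa> \<le> mean_curv n l \<and> (\<forall>i<n. \<forall>j<n. i \<noteq> j -->
   \<kappa> \<le> mean_curv n l * (l i + l j) - (l i)\<^sup>2 - (l j)\<^sup>2 - \<tau> * l i * l j))"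
proof -
 define t where "t = 2 - \<tau>"
 have t: "0 \<le> t" "t \<le> 2" "n = 3 ==> 0 < t" using \<tau> by (auto simp: t_def tau_range_def split: if_splits)
 define t' where "t' = (if n = 3 then t else 1)"
 have t': "0 < t'" "t' \<le> 2" using t by (auto simp: t'_def)
 define \<eta> where "\<eta> = t' * c0\<^sup>2 / (16 * L)"
 define \<kappa> where "\<kappa> = min c0 (t' * c0\<^sup>2 / 8)"
 have L: "0 < L" using c0 by simp
 have cc: "0 < c0\<^sup>2" "c0\<^sup>2 \<le> c0 * L" using c0 by (auto simp: power2_eq_square)
 have \<eta>: "0 < \<eta>" "\<eta> * L = t' * c0\<^sup>2 / 16" using t' L cc by (auto simp: \<eta>_def)
 have \<eta>8: "\<eta> \<le> c0 / 8"
 proof -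
  have "t' * c0\<^sup>2 \<le> 2 * (c0 * L)" using t' cc by (intro mult_mono) auto
  thus ?thesis using L by (simp add: \<eta>_def pos_divide_le_eq)
 qed
 have \<kappa>: "0 < \<kappa>" using c0 t' cc by (simp add: \<kappa>_def)
 show ?thesis
 proof (rule exI[of _ \<eta>], rule conjI[OF \<eta>(1)], rule exI[of _ \<kappa>], rule conjI[OF \<kappa>], intro conjI allI impI)
  show "\<eta> \<le> L" using \<eta>8 c0 by linarith
  fix l :: "nat => real"
  assume "almost_two_convex \<eta> L c0 n l"
  hence b: "\<forall>i<n. - \<eta> \<le> l i \<and> l i \<le> L" and o: "\<forall>i<n. \<forall>j<n. i \<noteq> j --> c0 \<le> l i \<or> c0 \<le> l j"
   unfolding almost_two_convex_def by blast+
  have "(real (card {..<n}) - 1) * c0 - \<eta> \<le> sum l {..<n}"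
   by (rule sum_all_but_one[of _ 0]) (use n b o \<eta> c0 in auto)
  moreover have "2 * c0 \<le> (real n - 1) * c0" using n c0 by (intro mult_right_mono) auto
  ultimately have "c0 \<le> sum l {..<n}" using \<eta>8 c0 unfolding card_lessThan by linarith
  thus "\<kappa> \<le> mean_curv n l" by (simp add: mean_curv_def \<kappa>_def)
  fix i j assume ij: "i < n" "j < n" "i \<noteq> j"
  define A where "A = {..<n} - {i, j}"
  define s where "s = sum l A"
  have cA: "card A = n - 2" using ij by (simp add: A_def card_Diff_subset)
  have fA: "finite A" by (simp add: A_def)
  have "A \<noteq> {}" using cA n by (metis card.empty diff_is_0_eq not_less_eq_eq numeral_3_eq_3 numeral_2_eq_2)
  then obtain k0 where k0: "k0 \<in> A" by blast
  have "{..<n} = insert i (insert j A)" using ij by (auto simp: A_def)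
  hence "sum l {..<n} = sum l (insert i (insert j A))" by (rule arg_cong)
  hence m: "mean_curv n l = l i + l j + s" using ij fA by (simp add: mean_curv_def s_def A_def)
  have e: "mean_curv n l * (l i + l j) - (l i)\<^sup>2 - (l j)\<^sup>2 - \<tau> * l i * l j = (l i + l j) * s + t * (l i * l j)"
   unfolding m by (simp add: t_def power2_eq_square algebra_simps)
  have bi: "- \<eta> \<le> l i" "l i \<le> L" "- \<eta> \<le> l j" "l j \<le> L" using b ij by auto
  show "\<kappa> \<le> mean_curv n l * (l i + l j) - (l i)\<^sup>2 - (l j)\<^sup>2 - \<tau> * l i * l j"
  proof (cases "c0 \<le> l i \<and> c0 \<le> l j")
   case True
   have p: "c0\<^sup>2 \<le> l i * l j" using True c0 mult_mono[of c0 "l i" c0 "l j"] by (simp add: power2_eq_square)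
   have tp: "t * c0\<^sup>2 \<le> t * (l i * l j)" using p t by (intro mult_left_mono) auto
   have s0: "(real (card A) - 1) * c0 - \<eta> \<le> s"
    unfolding s_def by (rule sum_all_but_one[OF fA k0]) (use b o \<eta> c0 in \<open>auto simp: A_def\<close>)
   have q: "2 * c0 \<le> l i + l j" "l i + l j \<le> 2 * L" using True bi by auto
   show ?thesis
   proof (cases "n = 3")
    case n3: True
    hence "- \<eta> \<le> s" using s0 cA by simp
    hence "(l i + l j) * (- \<eta>) \<le> (l i + l j) * s" using q c0 by (intro mult_left_mono) auto
    moreover have "(l i + l j) * \<eta> \<le> (2 * L) * \<eta>" using q \<eta> by (intro mult_right_mono) auto
    ultimately have "- (2 * (\<eta> * L)) \<le> (l i + l j) * s" by (simp only: mult_ac mult_minus_right)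
    hence "t' * c0\<^sup>2 - t' * c0\<^sup>2 / 8 \<le> (l i + l j) * s + t * (l i * l j)"
     using tp \<eta>(2) n3 by (simp add: t'_def)
    moreover have "0 \<le> t' * c0\<^sup>2" using t' by simp
    ultimately show ?thesis unfolding e \<kappa>_def by simp
   next
    case False
    hence "1 \<le> real (card A) - 1" using n cA by simp
    hence "1 * c0 \<le> (real (card A) - 1) * c0" using c0 by (intro mult_right_mono) auto
    hence "c0 / 2 \<le> s" using s0 \<eta>8 c0 by linarith
    hence "(2 * c0) * (c0 / 2) \<le> (l i + l j) * s" using q c0 by (intro mult_mono) auto
    moreover have "0 \<le> t * c0\<^sup>2" using t by simp
    ultimately have "c0\<^sup>2 / 8 \<le> (l i + l j) * s + t * (l i * l j)"
     using tp cc(1) unfolding power2_eq_square by linarith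
    thus ?thesis using False unfolding e \<kappa>_def t'_def by simp
   qed
  next
   case False
   have big: "c0 \<le> l k" if "k \<in> A" for k using False o that ij by (force simp: A_def)
   have "c0 \<le> l i \<or> c0 \<le> l j" using o ij by blast
   hence q: "c0 - \<eta> \<le> l i + l j" using bi by linarith
   have "real (card A) * c0 \<le> s" unfolding s_def using sum_mono[of A "\<lambda>_. c0" l] big by simp
   moreover have "1 * c0 \<le> real (card A) * c0" using n cA c0 by (intro mult_right_mono) auto
   ultimately have "c0 \<le> s" by linarith
   hence 1: "(c0 / 2) * c0 \<le> (l i + l j) * s" using q \<eta>8 c0 by (intro mult_mono) auto
   have "- (\<eta> * L) \<le> l i * l j"
   proof (cases "0 \<le> l i * l j")
    case True
    thus ?thesis using \<eta> L mult_nonneg_nonneg[of \<eta> L] by linarith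
   next
    case neg: False
    have "\<bar>l i * l j\<bar> \<le> \<eta> * L"
    proof (cases "l i < 0")
     case True
     hence "0 \<le> l j" using neg by (meson linorder_not_le mult_nonpos_nonpos less_imp_le)
     thus ?thesis using True bi unfolding abs_mult by (intro mult_mono) auto
    next
     case f: False
     hence "l j < 0" using neg by (meson linorder_not_le mult_nonneg_nonneg)
     hence "\<bar>l j\<bar> * \<bar>l i\<bar> \<le> \<eta> * L" using f bi by (intro mult_mono) auto
     thus ?thesis by (simp add: abs_mult mult.commute)
    qed
    thus ?thesis by linarith
   qed
   hence "t * (- (\<eta> * L)) \<le> t * (l i * l j)" using t by (intro mult_left_mono) auto
   moreover have "t * (\<eta> * L) \<le> 2 * (\<eta> * L)" using t \<eta> L by (intro mult_right_mono) auto
   moreover have "t' * c0\<^sup>2 \<le> 2 * c0\<^sup>2" using t' by (intro mult_right_mono) auto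
   ultimately have "t' * c0\<^sup>2 / 8 \<le> (l i + l j) * s + t * (l i * l j)"
    using 1 \<eta>(2) unfolding power2_eq_square by linarith
   thus ?thesis unfolding e \<kappa>_def by simp
  qed
 qed
qed

text \<open>In terms of the curvatures at scale \<open>r\<close>: the ambient curvature contributes a bounded term, negligible
 against \<open>r\<close> to the power \<open>-2\<close>, and the pinching constant can be taken small.\<close>

lemma pinching_at_scale:
 assumes n: "3 \<le> n" and \<tau>: "\<tau> \<in> tau_range n" and c0: "0 < c0" "c0 \<le> L"
 shows "\<exists>\<eta>>0. \<exists>\<kappa>>0. \<exists>\<rho>>0. \<forall>r lam. 0 < r \<and> r \<le> \<rho> \<and> almost_two_convex \<eta> L c0 n (\<lambda>i. r * lam i) -->
  pinched_at_scale n \<tau> \<kappa> r lam"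
proof -
 obtain \<eta> k where \<eta>: "0 < \<eta>" "\<eta> \<le> L" and k: "0 < k" and A: "\<And>l. almost_two_convex \<eta> L c0 n l ==>
  k \<le> mean_curv n l \<and> (\<forall>i<n. \<forall>j<n. i \<noteq> j -->
   k \<le> mean_curv n l * (l i + l j) - (l i)\<^sup>2 - (l j)\<^sup>2 - \<tau> * l i * l j)"
  using pinching_algebra[OF n \<tau> c0] by metis
 have L: "0 < L" using c0 by simp
 define M where "M = 4 * real n * L\<^sup>2 + 2"
 have M: "2 \<le> M" "4 * real n * L\<^sup>2 \<le> M" by (simp_all add: M_def)
 define \<kappa> where "\<kappa> = k / M"
 have \<kappa>: "0 < \<kappa>" "\<kappa> \<le> k / 2" "4 * real n * L\<^sup>2 * \<kappa> \<le> k"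
 proof -
  show "0 < \<kappa>" using k M by (simp add: \<kappa>_def)
  show "\<kappa> \<le> k / 2" unfolding \<kappa>_def using k M by (intro divide_left_mono) auto
  have "4 * real n * L\<^sup>2 * \<kappa> \<le> M * \<kappa>" using M(2) \<open>0 < \<kappa>\<close> by (intro mult_right_mono) auto
  thus "4 * real n * L\<^sup>2 * \<kappa> \<le> k" using M by (simp add: \<kappa>_def)
 qed
 define \<rho> where "\<rho> = min 1 (k / (4 * real n))"
 have \<rho>: "0 < \<rho>" using k n by (simp add: \<rho>_def)
 show ?thesis unfolding pinched_at_scale_def
 proof (rule exI[of _ \<eta>], rule conjI[OF \<eta>(1)], rule exI[of _ \<kappa>], rule conjI[OF \<kappa>(1)],
   rule exI[of _ \<rho>], rule conjI[OF \<rho>], intro conjI allI impI)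
  fix r :: real and lam :: "nat => real"
  assume asm: "0 < r \<and> r \<le> \<rho> \<and> almost_two_convex \<eta> L c0 n (\<lambda>i. r * lam i)"
  hence r: "0 < r" "r \<le> \<rho>" and b: "\<forall>i<n. - \<eta> \<le> r * lam i \<and> r * lam i \<le> L" by (auto simp: almost_two_convex_def)
  define l where "l i = r * lam i" for i
  have ml: "mean_curv n l = r * mean_curv n lam" by (simp add: mean_curv_def l_def sum_distrib_left)
  have kl: "k \<le> mean_curv n l" "\<And>i j. i < n ==> j < n ==> i \<noteq> j ==> k \<le> mean_curv n l * (l i + l j) - (l i)\<^sup>2 - (l j)\<^sup>2 - \<tau> * l i * l j"
   using A[of l] asm by (auto simp: l_def[abs_def])
  have "k \<le> r * mean_curv n lam" using kl ml by simp
  hence "k / r \<le> mean_curv n lam" using r by (simp add: pos_divide_le_eq mult.commute)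
  moreover have "\<kappa> / r \<le> k / r" using \<kappa> r k by (intro divide_right_mono) auto
  ultimately show "\<kappa> / r \<le> mean_curv n lam" by linarith
  have r2: "r\<^sup>2 * (2 * (real n - 1) - \<tau>) \<le> k / 2"
  proof -
   have "r\<^sup>2 \<le> r * 1" using r by (simp add: power2_eq_square \<rho>_def)
   hence "r\<^sup>2 \<le> k / (4 * real n)" using r by (simp add: \<rho>_def)
   hence "r\<^sup>2 * (2 * real n) \<le> k / (4 * real n) * (2 * real n)" by (rule mult_right_mono) simp
   moreover have "r\<^sup>2 * (2 * (real n - 1) - \<tau>) \<le> r\<^sup>2 * (2 * real n)"
    using \<tau> by (intro mult_left_mono) (auto simp: tau_range_def split: if_splits)
   ultimately show ?thesis using n by simp
  qed
  have PP: "k / 2 / r\<^sup>2 \<le> P n \<tau> lam i j" if "i < n" "j < n" "i \<noteq> j" for i j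
  proof -
   have "r\<^sup>2 * P n \<tau> lam i j = (mean_curv n l * (l i + l j) - (l i)\<^sup>2 - (l j)\<^sup>2 - \<tau> * l i * l j) - r\<^sup>2 * (2 * (real n - 1) - \<tau>)"
    unfolding ml P_def by (simp add: l_def power2_eq_square algebra_simps)
   hence "k / 2 \<le> P n \<tau> lam i j * r\<^sup>2" using kl(2)[OF that] r2 unfolding mult.commute[of _ "r\<^sup>2"] by linarith
   thus ?thesis using r by (subst pos_divide_le_eq) auto
  qed
  show "\<kappa> / r\<^sup>2 \<le> P n \<tau> lam i j" if "i < n" "j < n" "i \<noteq> j" for i j
  proof -
   have "\<kappa> / r\<^sup>2 \<le> k / 2 / r\<^sup>2" using \<kappa> by (intro divide_right_mono) auto
   thus ?thesis using PP[OF that] by linarith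
  qed
  fix \<alpha> assume "0 < \<alpha> \<and> \<alpha> \<le> \<kappa>"
  hence \<alpha>: "0 < \<alpha>" "\<alpha> \<le> \<kappa>" by auto
  show "pinched n \<tau> \<alpha> lam" unfolding pinched_def
  proof (intro allI impI)
   fix i j p q assume ij: "i < n" "j < n" "i \<noteq> j" and p: "p < n" and q: "q < n"
   have "mean_curv n l \<le> (\<Sum>i<n. L)" unfolding mean_curv_def using b by (intro sum_mono) (auto simp: l_def)
   hence m: "mean_curv n l \<le> real n * L" by simp
   have d: "\<bar>l p - l q\<bar> \<le> 2 * L"
   proof -
    have "- \<eta> \<le> l p" "l p \<le> L" "- \<eta> \<le> l q" "l q \<le> L" using b p q by (auto simp: l_def)
    thus ?thesis using \<eta> by (simp add: abs_le_iff)
   qed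
   have "\<alpha> * (mean_curv n l * \<bar>l p - l q\<bar>) \<le> \<kappa> * ((real n * L) * (2 * L))"
    using \<alpha> m d kl(1) k L by (intro mult_mono) auto
   also have "\<dots> = (4 * real n * L\<^sup>2 * \<kappa>) / 2" by (simp add: power2_eq_square)
   also have "\<dots> \<le> k / 2" using \<kappa> by (intro divide_right_mono) auto
   finally have "r\<^sup>2 * (\<alpha> * mean_curv n lam * \<bar>lam p - lam q\<bar>) \<le> k / 2"
    using r unfolding ml by (simp add: l_def power2_eq_square mult_ac abs_mult flip: right_diff_distrib)
   hence "\<alpha> * mean_curv n lam * \<bar>lam p - lam q\<bar> \<le> k / 2 / r\<^sup>2" using r by (simp add: pos_le_divide_eq mult.commute)
   thus "\<alpha> * mean_curv n lam * \<bar>lam p - lam q\<bar> \<le> P n \<tau> lam i j" using PP[OF ij] by linarith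
  qed
 qed
qed

section \<open>Volume densities and spherical averages\<close>

lemma gram_det_eq_det: "gram_det m G = Determinant.det (Matrix.mat m m (\<lambda>(i, j). G i j))"
 unfolding gram_det_def Determinant.det_def
 by (auto simp: lessThan_atLeast0 permutes_in_image intro!: sum.cong prod.cong)

lemma gram_det_orthogonal_change:
 assumes O: "\<And>i j. i < m ==> j < m ==> (\<Sum>k<m. Q i k * Q j k) = (if i = j then 1 else (0::real))"
  and G: "\<And>i j. i < m ==> j < m ==> G i j = (\<Sum>k<m. \<Sum>l<m. Q i k * H k l * Q j l)"
 shows "gram_det m G = gram_det m H"
proof -
 define q h where "q = Matrix.mat m m (\<lambda>(i, j). Q i j)" and "h = Matrix.mat m m (\<lambda>(i, j). H i j)"
 have c: "q \<in> carrier_mat m m" "h \<in> carrier_mat m m" "transpose_mat q \<in> carrier_mat m m"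
  by (auto simp: q_def h_def)
 have qq: "q * transpose_mat q = 1\<^sub>m m"
  by (rule eq_matI) (auto simp: q_def scalar_prod_def O lessThan_atLeast0[symmetric])
 have "Matrix.mat m m (\<lambda>(i, j). G i j) = q * h * transpose_mat q"
 proof (rule eq_matI)
  fix i j assume "i < dim_row (q * h * transpose_mat q)" "j < dim_col (q * h * transpose_mat q)"
  hence ij: "i < m" "j < m" by (auto simp: q_def)
  have "(q * h * transpose_mat q) $$ (i, j) = (\<Sum>l<m. (\<Sum>k<m. Q i k * H k l) * Q j l)"
   using ij by (simp add: q_def h_def scalar_prod_def lessThan_atLeast0[symmetric])
  also have "\<dots> = (\<Sum>l<m. \<Sum>k<m. Q i k * H k l * Q j l)" by (simp add: sum_distrib_right)
  also have "\<dots> = G i j" unfolding G[OF ij] by (rule sum.swap)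
  finally show "Matrix.mat m m (\<lambda>(i, j). G i j) $$ (i, j) = (q * h * transpose_mat q) $$ (i, j)" using ij by simp
 qed (auto simp: q_def)
 hence "gram_det m G = Determinant.det q * Determinant.det h * Determinant.det (transpose_mat q)"
  unfolding gram_det_eq_det using c by (simp add: Determinant.det_mult[of _ m])
 moreover have "Determinant.det q * Determinant.det (transpose_mat q) = 1"
  using Determinant.det_mult[OF c(1,3)] qq by simp
 ultimately show ?thesis unfolding gram_det_eq_det h_def by (simp add: mult_ac)
qed

lemma gram_det_identity: "gram_det m (\<lambda>i j. if i = j then 1 else 0) = 1"
proof -
 have "Matrix.mat m m (\<lambda>(i, j). if i = j then 1 else 0) = (1\<^sub>m m :: real mat)" by (rule eq_matI) auto
 thus ?thesis by (simp add: gram_det_eq_det)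
qed

lemma gram_det_scale: "gram_det m (\<lambda>i j. c * G i j) = c ^ m * gram_det m G"
 by (simp add: gram_det_def prod.distrib sum_distrib_left mult_ac)

lemma prod_close:
 fixes a b :: "nat => real" and t :: real
 assumes "finite I" "\<And>i. i \<in> I ==> \<bar>a i\<bar> \<le> 2" "\<And>i. i \<in> I ==> \<bar>b i\<bar> \<le> 1" "\<And>i. i \<in> I ==> \<bar>a i - b i\<bar> \<le> t" "0 \<le> t"
 shows "\<bar>prod a I - prod b I\<bar> \<le> real (card I) * 2 ^ card I * t"
 using assms(1-4)
proof (induction I)
 case (insert i I)
 have A: "\<bar>prod a I\<bar> \<le> 2 ^ card I"
  unfolding abs_prod using insert.prems(1) prod_mono[of I "\<lambda>i. \<bar>a i\<bar>" "\<lambda>_. 2"] by simp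
 have B: "\<bar>prod a I - prod b I\<bar> \<le> real (card I) * 2 ^ card I * t" using insert by simp
 have "prod a (insert i I) - prod b (insert i I) = (a i - b i) * prod a I + b i * (prod a I - prod b I)"
  using insert.hyps by (simp add: algebra_simps)
 also have "\<bar>\<dots>\<bar> \<le> \<bar>a i - b i\<bar> * \<bar>prod a I\<bar> + \<bar>b i\<bar> * \<bar>prod a I - prod b I\<bar>"
  using abs_triangle_ineq by (simp add: abs_mult[symmetric])
 also have "\<dots> \<le> t * 2 ^ card I + 1 * (real (card I) * 2 ^ card I * t)"
  using insert.prems A B assms(5) by (intro add_mono mult_mono) auto
 also have "\<dots> = real (Suc (card I)) * 2 ^ card I * t" by (simp add: algebra_simps)
 also have "\<dots> \<le> real (Suc (card I)) * 2 ^ Suc (card I) * t"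
  using assms(5) by (intro mult_right_mono mult_left_mono) auto
 finally show ?case using insert.hyps by (simp only: card_insert_disjoint not_False_eq_True)
qed simp

text \<open>Only the identity permutation contributes a term without a small factor.\<close>

lemma gram_det_close:
 "\<exists>C\<ge>0. \<forall>G t. 0 \<le> t \<and> t \<le> 1 \<and> (\<forall>i<m. \<forall>j<m. \<bar>G i j - (if i = j then 1 else 0)\<bar> \<le> t) --> \<bar>gram_det m G - 1\<bar> \<le> C * t"
proof -
 define C where "C = real (card {\<pi>. \<pi> permutes {..<m}}) * (real m * 2 ^ m)"
 have "\<bar>gram_det m G - 1\<bar> \<le> C * t"
  if t: "0 \<le> t" "t \<le> 1" and G: "\<forall>i<m. \<forall>j<m. \<bar>G i j - (if i = j then 1 else 0)\<bar> \<le> t" for G t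
 proof -
  define I where "I i j = (if i = j then 1 else (0::real))" for i j :: nat
  have "gram_det m G - 1 = gram_det m G - gram_det m I" using gram_det_identity[of m] by (simp add: I_def[abs_def])
  also have "\<dots> = (\<Sum>\<pi> | \<pi> permutes {..<m}. of_int (sign \<pi>) * ((\<Prod>i<m. G i (\<pi> i)) - (\<Prod>i<m. I i (\<pi> i))))"
   by (simp add: gram_det_def sum_subtractf right_diff_distrib)
  also have "\<bar>\<dots>\<bar> \<le> (\<Sum>\<pi> | \<pi> permutes {..<m}. real m * 2 ^ m * t)"
  proof (rule order_trans[OF sum_abs], rule sum_mono)
   fix \<pi> assume "\<pi> \<in> {\<pi>. \<pi> permutes {..<m}}"
   hence \<pi>: "\<pi> i < m" if "i < m" for i using permutes_in_image[of \<pi> "{..<m}" i] that by auto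
   have d: "\<bar>G i (\<pi> i) - I i (\<pi> i)\<bar> \<le> t" if "i < m" for i using G \<pi>[OF that] that by (simp add: I_def)
   have "\<bar>G i (\<pi> i)\<bar> \<le> 2" if "i < m" for i using d[OF that] t by (auto simp: I_def split: if_splits)
   hence "\<bar>(\<Prod>i<m. G i (\<pi> i)) - (\<Prod>i<m. I i (\<pi> i))\<bar> \<le> real (card {..<m}) * 2 ^ card {..<m} * t"
    using d t by (intro prod_close) (auto simp: I_def)
   moreover have "\<bar>of_int (sign \<pi>) :: real\<bar> = 1" by (simp add: sign_def)
   ultimately show "\<bar>of_int (sign \<pi>) * ((\<Prod>i<m. G i (\<pi> i)) - (\<Prod>i<m. I i (\<pi> i)))\<bar> \<le> real m * 2 ^ m * t"
    by (simp add: abs_mult)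
  qed
  also have "\<dots> = C * t" by (simp add: C_def)
  finally show ?thesis .
 qed
 thus ?thesis by (intro exI[of _ C]) (auto simp: C_def)
qed

lemma orthonormal_frame_expand:
 fixes V :: "'p::euclidean_space set"
 assumes e: "orthonormal_frame (\<bullet>) V m e" and d: "dim V = m" and v: "v \<in> V"
 shows "v = (\<Sum>k<m. (v \<bullet> e k) *\<^sub>R e k)"
proof -
 define B where "B = e ` {..<m}"
 have ee: "e i \<bullet> e j = (if i = j then 1 else 0)" if "i < m" "j < m" for i j
  using e that by (simp add: orthonormal_frame_def)
 have inj: "inj_on e {..<m}" by (rule inj_onI) (metis ee lessThan_iff zero_neq_one)
 have po: "pairwise orthogonal B" using ee by (auto simp: B_def pairwise_def orthogonal_def)
 have n1: "norm x = 1" if "x \<in> B" for x using that ee by (auto simp: B_def norm_eq_1)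
 have "independent B" using n1 by (intro pairwise_orthogonal_independent[OF po]) force
 moreover have "card B = m" using card_image[OF inj] by (simp add: B_def)
 moreover have "B \<subseteq> V" using e by (auto simp: B_def orthonormal_frame_def)
 ultimately have "V \<subseteq> span B" using d by (intro card_ge_dim_independent) auto
 hence "(\<Sum>x\<in>B. (v \<bullet> x) *\<^sub>R x) = v" using v n1 by (intro orthonormal_basis_expand[OF po]) (auto simp: B_def)
 thus ?thesis using sum.reindex[OF inj, of "\<lambda>x. (v \<bullet> x) *\<^sub>R x"] by (simp add: B_def)
qed

lemma orthonormal_frame_exists:
 fixes V :: "'p::euclidean_space set"
 assumes "subspace V" "dim V = m"
 shows "\<exists>e. orthonormal_frame (\<bullet>) V m e"
proof -
 obtain B where B: "B \<subseteq> V" "pairwise orthogonal B" "\<And>x. x \<in> B ==> norm x = 1" "independent B" "card B = dim V"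
  using orthonormal_basis_subspace[OF assms(1)] by metis
 have "finite B" using B(4) by (rule independent_imp_finite)
 then obtain e where e: "bij_betw e {0..<m} B" using ex_bij_betw_nat_finite[of B] B(5) assms(2) by metis
 have "orthonormal_frame (\<bullet>) V m e" unfolding orthonormal_frame_def
 proof (intro conjI allI impI)
  fix i assume i: "i < m"
  hence eB: "e i \<in> B" using e by (auto simp: bij_betw_def)
  thus "e i \<in> V" using B by blast
  fix j assume j: "j < m"
  show "e i \<bullet> e j = (if i = j then 1 else 0)"
  proof (cases "i = j")
   case True thus ?thesis using B(3)[OF eB] by (simp add: norm_eq_1)
  next
   case False
   hence "e i \<noteq> e j" using e i j by (auto simp: bij_betw_def inj_on_def)
   moreover have "e j \<in> B" using e j by (auto simp: bij_betw_def)
   ultimately show ?thesis using B(2) eB False by (auto simp: pairwise_def orthogonal_def)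
  qed
 qed
 thus ?thesis by blast
qed

text \<open>Two orthonormal frames differ by an orthogonal matrix, which does not change the Gram determinant; so the definite description
 may be evaluated in any frame.\<close>

lemma vol_density_eq:
 fixes X :: "'p::euclidean_space => 'b::real_inner \<times> real"
 assumes e: "orthonormal_frame (\<bullet>) (T x) m e" and d: "dim (T x) = m" and lin: "linear (D X x)"
 shows "vol_density T m X x = sqrt (gram_det m (\<lambda>i j. first_form lor X x (e i) (e j)))"
 unfolding vol_density_def
proof (rule the_equality)
 show "\<exists>e'. orthonormal_frame (\<bullet>) (T x) m e' \<and> sqrt (gram_det m (\<lambda>i j. first_form lor X x (e i) (e j)))
   = sqrt (gram_det m (\<lambda>i j. first_form lor X x (e' i) (e' j)))"
  using e by blast
 fix J assume "\<exists>e'. orthonormal_frame (\<bullet>) (T x) m e' \<and> J = sqrt (gram_det m (\<lambda>i j. first_form lor X x (e' i) (e' j)))"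
 then obtain e' where e': "orthonormal_frame (\<bullet>) (T x) m e'"
  and J: "J = sqrt (gram_det m (\<lambda>i j. first_form lor X x (e' i) (e' j)))" by blast
 have ex: "e' i = (\<Sum>k<m. (e' i \<bullet> e k) *\<^sub>R e k)" if "i < m" for i
  using orthonormal_frame_expand[OF e d] e' that by (simp add: orthonormal_frame_def)
 have ee: "e i \<bullet> e j = (if i = j then 1 else 0)" if "i < m" "j < m" for i j
  using e that by (simp add: orthonormal_frame_def)
 have "gram_det m (\<lambda>i j. first_form lor X x (e' i) (e' j)) = gram_det m (\<lambda>i j. first_form lor X x (e i) (e j))"
 proof (rule gram_det_orthogonal_change[where Q = "\<lambda>i k. e' i \<bullet> e k"])
  fix i j assume ij: "i < m" "j < m"
  have "(\<Sum>k<m. (e' i \<bullet> e k) * (e' j \<bullet> e k)) = e' i \<bullet> (\<Sum>k<m. (e' j \<bullet> e k) *\<^sub>R e k)"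
   by (simp add: inner_sum_right mult.commute)
  also have "\<dots> = e' i \<bullet> e' j" using ex[OF ij(2)] by simp
  finally show "(\<Sum>k<m. (e' i \<bullet> e k) * (e' j \<bullet> e k)) = (if i = j then 1 else 0)"
   using e' ij by (simp add: orthonormal_frame_def)
  have Dx: "D X x (e' i) = (\<Sum>k<m. (e' i \<bullet> e k) *\<^sub>R D X x (e k))" if "i < m" for i
  proof -
   have "D X x (e' i) = D X x (\<Sum>k<m. (e' i \<bullet> e k) *\<^sub>R e k)" using ex[OF that] by simp
   thus ?thesis by (simp add: linear_sum[OF lin] linear_scale[OF lin])
  qed
  show "first_form lor X x (e' i) (e' j) = (\<Sum>k<m. \<Sum>l<m. (e' i \<bullet> e k) * first_form lor X x (e k) (e l) * (e' j \<bullet> e l))"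
   unfolding first_form_def Dx[OF ij(1)] Dx[OF ij(2)]
   apply (simp add: bounded_bilinear.sum_left[OF lor_bb] bounded_bilinear.sum_right[OF lor_bb] lor_simps sum_distrib_left mult_ac)
   by (rule sum.swap)
 qed
 thus "J = sqrt (gram_det m (\<lambda>i j. first_form lor X x (e i) (e j)))" using J by simp
qed

text \<open>The reflection in the hyperplane orthogonal to \<open>u\<close>; the identity for \<open>u = 0\<close>.\<close>

definition reflect :: "'v::real_inner => 'v => 'v" where
 "reflect u v = v - (2 * (v \<bullet> u) / (u \<bullet> u)) *\<^sub>R u"

lemma reflect_inner: "reflect u v \<bullet> reflect u w = v \<bullet> w"
proof (cases "u = 0")
 case False
 hence "u \<bullet> u \<noteq> 0" by simp
 thus ?thesis by (simp add: reflect_def inner_diff_left inner_diff_right inner_commute field_simps)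
qed (simp add: reflect_def)

lemma reflect_linear: "linear (reflect u)"
 by (rule linearI) (simp_all add: reflect_def inner_add_left algebra_simps add_divide_distrib)

lemma reflect_swap:
 assumes "norm u = norm v"
 shows "reflect (u + v) u = - v"
proof (cases "u + v = 0")
 case True thus ?thesis by (simp add: reflect_def eq_neg_iff_add_eq_0)
next
 case False
 have "u \<bullet> u = v \<bullet> v" using assms by (simp add: norm_eq)
 hence "(u + v) \<bullet> (u + v) = 2 * (u \<bullet> (u + v))" by (simp add: inner_add_left inner_add_right inner_commute)
 moreover have "(u + v) \<bullet> (u + v) \<noteq> 0" using False by simp
 ultimately have "2 * (u \<bullet> (u + v)) / ((u + v) \<bullet> (u + v)) = 1" by simp
 hence "reflect (u + v) u = u - 1 *\<^sub>R (u + v)" unfolding reflect_def by (simp only:)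
 thus ?thesis by simp
qed

lemma slice_tangent_subspace: "subspace (slice_tangent x)"
 by (auto simp: subspace_def slice_tangent_def inner_add_left)

lemma slice_tangent_dim:
 fixes \<omega> :: "'a::euclidean_space"
 assumes "\<omega> \<noteq> 0" shows "dim (slice_tangent (\<omega>, s)) = DIM('a) - 1"
proof -
 have e: "slice_tangent (\<omega>, s) = (\<lambda>v. (v, 0)) ` {v. \<omega> \<bullet> v = 0}"
  by (auto simp: slice_tangent_def inner_commute image_iff)
 have "linear (\<lambda>v::'a. (v, 0::real))" by (rule linearI) auto
 moreover have "inj_on (\<lambda>v::'a. (v, 0::real)) (span {v. \<omega> \<bullet> v = 0})" by (auto simp: inj_on_def)
 ultimately have "dim ((\<lambda>v::'a. (v, 0::real)) ` {v. \<omega> \<bullet> v = 0}) = dim {v. \<omega> \<bullet> v = 0}" by (rule dim_image_eq)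
 thus ?thesis unfolding e using dim_hyperplane[OF assms] by simp
qed

lemma integrable_on_ball:
 fixes f :: "'a::euclidean_space => 'b::euclidean_space"
 assumes "continuous_on (ball 0 1 - {0}) f" "\<And>x. x \<in> ball 0 1 - {0} ==> norm (f x) \<le> M"
 shows "f integrable_on ball 0 1"
proof -
 have l: "ball 0 1 - {0} \<in> sets (lebesgue :: 'a measure)" by simp
 have lm: "(ball 0 1 - {0} :: 'a set) \<in> lmeasurable" by (rule bounded_set_imp_lmeasurable) (auto simp: l intro: bounded_subset[OF bounded_ball])
 have "(\<lambda>_. M) integrable_on (ball 0 1 - {0} :: 'a set)"
  using lm by (simp add: integrable_on_const)
 hence "f absolutely_integrable_on (ball 0 1 - {0})"
  by (intro measurable_bounded_by_integrable_imp_absolutely_integrable[OF continuous_imp_measurable_on_sets_lebesgue[OF assms(1) l] l _ assms(2)])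
 hence "f integrable_on (ball 0 1 - {0})" using absolutely_integrable_on_def by blast
 thus ?thesis by (rule integrable_spike_set) (auto intro: negligible_subset[of "{0}"])
qed

lemma integral_ball_odd:
 "integral (ball 0 1) (\<lambda>x::'a::euclidean_space. x /\<^sub>R norm x) = 0"
proof -
 define f where "f x = (if x \<in> ball 0 1 then x /\<^sub>R norm x else 0)" for x :: 'a
 define B where "B = (cbox (-One) One :: 'a set)"
 have sub: "ball 0 1 \<subseteq> B"
 proof
  fix x :: 'a assume "x \<in> ball 0 1"
  hence "\<bar>x \<bullet> b\<bar> \<le> 1" if "b \<in> Basis" for b using Basis_le_norm[OF that, of x] by simp
  thus "x \<in> B" unfolding B_def mem_box by (fastforce simp: inner_Basis abs_le_iff)
 qed
 have "(\<lambda>x::'a. x /\<^sub>R norm x) integrable_on ball 0 1"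
  by (rule integrable_on_ball[of _ 1]) (auto intro!: continuous_intros)
 then obtain i where i: "((\<lambda>x::'a. x /\<^sub>R norm x) has_integral i) (ball 0 1)" by blast
 hence fi: "(f has_integral i) B"
  unfolding f_def using has_integral_restrict[OF sub, of "\<lambda>x. x /\<^sub>R norm x" i] by simp
 have "((\<lambda>x. f (- 1 *\<^sub>R x + 0)) has_integral (1 / \<bar>- 1\<bar> ^ DIM('a)) *\<^sub>R i) ((\<lambda>x. (1 / - 1) *\<^sub>R x + - ((1 / - 1) *\<^sub>R 0)) ` B)"
  unfolding B_def by (rule has_integral_affinity) (use fi B_def in auto)
 moreover have "(\<lambda>x. (1 / - 1) *\<^sub>R x + - ((1 / - 1) *\<^sub>R 0)) ` B = B"
 proof -
  have "uminus ` B = B" unfolding B_def by (auto simp: image_iff mem_box intro!: bexI[of _ "- _"])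
  thus ?thesis by simp
 qed
 moreover have "f (- x) = - f x" for x by (simp add: f_def)
 ultimately have "((\<lambda>x. - f x) has_integral i) B" by simp
 hence "i = - i" using has_integral_neg[OF fi] has_integral_unique by blast
 hence "i = 0" by (simp add: eq_neg_iff_add_eq_0 flip: scaleR_2)
 thus ?thesis using i integral_unique by blast
qed

lemma has_integral_const_ball:
 "((\<lambda>_. c) has_integral (content (ball w \<rho>) * c)) (ball w \<rho>)" for c :: real and w :: "'a::euclidean_space"
 using has_integral_mult_left[OF has_integral_measure_lborel[OF _ emeasure_lborel_ball_finite], of w \<rho> c] by simp

lemma sphere_integrable:
 fixes g :: "'a::euclidean_space => 'b::euclidean_space"
 assumes "continuous_on (sphere 0 1) g"
 shows "(\<lambda>x. g (x /\<^sub>R norm x)) integrable_on ball 0 1"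
proof -
 have "compact (g ` sphere 0 1)" by (rule compact_continuous_image[OF assms]) simp
 then obtain M where M: "\<And>\<omega>. \<omega> \<in> sphere 0 1 ==> norm (g \<omega>) \<le> M"
  using compact_imp_bounded bounded_iff by (metis imageI)
 show ?thesis
 proof (rule integrable_on_ball)
  show "continuous_on (ball 0 1 - {0}) (\<lambda>x. g (x /\<^sub>R norm x))"
  proof (rule continuous_on_compose2[OF assms])
   show "continuous_on (ball 0 1 - {0}) (\<lambda>x::'a. x /\<^sub>R norm x)" by (auto intro!: continuous_intros)
   show "(\<lambda>x::'a. x /\<^sub>R norm x) ` (ball 0 1 - {0}) \<subseteq> sphere 0 1" by (intro image_subsetI) auto
  qed
  show "norm (g (x /\<^sub>R norm x)) \<le> M" if "x \<in> ball 0 1 - {0}" for x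
   using that by (intro M) auto
 qed
qed

lemma sphere_integral_linear:
 fixes g :: "'a::euclidean_space => 'b::euclidean_space" and T :: "'b => 'c::euclidean_space"
 assumes "(\<lambda>x. g (x /\<^sub>R norm x)) integrable_on ball 0 1" "bounded_linear T"
 shows "T (sphere_integral g) = sphere_integral (\<lambda>\<omega>. T (g \<omega>))"
 using integral_linear[OF assms] linear_scale[OF bounded_linear.linear[OF assms(2)]]
 by (simp add: sphere_integral_def o_def)

lemma sphere_integral_add:
 fixes g h :: "'a::euclidean_space => 'b::euclidean_space"
 assumes "continuous_on (sphere 0 1) g" "continuous_on (sphere 0 1) h"
 shows "sphere_integral (\<lambda>\<omega>. g \<omega> + h \<omega>) = sphere_integral g + sphere_integral h"
 using integral_add[OF sphere_integrable[OF assms(1)] sphere_integrable[OF assms(2)]]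
 by (simp add: sphere_integral_def scaleR_add_right)

lemma integral_spike_origin:
 fixes f g :: "'a::euclidean_space => 'b::euclidean_space"
 assumes "\<And>x. x \<in> ball 0 1 - {0} ==> f x = g x"
 shows "integral (ball 0 1) f = integral (ball 0 1) g"
 by (rule integral_spike[of "{0}"]) (use assms in auto)

lemma sphere_integral_cong:
 fixes f g :: "'a::euclidean_space => 'b::euclidean_space"
 assumes "\<And>\<omega>. \<omega> \<in> sphere 0 1 ==> f \<omega> = g \<omega>"
 shows "sphere_integral f = sphere_integral g"
 unfolding sphere_integral_def by (intro arg_cong[of _ _ "(*\<^sub>R) _"] integral_spike_origin assms) simp

lemma sphere_integral_mono:
 fixes g h :: "'a::euclidean_space => real"
 assumes "(\<lambda>x. g (x /\<^sub>R norm x)) integrable_on ball 0 1" "(\<lambda>x. h (x /\<^sub>R norm x)) integrable_on ball 0 1"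
  and "\<And>\<omega>. \<omega> \<in> sphere 0 1 ==> g \<omega> \<le> h \<omega>"
 shows "sphere_integral g \<le> sphere_integral h"
proof -
 define g' h' where "g' x = (if x = 0 then 0 else g (x /\<^sub>R norm x))" and "h' x = (if x = 0 then 0 else h (x /\<^sub>R norm x))" for x
 have "g' integrable_on ball 0 1" "h' integrable_on ball 0 1"
  using integrable_spike[OF assms(1), of "{0}" g'] integrable_spike[OF assms(2), of "{0}" h'] by (auto simp: g'_def h'_def)
 hence "integral (ball 0 1) g' \<le> integral (ball 0 1) h'"
  by (rule integral_le) (use assms(3) in \<open>auto simp: g'_def h'_def\<close>)
 moreover have "integral (ball 0 1) g' = integral (ball 0 1) (\<lambda>x. g (x /\<^sub>R norm x))"
  "integral (ball 0 1) h' = integral (ball 0 1) (\<lambda>x. h (x /\<^sub>R norm x))"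
  by (intro integral_spike_origin; simp add: g'_def h'_def)+
 ultimately show ?thesis by (simp add: sphere_integral_def mult_left_mono)
qed

lemma sphere_integral_const: "sphere_integral (\<lambda>\<omega>::'a::euclidean_space. M) = M * sphere_area TYPE('a)" for M :: real
 using integral_unique[OF has_integral_const_ball[of M "0::'a" 1]] integral_unique[OF has_integral_const_ball[of 1 "0::'a" 1]]
 by (simp add: sphere_integral_def sphere_area_def)

lemma sphere_area_eq: "sphere_area TYPE('a::euclidean_space) = real DIM('a) * content (ball (0::'a) 1)"
 using integral_unique[OF has_integral_const_ball[of 1 "0::'a" 1]] by (simp add: sphere_integral_def sphere_area_def)

lemma sphere_area_pos: "sphere_area TYPE('a::euclidean_space) > 0"
 using content_ball_pos[of 1 "0::'a"] by (simp add: sphere_area_eq DIM_positive)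

lemma sphere_integral_norm:
 fixes g :: "'a::euclidean_space => 'b::euclidean_space"
 assumes "(\<lambda>x. g (x /\<^sub>R norm x)) integrable_on ball 0 1" "(\<lambda>x. h (x /\<^sub>R norm x)) integrable_on ball 0 1"
  and "\<And>\<omega>. \<omega> \<in> sphere 0 1 ==> norm (g \<omega>) \<le> h \<omega>"
 shows "norm (sphere_integral g) \<le> sphere_integral h"
proof -
 define g' h' where "g' x = (if x = 0 then 0 else g (x /\<^sub>R norm x))" and "h' x = (if x = 0 then 0 else h (x /\<^sub>R norm x))" for x
 have "g' integrable_on ball 0 1" "h' integrable_on ball 0 1"
  using integrable_spike[OF assms(1), of "{0}" g'] integrable_spike[OF assms(2), of "{0}" h'] by (auto simp: g'_def h'_def)
 hence "norm (integral (ball 0 1) g') \<le> integral (ball 0 1) h'"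
  by (rule integral_norm_bound_integral) (use assms(3) in \<open>auto simp: g'_def h'_def\<close>)
 moreover have "integral (ball 0 1) g' = integral (ball 0 1) (\<lambda>x. g (x /\<^sub>R norm x))"
  "integral (ball 0 1) h' = integral (ball 0 1) (\<lambda>x. h (x /\<^sub>R norm x))"
  by (intro integral_spike_origin; simp add: g'_def h'_def)+
 ultimately show ?thesis by (simp add: sphere_integral_def mult_left_mono)
qed

lemma sphere_integral_bound:
 fixes g :: "'a::euclidean_space => 'b::euclidean_space"
 assumes "continuous_on (sphere 0 1) g" "\<And>\<omega>. \<omega> \<in> sphere 0 1 ==> norm (g \<omega>) \<le> M"
 shows "norm (sphere_integral g) \<le> M * sphere_area TYPE('a)"
 unfolding sphere_integral_const[symmetric]
 by (rule sphere_integral_norm[OF sphere_integrable[OF assms(1)] sphere_integrable[OF continuous_on_const] assms(2)])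

text \<open>The integrand is odd.\<close>

lemma sphere_integral_id: "sphere_integral (\<lambda>\<omega>::'a::euclidean_space. \<omega>) = 0"
 using integral_ball_odd by (simp add: sphere_integral_def)

text \<open>A quadratic form with small mean square on the sphere is small: near a maximizing direction
 it keeps a fixed fraction of its size.\<close>

lemma mean_square_bound:
 fixes T :: "'a::euclidean_space => 'b::euclidean_space"
 assumes T: "linear T" and I: "sphere_integral (\<lambda>\<omega>. (norm (T \<omega>))\<^sup>2) \<le> M\<^sup>2 * sphere_area TYPE('a)" and M: "0 \<le> M"
 shows "norm (T v) \<le> 2 * 8 ^ DIM('a) * M * norm v"
proof -
 have bl: "bounded_linear T" using T linear_conv_bounded_linear by blast
 have cT: "continuous_on A T" for A using linear_continuous_on[OF bl] .
 have ne: "sphere (0::'a) 1 \<noteq> {}" by simp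
 obtain w where w: "w \<in> sphere 0 1" "\<And>\<omega>. \<omega> \<in> sphere 0 1 ==> norm (T \<omega>) \<le> norm (T w)"
  using continuous_attains_sup[OF compact_sphere ne continuous_on_norm[OF cT]] by blast
 define \<tau> where "\<tau> = norm (T w)"
 have op: "norm (T v) \<le> \<tau> * norm v" for v
 proof (cases "v = 0")
  case True thus ?thesis using linear_0[OF T] by simp
 next
  case False
  have "norm (T (v /\<^sub>R norm v)) \<le> \<tau>" unfolding \<tau>_def by (rule w(2)) (use False in simp)
  thus ?thesis using False by (simp add: linear_scale[OF T] field_simps)
 qed
 have \<tau>0: "0 \<le> \<tau>" by (simp add: \<tau>_def)
 define S where "S = ball (w /\<^sub>R 2) (1/8)"
 have nw: "norm w = 1" using w by simp
 have SB: "S \<subseteq> ball 0 1 - {0}"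
 proof
  fix x assume "x \<in> S"
  hence d: "norm (w /\<^sub>R 2 - x) < 1/8" by (simp add: S_def dist_norm)
  have "norm x \<le> norm (w /\<^sub>R 2) + norm (w /\<^sub>R 2 - x)" "norm (w /\<^sub>R 2) \<le> norm x + norm (w /\<^sub>R 2 - x)"
   using norm_triangle_ineq4[of "w /\<^sub>R 2" "w /\<^sub>R 2 - x"] norm_triangle_ineq[of x "w /\<^sub>R 2 - x"] by auto
  hence "norm x < 1" "norm x > 0" using d nw by auto
  thus "x \<in> ball 0 1 - {0}" by auto
 qed
 have lower: "\<tau>\<^sup>2 / 4 \<le> (norm (T (x /\<^sub>R norm x)))\<^sup>2" if "x \<in> S" for x
 proof -
  have d: "norm (w /\<^sub>R 2 - x) < 1/8" using that by (simp add: S_def dist_norm)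
  have x0: "norm x > 0" using SB that by auto
  have "w - x /\<^sub>R norm x = 2 *\<^sub>R (w /\<^sub>R 2 - x) + (2 - 1 / norm x) *\<^sub>R x"
  proof -
   have "2 *\<^sub>R (w /\<^sub>R 2 - x) = w - 2 *\<^sub>R x" by (simp add: scaleR_diff_right)
   moreover have "(2 - 1 / norm x) *\<^sub>R x = 2 *\<^sub>R x - x /\<^sub>R norm x" by (simp add: scaleR_diff_left divide_inverse)
   ultimately show ?thesis by simp
  qed
  hence "norm (w - x /\<^sub>R norm x) \<le> norm (2 *\<^sub>R (w /\<^sub>R 2 - x)) + norm ((2 - 1 / norm x) *\<^sub>R x)"
   using norm_triangle_ineq by metis
  also have "norm ((2 - 1 / norm x) *\<^sub>R x) = \<bar>2 * norm x - 1\<bar>"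
  proof -
   have "(2 - 1 / norm x) * norm x = 2 * norm x - 1" using x0 by (simp add: field_simps)
   thus ?thesis using x0 by (metis abs_mult abs_norm_cancel norm_scaleR)
  qed
  also have "\<bar>2 * norm x - 1\<bar> \<le> 1/4"
  proof -
   have "\<bar>norm x - norm (w /\<^sub>R 2)\<bar> < 1/8"
    using norm_triangle_ineq3[of x "w /\<^sub>R 2"] d by (simp only: norm_minus_commute)
   moreover have "norm (w /\<^sub>R 2) = 1/2" using nw by simp
   ultimately show ?thesis unfolding abs_le_iff abs_less_iff by linarith
  qed
  also have "norm (2 *\<^sub>R (w /\<^sub>R 2 - x)) + 1/4 \<le> 1/2" using d unfolding norm_scaleR by simp
  finally have "norm (w - x /\<^sub>R norm x) \<le> 1/2" by simp
  hence "norm (T (w - x /\<^sub>R norm x)) \<le> \<tau> * (1/2)" using op[of "w - x /\<^sub>R norm x"] \<tau>0 mult_left_mono[of "norm (w - x /\<^sub>R norm x)" "1/2" \<tau>] by linarith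
  hence "\<tau> / 2 \<le> norm (T (x /\<^sub>R norm x))"
   using norm_triangle_sub[of "T w" "T (x /\<^sub>R norm x)"] by (simp add: linear_diff[OF T] \<tau>_def)
  hence "(\<tau> / 2)\<^sup>2 \<le> (norm (T (x /\<^sub>R norm x)))\<^sup>2" using \<tau>0 by (intro power_mono) auto
  thus ?thesis by (simp add: power_divide)
 qed
 have int: "(\<lambda>x. (norm (T (x /\<^sub>R norm x)))\<^sup>2) integrable_on ball 0 1"
  by (rule sphere_integrable[of "\<lambda>\<omega>. (norm (T \<omega>))\<^sup>2"]) (intro continuous_intros cT)
 have "((\<lambda>x. if x \<in> S then \<tau>\<^sup>2 / 4 else 0) has_integral (content S * (\<tau>\<^sup>2 / 4))) (ball 0 1)"
  using has_integral_restrict[of S "ball 0 1" "\<lambda>_. \<tau>\<^sup>2 / 4"] SB has_integral_const_ball[of "\<tau>\<^sup>2 / 4" "w /\<^sub>R 2" "1/8"]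
  unfolding S_def by blast
 from has_integral_le[OF this integrable_integral[OF int]]
 have c: "content S * (\<tau>\<^sup>2 / 4) \<le> integral (ball 0 1) (\<lambda>x. (norm (T (x /\<^sub>R norm x)))\<^sup>2)"
  using lower by auto
 have "real DIM('a) * (content S * (\<tau>\<^sup>2 / 4)) \<le> M\<^sup>2 * (real DIM('a) * content (ball (0::'a) 1))"
  using mult_left_mono[OF c, of "real DIM('a)"] I by (simp add: sphere_integral_def sphere_area_eq)
 hence "content S * (\<tau>\<^sup>2 / 4) \<le> M\<^sup>2 * content (ball (0::'a) 1)"
  using DIM_positive[where 'a = 'a] by (simp add: mult_ac)
 moreover have "content S = (1/8) ^ DIM('a) * content (ball (0::'a) 1)"
  unfolding S_def by (rule content_ball_conv_unit_ball) simp
 ultimately have "(1/8) ^ DIM('a) * (\<tau>\<^sup>2 / 4) \<le> M\<^sup>2"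
  using content_ball_pos[of 1 "0::'a"] by (simp add: mult_ac)
 hence "\<tau>\<^sup>2 \<le> 4 * 8 ^ DIM('a) * M\<^sup>2" by (simp add: power_one_over field_simps)
 also have "\<dots> \<le> (2 * 8 ^ DIM('a) * M)\<^sup>2"
 proof -
  have "(8::real) ^ DIM('a) \<le> (8 ^ DIM('a))\<^sup>2" by (simp add: power2_eq_square)
  hence "4 * 8 ^ DIM('a) * M\<^sup>2 \<le> 4 * (8 ^ DIM('a))\<^sup>2 * M\<^sup>2" by (intro mult_right_mono mult_left_mono) auto
  thus ?thesis by (simp add: power_mult_distrib)
 qed
 finally have "\<tau> \<le> 2 * 8 ^ DIM('a) * M" by (rule power2_le_imp_le) (use M in simp)
 thus ?thesis using op[of v] mult_right_mono[of \<tau> _ "norm v"] by (meson norm_ge_zero order_trans)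
qed

definition punctured :: "real => ('a::euclidean_space \<times> real) set" where
 "punctured L = (- {0}) \<times> {-L<..<L}"

definition cylmap :: "'a::euclidean_space \<times> real => 'a \<times> real" where
 "cylmap x = (fst x /\<^sub>R norm (fst x), snd x)"

lemma open_punctured: "open (punctured L)"
 unfolding punctured_def by (intro open_Times) (auto simp: open_Compl)

lemma cyl_punctured: "cyl L \<subseteq> punctured L"
 by (auto simp: cyl_def punctured_def)

lemma unit_derivative:
 fixes y :: "'a::euclidean_space"
 assumes "y \<noteq> 0"
 shows "((\<lambda>y. y /\<^sub>R norm y) has_derivative (\<lambda>v. (v - (v \<bullet> (y /\<^sub>R norm y)) *\<^sub>R (y /\<^sub>R norm y)) /\<^sub>R norm y)) (at y)"
proof -
 have n: "(norm has_derivative (\<lambda>v. v \<bullet> (y /\<^sub>R norm y))) (at y)"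
  using has_derivative_norm[OF assms] by (simp add: sgn_div_norm)
 have "((\<lambda>y. inverse (norm y)) has_derivative (\<lambda>v. - (inverse (norm y) * (v \<bullet> (y /\<^sub>R norm y)) * inverse (norm y)))) (at y)"
  by (rule Deriv.has_derivative_inverse[OF _ n]) (use assms in simp)
 from has_derivative_scaleR[OF this has_derivative_ident]
 have "((\<lambda>y. inverse (norm y) *\<^sub>R y) has_derivative (\<lambda>v. inverse (norm y) *\<^sub>R v +
   (- (inverse (norm y) * (v \<bullet> (y /\<^sub>R norm y)) * inverse (norm y))) *\<^sub>R y)) (at y)" by simp
 thus ?thesis by (simp add: scaleR_diff_right mult_ac)
qed

lemma cylmap_Ck: "Ck k (punctured L) cylmap"
proof -
 have f: "Ck k (punctured L) (\<lambda>x::'a \<times> real. fst x)" and s: "Ck k (punctured L) (\<lambda>x::'a \<times> real. snd x)"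
  by (rule Ck_of_linear, rule bounded_linear_fst, rule Ck_of_linear, rule bounded_linear_snd)
 have "Ck k (punctured L) (\<lambda>x::'a \<times> real. fst x /\<^sub>R norm (fst x))"
  by (rule Ck_compose[OF open_punctured f Ck_unit]) (auto simp: punctured_def)
 from Ck_Pair[OF open_punctured this s] show ?thesis by (simp add: cylmap_def[abs_def])
qed

lemma cylmap_D:
 assumes "x \<in> cyl L" "v \<in> cyl_tangent x"
 shows "D cylmap x v = v"
proof -
 have x: "fst x \<noteq> 0" "norm (fst x) = 1" using assms(1) by (auto simp: cyl_def)
 have "((\<lambda>x. fst x /\<^sub>R norm (fst x)) has_derivative (\<lambda>v. (fst v - (fst v \<bullet> (fst x /\<^sub>R norm (fst x))) *\<^sub>R (fst x /\<^sub>R norm (fst x))) /\<^sub>R norm (fst x))) (at x)"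
  using has_derivative_compose[OF has_derivative_fst[OF has_derivative_ident] unit_derivative[OF x(1)]] .
 from D_eq[OF has_derivative_Pair[OF this has_derivative_snd[OF has_derivative_ident]]]
 show ?thesis using assms(2) x(2) by (simp add: cylmap_def[abs_def] cyl_tangent_def)
qed

section \<open>The best approximating cylinder of a thin neck\<close>

text \<open>A thin neck \<open>W\<close> in the tangent space at its center, together with the rigid motion \<open>R\<close>, \<open>a\<close> that makes it close to
 the standard cylinder after rescaling. Radial extension turns it into a map on an open set.\<close>

locale neck_chart =
 fixes R :: "('a::euclidean_space \<times> real) \<times> real => 'a \<times> real" and p :: "('a \<times> real) \<times> real"
  and W :: "'a \<times> real => ('a \<times> real) \<times> real" and a :: "'a \<times> real" and r \<epsilon> L :: real
 assumes iso: "tangent_isometry R p" and r: "0 < r" and L: "40 \<le> L"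
  and W_tan: "\<And>x. x \<in> cyl L ==> W x \<in> htangent p"
  and X_diff: "\<And>x. x \<in> punctured L ==> radial W differentiable (at x)"
  and V_Ck: "\<And>k. Ck k (punctured L) (\<lambda>x. R (radial W x))"
  and small: "\<And>x. x \<in> cyl L ==> bd 3 (\<lambda>x. a + R (radial W x) /\<^sub>R r - cylmap x) x \<epsilon>"
begin

abbreviation X where "X \<equiv> radial W"
definition Z where "Z x = a + R (X x) /\<^sub>R r"
definition f where "f x = Z x - cylmap x"

lemma R_lin: "linear R" and R_bl: "bounded_linear R"
 using iso linear_conv_bounded_linear by (auto simp: tangent_isometry_def)

lemma R_lor: "v \<in> htangent p ==> w \<in> htangent p ==> R v \<bullet> R w = lor v w"
 using iso by (simp add: tangent_isometry_def)

lemma X_eq: "x \<in> punctured L ==> X x = W (cylmap x)"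
 by (simp add: radial_def cylmap_def case_prod_beta)

lemma cylmap_cyl: "x \<in> punctured L ==> cylmap x \<in> cyl L"
 by (auto simp: cylmap_def cyl_def punctured_def)

lemma cylmap_id: "x \<in> cyl L ==> cylmap x = x"
 by (auto simp: cylmap_def cyl_def)

lemma X_W: "x \<in> cyl L ==> X x = W x"
 using X_eq cylmap_id cyl_punctured by fastforce

lemma X_tan: "x \<in> punctured L ==> X x \<in> htangent p"
 using X_eq[of x] W_tan[of "cylmap x"] cylmap_cyl[of x] by simp

lemma DX_tan: "x \<in> punctured L ==> D X x v \<in> htangent p"
proof -
 assume x: "x \<in> punctured L"
 have "D (\<lambda>x. lor p (X x)) x v = 0"
  using D_cong[OF open_punctured x, of "\<lambda>x. lor p (X x)" "\<lambda>_. 0"] X_tan by (simp add: htangent_def)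
 thus ?thesis
  using D_bounded_linear(1)[OF bounded_bilinear.bounded_linear_right[OF lor_bb] X_diff[OF x], of p v]
  by (simp add: htangent_def)
qed

lemma Z_Ck: "Ck k (punctured L) Z"
 unfolding Z_def[abs_def]
 by (intro Ck_add[OF open_punctured] Ck_scaleR[OF open_punctured] Ck_const V_Ck)

lemma f_Ck: "Ck k (punctured L) f"
 unfolding f_def[abs_def] by (intro Ck_diff_fun[OF open_punctured] Z_Ck cylmap_Ck)

lemma f_bd: "x \<in> cyl L ==> bd 3 f x \<epsilon>"
 using small by (simp add: f_def[abs_def] Z_def[abs_def])

lemma Z_diff: "x \<in> punctured L ==> Z differentiable (at x)"
 using Z_Ck[of 1] by simp
lemma f_diff: "x \<in> punctured L ==> f differentiable (at x)"
 using f_Ck[of 1] by simp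

lemma R_DX: "x \<in> punctured L ==> R (D X x v) = r *\<^sub>R D Z x v"
proof -
 assume x: "x \<in> punctured L"
 have dR: "(\<lambda>x. R (X x)) differentiable (at x)" by (rule D_bounded_linear(2)[OF R_bl X_diff[OF x]])
 have dS: "(\<lambda>x. R (X x) /\<^sub>R r) differentiable (at x)"
  by (rule D_bounded_linear(2)[OF bounded_linear_scaleR_right dR])
 have "D Z x v = 0 + (R (D X x v)) /\<^sub>R r"
  unfolding Z_def[abs_def] using D_add[OF differentiable_const dS, of a v]
   D_bounded_linear(1)[OF bounded_linear_scaleR_right dR, of "inverse r" v] D_bounded_linear(1)[OF R_bl X_diff[OF x], of v]
  by simp
 thus ?thesis using r by simp
qed

lemma first_form_Z: "x \<in> punctured L ==> first_form lor X x v w = r\<^sup>2 * (D Z x v \<bullet> D Z x w)"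
 unfolding first_form_def R_lor[OF DX_tan DX_tan, symmetric] R_DX by (simp add: power2_eq_square)

text \<open>The operator norm is at most the dimension times a bound for the partial derivatives.\<close>

definition e1 where "e1 = real DIM('a \<times> real) * \<epsilon>"

lemma \<epsilon>_nonneg: "0 \<le> \<epsilon>"
proof -
 obtain b :: 'a where "b \<in> Basis" using nonempty_Basis by blast
 hence "(b, 0) \<in> cyl L" using L by (simp add: cyl_def)
 thus ?thesis using f_bd bd_nonneg by blast
qed

lemma e1_nonneg: "0 \<le> e1" and \<epsilon>_le_e1: "\<epsilon> \<le> e1"
 using \<epsilon>_nonneg mult_right_mono[of 1 "real DIM('a \<times> real)" \<epsilon>] by (auto simp: e1_def)

lemma Df_small: "x \<in> cyl L ==> norm (D f x v) \<le> e1 * norm v"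
 unfolding e1_def using f_bd[of x] f_diff[of x] cyl_punctured[of L]
 by (intro bd_D_norm) (auto simp: numeral_3_eq_3 dest: bd_norm)

lemma f_small: "x \<in> cyl L ==> norm (f x) \<le> \<epsilon>"
 using f_bd bd_norm by blast

lemma DZ_close: "x \<in> cyl L ==> v \<in> cyl_tangent x ==> norm (D Z x v - v) \<le> e1 * norm v"
proof -
 assume x: "x \<in> cyl L" and v: "v \<in> cyl_tangent x"
 have xp: "x \<in> punctured L" using x cyl_punctured by blast
 have "Ck 1 (punctured L) (cylmap :: 'a \<times> real => _)" by (rule cylmap_Ck)
 hence "cylmap differentiable (at x)" using xp by simp
 hence "D (\<lambda>x. f x + cylmap x) x v = D f x v + D cylmap x v" by (rule D_add[OF f_diff[OF xp]])
 moreover have "(\<lambda>x. f x + cylmap x) = Z" by (simp add: f_def[abs_def])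
 ultimately show ?thesis using Df_small[OF x, of v] cylmap_D[OF x v] by simp
qed

lemma slice_cyl_tangent: "v \<in> slice_tangent x ==> v \<in> cyl_tangent x"
 by (simp add: slice_tangent_def cyl_tangent_def)

lemma slice0: "\<omega> \<in> sphere 0 1 ==> (\<omega>, 0) \<in> cyl L" "\<omega> \<in> sphere 0 1 ==> (\<omega>, 0) \<in> punctured L"
 using L by (auto simp: cyl_def punctured_def)

definition m where "m = DIM('a) - 1"
definition w where "w \<omega> = slice_density X (\<omega>, 0)"
definition \<rho> where "\<rho> = r ^ m"

lemma \<rho>_pos: "0 < \<rho>" using r by (simp add: \<rho>_def)

lemma w_frame:
 assumes \<omega>: "\<omega> \<in> sphere 0 1" and e: "orthonormal_frame (\<bullet>) (slice_tangent (\<omega>, 0)) m e"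
 shows "w \<omega> = \<rho> * sqrt (gram_det m (\<lambda>i j. D Z (\<omega>, 0) (e i) \<bullet> D Z (\<omega>, 0) (e j)))"
proof -
 have \<omega>0: "\<omega> \<noteq> 0" using \<omega> by auto
 have "w \<omega> = sqrt (gram_det m (\<lambda>i j. first_form lor X (\<omega>, 0) (e i) (e j)))"
  unfolding w_def slice_density_def m_def[symmetric]
  by (rule vol_density_eq[where T = slice_tangent and x = "(\<omega>, 0)" and m = m and e = e, OF e]) (use \<omega> slice_tangent_dim[OF \<omega>0, of 0] D_linear[OF X_diff[OF slice0(2)]] m_def in auto)
 also have "\<dots> = sqrt ((r\<^sup>2) ^ m * gram_det m (\<lambda>i j. D Z (\<omega>, 0) (e i) \<bullet> D Z (\<omega>, 0) (e j)))"
  unfolding first_form_Z[OF slice0(2)[OF \<omega>]] gram_det_scale ..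
 also have "(r\<^sup>2) ^ m = \<rho>\<^sup>2" by (simp add: \<rho>_def power_mult[symmetric] mult.commute)
 finally show ?thesis using \<rho>_pos by (simp add: real_sqrt_mult)
qed

lemma frame_ex:
 assumes \<omega>: "(\<omega>::'a) \<in> sphere 0 1" obtains e where "orthonormal_frame (\<bullet>) (slice_tangent (\<omega>, 0)) m e"
 using orthonormal_frame_exists[OF slice_tangent_subspace slice_tangent_dim[of \<omega> 0]] \<omega> unfolding m_def by force

text \<open>Near a given point the density can be computed in frames that depend continuously on the point.\<close>

lemma w_continuous: "continuous_on (sphere 0 1) w"
 unfolding continuous_on_eq_continuous_within
proof
 fix \<omega>1 :: 'a assume \<omega>1: "\<omega>1 \<in> sphere 0 1"
 obtain e where e: "orthonormal_frame (\<bullet>) (slice_tangent (\<omega>1, 0)) m e" using frame_ex[OF \<omega>1] .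
 \<comment> \<open>A reflection exchanging the two normal directions carries a frame at one point to a frame at a nearby one.\<close>
 define e' where "e' \<omega> i = (reflect (\<omega>1 + \<omega>) (fst (e i)), 0::real)" for \<omega> i
 have fr: "orthonormal_frame (\<bullet>) (slice_tangent (\<omega>, 0)) m (e' \<omega>)" if \<omega>: "\<omega> \<in> sphere 0 1" for \<omega>
  unfolding orthonormal_frame_def
 proof (intro conjI allI impI)
  fix i assume i: "i < m"
  have t: "fst (e i) \<bullet> \<omega>1 = 0" "snd (e i) = 0" using e i by (auto simp: orthonormal_frame_def slice_tangent_def)
  have "reflect (\<omega>1 + \<omega>) (fst (e i)) \<bullet> (- \<omega>) = reflect (\<omega>1 + \<omega>) (fst (e i)) \<bullet> reflect (\<omega>1 + \<omega>) \<omega>1"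
   using reflect_swap[of \<omega>1 \<omega>] \<omega>1 \<omega> by simp
  thus "e' \<omega> i \<in> slice_tangent (\<omega>, 0)" using t by (simp add: e'_def slice_tangent_def reflect_inner)
  fix j assume j: "j < m"
  have "e i \<bullet> e j = (if i = j then 1 else 0)" using e i j by (simp add: orthonormal_frame_def)
  hence "fst (e i) \<bullet> fst (e j) = (if i = j then 1 else 0)" using t(2) by (simp add: inner_prod_def)
  thus "e' \<omega> i \<bullet> e' \<omega> j = (if i = j then 1 else 0)"
   by (simp add: e'_def inner_prod_def reflect_inner)
 qed
 have c0: "((\<lambda>\<omega>. D Z (\<omega>, 0) b) \<longlongrightarrow> D Z (\<omega>1, 0) b) (at \<omega>1 within sphere 0 1)" if b: "b \<in> Basis" for b
 proof -
  have "Ck 1 (punctured L) (\<lambda>x. D Z x b)" using Z_Ck[of 2] b by (simp add: numeral_2_eq_2)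
  hence "continuous_on (punctured L) (\<lambda>x. D Z x b)" using Ck_continuous[of 0] by simp
  hence "continuous_on (sphere 0 1) (\<lambda>\<omega>. D Z (\<omega>, 0) b)"
   by (rule continuous_on_compose2) (auto intro!: continuous_intros slice0(2))
  thus ?thesis using \<omega>1 by (simp add: continuous_on_def)
 qed
 have c1: "((\<lambda>\<omega>. e' \<omega> i) \<longlongrightarrow> e' \<omega>1 i) (at \<omega>1 within sphere 0 1)" for i
 proof -
  have "(\<omega>1 + \<omega>1) \<bullet> (\<omega>1 + \<omega>1) \<noteq> 0" using \<omega>1 by (auto simp flip: scaleR_2)
  thus ?thesis unfolding e'_def reflect_def by (intro tendsto_intros) auto
 qed
 have c2: "((\<lambda>\<omega>. D Z (\<omega>, 0) (e' \<omega> i)) \<longlongrightarrow> D Z (\<omega>1, 0) (e' \<omega>1 i)) (at \<omega>1 within sphere 0 1)" for i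
 proof -
  have "((\<lambda>\<omega>. \<Sum>b\<in>Basis. (e' \<omega> i \<bullet> b) *\<^sub>R D Z (\<omega>, 0) b) \<longlongrightarrow> (\<Sum>b\<in>Basis. (e' \<omega>1 i \<bullet> b) *\<^sub>R D Z (\<omega>1, 0) b)) (at \<omega>1 within sphere 0 1)"
   by (intro tendsto_intros c0 c1)
  moreover have "\<forall>\<^sub>F \<omega> in at \<omega>1 within sphere 0 1. (\<Sum>b\<in>Basis. (e' \<omega> i \<bullet> b) *\<^sub>R D Z (\<omega>, 0) b) = D Z (\<omega>, 0) (e' \<omega> i)"
   using D_expand[OF Z_diff[OF slice0(2)]] by (auto simp: eventually_at_filter intro!: always_eventually)
  ultimately show ?thesis
   using D_expand[OF Z_diff[OF slice0(2)[OF \<omega>1]], of "e' \<omega>1 i"] by (simp add: tendsto_cong)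
 qed
 have "((\<lambda>\<omega>. \<rho> * sqrt (gram_det m (\<lambda>i j. D Z (\<omega>, 0) (e' \<omega> i) \<bullet> D Z (\<omega>, 0) (e' \<omega> j))))
   \<longlongrightarrow> \<rho> * sqrt (gram_det m (\<lambda>i j. D Z (\<omega>1, 0) (e' \<omega>1 i) \<bullet> D Z (\<omega>1, 0) (e' \<omega>1 j)))) (at \<omega>1 within sphere 0 1)"
  unfolding gram_det_def by (intro tendsto_intros c2)
 moreover have "\<forall>\<^sub>F \<omega> in at \<omega>1 within sphere 0 1. \<rho> * sqrt (gram_det m (\<lambda>i j. D Z (\<omega>, 0) (e' \<omega> i) \<bullet> D Z (\<omega>, 0) (e' \<omega> j))) = w \<omega>"
  using w_frame[OF _ fr] by (auto simp: eventually_at_filter intro!: always_eventually)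
 ultimately have "(w \<longlongrightarrow> \<rho> * sqrt (gram_det m (\<lambda>i j. D Z (\<omega>1, 0) (e' \<omega>1 i) \<bullet> D Z (\<omega>1, 0) (e' \<omega>1 j)))) (at \<omega>1 within sphere 0 1)"
  by (rule Lim_transform_eventually)
 thus "continuous (at \<omega>1 within sphere 0 1) w"
  unfolding continuous_within using w_frame[OF \<omega>1 fr[OF \<omega>1]] by simp
qed

lemma w_close:
 assumes C: "\<forall>G t. 0 \<le> t \<and> t \<le> 1 \<and> (\<forall>i<m. \<forall>j<m. \<bar>G i j - (if i = j then 1 else 0)\<bar> \<le> t) --> \<bar>gram_det m G - 1\<bar> \<le> C * t"
  and s: "3 * e1 \<le> 1" "C * (3 * e1) \<le> d" "d \<le> 1" and \<omega>: "\<omega> \<in> sphere 0 1"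
 shows "\<bar>w \<omega> - \<rho>\<bar> \<le> d * \<rho>"
proof -
 obtain e where e: "orthonormal_frame (\<bullet>) (slice_tangent (\<omega>, 0)) m e" using frame_ex[OF \<omega>] .
 define G where "G i j = D Z (\<omega>, 0) (e i) \<bullet> D Z (\<omega>, 0) (e j)" for i j
 have "\<bar>G i j - (if i = j then 1 else 0)\<bar> \<le> 3 * e1" if ij: "i < m" "j < m" for i j
 proof -
  have ei: "norm (e k) = 1" if "k < m" for k using e that by (simp add: orthonormal_frame_def norm_eq_1)
  have et: "e k \<in> cyl_tangent (\<omega>, 0)" if "k < m" for k
   using e that slice_cyl_tangent[of "e k" "(\<omega>, 0)"] by (simp add: orthonormal_frame_def)
  define x y where "x = D Z (\<omega>, 0) (e i) - e i" and "y = D Z (\<omega>, 0) (e j) - e j"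
  have xy: "norm x \<le> e1" "norm y \<le> e1"
   using DZ_close[OF slice0(1)[OF \<omega>] et[OF ij(1)]] DZ_close[OF slice0(1)[OF \<omega>] et[OF ij(2)]] ei ij by (auto simp: x_def y_def)
  have "D Z (\<omega>, 0) (e i) = e i + x" "D Z (\<omega>, 0) (e j) = e j + y" by (simp_all add: x_def y_def)
  hence "G i j - e i \<bullet> e j = e i \<bullet> y + x \<bullet> e j + x \<bullet> y" by (simp add: G_def inner_add_left inner_add_right)
  moreover have "\<bar>e i \<bullet> y\<bar> \<le> e1" "\<bar>x \<bullet> e j\<bar> \<le> e1" "\<bar>x \<bullet> y\<bar> \<le> e1"
  proof -
   show "\<bar>e i \<bullet> y\<bar> \<le> e1" "\<bar>x \<bullet> e j\<bar> \<le> e1"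
    using Cauchy_Schwarz_ineq2[of "e i" y] Cauchy_Schwarz_ineq2[of x "e j"] ei ij xy by auto
   have "\<bar>x \<bullet> y\<bar> \<le> norm x * norm y" by (rule Cauchy_Schwarz_ineq2)
   also have "\<dots> \<le> e1 * 1" using xy s e1_nonneg by (intro mult_mono) auto
   finally show "\<bar>x \<bullet> y\<bar> \<le> e1" by simp
  qed
  moreover have "e i \<bullet> e j = (if i = j then 1 else 0)" using e ij by (simp add: orthonormal_frame_def)
  ultimately show ?thesis by linarith
 qed
 hence "\<bar>gram_det m G - 1\<bar> \<le> C * (3 * e1)" using C s e1_nonneg by auto
 hence g: "\<bar>gram_det m G - 1\<bar> \<le> d" using s by linarith
 hence g0: "0 \<le> gram_det m G" using s by linarith
 have "\<bar>sqrt (gram_det m G) - 1\<bar> \<le> \<bar>sqrt (gram_det m G) - 1\<bar> * (sqrt (gram_det m G) + 1)"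
  using g0 mult_left_mono[of 1 "sqrt (gram_det m G) + 1" "\<bar>sqrt (gram_det m G) - 1\<bar>"] by simp
 also have "\<dots> = \<bar>(sqrt (gram_det m G) - 1) * (sqrt (gram_det m G) + 1)\<bar>" using g0 by (simp add: abs_mult)
 also have "(sqrt (gram_det m G) - 1) * (sqrt (gram_det m G) + 1) = gram_det m G - 1"
  using g0 by (simp add: algebra_simps)
 finally have "\<bar>sqrt (gram_det m G) - 1\<bar> \<le> d" using g by linarith
 moreover have "w \<omega> - \<rho> = \<rho> * (sqrt (gram_det m G) - 1)"
  using w_frame[OF \<omega> e] by (simp add: G_def[abs_def] right_diff_distrib)
 ultimately show ?thesis using \<rho>_pos by (simp add: abs_mult mult.commute)
qed

abbreviation e3 :: "'a \<times> real" where "e3 \<equiv> (0, 1)"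

text \<open>The induced metric is close to the standard one, so the orthogonal complement of the slice in the tangent space is a line; this resolves the
 definite description.\<close>

lemma slice_normal_unique:
 assumes \<omega>: "\<omega> \<in> sphere 0 1" and s: "2 * e1 \<le> 1"
 shows "slice_normal X (\<omega>, 0) \<in> cyl_tangent (\<omega>, 0)" "snd (slice_normal X (\<omega>, 0)) > 0"
  "first_form lor X (\<omega>, 0) (slice_normal X (\<omega>, 0)) (slice_normal X (\<omega>, 0)) = 1"
  "\<And>v. v \<in> slice_tangent (\<omega>, 0) ==> first_form lor X (\<omega>, 0) (slice_normal X (\<omega>, 0)) v = 0"
proof -
 define x where "x = (\<omega>, 0::real)"
 have xc: "x \<in> cyl L" "x \<in> punctured L" using slice0[OF \<omega>] by (auto simp: x_def)
 have lin: "linear (D Z x)" using D_linear[OF Z_diff[OF xc(2)]] .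
 note ff = first_form_Z[OF xc(2)]
 have inj: "v = 0" if v: "v \<in> cyl_tangent x" "D Z x v = 0" for v
 proof (rule ccontr)
  assume "v \<noteq> 0"
  have "norm v \<le> e1 * norm v" using DZ_close[OF xc(1) v(1)] v(2) by simp
  also have "\<dots> \<le> (1/2) * norm v" using s by (intro mult_right_mono) auto
  finally show False using \<open>v \<noteq> 0\<close> by simp
 qed
 have e3t: "e3 \<in> cyl_tangent x" by (simp add: cyl_tangent_def)
 have sub: "subspace (cyl_tangent x)" by (auto simp: subspace_def cyl_tangent_def inner_add_left)
 define S where "S = D Z x ` slice_tangent x"
 have Ss: "subspace S" unfolding S_def by (rule linear_subspace_image[OF lin slice_tangent_subspace])
 obtain y z where yz: "y \<in> span S" "\<And>w. w \<in> span S ==> Linear_Algebra.orthogonal z w" "D Z x e3 = y + z"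
  using orthogonal_subspace_decomp_exists[of S "D Z x e3"] by metis
 have "y \<in> S" using yz(1) Ss span_eq_iff by metis
 then obtain v where v: "v \<in> slice_tangent x" "y = D Z x v" by (auto simp: S_def)
 define u0 where "u0 = e3 - v"
 have u0t: "u0 \<in> cyl_tangent x" unfolding u0_def using subspace_diff[OF sub e3t] slice_cyl_tangent[OF v(1)] by blast
 have snd0: "snd u0 = 1" using v(1) by (simp add: u0_def slice_tangent_def)
 have z: "D Z x u0 = z" using yz(3) v(2) by (simp add: u0_def linear_diff[OF lin])
 have zo: "z \<bullet> D Z x v' = 0" if "v' \<in> slice_tangent x" for v'
  using yz(2)[of "D Z x v'"] that by (simp add: S_def span_base Linear_Algebra.orthogonal_def)
 have z0: "z \<noteq> 0" using inj[OF u0t] z snd0 by auto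
 define u where "u = (1 / (r * norm z)) *\<^sub>R u0"
 have k: "1 / (r * norm z) > 0" using r z0 by simp
 have DZu: "D Z x u = (1 / (r * norm z)) *\<^sub>R z" by (simp add: u_def linear_scale[OF lin] z)
 have U: "u \<in> cyl_tangent x \<and> snd u > 0 \<and> first_form lor X x u u = 1 \<and> (\<forall>v\<in>slice_tangent x. first_form lor X x u v = 0)"
 proof (intro conjI ballI)
  show "u \<in> cyl_tangent x" unfolding u_def using subspace_scale[OF sub u0t] .
  show "snd u > 0" using k snd0 by (simp add: u_def)
  show "first_form lor X x u u = 1" unfolding ff DZu using r z0
   by (simp add: power2_eq_square flip: power2_norm_eq_inner)
  show "first_form lor X x u v' = 0" if "v' \<in> slice_tangent x" for v' unfolding ff DZu using zo[OF that] by simp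
 qed
 have un: "u' = u" if u': "u' \<in> cyl_tangent x \<and> snd u' > 0 \<and> first_form lor X x u' u' = 1 \<and> (\<forall>v\<in>slice_tangent x. first_form lor X x u' v = 0)" for u'
 proof -
  define d where "d = snd u *\<^sub>R u' - snd u' *\<^sub>R u"
  have dt: "d \<in> cyl_tangent x" unfolding d_def using U u' subspace_scale[OF sub] subspace_diff[OF sub] by blast
  have "d \<in> slice_tangent x" using dt by (simp add: d_def slice_tangent_def cyl_tangent_def)
  hence "first_form lor X x u d = 0" "first_form lor X x u' d = 0" using U u' by blast+
  hence o: "D Z x u \<bullet> D Z x d = 0" "D Z x u' \<bullet> D Z x d = 0" unfolding ff using r by auto
  have "D Z x d \<bullet> D Z x d = 0"
  proof -
   have "D Z x d = snd u *\<^sub>R D Z x u' - snd u' *\<^sub>R D Z x u" by (simp add: d_def linear_diff[OF lin] linear_scale[OF lin])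
   hence "D Z x d \<bullet> D Z x d = (snd u *\<^sub>R D Z x u' - snd u' *\<^sub>R D Z x u) \<bullet> D Z x d" by simp
   thus ?thesis using o by (simp add: inner_diff_left)
  qed
  hence "d = 0" using inj[OF dt] by simp
  hence eq: "snd u *\<^sub>R u' = snd u' *\<^sub>R u" by (simp add: d_def)
  have "snd u *\<^sub>R D Z x u' = snd u' *\<^sub>R D Z x u"
   unfolding linear_scale[OF lin, symmetric] eq ..
  hence "(snd u *\<^sub>R D Z x u') \<bullet> (snd u *\<^sub>R D Z x u') = (snd u' *\<^sub>R D Z x u) \<bullet> (snd u' *\<^sub>R D Z x u)"
   by (simp only:)
  hence q: "(snd u)\<^sup>2 * (D Z x u' \<bullet> D Z x u') = (snd u')\<^sup>2 * (D Z x u \<bullet> D Z x u)"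
   by (simp add: power2_eq_square mult.assoc)
  have "first_form lor X x u' u' = 1" "first_form lor X x u u = 1" using U u' by blast+
  hence "r\<^sup>2 * (D Z x u' \<bullet> D Z x u') = 1" and n: "r\<^sup>2 * (D Z x u \<bullet> D Z x u) = 1" unfolding ff .
  hence "r\<^sup>2 * (D Z x u' \<bullet> D Z x u') = r\<^sup>2 * (D Z x u \<bullet> D Z x u)" by (simp only:)
  hence "D Z x u' \<bullet> D Z x u' = D Z x u \<bullet> D Z x u" using r mult_left_cancel[of "r\<^sup>2"] by simp
  moreover have "D Z x u \<bullet> D Z x u \<noteq> 0" using n by (metis mult_zero_right zero_neq_one)
  ultimately have "(snd u)\<^sup>2 = (snd u')\<^sup>2" using q by simp
  moreover have p: "0 < snd u" "0 < snd u'" using U u' by blast+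
  ultimately have "snd u = snd u'" using power2_eq_imp_eq[OF _ less_imp_le less_imp_le] by blast
  hence "snd u *\<^sub>R u' = snd u *\<^sub>R u" using eq by (simp only:)
  hence "u' = u \<or> snd u = 0" unfolding scaleR_cancel_left by blast
  thus ?thesis using p(1) by auto
 qed
 have "slice_normal X x = u" unfolding slice_normal_def by (rule the_equality) (use U un in blast)+
 thus "slice_normal X (\<omega>, 0) \<in> cyl_tangent (\<omega>, 0)" "snd (slice_normal X (\<omega>, 0)) > 0"
  "first_form lor X (\<omega>, 0) (slice_normal X (\<omega>, 0)) (slice_normal X (\<omega>, 0)) = 1"
  "\<And>v. v \<in> slice_tangent (\<omega>, 0) ==> first_form lor X (\<omega>, 0) (slice_normal X (\<omega>, 0)) v = 0"
  using U by (auto simp: x_def)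
qed

lemma slice_normal_vec_close:
 assumes \<omega>: "\<omega> \<in> sphere 0 1" and s: "10 * e1 \<le> 1"
 shows "norm (R (slice_normal_vec X (\<omega>, 0)) - e3) \<le> 10 * e1" "slice_normal_vec X (\<omega>, 0) \<in> htangent p"
proof -
 define x where "x = (\<omega>, 0::real)"
 have xc: "x \<in> cyl L" "x \<in> punctured L" using slice0[OF \<omega>] by (auto simp: x_def)
 have s2: "2 * e1 \<le> 1" using s e1_nonneg by linarith
 note N = slice_normal_unique[OF \<omega> s2, folded x_def]
 have lin: "linear (D Z x)" using D_linear[OF Z_diff[OF xc(2)]] .
 note ff = first_form_Z[OF xc(2)]
 define u where "u = r *\<^sub>R slice_normal X x"
 have DZu: "D Z x u = r *\<^sub>R D Z x (slice_normal X x)" by (simp add: u_def linear_scale[OF lin])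
 have R: "R (slice_normal_vec X x) = D Z x u" unfolding slice_normal_vec_def R_DX[OF xc(2)] DZu ..
 show "slice_normal_vec X (\<omega>, 0) \<in> htangent p" unfolding slice_normal_vec_def using DX_tan xc(2) by (simp add: x_def)
 have ut: "u \<in> cyl_tangent x" using N(1) by (simp add: u_def cyl_tangent_def)
 have u1: "norm (D Z x u) = 1" using N(3) unfolding ff DZu norm_eq_1 by (simp add: power2_eq_square mult.assoc)
 have uo: "D Z x u \<bullet> D Z x v = 0" if "v \<in> slice_tangent x" for v using N(4)[OF that] r unfolding ff DZu by simp
 have cl: "norm (D Z x u - u) \<le> e1 * norm u" by (rule DZ_close[OF xc(1) ut])
 have "norm u \<le> 1 + e1 * norm u" using norm_triangle_sub[of u "D Z x u"] cl u1 by (simp add: norm_minus_commute)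
 moreover have "e1 * norm u \<le> (1/2) * norm u" using s2 by (intro mult_right_mono) auto
 ultimately have u2: "norm u \<le> 2" by linarith
 hence "e1 * norm u \<le> e1 * 2" using e1_nonneg by (intro mult_left_mono) auto
 hence cl2: "norm (D Z x u - u) \<le> 2 * e1" using cl by linarith
 define v where "v = (fst u, 0::real)"
 have vt: "v \<in> slice_tangent x" using ut by (simp add: v_def slice_tangent_def cyl_tangent_def)
 have vc: "norm (D Z x v - v) \<le> e1 * norm v" by (rule DZ_close[OF xc(1) slice_cyl_tangent[OF vt]])
 have "norm v * norm v = u \<bullet> v" by (simp add: v_def inner_prod_def norm_Pair flip: power2_norm_eq_inner power2_eq_square)
 also have "\<dots> = (u - D Z x u) \<bullet> v - D Z x u \<bullet> (D Z x v - v)" using uo[OF vt] by (simp add: inner_diff_left inner_diff_right)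
 also have "\<dots> \<le> norm (u - D Z x u) * norm v + norm (D Z x u) * norm (D Z x v - v)"
  using norm_cauchy_schwarz[of "u - D Z x u" v] Cauchy_Schwarz_ineq2[of "D Z x u" "D Z x v - v"] by linarith
 also have "\<dots> \<le> (2 * e1) * norm v + 1 * (e1 * norm v)"
  using cl2 vc u1 e1_nonneg by (intro add_mono mult_mono) (auto simp: norm_minus_commute)
 also have "\<dots> = (3 * e1) * norm v" by simp
 finally have v3: "norm v \<le> 3 * e1" using e1_nonneg by (cases "norm v = 0") auto
 have uv: "u = v + snd u *\<^sub>R e3" by (simp add: v_def prod_eq_iff)
 have su: "snd u > 0" using N(2) r by (simp add: u_def)
 have n3: "norm (snd u *\<^sub>R e3) = snd u" using su by (simp add: norm_Pair)
 have "snd u \<le> norm u + norm v" "norm u \<le> norm v + snd u"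
  using norm_triangle_ineq4[of u v] norm_triangle_ineq[of v "snd u *\<^sub>R e3"] n3 uv by (metis add_diff_cancel_left')+
 moreover have "norm u \<le> 1 + 2 * e1" "1 \<le> norm u + 2 * e1"
  using norm_triangle_sub[of u "D Z x u"] norm_triangle_sub[of "D Z x u" u] cl2 u1 by (simp_all add: norm_minus_commute)
 ultimately have t: "\<bar>snd u - 1\<bar> \<le> 5 * e1" using v3 by linarith
 have "v + (snd u - 1) *\<^sub>R e3 = u - e3"
  by (simp only: scaleR_diff_left scaleR_one add_diff_eq uv[symmetric])
 hence "D Z x u - e3 = (D Z x u - u) + (v + (snd u - 1) *\<^sub>R e3)" by (simp only: add_diff_eq diff_add_cancel)
 hence "norm (D Z x u - e3) \<le> norm (D Z x u - u) + (norm v + norm ((snd u - 1) *\<^sub>R e3))"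
  by (simp only:) (intro norm_triangle_le add_left_mono norm_triangle_ineq)
 also have "norm ((snd u - 1) *\<^sub>R e3) = \<bar>snd u - 1\<bar>" by (simp add: norm_Pair)
 finally show "norm (R (slice_normal_vec X (\<omega>, 0)) - e3) \<le> 10 * e1" using cl2 v3 t R by (simp add: x_def)
qed

end

context neck_chart
begin

text \<open>The center of the approximating cylinder in the rescaled coordinates, where the standard cylinder is centered at the origin.\<close>

definition shift where "shift = a + R (slice_center W) /\<^sub>R r"

lemma W0: "\<omega> \<in> sphere 0 1 ==> W (\<omega>, 0) = X (\<omega>, 0)"
 using X_W[OF slice0(1)] by simp

lemma X0_continuous: "continuous_on (sphere 0 1) (\<lambda>\<omega>. X (\<omega>, 0))"
proof -
 have "continuous_on (punctured L) X"
  using X_diff by (auto intro!: continuous_at_imp_continuous_on differentiable_imp_continuous_within)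
 thus ?thesis by (rule continuous_on_compose2) (auto intro!: continuous_intros slice0(2))
qed

lemma W0_continuous: "continuous_on (sphere 0 1) (\<lambda>\<omega>. W (\<omega>, 0))"
 using X0_continuous continuous_on_cong[OF refl, of "sphere 0 1" "\<lambda>\<omega>. X (\<omega>, 0)" "\<lambda>\<omega>. W (\<omega>, 0)"] W0 by simp

lemma Z0: "\<omega> \<in> sphere 0 1 ==> Z (\<omega>, 0) = (\<omega>, 0) + f (\<omega>, 0)"
 by (simp add: f_def cylmap_id[OF slice0(1)])

lemma Z0_continuous: "continuous_on (sphere 0 1) (\<lambda>\<omega>. Z (\<omega>, 0))"
 unfolding Z_def by (intro continuous_intros bounded_linear.continuous_on[OF R_bl] X0_continuous)

lemma f0_continuous: "continuous_on (sphere 0 1) (\<lambda>\<omega>. f (\<omega>, 0))"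
proof -
 have "continuous_on (sphere 0 1) (\<lambda>\<omega>. Z (\<omega>, 0) - (\<omega>, 0))" by (intro continuous_intros Z0_continuous)
 thus ?thesis
  by (rule continuous_on_eq) (simp add: f_def cylmap_id[OF slice0(1)])
qed

context
 fixes d :: real
 assumes d: "0 \<le> d" "3 * d \<le> 1" and e1s: "20 * e1 \<le> 1"
  and wd: "\<And>\<omega>. \<omega> \<in> sphere 0 1 ==> \<bar>w \<omega> - \<rho>\<bar> \<le> d * \<rho>"
begin

lemma w_lower: "\<omega> \<in> sphere 0 1 ==> (1 - d) * \<rho> \<le> w \<omega>" and w_upper: "\<omega> \<in> sphere 0 1 ==> w \<omega> \<le> (1 + d) * \<rho>"
 using wd by (fastforce simp: abs_le_iff algebra_simps)+

lemma w_pos: "\<omega> \<in> sphere 0 1 ==> 0 < w \<omega>"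
proof -
 assume "\<omega> \<in> sphere 0 1"
 moreover have "0 < (1 - d) * \<rho>" using d \<rho>_pos by simp
 ultimately show ?thesis using w_lower by fastforce
qed

definition Mw where "Mw = sphere_integral w"

lemma Mw_lower: "(1 - d) * \<rho> * sphere_area TYPE('a) \<le> Mw"
 unfolding Mw_def sphere_integral_const[symmetric]
 by (rule sphere_integral_mono[OF sphere_integrable[OF continuous_on_const] sphere_integrable[OF w_continuous]]) (rule w_lower)

lemma Mw_pos: "0 < Mw"
proof -
 have "0 < (1 - d) * \<rho> * sphere_area TYPE('a)" using d \<rho>_pos sphere_area_pos[where 'a = 'a] by simp
 thus ?thesis using Mw_lower by linarith
qed

text \<open>For the exact cylinder the average of the position over the slice is zero by symmetry.\<close>

lemma shift_small: "norm shift \<le> 2 * d + 2 * \<epsilon>"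
proof -
 have c1: "continuous_on (sphere 0 1) (\<lambda>\<omega>. w \<omega> *\<^sub>R W (\<omega>, 0))"
  by (intro continuous_intros w_continuous W0_continuous)
 have "slice_center W = sphere_integral (\<lambda>\<omega>. w \<omega> *\<^sub>R W (\<omega>, 0)) /\<^sub>R Mw"
  by (simp add: slice_center_def w_def[abs_def] Mw_def)
 hence "R (slice_center W) = sphere_integral (\<lambda>\<omega>. R (w \<omega> *\<^sub>R W (\<omega>, 0))) /\<^sub>R Mw"
  using sphere_integral_linear[OF sphere_integrable[OF c1] R_bl] by (simp add: linear_scale[OF R_lin])
 hence "Mw *\<^sub>R (R (slice_center W) /\<^sub>R r) = sphere_integral (\<lambda>\<omega>. R (w \<omega> *\<^sub>R W (\<omega>, 0))) /\<^sub>R r"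
  using Mw_pos by simp
 also have "\<dots> = sphere_integral (\<lambda>\<omega>. R (w \<omega> *\<^sub>R W (\<omega>, 0)) /\<^sub>R r)"
  by (rule sphere_integral_linear[OF sphere_integrable bounded_linear_scaleR_right])
   (intro bounded_linear.continuous_on[OF R_bl] c1)
 finally have 1: "Mw *\<^sub>R (R (slice_center W) /\<^sub>R r) = sphere_integral (\<lambda>\<omega>. R (w \<omega> *\<^sub>R W (\<omega>, 0)) /\<^sub>R r)" .
 have 2: "Mw *\<^sub>R a = sphere_integral (\<lambda>\<omega>. w \<omega> *\<^sub>R a)"
  unfolding Mw_def by (rule sphere_integral_linear[OF sphere_integrable[OF w_continuous] bounded_linear_scaleR_left])
 have "Mw *\<^sub>R shift = sphere_integral (\<lambda>\<omega>. w \<omega> *\<^sub>R a + R (w \<omega> *\<^sub>R W (\<omega>, 0)) /\<^sub>R r)"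
  unfolding shift_def scaleR_add_right 1 2
  by (rule sphere_integral_add[symmetric])
   (intro continuous_intros bounded_linear.continuous_on[OF R_bl] c1 w_continuous)+
 also have "\<dots> = sphere_integral (\<lambda>\<omega>. \<rho> *\<^sub>R (\<omega>, 0) + ((w \<omega> - \<rho>) *\<^sub>R (\<omega>, 0) + w \<omega> *\<^sub>R f (\<omega>, 0)))"
 proof (rule sphere_integral_cong)
  fix \<omega> :: 'a assume \<omega>: "\<omega> \<in> sphere 0 1"
  have "w \<omega> *\<^sub>R a + R (w \<omega> *\<^sub>R W (\<omega>, 0)) /\<^sub>R r = w \<omega> *\<^sub>R Z (\<omega>, 0)"
   using W0[OF \<omega>] by (simp add: Z_def linear_scale[OF R_lin] scaleR_add_right)
  also have "\<dots> = \<rho> *\<^sub>R (\<omega>, 0) + ((w \<omega> - \<rho>) *\<^sub>R (\<omega>, 0) + w \<omega> *\<^sub>R f (\<omega>, 0))"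
   unfolding Z0[OF \<omega>] scaleR_add_right by (simp only: scaleR_diff_left) simp
  finally show "w \<omega> *\<^sub>R a + R (w \<omega> *\<^sub>R W (\<omega>, 0)) /\<^sub>R r = \<rho> *\<^sub>R (\<omega>, 0) + ((w \<omega> - \<rho>) *\<^sub>R (\<omega>, 0) + w \<omega> *\<^sub>R f (\<omega>, 0))" .
 qed
 also have "\<dots> = sphere_integral (\<lambda>\<omega>::'a. \<rho> *\<^sub>R (\<omega>, 0::real)) + sphere_integral (\<lambda>\<omega>. (w \<omega> - \<rho>) *\<^sub>R (\<omega>, 0) + w \<omega> *\<^sub>R f (\<omega>, 0))"
  by (rule sphere_integral_add) (intro continuous_intros w_continuous f0_continuous)+
 also have "sphere_integral (\<lambda>\<omega>::'a. \<rho> *\<^sub>R (\<omega>, 0::real)) = 0"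
 proof -
  have "bounded_linear (\<lambda>v::'a. \<rho> *\<^sub>R (v, 0::real))"
   by (intro bounded_linear_compose[OF bounded_linear_scaleR_right] bounded_linear_Pair bounded_linear_ident bounded_linear_zero)
  from sphere_integral_linear[OF sphere_integrable[OF continuous_on_id] this]
  show ?thesis using sphere_integral_id[where 'a = 'a] by (simp add: zero_prod_def)
 qed
 also have "norm (0 + sphere_integral (\<lambda>\<omega>. (w \<omega> - \<rho>) *\<^sub>R (\<omega>, 0::real) + w \<omega> *\<^sub>R f (\<omega>, 0))) \<le> (d * \<rho> + (1 + d) * \<rho> * \<epsilon>) * sphere_area TYPE('a)"
  unfolding add_0
 proof (rule sphere_integral_bound)
  show "continuous_on (sphere 0 1) (\<lambda>\<omega>. (w \<omega> - \<rho>) *\<^sub>R (\<omega>, 0::real) + w \<omega> *\<^sub>R f (\<omega>, 0))"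
   by (intro continuous_intros w_continuous f0_continuous)
  fix \<omega> :: 'a assume \<omega>: "\<omega> \<in> sphere 0 1"
  have "norm ((w \<omega> - \<rho>) *\<^sub>R (\<omega>, 0::real)) \<le> d * \<rho>" using wd[OF \<omega>] \<omega> by (simp add: norm_Pair)
  moreover have "w \<omega> * norm (f (\<omega>, 0)) \<le> (1 + d) * \<rho> * \<epsilon>"
   using w_upper[OF \<omega>] w_pos[OF \<omega>] f_small[OF slice0(1)[OF \<omega>]] d \<rho>_pos by (intro mult_mono) auto
  hence "norm (w \<omega> *\<^sub>R f (\<omega>, 0)) \<le> (1 + d) * \<rho> * \<epsilon>" using w_pos[OF \<omega>] by simp
  ultimately show "norm ((w \<omega> - \<rho>) *\<^sub>R (\<omega>, 0::real) + w \<omega> *\<^sub>R f (\<omega>, 0)) \<le> d * \<rho> + (1 + d) * \<rho> * \<epsilon>"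
   by (intro norm_triangle_le add_mono)
 qed
 finally have "Mw * norm shift \<le> (d * \<rho> + (1 + d) * \<rho> * \<epsilon>) * sphere_area TYPE('a)" using Mw_pos by simp
 moreover have "((1 - d) * \<rho> * sphere_area TYPE('a)) * norm shift \<le> Mw * norm shift" using Mw_lower by (intro mult_right_mono) auto
 ultimately have "(\<rho> * sphere_area TYPE('a)) * ((1 - d) * norm shift) \<le> (\<rho> * sphere_area TYPE('a)) * (d + (1 + d) * \<epsilon>)" by (simp add: algebra_simps)
 hence s: "(1 - d) * norm shift \<le> d + (1 + d) * \<epsilon>" using \<rho>_pos sphere_area_pos[where 'a = 'a] by simp
 have "(2/3) * norm shift \<le> (1 - d) * norm shift" using d by (intro mult_right_mono) auto
 moreover have "(1 + d) * \<epsilon> \<le> (4/3) * \<epsilon>" using d \<epsilon>_nonneg by (intro mult_right_mono) auto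
 ultimately show ?thesis using s d(1) by linarith
qed

context
 fixes A :: "'a \<times> real => ('a \<times> real) \<times> real"
 assumes A: "best_cylinder p r W A"
begin

lemma A_frame: "linear A" "range A \<subseteq> htangent p" "lor (A v) (A u) = v \<bullet> u"
 using A unfolding best_cylinder_def cylinder_frame_def by blast+

definition Q where "Q v = R (A v)"

lemma Q_orth: "orthogonal_transformation Q"
 unfolding orthogonal_transformation_def
proof (intro conjI allI)
 show "linear Q" unfolding Q_def[abs_def] using linear_compose[OF A_frame(1) R_lin] by (simp add: o_def)
 show "Q v \<bullet> Q u = v \<bullet> u" for v u unfolding Q_def using R_lor[of "A v" "A u"] A_frame by auto
qed

lemma Q_lin: "linear Q" and Q_norm: "norm (Q v) = norm v" and Q_inner: "Q v \<bullet> Q u = v \<bullet> u"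
proof -
 show "linear Q" "Q v \<bullet> Q u = v \<bullet> u" using Q_orth unfolding orthogonal_transformation_def by blast+
 show "norm (Q v) = norm v" by (rule orthogonal_transformation_norm[OF Q_orth])
qed

text \<open>The axis is an average of normals, all close to the standard axis.\<close>

lemma axis_close: "norm (Q e3 - e3) \<le> 20 * e1"
proof -
 define s where "s \<omega> = slice_normal_vec X (\<omega>, 0)" for \<omega>
 have s10: "10 * e1 \<le> 1" using e1s e1_nonneg by linarith
 have sc: "norm (R (s \<omega>) - e3) \<le> 10 * e1" "s \<omega> \<in> htangent p" if "\<omega> \<in> sphere 0 1" for \<omega>
  using slice_normal_vec_close[OF that s10] by (auto simp: s_def)
 define mm where "mm = sphere_integral (\<lambda>\<omega>. w \<omega> *\<^sub>R s \<omega>)"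
 have mA: "mm \<noteq> 0" "A e3 = mm /\<^sub>R sqrt (lor mm mm)"
  using A unfolding best_cylinder_def cylinder_frame_def Let_def mm_def w_def s_def by auto
 \<comment> \<open>A function that is not integrable has integral zero, which is excluded here.\<close>
 have int: "(\<lambda>x. w (x /\<^sub>R norm x) *\<^sub>R s (x /\<^sub>R norm x)) integrable_on ball 0 1"
 proof (rule ccontr)
  assume "\<not> (\<lambda>x. w (x /\<^sub>R norm x) *\<^sub>R s (x /\<^sub>R norm x)) integrable_on ball 0 1"
  hence "mm = 0" by (simp add: mm_def sphere_integral_def not_integrable_integral)
  with mA show False by simp
 qed
 have "lor p mm = sphere_integral (\<lambda>\<omega>. lor p (w \<omega> *\<^sub>R s \<omega>))"
  unfolding mm_def
  by (rule sphere_integral_linear[of "\<lambda>\<omega>. w \<omega> *\<^sub>R s \<omega>", OF int bounded_bilinear.bounded_linear_right[OF lor_bb]])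
 also have "\<dots> = sphere_integral (\<lambda>\<omega>::'a. 0::real)"
  by (rule sphere_integral_cong) (use sc in \<open>auto simp: htangent_def lor_simps\<close>)
 finally have mt: "mm \<in> htangent p" by (simp add: htangent_def sphere_integral_def)
 have lm: "lor mm mm = (norm (R mm))\<^sup>2" using R_lor[OF mt mt] by (simp add: power2_norm_eq_inner)
 hence A3: "A e3 = mm /\<^sub>R norm (R mm)" using mA by simp
 have Q3: "Q e3 = R mm /\<^sub>R norm (R mm)" unfolding Q_def A3 by (simp add: linear_scale[OF R_lin])
 have n0: "norm (R mm) \<noteq> 0"
 proof
  assume "norm (R mm) = 0"
  hence "Q e3 = 0" using Q3 by simp
  thus False using Q_norm[of e3] by (simp add: norm_Pair)
 qed
 have intR: "(\<lambda>x. R (w (x /\<^sub>R norm x) *\<^sub>R s (x /\<^sub>R norm x))) integrable_on ball 0 1"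
  using integrable_linear[OF int R_bl] by (simp add: o_def)
 have Rm: "R mm = sphere_integral (\<lambda>\<omega>. R (w \<omega> *\<^sub>R s \<omega>))"
  unfolding mm_def by (rule sphere_integral_linear[of "\<lambda>\<omega>. w \<omega> *\<^sub>R s \<omega>"]) (use int R_bl in auto)
 have M3: "Mw *\<^sub>R e3 = sphere_integral (\<lambda>\<omega>. w \<omega> *\<^sub>R e3)"
  unfolding Mw_def by (rule sphere_integral_linear[OF sphere_integrable[OF w_continuous] bounded_linear_scaleR_left])
 have intM: "(\<lambda>x. w (x /\<^sub>R norm x) *\<^sub>R e3) integrable_on ball 0 1"
  by (rule sphere_integrable[of "\<lambda>\<omega>. w \<omega> *\<^sub>R e3"]) (intro continuous_intros w_continuous)
 have "R mm - Mw *\<^sub>R e3 = sphere_integral (\<lambda>\<omega>. R (w \<omega> *\<^sub>R s \<omega>) - w \<omega> *\<^sub>R e3)"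
  unfolding Rm M3 using integral_diff[OF intR intM] by (simp only: sphere_integral_def scaleR_diff_right)
 also have "norm \<dots> \<le> sphere_integral (\<lambda>\<omega>. 10 * e1 * w \<omega>)"
 proof (rule sphere_integral_norm)
  show "(\<lambda>x. R (w (x /\<^sub>R norm x) *\<^sub>R s (x /\<^sub>R norm x)) - w (x /\<^sub>R norm x) *\<^sub>R e3) integrable_on ball 0 1"
   by (rule integrable_diff[OF intR intM])
  show "(\<lambda>x. 10 * e1 * w (x /\<^sub>R norm x)) integrable_on ball 0 1"
   by (rule sphere_integrable[of "\<lambda>\<omega>. 10 * e1 * w \<omega>"]) (intro continuous_intros w_continuous)
  fix \<omega> :: 'a assume \<omega>: "\<omega> \<in> sphere 0 1"
  have "R (w \<omega> *\<^sub>R s \<omega>) - w \<omega> *\<^sub>R e3 = w \<omega> *\<^sub>R (R (s \<omega>) - e3)"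
   by (simp only: linear_scale[OF R_lin] scaleR_diff_right)
  thus "norm (R (w \<omega> *\<^sub>R s \<omega>) - w \<omega> *\<^sub>R e3) \<le> 10 * e1 * w \<omega>"
   using sc(1)[OF \<omega>] w_pos[OF \<omega>] mult_right_mono[OF sc(1)[OF \<omega>], of "w \<omega>"] by (simp add: mult.commute)
 qed
 also have "\<dots> = 10 * e1 * Mw"
  unfolding Mw_def by (simp add: sphere_integral_def)
 finally have cl: "norm (R mm - Mw *\<^sub>R e3) \<le> 10 * e1 * Mw" .
 define k where "k = norm (R mm)"
 have k: "\<bar>k - Mw\<bar> \<le> 10 * e1 * Mw"
  using norm_triangle_ineq3[of "R mm" "Mw *\<^sub>R e3"] cl Mw_pos by (simp add: k_def norm_Pair)
 have "R mm = k *\<^sub>R Q e3" unfolding Q3 k_def using n0 by simp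
 hence "Mw *\<^sub>R (Q e3 - e3) = (R mm - Mw *\<^sub>R e3) - (k - Mw) *\<^sub>R Q e3"
  by (simp only: scaleR_diff_right scaleR_diff_left) simp
 hence "norm (Mw *\<^sub>R (Q e3 - e3)) \<le> norm (R mm - Mw *\<^sub>R e3) + norm ((k - Mw) *\<^sub>R Q e3)"
  by (simp only:) (rule norm_triangle_ineq4)
 also have "norm ((k - Mw) *\<^sub>R Q e3) = \<bar>k - Mw\<bar>" using Q_norm[of e3] by (simp add: norm_Pair)
 finally have "norm (Mw *\<^sub>R (Q e3 - e3)) \<le> norm (R mm - Mw *\<^sub>R e3) + \<bar>k - Mw\<bar>" .
 hence "Mw * norm (Q e3 - e3) \<le> Mw * (20 * e1)" 
 proof -
  have "10 * e1 * Mw + 10 * e1 * Mw = Mw * (20 * e1)" by simp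
  thus ?thesis
   using \<open>norm (Mw *\<^sub>R (Q e3 - e3)) \<le> norm (R mm - Mw *\<^sub>R e3) + \<bar>k - Mw\<bar>\<close> cl k
   unfolding norm_scaleR abs_of_pos[OF Mw_pos] by linarith
 qed
 thus ?thesis using Mw_pos by simp
qed

lemma fit_error_eq:
 assumes B: "linear B" "range B \<subseteq> htangent p"
 shows "fit_error r W B = r\<^sup>2 * sphere_integral (\<lambda>\<omega>. w \<omega> * (norm (((\<omega>, 0) - R (B (\<omega>, 0))) + (f (\<omega>, 0) - shift)))\<^sup>2)"
  and "continuous_on (sphere 0 1) (\<lambda>\<omega>. w \<omega> * (norm (((\<omega>, 0) - R (B (\<omega>, 0))) + (f (\<omega>, 0) - shift)))\<^sup>2)"
proof -
 have Bb: "bounded_linear B" using B(1) linear_conv_bounded_linear by blast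
 show "continuous_on (sphere 0 1) (\<lambda>\<omega>. w \<omega> * (norm (((\<omega>, 0) - R (B (\<omega>, 0))) + (f (\<omega>, 0) - shift)))\<^sup>2)"
  by (intro continuous_intros w_continuous f0_continuous bounded_linear.continuous_on[OF R_bl] bounded_linear.continuous_on[OF Bb])
 have ct: "slice_center W \<in> htangent p"
 proof -
  have c1: "continuous_on (sphere 0 1) (\<lambda>\<omega>. w \<omega> *\<^sub>R W (\<omega>, 0))"
   by (intro continuous_intros w_continuous W0_continuous)
  have "lor p (sphere_integral (\<lambda>\<omega>. w \<omega> *\<^sub>R W (\<omega>, 0))) = sphere_integral (\<lambda>\<omega>. lor p (w \<omega> *\<^sub>R W (\<omega>, 0)))"
   by (rule sphere_integral_linear[OF sphere_integrable[OF c1] bounded_bilinear.bounded_linear_right[OF lor_bb]])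
  also have "\<dots> = sphere_integral (\<lambda>\<omega>::'a. 0::real)"
   by (rule sphere_integral_cong) (use W_tan[OF slice0(1)] in \<open>auto simp: htangent_def lor_simps\<close>)
  finally have "lor p (sphere_integral (\<lambda>\<omega>. w \<omega> *\<^sub>R W (\<omega>, 0))) = 0" by (simp add: sphere_integral_def)
  thus ?thesis by (simp add: slice_center_def w_def htangent_def lor_simps)
 qed
 have "fit_error r W B = sphere_integral (\<lambda>\<omega>. r\<^sup>2 *\<^sub>R (w \<omega> * (norm (((\<omega>, 0) - R (B (\<omega>, 0))) + (f (\<omega>, 0) - shift)))\<^sup>2))"
  unfolding fit_error_def
 proof (rule sphere_integral_cong)
  fix \<omega> :: 'a assume \<omega>: "\<omega> \<in> sphere 0 1"
  define dd where "dd = W (\<omega>, 0) - (slice_center W + r *\<^sub>R B (\<omega>, 0))"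
  have Wt: "W (\<omega>, 0) \<in> htangent p" using W_tan[OF slice0(1)[OF \<omega>]] .
  have Bt: "B (\<omega>, 0) \<in> htangent p" using B(2) by blast
  have dt: "dd \<in> htangent p" using Wt Bt ct by (simp add: dd_def htangent_def lor_simps)
  have "R dd = R (X (\<omega>, 0)) - R (slice_center W) - r *\<^sub>R R (B (\<omega>, 0))"
   using W0[OF \<omega>] by (simp add: dd_def linear_diff[OF R_lin] linear_add[OF R_lin] linear_scale[OF R_lin])
  also have "\<dots> = r *\<^sub>R ((a + R (X (\<omega>, 0)) /\<^sub>R r) - (a + R (slice_center W) /\<^sub>R r) - R (B (\<omega>, 0)))"
   using r by (simp add: scaleR_diff_right)
  also have "\<dots> = r *\<^sub>R (((\<omega>, 0) - R (B (\<omega>, 0))) + (f (\<omega>, 0) - shift))"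
   unfolding Z_def[symmetric] shift_def[symmetric] Z0[OF \<omega>] by (simp only: algebra_simps)
  finally have Rd: "R dd = r *\<^sub>R (((\<omega>, 0) - R (B (\<omega>, 0))) + (f (\<omega>, 0) - shift))" .
  have "lor dd dd = (norm (R dd))\<^sup>2" using R_lor[OF dt dt] by (simp add: power2_norm_eq_inner)
  hence "lor dd dd = r\<^sup>2 * (norm (((\<omega>, 0) - R (B (\<omega>, 0))) + (f (\<omega>, 0) - shift)))\<^sup>2"
   unfolding Rd norm_scaleR by (simp add: power_mult_distrib)
  thus "(let d = W (\<omega>, 0) - (slice_center W + r *\<^sub>R B (\<omega>, 0)) in slice_density X (\<omega>, 0) * lor d d)
    = r\<^sup>2 *\<^sub>R (w \<omega> * (norm (((\<omega>, 0) - R (B (\<omega>, 0))) + (f (\<omega>, 0) - shift)))\<^sup>2)"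
   by (simp add: dd_def[symmetric] w_def)
 qed
 thus "fit_error r W B = r\<^sup>2 * sphere_integral (\<lambda>\<omega>. w \<omega> * (norm (((\<omega>, 0) - R (B (\<omega>, 0))) + (f (\<omega>, 0) - shift)))\<^sup>2)"
  unfolding sphere_integral_def by simp
qed

text \<open>The competitor is the best cylinder precomposed with the isometry that undoes its rotation and then
 turns the standard axis into the prescribed one by two reflections.\<close>

lemma rotation_close: "norm ((v, 0) - Q (v, 0)) \<le> 2 * 8 ^ DIM('a) * (3 * (40 * e1 + (\<epsilon> + 2 * d + 2 * \<epsilon>))) * norm v"
proof -
 let ?area = "sphere_area TYPE('a)"
 define q where "q = Q e3"
 have q1: "norm q = 1" using Q_norm[of e3] by (simp add: q_def norm_Pair)
 have qe: "norm (q - e3) \<le> 20 * e1" using axis_close by (simp add: q_def)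
 define Q' where "Q' v = reflect (e3 + q) (reflect e3 v)" for v
 have Q'lin: "linear Q'" unfolding Q'_def using linear_compose[OF reflect_linear reflect_linear] by (simp add: o_def)
 have Q'in: "Q' v \<bullet> Q' u = v \<bullet> u" for u v by (simp add: Q'_def reflect_inner)
 have Q'3: "Q' e3 = q"
 proof -
  have "reflect e3 e3 = - e3" by (simp add: reflect_def inner_prod_def)
  hence "Q' e3 = - reflect (e3 + q) e3" unfolding Q'_def using linear_neg[OF reflect_linear] by metis
  also have "reflect (e3 + q) e3 = - q" by (rule reflect_swap) (simp add: q1 norm_Pair)
  finally show ?thesis by simp
 qed
 have T'small: "norm ((\<omega>, 0) - Q' (\<omega>, 0)) \<le> 40 * e1" if \<omega>: "\<omega> \<in> sphere 0 1" for \<omega>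
 proof -
  define u where "u = e3 + q"
  have "reflect e3 (\<omega>, 0) = (\<omega>, 0)" by (simp add: reflect_def inner_prod_def)
  hence eq: "(\<omega>, 0) - Q' (\<omega>, 0) = (2 * ((\<omega>, 0) \<bullet> u) / (u \<bullet> u)) *\<^sub>R u" by (simp add: Q'_def reflect_def u_def)
  have "2 *\<^sub>R e3 = u - (q - e3)" by (simp add: u_def scaleR_2)
  hence "norm (2 *\<^sub>R e3) \<le> norm u + norm (q - e3)" using norm_triangle_ineq4 by metis
  hence u1: "1 \<le> norm u" using qe e1s by (simp add: norm_Pair)
  have "(\<omega>, 0) \<bullet> u = (\<omega>, 0) \<bullet> (q - e3)" by (simp add: u_def inner_prod_def)
  hence iu: "\<bar>(\<omega>, 0) \<bullet> u\<bar> \<le> 20 * e1"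
   using Cauchy_Schwarz_ineq2[of "(\<omega>, 0)" "q - e3"] qe \<omega> by (simp add: norm_Pair)
  have "norm ((\<omega>, 0) - Q' (\<omega>, 0)) = 2 * \<bar>(\<omega>, 0) \<bullet> u\<bar> / (u \<bullet> u) * norm u" unfolding eq by (simp add: abs_mult)
  also have "\<dots> = 2 * \<bar>(\<omega>, 0) \<bullet> u\<bar> / norm u"
   using u1 by (simp add: power2_norm_eq_inner[symmetric] power2_eq_square)
  also have "\<dots> \<le> 2 * \<bar>(\<omega>, 0) \<bullet> u\<bar> / 1" using u1 by (intro divide_left_mono) auto
  finally show ?thesis using iu by simp
 qed
 obtain Qi where Qi: "orthogonal_transformation Qi" "\<And>v. Q (Qi v) = v" "\<And>v. Qi (Q v) = v"
 proof -
  have "orthogonal_transformation (inv_into UNIV Q)" by (rule orthogonal_transformation_inv[OF Q_orth])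
  moreover have "bij Q" by (rule orthogonal_transformation_bij[OF Q_orth])
  ultimately show ?thesis by (intro that[of "inv_into UNIV Q"]) (auto simp: bij_def surj_f_inv_f inv_into_f_f)
 qed
 define B where "B v = A (Qi (Q' v))" for v
 have RB: "R (B v) = Q' v" for v by (simp add: B_def Q_def[symmetric] Qi)
 have Bl: "linear B"
  unfolding B_def using linear_compose[OF linear_compose[OF Q'lin orthogonal_transformation_linear[OF Qi(1)]] A_frame(1)]
  by (simp add: o_def)
 have Br: "range B \<subseteq> htangent p" using A_frame(2) by (auto simp: B_def)
 have cf: "cylinder_frame p W B"
  unfolding cylinder_frame_def
 proof (intro conjI Bl Br allI)
  show "lor (B v) (B u) = v \<bullet> u" for v u
  proof -
   have "Qi x \<bullet> Qi y = x \<bullet> y" for x y using Qi(1) unfolding orthogonal_transformation_def by blast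
   thus ?thesis by (simp only: B_def A_frame(3) Q'in)
  qed
  have "B e3 = A e3" by (simp add: B_def Q'3 q_def Qi)
  thus "let m = sphere_integral (\<lambda>\<omega>. slice_density X (\<omega>, 0) *\<^sub>R slice_normal_vec X (\<omega>, 0)) in m \<noteq> 0 \<and> B e3 = m /\<^sub>R sqrt (lor m m)"
   using A by (simp add: best_cylinder_def cylinder_frame_def)
 qed
 define E where "E = 40 * e1 + (\<epsilon> + 2 * d + 2 * \<epsilon>)"
 define e2 where "e2 = \<epsilon> + 2 * d + 2 * \<epsilon>"
 have e2: "0 \<le> e2" "e2 \<le> E" "0 \<le> E" using \<epsilon>_nonneg d e1_nonneg by (auto simp: e2_def E_def)
 define g where "g \<omega> = f (\<omega>, 0) - shift" for \<omega>
 have gs: "norm (g \<omega>) \<le> e2" if "\<omega> \<in> sphere 0 1" for \<omega>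
  using norm_triangle_ineq4[of "f (\<omega>, 0)" shift] f_small[OF slice0(1)[OF that]] shift_small by (simp add: g_def e2_def)
 let ?e = "\<lambda>Q \<omega>. w \<omega> * (norm (((\<omega>, 0) - Q (\<omega>, 0)) + g \<omega>))\<^sup>2"
 have "fit_error r W A \<le> fit_error r W B" using A cf by (simp add: best_cylinder_def)
 hence le: "sphere_integral (?e Q)
   \<le> sphere_integral (?e Q')"
  using fit_error_eq(1)[OF A_frame(1,2)] fit_error_eq(1)[OF Bl Br] r by (simp add: RB Q_def g_def)
 have c1: "continuous_on (sphere 0 1) (?e Q)"
  and c2: "continuous_on (sphere 0 1) (?e Q')"
  using fit_error_eq(2)[OF A_frame(1,2)] fit_error_eq(2)[OF Bl Br] by (simp_all add: RB Q_def g_def)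
 have up: "sphere_integral (?e Q') \<le> ((1 + d) * \<rho> * E\<^sup>2) * ?area"
  unfolding sphere_integral_const[symmetric]
 proof (rule sphere_integral_mono[OF sphere_integrable[OF c2] sphere_integrable[OF continuous_on_const]])
  fix \<omega> :: 'a assume \<omega>: "\<omega> \<in> sphere 0 1"
  have "norm (((\<omega>, 0) - Q' (\<omega>, 0)) + g \<omega>) \<le> E"
   using norm_triangle_ineq[of "(\<omega>, 0) - Q' (\<omega>, 0)" "g \<omega>"] T'small[OF \<omega>] gs[OF \<omega>] by (simp add: E_def e2_def)
  hence "(norm (((\<omega>, 0) - Q' (\<omega>, 0)) + g \<omega>))\<^sup>2 \<le> E\<^sup>2" by (intro power_mono) auto
  thus "w \<omega> * (norm (((\<omega>, 0) - Q' (\<omega>, 0)) + g \<omega>))\<^sup>2 \<le> (1 + d) * \<rho> * E\<^sup>2"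
   using w_upper[OF \<omega>] w_pos[OF \<omega>] d \<rho>_pos by (intro mult_mono) auto
 qed
 define T where "T v = (v, 0::real) - Q (v, 0)" for v :: 'a
 have Tl: "linear T"
 proof -
  have i: "linear (\<lambda>v::'a. (v, 0::real))" by (rule linearI) auto
  show ?thesis unfolding T_def using linear_compose_sub[OF i linear_compose[OF i Q_lin]] by (simp add: o_def)
 qed
 have cT: "continuous_on (sphere 0 1) (\<lambda>\<omega>. (norm (T \<omega>))\<^sup>2)"
  using Tl linear_conv_bounded_linear linear_continuous_on by (intro continuous_intros) blast
 let ?I = "sphere_integral (\<lambda>\<omega>. (norm (T \<omega>))\<^sup>2)"
 have "sphere_integral (\<lambda>\<omega>. (1 - d) * \<rho> * ((norm (T \<omega>))\<^sup>2 / 2 - e2\<^sup>2)) \<le> sphere_integral (?e Q)"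
 proof (rule sphere_integral_mono[OF sphere_integrable sphere_integrable[OF c1]])
  show "continuous_on (sphere 0 1) (\<lambda>\<omega>. (1 - d) * \<rho> * ((norm (T \<omega>))\<^sup>2 / 2 - e2\<^sup>2))"
   by (intro continuous_intros cT) simp
  fix \<omega> :: 'a assume \<omega>: "\<omega> \<in> sphere 0 1"
  define x y where "x = norm (T \<omega> + g \<omega>)" and "y = norm (g \<omega>)"
  have "norm (T \<omega>) \<le> x + y" using norm_triangle_ineq4[of "T \<omega> + g \<omega>" "g \<omega>"] by (simp add: x_def y_def)
  hence "(norm (T \<omega>))\<^sup>2 \<le> (x + y)\<^sup>2" by (intro power_mono) auto
  also have "\<dots> \<le> 2 * x\<^sup>2 + 2 * y\<^sup>2" using sum_squares_ge_zero[of "x - y" 0] by (simp add: power2_eq_square algebra_simps)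
  finally have 1: "(norm (T \<omega>))\<^sup>2 \<le> 2 * x\<^sup>2 + 2 * y\<^sup>2" .
  have "y\<^sup>2 \<le> e2\<^sup>2" using gs[OF \<omega>] by (intro power_mono) (auto simp: y_def)
  hence 2: "(norm (T \<omega>))\<^sup>2 / 2 - e2\<^sup>2 \<le> x\<^sup>2" using 1 by simp
  have "(1 - d) * \<rho> * ((norm (T \<omega>))\<^sup>2 / 2 - e2\<^sup>2) \<le> (1 - d) * \<rho> * x\<^sup>2"
   using 2 d \<rho>_pos by (intro mult_left_mono) auto
  also have "\<dots> \<le> w \<omega> * x\<^sup>2" using w_lower[OF \<omega>] by (intro mult_right_mono) auto
  finally show "(1 - d) * \<rho> * ((norm (T \<omega>))\<^sup>2 / 2 - e2\<^sup>2) \<le> w \<omega> * (norm (((\<omega>, 0) - Q (\<omega>, 0)) + g \<omega>))\<^sup>2"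
   by (simp add: x_def T_def)
 qed
 also have "sphere_integral (\<lambda>\<omega>. (1 - d) * \<rho> * ((norm (T \<omega>))\<^sup>2 / 2 - e2\<^sup>2))
   = (1 - d) * \<rho> * (?I / 2 - e2\<^sup>2 * ?area)"
 proof -
  have 1: "sphere_integral (\<lambda>\<omega>. (norm (T \<omega>))\<^sup>2 / 2 + - (e2\<^sup>2)) = sphere_integral (\<lambda>\<omega>. (norm (T \<omega>))\<^sup>2 / 2) + sphere_integral (\<lambda>\<omega>::'a. - (e2\<^sup>2))"
   by (rule sphere_integral_add[OF _ continuous_on_const]) (intro continuous_intros cT, simp)
  have 2: "sphere_integral (\<lambda>\<omega>. c *\<^sub>R h \<omega>) = c *\<^sub>R sphere_integral h" for c and h :: "'a => real"
   unfolding sphere_integral_def by simp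
  show ?thesis using 1 2[of "(1 - d) * \<rho>" "\<lambda>\<omega>. (norm (T \<omega>))\<^sup>2 / 2 + - (e2\<^sup>2)"] 2[of "1/2" "\<lambda>\<omega>. (norm (T \<omega>))\<^sup>2"]
   by (simp add: sphere_integral_const)
 qed
 finally have "(1 - d) * \<rho> * (?I / 2 - e2\<^sup>2 * ?area) \<le> ((1 + d) * \<rho> * E\<^sup>2) * ?area"
  using le up by linarith
 hence "\<rho> * ((1 - d) * (?I / 2 - e2\<^sup>2 * ?area)) \<le> \<rho> * ((1 + d) * (E\<^sup>2 * ?area))"
  by (simp only: mult_ac)
 hence k: "(1 - d) * (?I / 2 - e2\<^sup>2 * ?area) \<le> (1 + d) * (E\<^sup>2 * ?area)"
  using \<rho>_pos by (simp only: mult_le_cancel_left_pos)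
 have "(1 + d) * (E\<^sup>2 * ?area) \<le> ((1 - d) * 2) * (E\<^sup>2 * ?area)"
  using d sphere_area_pos[where 'a = 'a] by (intro mult_right_mono) auto
 hence "(1 - d) * (?I / 2 - e2\<^sup>2 * ?area) \<le> (1 - d) * (2 * (E\<^sup>2 * ?area))"
  using k by linarith
 hence "?I / 2 - e2\<^sup>2 * ?area \<le> 2 * (E\<^sup>2 * ?area)"
  using d by (simp only: mult_le_cancel_left_pos)
 moreover have "e2\<^sup>2 * ?area \<le> E\<^sup>2 * ?area" using e2 sphere_area_pos[where 'a = 'a] by (intro mult_right_mono power_mono) auto
 moreover have "0 \<le> E\<^sup>2 * ?area" using sphere_area_pos[where 'a = 'a] by simp
 ultimately have "?I \<le> (3 * E)\<^sup>2 * ?area" unfolding power_mult_distrib by simp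
 from mean_square_bound[OF Tl this, of v] show ?thesis using e2 by (simp add: T_def E_def)
qed

end

end

end

section \<open>The neck in disc coordinates\<close>

lemma hlog_self:
 assumes p: "p \<in> hyp" shows "hlog p p = 0"
proof -
 define v where "v = hlog p p"
 have v: "v \<in> htangent p" "hexp p v = p" using hlog_exp[OF p p] by (auto simp: v_def)
 have "cosh (sqrt (lor v v)) = 1" using hexp_lor[OF p v(1)] v(2) hyp_D(3)[OF p] by simp
 hence "lor v v = 0" by simp
 thus ?thesis using lor_pos[OF p, of v] v(1) lor_commute[of v p] by (auto simp: htangent_def v_def)
qed

text \<open>The neck is given as a smooth map into the hyperboloid; smoothness of its preimage in the tangent
 space follows from \<open>exp0_regularity\<close>.\<close>

lemma neck_chart_of_neck:
 fixes N :: "'a::euclidean_space \<times> real => ('a \<times> real) \<times> real"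
 assumes im: "immersed_cylinder L N \<nu>" and nk: "neck_at \<omega>\<^sub>0 \<epsilon> k L r N" and k: "3 \<le> k" and L: "40 \<le> L"
  and un: "unit_normal_field lor (cyl L) cyl_tangent (\<lambda>_. htangent (N (\<omega>\<^sub>0, 0)))
    (radial (\<lambda>x. hlog (N (\<omega>\<^sub>0, 0)) (N x))) (radial \<nu>')"
 obtains R a where "neck_chart R (N (\<omega>\<^sub>0, 0)) (\<lambda>x. hlog (N (\<omega>\<^sub>0, 0)) (N x)) a r \<epsilon> L" "norm a \<le> 1 + \<epsilon>"
proof -
 define p where "p = N (\<omega>\<^sub>0, 0)"
 define W where "W = (\<lambda>x. hlog p (N x))"
 obtain R a where \<omega>0: "\<omega>\<^sub>0 \<in> sphere 0 1" and r: "0 < r" and R: "linear R" "\<forall>v\<in>htangent p. \<forall>w\<in>htangent p. R v \<bullet> R w = lor v w"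
  and b: "\<forall>x\<in>cyl L. \<forall>vs. length vs \<le> k \<and> (\<forall>v\<in>set vs. norm v \<le> 1) -->
      norm (iter_D (radial (\<lambda>x. a + R (hlog p (N x) /\<^sub>R r) - x)) vs x) \<le> \<epsilon>"
  using nk unfolding neck_at_def Let_def p_def[symmetric] by blast
 have c0: "(\<omega>\<^sub>0, 0) \<in> cyl L" using \<omega>0 L by (simp add: cyl_def)
 have Nh: "N x \<in> hyp" if "x \<in> cyl L" for x using im that unfolding immersed_cylinder_def by blast
 have p: "p \<in> hyp" using Nh[OF c0] by (simp add: p_def)
 have iso: "tangent_isometry R p" using p R by (simp add: tangent_isometry_def)
 have Wt: "W x \<in> htangent p" and We: "hexp p (W x) = N x" if "x \<in> cyl L" for x
  using hlog_exp[OF p Nh[OF that]] by (auto simp: W_def)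
 have cm: "cylmap x \<in> cyl L" if "x \<in> punctured L" for x :: "'a \<times> real"
  using that by (auto simp: cylmap_def cyl_def punctured_def)
 have rad: "radial h x = h (cylmap x)" for h :: "'a \<times> real => 'z" and x by (simp add: radial_def cylmap_def case_prod_beta)
 have X_diff: "radial W differentiable (at x)" if x: "x \<in> punctured L" for x
 proof -
  \<comment> \<open>Radial maps are invariant under scaling of the first factor.\<close>
  define c where "c = inverse (norm (fst x))"
  have c: "c > 0" using x by (auto simp: punctured_def c_def)
  define S where "S y = (c *\<^sub>R fst y, snd y)" for y :: "'a \<times> real"
  have "bounded_linear S" unfolding S_def
   by (intro bounded_linear_Pair bounded_linear_compose[OF bounded_linear_scaleR_right bounded_linear_fst] bounded_linear_snd)
  hence dS: "S differentiable (at x)" by (rule bounded_linear_imp_differentiable)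
  have Sx: "S x = cylmap x" by (simp add: S_def cylmap_def c_def)
  have "radial W differentiable (at (S x))"
   using un cm[OF x] unfolding unit_normal_field_def Sx W_def p_def by blast
  from D_compose(2)[OF dS this] have "(\<lambda>y. radial W (S y)) differentiable (at x)" .
  moreover have "radial W (S y) = radial W y" for y
  proof -
   have "cylmap (S y) = cylmap y" using c by (simp add: cylmap_def S_def)
   thus ?thesis by (simp add: rad)
  qed
  ultimately show ?thesis by simp
 qed
 have lc: "bounded_linear (lchart R p)" using lchart_linear[OF iso] linear_conv_bounded_linear by blast
 have bR: "bounded_linear R" using R(1) linear_conv_bounded_linear by blast
 have V: "Ck j (punctured L) (\<lambda>x. R (radial W x))" for j
 proof (rule exp0_regularity[OF open_punctured])
  show "(\<lambda>x. R (radial W x)) differentiable (at x)" if "x \<in> punctured L" for x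
   by (rule D_bounded_linear(2)[OF bR X_diff[OF that]])
  have "smooth_on (punctured L) (radial N)" using im unfolding immersed_cylinder_def punctured_def by blast
  hence "Ck j (punctured L) (\<lambda>x. fst (lchart R p (radial N x)))"
   by (intro Ck_fst[OF open_punctured] Ck_blin[OF open_punctured lc] smooth_on_Ck)
  moreover have "fst (lchart R p (radial N x)) = exp0 (R (radial W x))" if "x \<in> punctured L" for x
   using lchart_hexp[OF iso Wt[OF cm[OF that]]] We[OF cm[OF that]] by (simp add: rad)
  ultimately show "Ck j (punctured L) (\<lambda>x. exp0 (R (radial W x)))"
   by (rule Ck_cong[OF open_punctured])
 qed
 have "neck_chart R p W a r \<epsilon> L"
 proof (unfold_locales)
  show "bd 3 (\<lambda>x. a + R (radial W x) /\<^sub>R r - cylmap x) x \<epsilon>" if x: "x \<in> cyl L" for x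
  proof (rule bd_iter_D)
   fix vs :: "('a \<times> real) list" assume vs: "length vs \<le> 3" "set vs \<subseteq> Basis"
   have "norm (iter_D (radial (\<lambda>x. a + R (hlog p (N x) /\<^sub>R r) - x)) vs x) \<le> \<epsilon>"
   proof (rule b[rule_format, OF x])
    have "length vs \<le> k" using vs(1) k by linarith
    moreover have "norm v \<le> 1" if "v \<in> set vs" for v using that vs(2) norm_Basis[of v] by auto
    ultimately show "length vs \<le> k \<and> (\<forall>v\<in>set vs. norm v \<le> 1)" by blast
   qed
   moreover have "radial (\<lambda>x. a + R (hlog p (N x) /\<^sub>R r) - x) = (\<lambda>x. a + R (radial W x) /\<^sub>R r - cylmap x)"
    by (rule ext) (simp add: rad W_def linear_scale[OF R(1)])
   ultimately show "norm (iter_D (\<lambda>x. a + R (radial W x) /\<^sub>R r - cylmap x) vs x) \<le> \<epsilon>" by simp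
  qed
 qed (use iso r L Wt X_diff V in auto)
 moreover have "norm a \<le> 1 + \<epsilon>"
 proof -
  have "norm (iter_D (radial (\<lambda>x. a + R (hlog p (N x) /\<^sub>R r) - x)) [] (\<omega>\<^sub>0, 0)) \<le> \<epsilon>"
   by (rule b[rule_format, OF c0]) simp
  hence "norm (a - (\<omega>\<^sub>0, 0)) \<le> \<epsilon>"
   using hlog_self[OF p] \<omega>0 linear_0[OF R(1)] by (simp add: rad cylmap_def p_def[symmetric])
  thus ?thesis using norm_triangle_sub[of a "(\<omega>\<^sub>0, 0)"] \<omega>0 by (simp add: norm_Pair)
 qed
 ultimately show thesis using that by (simp add: p_def W_def)
qed

lemma transversal_of_normal:
 assumes n: "norm n = 1" and o: "\<And>v. n \<bullet> D U y v = 0" and c: "0 \<le> c" "c \<le> 1" "\<And>v. c * norm v \<le> norm (D U y v)"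
 shows "transversal c U y n"
 unfolding transversal_def
proof (intro conjI allI n)
 fix v t
 have "(norm (D U y v + t *\<^sub>R n))\<^sup>2 = (norm (D U y v))\<^sup>2 + t\<^sup>2"
 proof -
  have o': "D U y v \<bullet> n = 0" using o[of v] by (subst inner_commute)
  have "n \<bullet> n = 1" using n by (simp add: norm_eq_1)
  thus ?thesis unfolding power2_norm_eq_inner inner_add_left inner_add_right inner_scaleR_left inner_scaleR_right
    o o' by (simp add: power2_eq_square)
 qed
 moreover have "(c * norm v)\<^sup>2 \<le> (norm (D U y v))\<^sup>2" using c(3)[of v] c(1) by (intro power_mono) auto
 moreover have "c\<^sup>2 * t\<^sup>2 \<le> 1 * t\<^sup>2" using c by (intro mult_right_mono) (auto simp: power_le_one)
 ultimately have "(c * norm (v, t))\<^sup>2 \<le> (norm (D U y v + t *\<^sub>R n))\<^sup>2"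
  by (simp add: norm_Pair power_mult_distrib distrib_left)
 thus "c * norm (v, t) \<le> norm (D U y v + t *\<^sub>R n)" by (rule power2_le_imp_le) simp
qed

lemma bd_Basis_expand:
 fixes \<zeta> :: "'b::euclidean_space" and Y :: "'a::euclidean_space => 'b"
 assumes "Y differentiable (at y)" "\<And>b. b \<in> Basis ==> \<bar>\<zeta> \<bullet> D Y y b\<bar> \<le> \<alpha>"
 shows "\<bar>\<zeta> \<bullet> D Y y v\<bar> \<le> real DIM('a) * \<alpha> * norm v"
proof -
 have "\<zeta> \<bullet> D Y y v = (\<Sum>b\<in>Basis. (v \<bullet> b) * (\<zeta> \<bullet> D Y y b))"
  unfolding D_expand[OF assms(1), of v] by (simp add: inner_sum_right)
 also have "\<bar>\<dots>\<bar> \<le> (\<Sum>b\<in>(Basis::'a set). norm v * \<alpha>)"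
 proof (rule order_trans[OF sum_abs], rule sum_mono)
  fix b :: 'a assume b: "b \<in> Basis"
  show "\<bar>(v \<bullet> b) * (\<zeta> \<bullet> D Y y b)\<bar> \<le> norm v * \<alpha>"
   unfolding abs_mult using assms(2)[OF b] Basis_le_norm[OF b, of v] by (intro mult_mono) auto
 qed
 finally show ?thesis by (simp add: mult_ac)
qed

text \<open>Derivatives of a unit normal field solve linear systems whose coefficients are the tangent frame
 and the normal itself. This yields both its smoothness and bounds for it.\<close>

lemma unit_normal_bounds:
 fixes Y \<mu> :: "'a::euclidean_space => 'a \<times> real"
 assumes S: "open S" and Y: "\<And>k. Ck k S Y" and d\<mu>: "\<And>z. z \<in> S ==> \<mu> differentiable (at z)"
  and u: "\<And>z. z \<in> S ==> \<mu> z \<bullet> \<mu> z = 1" and o: "\<And>z v. z \<in> S ==> \<mu> z \<bullet> D Y z v = 0"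
  and c: "0 < c" "c \<le> 1" "\<And>z v. z \<in> S ==> c * norm v \<le> norm (D Y z v)"
 shows "Ck k S \<mu>"
  and "y \<in> S ==> bd 3 Y y M ==> 1 \<le> M ==> K1 = real DIM('a) * M / c ==>
   bd 2 \<mu> y (1 + K1 + (real DIM('a) * (2 * K1 * M + M) + K1\<^sup>2) / c)"
proof -
 have dY: "Y differentiable (at z)" if "z \<in> S" for z using Y[of 1] that by simp
 have tr: "transversal c Y z (\<mu> z)" if z: "z \<in> S" for z
  by (rule transversal_of_normal) (use u[OF z] o[OF z] c z in \<open>auto simp: norm_eq_1\<close>)
 have dual: "norm \<zeta> \<le> (real DIM('a) * \<alpha> + \<beta>) / c"
  if "z \<in> S" "\<And>b. b \<in> Basis ==> \<bar>\<zeta> \<bullet> D Y z b\<bar> \<le> \<alpha>" "\<bar>\<zeta> \<bullet> \<mu> z\<bar> \<le> \<beta>" "0 \<le> \<alpha>" for z \<zeta> \<alpha> \<beta>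
  by (rule transversal_dual[OF tr[OF that(1)] c(1) dY[OF that(1)] bd_Basis_expand[OF dY[OF that(1)] that(2)] that(3)])
   (use that in auto)
 have eq1: "D \<mu> z b \<bullet> D Y z b' = - (\<mu> z \<bullet> D2 Y b' z b)" if z: "z \<in> S" for z b b'
 proof -
  have "(\<lambda>z. D Y z b') differentiable (at z)" using Ck2_differentiable(2)[OF S Y z] .
  from D_bilinear(1)[OF bounded_bilinear_inner d\<mu>[OF z] this, of b]
  show ?thesis using D_cong[OF S z, of "\<lambda>z. \<mu> z \<bullet> D Y z b'" "\<lambda>_. 0"] o by simp
 qed
 have eq2: "D \<mu> z b \<bullet> \<mu> z = 0" if z: "z \<in> S" for z b
  using D_bilinear(1)[OF bounded_bilinear_inner d\<mu>[OF z] d\<mu>[OF z], of b]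
   D_cong[OF S z, of "\<lambda>z. \<mu> z \<bullet> \<mu> z" "\<lambda>_. 1"] u by (simp add: inner_commute)
 show Ck: "Ck k S \<mu>" for k
 proof (induction k)
  case (Suc k)
  have "Ck k S (\<lambda>z. D \<mu> z b)" if b: "b \<in> Basis" for b
  proof (rule solve_Ck[where J = "insert None (Some ` Basis)"
     and q = "\<lambda>j z. case j of None => \<mu> z | Some b' => D Y z b'"
     and \<rho> = "\<lambda>j z. case j of None => 0 | Some b' => - (\<mu> z \<bullet> D2 Y b' z b)"])
   show "finite (insert None (Some ` (Basis :: 'a set)))" by simp
   show "open S" by (rule S)
   show "Ck k S (\<lambda>z. case j of None => \<mu> z | Some b' => D Y z b')" for j
    using Suc Ck_D[OF S Y] by (cases j) auto
   show "Ck k S (\<lambda>z. case j of None => 0 | Some b' => - (\<mu> z \<bullet> D2 Y b' z b))" for j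
   proof (cases j)
    case (Some b')
    have "Ck k S (\<lambda>z. - (\<mu> z \<bullet> D2 Y b' z b))"
     by (intro Ck_uminus[OF S] Ck_inner[OF S Suc] Ck_D[OF S Ck_D[OF S Y]])
    thus ?thesis using Some by simp
   qed (simp add: Ck_const)
   show "D \<mu> z b \<bullet> (case j of None => \<mu> z | Some b' => D Y z b')
     = (case j of None => 0 | Some b' => - (\<mu> z \<bullet> D2 Y b' z b))" if "z \<in> S" for z j
    using eq1[OF that] eq2[OF that] by (cases j) auto
   show "\<zeta> = 0" if z: "z \<in> S" and 0: "\<And>j. j \<in> insert None (Some ` Basis) ==> \<zeta> \<bullet> (case j of None => \<mu> z | Some b' => D Y z b') = 0" for z \<zeta>
   proof -
    have "\<zeta> \<bullet> D Y z b = 0" if "b \<in> Basis" for b using 0[of "Some b"] that by simp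
    moreover have "\<zeta> \<bullet> \<mu> z = 0" using 0[of None] by simp
    ultimately have "norm \<zeta> \<le> (real DIM('a) * 0 + 0) / c" by (intro dual[OF z]) auto
    thus ?thesis by simp
   qed
  qed
  thus ?case using d\<mu> by simp
 qed simp
 assume y: "y \<in> S" and Yb: "bd 3 Y y M" and M: "1 \<le> M" and K1: "K1 = real DIM('a) * M / c"
 have Y2: "norm (D2 Y b' y b) \<le> M" if "b \<in> Basis" "b' \<in> Basis" for b b'
  using Yb that by (auto simp: numeral_3_eq_3 dest: bd_norm)
 have Y3: "norm (D (\<lambda>z. D (\<lambda>z. D Y z b') z b) y b'') \<le> M" if "b \<in> Basis" "b' \<in> Basis" "b'' \<in> Basis" for b b' b''
  using Yb that by (auto simp: numeral_3_eq_3)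
 have n\<mu>: "norm (\<mu> y) = 1" using u[OF y] by (simp add: norm_eq_1)
 have K10: "0 \<le> K1" using M c by (simp add: K1)
 have m1: "norm (D \<mu> y b) \<le> K1" if b: "b \<in> Basis" for b
 proof -
  have "norm (D \<mu> y b) \<le> (real DIM('a) * M + 0) / c"
  proof (rule dual[OF y])
   show "\<bar>D \<mu> y b \<bullet> D Y y b'\<bar> \<le> M" if "b' \<in> Basis" for b'
    using Cauchy_Schwarz_ineq2[of "\<mu> y" "D2 Y b' y b"] Y2[OF b that] n\<mu> unfolding eq1[OF y] by simp
  qed (use eq2[OF y] M in auto)
  thus ?thesis by (simp add: K1)
 qed
 have m2: "norm (D2 \<mu> b y b'') \<le> (real DIM('a) * (2 * K1 * M + M) + K1\<^sup>2) / c" if b: "b \<in> Basis" "b'' \<in> Basis" for b b''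
 proof -
  have ddm: "(\<lambda>z. D \<mu> z b) differentiable (at y)" using Ck2_differentiable(2)[OF S Ck y] .
  have "\<bar>D (\<lambda>z. D \<mu> z b) y b'' \<bullet> D Y y b'\<bar> \<le> 2 * K1 * M + M" if b': "b' \<in> Basis" for b'
  proof -
   have ddY: "(\<lambda>z. D Y z b') differentiable (at y)" using Ck2_differentiable(2)[OF S Y y] .
   have "Ck 2 S (\<lambda>z. D Y z b')" using Ck_D[OF S Y] by blast
   hence d3Y: "(\<lambda>z. D2 Y b' z b) differentiable (at y)" using Ck2_differentiable(2)[OF S _ y] by blast
   have "D (\<lambda>z. D \<mu> z b \<bullet> D Y z b') y b'' = D (\<lambda>z. - (\<mu> z \<bullet> D2 Y b' z b)) y b''"
    using D_cong[OF S y, of "\<lambda>z. D \<mu> z b \<bullet> D Y z b'" "\<lambda>z. - (\<mu> z \<bullet> D2 Y b' z b)"] eq1 by simp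
   also have "\<dots> = - (\<mu> y \<bullet> D (\<lambda>z. D (\<lambda>z. D Y z b') z b) y b'' + D \<mu> y b'' \<bullet> D2 Y b' y b)"
    using D_bounded_linear(1)[OF bounded_linear_minus[OF bounded_linear_ident] D_bilinear(2)[OF bounded_bilinear_inner d\<mu>[OF y] d3Y]]
     D_bilinear(1)[OF bounded_bilinear_inner d\<mu>[OF y] d3Y, of b''] by simp
   finally have "D2 \<mu> b y b'' \<bullet> D Y y b' = - (D \<mu> y b \<bullet> D2 Y b' y b'')
     - (\<mu> y \<bullet> D (\<lambda>z. D (\<lambda>z. D Y z b') z b) y b'' + D \<mu> y b'' \<bullet> D2 Y b' y b)"
    using D_bilinear(1)[OF bounded_bilinear_inner ddm ddY, of b''] by simp
   moreover have "\<bar>D \<mu> y b \<bullet> D2 Y b' y b''\<bar> \<le> K1 * M" "\<bar>D \<mu> y b'' \<bullet> D2 Y b' y b\<bar> \<le> K1 * M"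
    using Cauchy_Schwarz_ineq2[of "D \<mu> y b" "D2 Y b' y b''"] Cauchy_Schwarz_ineq2[of "D \<mu> y b''" "D2 Y b' y b"]
     mult_mono[OF m1[OF b(1)] Y2[OF b(2) b']] mult_mono[OF m1[OF b(2)] Y2[OF b(1) b']] K10 by auto
   moreover have "\<bar>\<mu> y \<bullet> D (\<lambda>z. D (\<lambda>z. D Y z b') z b) y b''\<bar> \<le> M"
    using Cauchy_Schwarz_ineq2[of "\<mu> y" "D (\<lambda>z. D (\<lambda>z. D Y z b') z b) y b''"] Y3[OF b(1) b' b(2)] n\<mu> by simp
   ultimately show ?thesis by linarith
  qed
  moreover have "\<bar>D (\<lambda>z. D \<mu> z b) y b'' \<bullet> \<mu> y\<bar> \<le> K1\<^sup>2"
  proof -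
   have "D2 \<mu> b y b'' \<bullet> \<mu> y = - (D \<mu> y b \<bullet> D \<mu> y b'')"
    using D_bilinear(1)[OF bounded_bilinear_inner ddm d\<mu>[OF y], of b'']
     D_cong[OF S y, of "\<lambda>z. D \<mu> z b \<bullet> \<mu> z" "\<lambda>_. 0"] eq2 by simp
   thus ?thesis
    using Cauchy_Schwarz_ineq2[of "D \<mu> y b" "D \<mu> y b''"] mult_mono[OF m1[OF b(1)] m1[OF b(2)]] K10 by (simp add: power2_eq_square)
  qed
  ultimately show ?thesis using K10 M by (intro dual[OF y]) auto
 qed
 define K2 where "K2 = (real DIM('a) * (2 * K1 * M + M) + K1\<^sup>2) / c"
 have "0 \<le> K2" using K10 M c by (simp add: K2_def)
 hence "norm (\<mu> y) \<le> 1 + K1 + K2" "\<And>b. b \<in> Basis ==> norm (D \<mu> y b) \<le> 1 + K1 + K2"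
  "\<And>b b''. b \<in> Basis ==> b'' \<in> Basis ==> norm (D2 \<mu> b y b'') \<le> 1 + K1 + K2"
  using n\<mu> K10 m1 m2 by (force simp: K2_def)+
 thus "bd 2 \<mu> y (1 + K1 + (real DIM('a) * (2 * K1 * M + M) + K1\<^sup>2) / c)"
  by (simp add: numeral_2_eq_2 K2_def)
qed

text \<open>The standard cylinder in the disc coordinate of the half with \<open>\<sigma> * s > 0\<close>.\<close>

definition neckmap :: "real => 'a::euclidean_space => 'a \<times> real" where
 "neckmap \<sigma> y = (y /\<^sub>R norm y, \<sigma> * norm y)"

lemma neckmap_Ck: "Ck k (- {0}) (neckmap \<sigma>)"
proof -
 have o: "open (- {0::'a})" by (simp add: open_Compl)
 show ?thesis unfolding neckmap_def[abs_def]
  by (intro Ck_Pair[OF o Ck_unit] Ck_mult[OF o Ck_const Ck_norm])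
qed

lemma neckmap_D:
 fixes y :: "'a::euclidean_space"
 assumes "y \<noteq> 0" defines "u \<equiv> y /\<^sub>R norm y"
 shows "D (neckmap \<sigma>) y v = ((v - (v \<bullet> u) *\<^sub>R u) /\<^sub>R norm y, \<sigma> * (v \<bullet> u))"
proof -
 have n: "(norm has_derivative (\<lambda>v. v \<bullet> (y /\<^sub>R norm y))) (at y)"
  using has_derivative_norm[OF assms(1)] by (simp add: sgn_div_norm)
 show ?thesis
  using D_eq[OF has_derivative_Pair[OF unit_derivative[OF assms(1)] has_derivative_mult_right[OF n, of \<sigma>]]]
  by (simp add: neckmap_def[abs_def] u_def)
qed

lemma bd2_real:
 fixes g g' :: "real => real"
 assumes "open S" "z \<in> S" "\<And>x. x \<in> S ==> (g has_real_derivative g' x) (at x)" "(g' has_real_derivative g'') (at z)"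
  and "\<bar>g z\<bar> \<le> M" "\<bar>g' z\<bar> \<le> M" "\<bar>g''\<bar> \<le> M"
 shows "bd 2 g z M"
proof -
 have d: "D g x 1 = g' x" if "x \<in> S" for x
  using D_eq[OF assms(3)[OF that, unfolded has_field_derivative_def]] by simp
 have "D2 g 1 z 1 = D g' z 1" using D_cong[OF assms(1,2), of "\<lambda>x. D g x 1" g'] d by simp
 also have "\<dots> = g''" using D_eq[OF assms(4)[unfolded has_field_derivative_def]] by simp
 finally show ?thesis using assms d by (simp add: numeral_2_eq_2)
qed

lemma exp_neg_power:
 fixes x :: real assumes "0 \<le> x"
 shows "x ^ 2 * exp (- x) \<le> 4" "x ^ 3 * exp (- x) \<le> 27" "x ^ 4 * exp (- x) \<le> 256"
proof -
 have *: "x ^ n * exp (- x) \<le> real n ^ n" if n: "0 < n" for n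
 proof -
  have "x / n \<le> exp (x / n)" using exp_ge_add_one_self[of "x / n"] by linarith
  hence "(x / n) ^ n \<le> exp (x / n) ^ n" using assms by (intro power_mono) auto
  also have "\<dots> = exp x" using n by (simp add: exp_of_nat_mult[symmetric])
  finally have "x ^ n \<le> exp x * real n ^ n" using n by (simp add: power_divide pos_divide_le_eq)
  hence "x ^ n * exp (- x) \<le> (exp x * real n ^ n) * exp (- x)" by (intro mult_right_mono) auto
  also have "\<dots> = real n ^ n" by (simp add: exp_minus)
  finally show ?thesis .
 qed
 show "x ^ 2 * exp (- x) \<le> 4" "x ^ 3 * exp (- x) \<le> 27" "x ^ 4 * exp (- x) \<le> 256" using *[of 2] *[of 3] *[of 4] by simp_all
qed

text \<open>The bending function is flat at \<open>z = 10\<close>, so its derivatives stay bounded there.\<close>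

lemma bend_bd:
 assumes B: "1 \<le> B" and z: "10 < z"
 shows "bd 2 (bend B) z 310" and "Ck k {10<..} (bend B)" and "0 \<le> bend B z" "bend B z \<le> 1"
proof -
 have o: "open ({10<..} :: real set)" by simp
 have e: "bend B x = exp (- (B * inverse (x - 10)))" if "x \<in> {10<..}" for x
  using that by (simp add: bend_def divide_inverse)
 have dx: "Ck k {10<..} (\<lambda>x::real. x - 10)"
  by (rule Ck_diff_fun[OF o Ck_of_linear[OF bounded_linear_ident] Ck_const])
 have "Ck k {10<..} (\<lambda>x. exp (- (B * inverse (x - 10))))"
  by (rule Ck_compose[OF o Ck_uminus[OF o Ck_mult[OF o Ck_const Ck_inv_compose[OF o dx]]] Ck_exp]) auto
 thus "Ck k {10<..} (bend B)" by (rule Ck_cong[OF o]) (simp add: e)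
 show "0 \<le> bend B z" "bend B z \<le> 1" using z B by (auto simp: bend_def)
 define g' where "g' x = exp (- (B * inverse (x - 10))) * (B * (inverse (x - 10))\<^sup>2)" for x
 have 1: "((\<lambda>x. exp (- (B * inverse (x - 10)))) has_real_derivative g' x) (at x)" if "x \<in> {10<..}" for x
  using that unfolding g'_def by (auto intro!: derivative_eq_intros simp: power2_eq_square)
 have 2: "(bend B has_real_derivative g' x) (at x)" if "x \<in> {10<..}" for x
  using has_field_derivative_transform_within_open[OF 1[OF that] o that] e by simp
 have 3: "(g' has_real_derivative exp (- (B * inverse (z - 10))) * (B * (inverse (z - 10))\<^sup>2) * (B * (inverse (z - 10))\<^sup>2)
   - exp (- (B * inverse (z - 10))) * (2 * B * (inverse (z - 10)) ^ 3)) (at z)"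
  unfolding g'_def using z by (auto intro!: derivative_eq_intros simp: power2_eq_square power3_eq_cube algebra_simps)
 define x where "x = B * inverse (z - 10)"
 have x: "0 \<le> x" using B z by (simp add: x_def)
 have iz: "inverse (z - 10) = x / B" using B by (simp add: x_def)
 note P = exp_neg_power[OF x]
 have BB: "1 \<le> B\<^sup>2" using B by (simp add: one_le_power)
 show "bd 2 (bend B) z 310"
 proof (rule bd2_real[OF o _ 2 3])
  show "\<bar>bend B z\<bar> \<le> 310" using e[of z] z x by (simp add: x_def[symmetric]) (smt (verit) exp_le_one_iff)
  have "g' z = (x ^ 2 * exp (- x)) / B" unfolding g'_def x_def[symmetric] iz using B by (simp add: power2_eq_square)
  moreover have "\<bar>(x ^ 2 * exp (- x)) / B\<bar> \<le> 4"
  proof -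
   have "(x ^ 2 * exp (- x)) / B \<le> (x ^ 2 * exp (- x)) / 1" using B by (intro divide_left_mono) auto
   thus ?thesis using P(1) B by simp
  qed
  ultimately show "\<bar>g' z\<bar> \<le> 310" by simp
  have "exp (- (B * inverse (z - 10))) * (B * (inverse (z - 10))\<^sup>2) * (B * (inverse (z - 10))\<^sup>2)
   - exp (- (B * inverse (z - 10))) * (2 * B * (inverse (z - 10)) ^ 3) = (x ^ 4 * exp (- x)) / B\<^sup>2 - 2 * ((x ^ 3 * exp (- x)) / B\<^sup>2)"
   unfolding x_def[symmetric] iz using B by (simp add: power2_eq_square power3_eq_cube power4_eq_xxxx field_simps)
  moreover have "\<bar>(x ^ 4 * exp (- x)) / B\<^sup>2\<bar> \<le> 256" "\<bar>(x ^ 3 * exp (- x)) / B\<^sup>2\<bar> \<le> 27"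
  proof -
   have "(x ^ 4 * exp (- x)) / B\<^sup>2 \<le> (x ^ 4 * exp (- x)) / 1" "(x ^ 3 * exp (- x)) / B\<^sup>2 \<le> (x ^ 3 * exp (- x)) / 1"
    using BB x divide_left_mono[of 1 "B\<^sup>2" "x ^ 4 * exp (- x)"] divide_left_mono[of 1 "B\<^sup>2" "x ^ 3 * exp (- x)"] B by auto
   thus "\<bar>(x ^ 4 * exp (- x)) / B\<^sup>2\<bar> \<le> 256" "\<bar>(x ^ 3 * exp (- x)) / B\<^sup>2\<bar> \<le> 27"
    using P x by (simp_all add: abs_of_nonneg)
  qed
  ultimately show "\<bar>exp (- (B * inverse (z - 10))) * (B * (inverse (z - 10))\<^sup>2) * (B * (inverse (z - 10))\<^sup>2)
   - exp (- (B * inverse (z - 10))) * (2 * B * (inverse (z - 10)) ^ 3)\<bar> \<le> 310" by linarith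
 qed (use z in auto)
qed

text \<open>The cutoff and the bending function have fixed bounds, so the blend is small as soon as its two parts differ little
 from the standard cylinder.\<close>

lemma blend_bd:
 fixes g1 \<mu> C q :: "'a::euclidean_space => 'v::euclidean_space" and h u :: "'a => real"
 assumes S: "open S" "y \<in> S" and k: "Ck 2 S g1" "Ck 2 S \<mu>" "Ck 2 S C" "Ck 2 S q" "Ck 2 S h" "Ck 2 S u"
  and b: "bd 2 g1 y e" "bd 2 \<mu> y M" "bd 2 C y M" "bd 2 q y M" "bd 2 h y M" "bd 2 u y M" and M: "1 \<le> M"
  and Lin: "bounded_linear T" "\<And>v. norm (T v) \<le> t * norm v" "0 \<le> t" and s: "norm s \<le> e'" and \<delta>: "0 \<le> \<delta>"
 shows "bd 2 (\<lambda>y. h y *\<^sub>R (g1 y - (\<delta> * u y) *\<^sub>R \<mu> y) + (1 - h y) *\<^sub>R (s + T (C y) - (\<delta> * u y) *\<^sub>R q y)) y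
   (4 * M * (e + 4 * \<delta> * M\<^sup>2) + 8 * M * (e' + t * M + 4 * \<delta> * M\<^sup>2))"
proof -
 have du: "Ck 2 S (\<lambda>y. \<delta> * u y)" by (intro Ck_mult[OF S(1)] Ck_const k)
 have bu: "bd 2 (\<lambda>y. \<delta> * u y) y (\<delta> * M)"
  using bd_blin[OF S bounded_linear_mult_right _ _ k(6) b(6), of \<delta> \<delta>] \<delta> by (simp add: abs_mult)
 have p: "Ck 2 S (\<lambda>y. (\<delta> * u y) *\<^sub>R j y)" if "Ck 2 S j" for j :: "'a => 'v" using Ck_scaleR[OF S(1) du that] .
 have bp: "bd 2 (\<lambda>y. (\<delta> * u y) *\<^sub>R j y) y (4 * \<delta> * M\<^sup>2)" if "Ck 2 S j" "bd 2 j y M" for j :: "'a => 'v"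
  using bd_scaleR[OF S du that(1) bu that(2)] by (simp add: power2_eq_square mult_ac)
 have c1: "Ck 2 S (\<lambda>y. g1 y - (\<delta> * u y) *\<^sub>R \<mu> y)" by (intro Ck_diff_fun[OF S(1)] k p)
 have b1: "bd 2 (\<lambda>y. g1 y - (\<delta> * u y) *\<^sub>R \<mu> y) y (e + 4 * \<delta> * M\<^sup>2)"
  by (rule bd_diff[OF S k(1) p[OF k(2)] b(1) bp[OF k(2) b(2)]])
 have cT: "Ck 2 S (\<lambda>y. s + T (C y))" by (intro Ck_add[OF S(1)] Ck_const Ck_blin[OF S(1) Lin(1)] k)
 have bT: "bd 2 (\<lambda>y. s + T (C y)) y (e' + t * M)"
  by (rule bd_add[OF S Ck_const Ck_blin[OF S(1) Lin(1) k(3)] bd_const[OF s] bd_blin[OF S Lin k(3) b(3)]])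
 have c2: "Ck 2 S (\<lambda>y. s + T (C y) - (\<delta> * u y) *\<^sub>R q y)" by (intro Ck_diff_fun[OF S(1)] cT p k)
 have b2: "bd 2 (\<lambda>y. s + T (C y) - (\<delta> * u y) *\<^sub>R q y) y (e' + t * M + 4 * \<delta> * M\<^sup>2)"
  by (rule bd_diff[OF S cT p[OF k(4)] bT bp[OF k(4) b(4)]])
 have cc: "Ck 2 S (\<lambda>y. 1 - h y)" by (intro Ck_diff_fun[OF S(1)] Ck_const k)
 have bc: "bd 2 (\<lambda>y. 1 - h y) y (2 * M)"
  using bd_diff[OF S Ck_const k(5) bd_const b(5), of 1 M] M by simp
 have "bd 2 (\<lambda>y. h y *\<^sub>R (g1 y - (\<delta> * u y) *\<^sub>R \<mu> y) + (1 - h y) *\<^sub>R (s + T (C y) - (\<delta> * u y) *\<^sub>R q y)) y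
   (2 ^ 2 * (M * (e + 4 * \<delta> * M\<^sup>2)) + 2 ^ 2 * (2 * M * (e' + t * M + 4 * \<delta> * M\<^sup>2)))"
  by (rule bd_add[OF S Ck_scaleR[OF S(1) k(5) c1] Ck_scaleR[OF S(1) cc c2] bd_scaleR[OF S k(5) c1 b(5) b1] bd_scaleR[OF S cc c2 bc b2]])
 thus ?thesis by (simp add: mult.assoc)
qed

section \<open>The two comparison surfaces: cylinder and cap\<close>

text \<open>On the boundary the derivative vanishes along inward directions, and these span the space.\<close>

lemma cball_derivative_zero:
 fixes f :: "'a::euclidean_space => 'v::real_normed_vector"
 assumes d: "f differentiable (at y)" and y: "y \<in> cball 0 R" and R: "0 < R" and 0: "\<And>z. z \<in> cball 0 R ==> f z = 0"
 shows "D f y v = 0"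
proof -
 have lin: "linear (D f y)" using D_linear[OF d] .
 have *: "D f y (z - y) = 0" if z: "z \<in> cball 0 R" for z
 proof -
  have seg: "y + t *\<^sub>R (z - y) \<in> cball 0 R" if "t \<in> {0..1}" for t
   using convexD_alt[OF convex_cball y z, of t] that by (simp add: algebra_simps)
  have "((\<lambda>t. y + t *\<^sub>R (z - y)) has_derivative (\<lambda>t. t *\<^sub>R (z - y))) (at 0)"
   by (auto intro!: derivative_eq_intros)
  moreover have "(f has_derivative D f y) (at (y + 0 *\<^sub>R (z - y)))" using D_works[OF d] by simp
  ultimately have "((\<lambda>t. f (y + t *\<^sub>R (z - y))) has_derivative (\<lambda>t. D f y (t *\<^sub>R (z - y)))) (at 0)"
   by (rule has_derivative_compose)
  hence "((\<lambda>t. f (y + t *\<^sub>R (z - y))) has_vector_derivative D f y (z - y)) (at 0)"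
   by (simp add: has_vector_derivative_def linear_scale[OF lin])
  hence 1: "((\<lambda>t. f (y + t *\<^sub>R (z - y))) has_vector_derivative D f y (z - y)) (at 0 within cbox 0 1)"
   by (rule has_vector_derivative_at_within)
  have 2: "((\<lambda>t. f (y + t *\<^sub>R (z - y))) has_vector_derivative 0) (at 0 within cbox 0 1)"
   by (rule has_vector_derivative_transform[OF _ _ has_vector_derivative_const[of 0]]) (use seg 0 in auto)
  show ?thesis by (rule vector_derivative_unique_within_closed_interval[OF _ _ 1 2]) auto
 qed
 have "D f y y = 0" using *[of 0] R linear_neg[OF lin, of y] by simp
 hence z: "D f y z = 0" if "z \<in> cball 0 R" for z using *[OF that] linear_diff[OF lin, of z y] by simp
 show ?thesis
 proof (cases "v = 0")
  case False
  hence "(R / norm v) *\<^sub>R v \<in> cball 0 R" using R by simp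
  from z[OF this] show ?thesis using False R by (simp add: linear_scale[OF lin])
 qed (simp add: linear_0[OF lin])
qed

lemma D2_expand:
 fixes f :: "'a::euclidean_space => 'v::real_normed_vector"
 assumes S: "open S" "y \<in> S" and f: "Ck 2 S f"
 shows "D2 f w y v = (\<Sum>b'\<in>Basis. \<Sum>b\<in>Basis. ((w \<bullet> b') * (v \<bullet> b)) *\<^sub>R D2 f b' y b)"
proof -
 note d1 = Ck2_differentiable(1)[OF S(1) f] and d2 = Ck2_differentiable(2)[OF S(1) f S(2)]
 have "D2 f w y v = D (\<lambda>z. \<Sum>b'\<in>Basis. (w \<bullet> b') *\<^sub>R D f z b') y v"
  by (rule fun_cong[OF D_cong[OF S]]) (rule D_expand[OF d1])
 also have "\<dots> = (\<Sum>b'\<in>Basis. (w \<bullet> b') *\<^sub>R D2 f b' y v)"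
 proof -
  have "((\<lambda>z. \<Sum>b'\<in>Basis. (w \<bullet> b') *\<^sub>R D f z b') has_derivative (\<lambda>v. \<Sum>b'\<in>Basis. (w \<bullet> b') *\<^sub>R D2 f b' y v)) (at y)"
   by (intro has_derivative_sum has_derivative_scaleR_right D_works d2)
  from D_eq[OF this] show ?thesis by simp
 qed
 also have "\<dots> = (\<Sum>b'\<in>Basis. (w \<bullet> b') *\<^sub>R (\<Sum>b\<in>Basis. (v \<bullet> b) *\<^sub>R D2 f b' y b))"
  by (intro sum.cong[OF HOL.refl] arg_cong2[where f = scaleR] HOL.refl D_expand[OF d2])
 finally show ?thesis by (simp add: scaleR_right.sum)
qed

lemma bd2_jet:
 fixes f :: "'a::euclidean_space => 'v::real_normed_vector"
 assumes S: "open S" "y \<in> S" and f: "Ck 2 S f" and b: "bd 2 f y M"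
 shows "norm (f y) \<le> M" "norm (D f y v) \<le> real DIM('a) * M * norm v"
  "norm (D2 f w y v) \<le> (real DIM('a))\<^sup>2 * M * norm v * norm w"
proof -
 show "norm (f y) \<le> M" using b by (rule bd_norm)
 show "norm (D f y v) \<le> real DIM('a) * M * norm v"
  by (rule bd_D_norm[OF Ck2_differentiable(1)[OF S(1) f S(2)]]) (use b in \<open>auto simp: numeral_2_eq_2 dest: bd_norm\<close>)
 have "norm (D2 f w y v) \<le> (\<Sum>b'\<in>(Basis::'a set). \<Sum>b\<in>(Basis::'a set). norm w * norm v * M)"
  unfolding D2_expand[OF S f, of w v]
 proof (intro order_trans[OF norm_sum] sum_mono)
  fix b' c :: 'a assume bb: "b' \<in> Basis" "c \<in> Basis"
  have "norm (D2 f b' y c) \<le> M" using b bb by (auto simp: numeral_2_eq_2)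
  thus "norm (((w \<bullet> b') * (v \<bullet> c)) *\<^sub>R D2 f b' y c) \<le> norm w * norm v * M"
   unfolding norm_scaleR abs_mult
   using Basis_le_norm[OF bb(1), of w] Basis_le_norm[OF bb(2), of v] by (intro mult_mono) auto
 qed
 thus "norm (D2 f w y v) \<le> (real DIM('a))\<^sup>2 * M * norm v * norm w"
  by (simp add: power2_eq_square mult_ac)
qed

lemma bounded_jet_of_bd:
 fixes f :: "'a::euclidean_space => 'v::euclidean_space"
 assumes S: "open S" "y \<in> S" and f: "Ck 2 S f" and b: "bd 2 f y M"
 shows "bounded_jet ((real DIM('a))\<^sup>2 * M) f y"
proof -
 note j = bd2_jet[OF S f b]
 have M: "0 \<le> M" using b by (rule bd_nonneg)
 have n: "1 \<le> real DIM('a)" using DIM_positive[where 'a='a] by simp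
 have n2: "1 * M \<le> (real DIM('a))\<^sup>2 * M" "real DIM('a) * M \<le> (real DIM('a))\<^sup>2 * M"
  using n M self_le_power[OF n, of 2] by (intro mult_right_mono; simp)+
 show ?thesis unfolding bounded_jet_def
 proof (intro conjI allI)
  show "norm (D f y v) \<le> (real DIM('a))\<^sup>2 * M * norm v" for v
   by (rule order_trans[OF j(2) mult_right_mono[OF n2(2)]]) simp
 qed (use S f j n2 in auto)
qed

text \<open>The normal of the cap is only known to be differentiable at each point of the closed disc, so its
 derivative need not be continuous. Moving the derivative to the surface gives a continuous
 expression for the second fundamental form, and strict convexity becomes uniform by compactness.\<close>

lemma cap_data:
 fixes Kf \<nu> :: "'a::euclidean_space => 'a \<times> real"
 assumes R: "0 < R" and S: "open S" "cball 0 R \<subseteq> S" and Kf: "Ck 3 S Kf"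
  and un: "unit_normal_field (\<bullet>) (cball 0 R) (\<lambda>_. UNIV) (\<lambda>_. UNIV) Kf \<nu>"
  and conv: "\<And>y v. y \<in> cball 0 R ==> v \<noteq> 0 ==> second_form (\<bullet>) Kf \<nu> y v v > 0"
 obtains K c \<kappa> where "1 \<le> K" "0 < c" "c \<le> 1" "0 < \<kappa>"
  "\<And>y. y \<in> cball 0 R ==> jet_ok K c 0 Kf y (\<nu> y) \<and> (\<forall>v. \<kappa> * (norm v)\<^sup>2 \<le> - (\<nu> y \<bullet> D2 Kf v y v))
    \<and> (\<forall>v. second_form (\<bullet>) Kf \<nu> y v v = - (\<nu> y \<bullet> D2 Kf v y v))"
proof -
 define B where "B = (cball 0 R :: 'a set)"
 have cB: "compact B" by (simp add: B_def)
 have Kf2: "Ck 2 S Kf" using Ck_mono[OF Kf] by simp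
 have BS: "y \<in> S" if "y \<in> B" for y using that S by (auto simp: B_def)
 note d1 = Ck2_differentiable(1)[OF S(1) Kf2 BS] and d2 = Ck2_differentiable(2)[OF S(1) Kf2 BS]
 have inj: "inj (D Kf y)" and d\<nu>: "\<nu> differentiable (at y)" and u: "\<nu> y \<bullet> \<nu> y = 1" and o: "\<And>v. \<nu> y \<bullet> D Kf y v = 0"
  if "y \<in> B" for y using un that unfolding unit_normal_field_def B_def by auto
 have sf: "second_form (\<bullet>) Kf \<nu> y v w = - (\<nu> y \<bullet> D2 Kf w y v)" if y: "y \<in> B" for y v w
 proof -
  have "D (\<lambda>z. \<nu> z \<bullet> D Kf z w) y v = 0"
   by (rule cball_derivative_zero[OF D_bilinear(2)[OF bounded_bilinear_inner d\<nu>[OF y] d2[OF y]] y[unfolded B_def] R])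
    (use o in \<open>simp add: B_def\<close>)
  thus ?thesis using D_bilinear(1)[OF bounded_bilinear_inner d\<nu>[OF y] d2[OF y], of w v] by (simp add: second_form_def)
 qed
 have cK: "continuous_on B (\<lambda>y. D Kf y b)" for b
  by (rule continuous_on_subset[of S, OF Ck_continuous[where k = 0]]) (use Ck_D[OF S(1), of 1 Kf b] Kf2 S in \<open>auto simp: numeral_2_eq_2 B_def\<close>)
 have cK2: "continuous_on B (\<lambda>y. D2 Kf b' y b)" for b b'
 proof (rule continuous_on_subset[of S, OF Ck_continuous[where k = 0]])
  have "Ck 2 S (\<lambda>z. D Kf z b')" using Ck_D[OF S(1), of 2 Kf b'] Kf by (simp add: numeral_3_eq_3 numeral_2_eq_2)
  thus "Ck (Suc 0) S (\<lambda>y. D2 Kf b' y b)" using Ck_D[OF S(1), of 1 "\<lambda>z. D Kf z b'" b] by (simp only: numeral_2_eq_2 One_nat_def)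
 qed (use S in \<open>simp add: B_def\<close>)
 have c\<nu>: "continuous_on B \<nu>"
  by (intro continuous_at_imp_continuous_on ballI differentiable_imp_continuous_within d\<nu>)
 define Z where "Z = B \<times> (sphere 0 1 :: 'a set)"
 have cZ: "compact Z" "Z \<noteq> {}" using R unfolding Z_def by (auto intro!: compact_Times cB simp: B_def)
 have fz: "continuous_on Z (\<lambda>p. g (fst p))" if "continuous_on B g" for g :: "'a => 'z::real_normed_vector"
  by (rule continuous_on_compose2[OF that continuous_on_fst[OF continuous_on_id]]) (auto simp: Z_def)
 \<comment> \<open>Minima over the unit tangent vectors.\<close>
 have "continuous_on Z (\<lambda>p. norm (\<Sum>b\<in>Basis. (snd p \<bullet> b) *\<^sub>R D Kf (fst p) b))"
  by (intro continuous_intros fz cK)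
 from continuous_attains_inf[OF cZ this] obtain p where p: "p \<in> Z"
  "\<And>q. q \<in> Z ==> norm (\<Sum>b\<in>Basis. (snd p \<bullet> b) *\<^sub>R D Kf (fst p) b) \<le> norm (\<Sum>b\<in>Basis. (snd q \<bullet> b) *\<^sub>R D Kf (fst q) b)" by blast
 define c1 where "c1 = norm (\<Sum>b\<in>Basis. (snd p \<bullet> b) *\<^sub>R D Kf (fst p) b)"
 have ZB: "fst q \<in> B" "norm (snd q) = 1" if "q \<in> Z" for q using that by (auto simp: Z_def)
 have "c1 = norm (D Kf (fst p) (snd p))" unfolding c1_def using D_expand[OF d1[OF ZB(1)[OF p(1)]], of "snd p"] by simp
 moreover have "D Kf (fst p) (snd p) \<noteq> 0"
  using linear_injective_0[OF D_linear[OF d1[OF ZB(1)[OF p(1)]]]] inj[OF ZB(1)[OF p(1)]] ZB(2)[OF p(1)] by force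
 ultimately have c1: "0 < c1" by simp
 have lo: "c1 * norm v \<le> norm (D Kf y v)" if y: "y \<in> B" for y v
 proof (cases "v = 0")
  case False
  have "(y, v /\<^sub>R norm v) \<in> Z" using y False by (simp add: Z_def)
  from p(2)[OF this] have "c1 \<le> norm (D Kf y (v /\<^sub>R norm v))"
   using D_expand[OF d1[OF y], of "v /\<^sub>R norm v"] by (simp add: c1_def)
  thus ?thesis using False by (simp add: linear_scale[OF D_linear[OF d1[OF y]]] field_simps)
 qed simp
 have "continuous_on Z (\<lambda>p. - (\<nu> (fst p) \<bullet> (\<Sum>b'\<in>Basis. \<Sum>b\<in>Basis. ((snd p \<bullet> b') * (snd p \<bullet> b)) *\<^sub>R D2 Kf b' (fst p) b)))"
  by (intro continuous_intros fz cK2 c\<nu>)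
 hence "continuous_on Z (\<lambda>p. - (\<nu> (fst p) \<bullet> D2 Kf (snd p) (fst p) (snd p)))"
  by (rule continuous_on_eq) (use D2_expand[OF S(1) BS[OF ZB(1)] Kf2] in simp)
 from continuous_attains_inf[OF cZ this] obtain q where q: "q \<in> Z"
  "\<And>p. p \<in> Z ==> - (\<nu> (fst q) \<bullet> D2 Kf (snd q) (fst q) (snd q)) \<le> - (\<nu> (fst p) \<bullet> D2 Kf (snd p) (fst p) (snd p))" by blast
 define \<kappa> where "\<kappa> = - (\<nu> (fst q) \<bullet> D2 Kf (snd q) (fst q) (snd q))"
 have "\<kappa> = second_form (\<bullet>) Kf \<nu> (fst q) (snd q) (snd q)" unfolding \<kappa>_def sf[OF ZB(1)[OF q(1)]] ..
 hence \<kappa>: "0 < \<kappa>" using conv[OF ZB(1)[OF q(1), unfolded B_def], of "snd q"] ZB(2)[OF q(1)] by force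
 have up: "\<kappa> * (norm v)\<^sup>2 \<le> - (\<nu> y \<bullet> D2 Kf v y v)" if y: "y \<in> B" for y v
 proof (cases "v = 0")
  case True
  thus ?thesis by (subst D2_expand[OF S(1) BS[OF y] Kf2]) simp
 next
  case False
  define w where "w = v /\<^sub>R norm v"
  have vw: "v = norm v *\<^sub>R w" using False by (simp add: w_def)
  have "(y, w) \<in> Z" using y False by (simp add: Z_def w_def)
  from q(2)[OF this] have *: "\<kappa> \<le> - (\<nu> y \<bullet> D2 Kf w y w)" by (simp add: \<kappa>_def)
  have "D2 Kf v y v = (norm v)\<^sup>2 *\<^sub>R D2 Kf w y w"
  proof -
   have "v \<bullet> b = norm v * (w \<bullet> b)" for b by (subst vw) simp
   thus ?thesis
    by (subst (1 2) D2_expand[OF S(1) BS[OF y] Kf2]) (simp add: scaleR_right.sum power2_eq_square mult_ac)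
  qed
  thus ?thesis using mult_left_mono[OF *, of "(norm v)\<^sup>2"] by (simp add: mult_ac)
 qed
 obtain M where M: "0 \<le> M" "\<And>y. y \<in> B ==> bd 2 Kf y M"
  using bd_compact[of B S 2 Kf] cB Kf S by (auto simp: B_def numeral_3_eq_3 numeral_2_eq_2)
 define K where "K = (real DIM('a))\<^sup>2 * (M + 1)"
 have K1: "1 \<le> K"
 proof -
  have "1 * 1 \<le> (real DIM('a))\<^sup>2 * (M + 1)" using M(1) DIM_positive[where 'a='a] by (intro mult_mono) auto
  thus ?thesis by (simp add: K_def)
 qed
 define c where "c = min c1 1"
 show thesis
 proof (rule that[OF K1 _ _ \<kappa>])
  show c: "0 < c" "c \<le> 1" using c1 by (auto simp: c_def)
  fix y :: 'a assume "y \<in> cball 0 R"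
  hence y: "y \<in> B" by (simp add: B_def)
  have "bounded_jet K Kf y" unfolding K_def
   by (rule bounded_jet_of_bd[OF S(1) BS[OF y] Kf2 bd_mono[OF M(2)[OF y]]]) simp
  moreover have "transversal c Kf y (\<nu> y)"
  proof (rule transversal_of_normal)
   show "norm (\<nu> y) = 1" using u[OF y] by (simp add: norm_eq_1)
   show "c * norm v \<le> norm (D Kf y v)" for v
    by (rule order_trans[OF mult_right_mono lo[OF y]]) (auto simp: c_def)
  qed (use o[OF y] c in auto)
  ultimately show "jet_ok K c 0 Kf y (\<nu> y) \<and> (\<forall>v. \<kappa> * (norm v)\<^sup>2 \<le> - (\<nu> y \<bullet> D2 Kf v y v))
    \<and> (\<forall>v. second_form (\<bullet>) Kf \<nu> y v v = - (\<nu> y \<bullet> D2 Kf v y v))"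
   using o[OF y] up[OF y] sf[OF y] by (simp add: jet_ok_def almost_normal_def)
 qed
qed

text \<open>The radius is one: both forms agree on the sphere factor, and the second one vanishes along the axis.\<close>

lemma neckmap_forms:
 fixes y :: "'a::euclidean_space"
 assumes y: "y \<noteq> 0" and \<sigma>: "\<sigma> \<in> {1, -1 :: real}"
 defines "u \<equiv> y /\<^sub>R norm y"
 defines "T \<equiv> \<lambda>v w. ((v - (v \<bullet> u) *\<^sub>R u) \<bullet> (w - (w \<bullet> u) *\<^sub>R u)) / (norm y)\<^sup>2"
 shows "D (neckmap \<sigma>) y v \<bullet> D (neckmap \<sigma>) y w = T v w + (v \<bullet> u) * (w \<bullet> u)"
  and "(u, 0) \<bullet> D (neckmap \<sigma>) y v = 0"
  and "- ((u, 0) \<bullet> D2 (neckmap \<sigma>) w y v) = T v w"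
proof -
 have \<sigma>2: "\<sigma> * \<sigma> = 1" using \<sigma> by auto
 have u1: "u \<bullet> u = 1" using norm_eq_1[of u] y by (simp add: u_def)
 show "D (neckmap \<sigma>) y v \<bullet> D (neckmap \<sigma>) y w = T v w + (v \<bullet> u) * (w \<bullet> u)"
  using \<sigma>2 unfolding neckmap_D[OF y] u_def[symmetric] T_def
  by (simp add: inner_prod_def power2_eq_square divide_inverse mult_ac)
 have o: "(z /\<^sub>R norm z, 0) \<bullet> D (neckmap \<sigma>) z w = 0" if z: "z \<noteq> 0" for z w
 proof -
  have "(z /\<^sub>R norm z) \<bullet> (z /\<^sub>R norm z) = 1" using norm_eq_1[of "z /\<^sub>R norm z"] z by simp
  hence "(z /\<^sub>R norm z) \<bullet> (w - (w \<bullet> (z /\<^sub>R norm z)) *\<^sub>R (z /\<^sub>R norm z)) = 0"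
   unfolding inner_diff_right inner_scaleR_right[of _ "w \<bullet> (z /\<^sub>R norm z)"] by (simp add: inner_commute[of w z])
  thus ?thesis unfolding neckmap_D[OF z] inner_prod_def fst_conv snd_conv inner_scaleR_right by simp
 qed
 show "(u, 0) \<bullet> D (neckmap \<sigma>) y v = 0" using o[OF y] by (simp add: u_def)
 \<comment> \<open>Differentiate the orthogonality of the normal and the tangent vectors.\<close>
 have S: "open (- {0 :: 'a})" "y \<in> - {0}" using y by (auto simp: open_Compl)
 have dN: "((\<lambda>z. (z /\<^sub>R norm z, 0 :: real)) has_derivative (\<lambda>v. ((v - (v \<bullet> u) *\<^sub>R u) /\<^sub>R norm y, 0))) (at y)"
  using has_derivative_Pair[OF unit_derivative[OF y] has_derivative_const[of "0::real"]] by (simp add: u_def)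
 have d2: "(\<lambda>z. D (neckmap \<sigma>) z w) differentiable (at y)"
  by (rule Ck2_differentiable(2)[OF S(1) neckmap_Ck S(2)])
 have "D (\<lambda>z. (z /\<^sub>R norm z, 0) \<bullet> D (neckmap \<sigma>) z w) y v = 0"
  by (subst D_cong[OF S, of _ "\<lambda>_. 0"]) (use o in simp_all)
 hence "(u, 0) \<bullet> D2 (neckmap \<sigma>) w y v + ((v - (v \<bullet> u) *\<^sub>R u) /\<^sub>R norm y, 0) \<bullet> D (neckmap \<sigma>) y w = 0"
  using D_bilinear(1)[OF bounded_bilinear_inner differentiableI[OF dN] d2, of v] D_eq[OF dN] by (simp add: u_def)
 thus "- ((u, 0) \<bullet> D2 (neckmap \<sigma>) w y v) = T v w"
  unfolding neckmap_D[OF y] u_def[symmetric] T_def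
  by (simp add: inner_prod_def power2_eq_square divide_inverse mult_ac)
qed

lemma neckmap_D_lower:
 fixes y :: "'a::euclidean_space"
 assumes y: "y \<noteq> 0" and \<sigma>: "\<sigma> \<in> {1, -1 :: real}" and M: "norm y \<le> M" "1 \<le> M"
 shows "norm v / M \<le> norm (D (neckmap \<sigma>) y v)"
proof -
 define u where "u = y /\<^sub>R norm y"
 define t where "t = v - (v \<bullet> u) *\<^sub>R u"
 have u1: "u \<bullet> u = 1" using norm_eq_1[of u] y by (simp add: u_def)
 have "v \<bullet> v = t \<bullet> t + (v \<bullet> u)\<^sup>2"
  using u1 by (simp add: t_def inner_diff_left inner_diff_right inner_commute[of u v] power2_eq_square)
 moreover have "D (neckmap \<sigma>) y v \<bullet> D (neckmap \<sigma>) y v = (t \<bullet> t) / (norm y)\<^sup>2 + (v \<bullet> u)\<^sup>2"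
  using neckmap_forms(1)[OF y \<sigma>, of v v] by (simp add: t_def u_def power2_eq_square)
 moreover have "(t \<bullet> t) / M\<^sup>2 \<le> (t \<bullet> t) / (norm y)\<^sup>2" using y M by (intro divide_left_mono power_mono) auto
 moreover have "(v \<bullet> u)\<^sup>2 / M\<^sup>2 \<le> (v \<bullet> u)\<^sup>2 / 1" using M by (intro divide_left_mono) (auto simp: one_le_power)
 ultimately have "(norm v / M)\<^sup>2 \<le> (norm (D (neckmap \<sigma>) y v))\<^sup>2"
  by (simp add: power_divide power2_norm_eq_inner add_divide_distrib)
 thus ?thesis by (rule power2_le_imp_le) simp
qed

text \<open>What a comparison surface provides at a point: \<open>n\<close> singles out a unit normal, this normal is close to \<open>n\<close>, and the
 principal curvatures satisfy \<open>\<Phi>\<close>.\<close>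

definition controlled :: "'a set => ('a::euclidean_space => ('a \<times> real) \<times> real) => 'a => 'a \<times> real => real
  => (nat => (nat => real) => bool) => bool" where
 "controlled S F y n \<theta> \<Phi> \<longleftrightarrow> (\<forall>\<nu>. hnormal F y \<nu> \<and> fst \<nu> \<bullet> n = 0 --> \<nu> = 0) \<and>
  (\<forall>\<nu>. good_normal F y n \<nu> --> norm (\<nu> - (n, 0)) \<le> \<theta>) \<and>
  (\<forall>\<nu> m lam. surface_curvatures S F n \<nu> y m lam --> inj (D F y) \<and> \<Phi> m lam)"

lemma controlledD:
 assumes "controlled S F y n \<theta> \<Phi>"
 shows "hnormal F y \<nu> ==> fst \<nu> \<bullet> n = 0 ==> \<nu> = 0"
  and "good_normal F y n \<nu> ==> norm (\<nu> - (n, 0)) \<le> \<theta>"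
  and "surface_curvatures S F n \<nu>' y m lam ==> inj (D F y) \<and> \<Phi> m lam"
 using assms unfolding controlled_def by blast+

text \<open>Near a cylinder all principal curvatures except one are close to the inverse radius, and the
 remaining one is almost nonnegative.\<close>

lemma near_cylinder:
 assumes \<eta>0: "0 < \<eta>0"
 shows "\<exists>e0>0. \<exists>r0>0. \<forall>(U :: 'a::euclidean_space => 'a \<times> real) S \<sigma> t0 y r. open S \<and> 0 \<notin> S \<and> Ck 2 S U \<and> y \<in> S \<and>
  10 \<le> norm y \<and> norm y \<le> 30 \<and> \<sigma> \<in> {1, -1} \<and> norm t0 \<le> 3 \<and> bd 2 (\<lambda>z. U z + t0 - neckmap \<sigma> z) y e0 \<and> 0 < r \<and> r \<le> r0 -->
  controlled S (hsurf r U) y (y /\<^sub>R norm y, 0) 1 (\<lambda>m lam. almost_two_convex \<eta>0 2 (1/4) m (\<lambda>i. r * lam i))"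
proof -
 define n where "n = real DIM('a)"
 have n1: "1 \<le> n" using DIM_positive[where 'a='a] by (simp add: n_def)
 have nn: "n \<le> n\<^sup>2" "1 \<le> n\<^sup>2" using self_le_power[OF n1, of 2] n1 by auto
 define A where "A = cball 0 30 - ball (0::'a) 10"
 have "\<exists>M\<ge>0. \<forall>y\<in>A. bd 2 (neckmap \<sigma>) y M" for \<sigma>
  by (rule bd_compact[of A "- {0}"]) (auto simp: A_def intro: compact_diff neckmap_Ck)
 then obtain M1 M2 where M: "0 \<le> M1" "\<forall>y\<in>A. bd 2 (neckmap 1) y M1" "0 \<le> M2" "\<forall>y\<in>A. bd 2 (neckmap (-1)) y M2" by meson
 define K where "K = n\<^sup>2 * (M1 + M2 + 5)"
 have K1: "1 \<le> K" using mult_mono[of 1 "n\<^sup>2" 1 "M1 + M2 + 5"] nn M by (simp add: K_def)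
 have n2K: "n\<^sup>2 \<le> K" using mult_left_mono[of 1 "M1 + M2 + 5" "n\<^sup>2"] M by (simp add: K_def)
 obtain Cn where Cn: "Cn \<ge> 1" and cf: "\<And>(U :: 'a => 'a \<times> real) y n r \<eta>. jet_ok K (1/60) \<eta> U y n ==> 0 < r ==> 0 \<le> \<eta> ==>
   (r + \<eta>) * Cn \<le> 1 ==> close_forms Cn r \<eta> U y n"
  using forms_close[OF K1, of "1/60", where ?'a = 'a] by auto
 obtain C where C: "C \<ge> 1" and pf: "\<forall>(U :: 'a => 'a \<times> real) S n r \<eta> \<nu> y m lam. open S \<and> y \<in> S \<and> Ck 2 S U \<and>
  jet_ok K (1/60) \<eta> U y n \<and> 0 < r \<and> 0 \<le> \<eta> \<and> (r + \<eta>) * C \<le> 1 \<and> surface_curvatures S (hsurf r U) n \<nu> y m lam -->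
  inj (D (hsurf r U) y) \<and> (\<exists>e. almost_principal K (1/60) (C * r) (C * (r + \<eta>)) U y n m (\<lambda>i. r * lam i) e)"
  using principal_frame[OF K1, of "1/60", where ?'a = 'a] by auto
 define \<eta>1 where "\<eta>1 = min \<eta>0 (1/32)"
 have \<eta>1: "0 < \<eta>1" "\<eta>1 \<le> \<eta>0" "\<eta>1 \<le> 1/32" using \<eta>0 by (auto simp: \<eta>1_def)
 \<comment> \<open>All error terms are at most half of \<open>\<eta>1\<close>.\<close>
 define H where "H = 4 * (C + Cn) + 120\<^sup>2 * (3 * K) * 2 + 60"
 have H: "4 * (C + Cn) \<le> H" "2 * (120\<^sup>2 * (3 * K)) \<le> H" "60 \<le> H" "1 \<le> H" using C Cn K1 by (auto simp: H_def)
 define r0 where "r0 = \<eta>1 / H"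
 define e0 where "e0 = \<eta>1 / (2 * H * n\<^sup>2)"
 have Hp: "0 < H" "0 < n" using H n1 by auto
 have r0: "0 < r0" "0 < e0" "0 < r0 / 4" using \<eta>1 Hp by (auto simp: r0_def e0_def)
 have e0: "n\<^sup>2 * e0 = \<eta>1 / (2 * H)" using Hp by (simp add: e0_def)
 have eH: "n\<^sup>2 * e0 * H \<le> \<eta>1 / 2" "r0 * H \<le> \<eta>1" using H unfolding e0 by (auto simp: r0_def)
 show ?thesis
 proof (rule exI[of _ e0], rule conjI[OF r0(2)], rule exI[of _ "r0 / 4"], rule conjI[OF r0(3)], intro allI impI, elim conjE)
  fix U :: "'a => 'a \<times> real" and S :: "'a set" and \<sigma> t0 y r
  assume S: "open S" and S0: "0 \<notin> S" and U: "Ck 2 S U" and y: "y \<in> S" and ny: "10 \<le> norm y" "norm y \<le> 30" and \<sigma>: "\<sigma> \<in> {1, -1 :: real}"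
   and t0: "norm t0 \<le> 3" and b: "bd 2 (\<lambda>z. U z + t0 - neckmap \<sigma> z) y e0" and r: "0 < r" "r \<le> r0 / 4"
  have y0: "y \<noteq> 0" using y S0 by blast
  define g where "g z = U z + t0 - neckmap \<sigma> z" for z
  have nm: "Ck 2 S (neckmap \<sigma>)" by (rule Ck_subset[OF neckmap_Ck]) (use S0 in auto)
  have g: "Ck 2 S g" unfolding g_def[abs_def] by (intro Ck_diff_fun[OF S] Ck_add[OF S] U Ck_const nm)
  have bg: "bd 2 g y e0" using b by (simp add: g_def[abs_def])
  have e0n: "e0 \<le> n\<^sup>2 * e0" using nn r0 by simp
  have gj: "norm (g y) \<le> e0" "norm (D g y v) \<le> n\<^sup>2 * e0 * norm v" "norm (D2 g w y v) \<le> n\<^sup>2 * e0 * norm v * norm w" for v w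
  proof -
   show "norm (g y) \<le> e0" "norm (D2 g w y v) \<le> n\<^sup>2 * e0 * norm v * norm w" using bd2_jet[OF S y g bg] by (auto simp: n_def)
   have "norm (D g y v) \<le> n * e0 * norm v" using bd2_jet(2)[OF S y g bg] by (simp add: n_def)
   also have "\<dots> \<le> n\<^sup>2 * e0 * norm v" using nn r0 by (intro mult_right_mono) auto
   finally show "norm (D g y v) \<le> n\<^sup>2 * e0 * norm v" .
  qed
  define \<eta> where "\<eta> = n\<^sup>2 * e0"
  have \<eta>: "0 \<le> \<eta>" "\<eta> * H \<le> \<eta>1 / 2" using nn r0 eH by (auto simp: \<eta>_def)
  have rH: "r * H \<le> \<eta>1 / 4"
  proof -
   have "r * H \<le> r0 / 4 * H" using r H by (intro mult_right_mono) auto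
   thus ?thesis using eH(2) by simp
  qed
  have \<eta>60: "\<eta> \<le> 1 / 60"
  proof -
   have "\<eta> * 60 \<le> \<eta> * H" using H \<eta> by (intro mult_left_mono) auto
   thus ?thesis using \<eta> \<eta>1 by linarith
  qed
  have Dn: "neckmap \<sigma> differentiable (at y)" "(\<lambda>z. D (neckmap \<sigma>) z w) differentiable (at y)"
   and Dg: "g differentiable (at y)" "(\<lambda>z. D g z w) differentiable (at y)" for w
   using Ck2_differentiable[OF S nm y] Ck2_differentiable[OF S g y] by auto
  have Ug: "U z = (neckmap \<sigma> z + g z) + (- t0)" for z by (simp add: g_def)
  have DU': "D U z v = D (neckmap \<sigma>) z v + D g z v" if z: "z \<in> S" for z v
  proof -
   note d = Ck2_differentiable(1)[OF S nm z] Ck2_differentiable(1)[OF S g z]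
   have "D (\<lambda>z. (neckmap \<sigma> z + g z) + (- t0)) z v = D (neckmap \<sigma>) z v + D g z v"
    using D_add[OF differentiable_add[OF d] differentiable_const, of "- t0" v] D_add[OF d, of v] by simp
   moreover have "D U z v = D (\<lambda>z. (neckmap \<sigma> z + g z) + (- t0)) z v"
    by (rule arg_cong[of U _ "\<lambda>f. D f z v"]) (rule ext, rule Ug)
   ultimately show ?thesis by (rule HOL.trans[rotated])
  qed
  have DU: "D U y v = D (neckmap \<sigma>) y v + D g y v" for v by (rule DU'[OF y])
  have DDU: "D2 U w y v = D2 (neckmap \<sigma>) w y v + D2 g w y v" for v w
  proof -
   have "D2 U w y = D (\<lambda>z. D (neckmap \<sigma>) z w + D g z w) y" by (rule D_cong[OF S y]) (rule DU')
   thus ?thesis using D_add[OF Dn(2)[of w] Dg(2)[of w], of v] by simp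
  qed
  define u where "u = y /\<^sub>R norm y"
  have u1: "norm u = 1" using y0 by (simp add: u_def)
  have u2: "u \<bullet> u = 1" using u1 by (simp add: norm_eq_1)
  define T where "T v w = ((v - (v \<bullet> u) *\<^sub>R u) \<bullet> (w - (w \<bullet> u) *\<^sub>R u)) / (norm y)\<^sup>2" for v w
  note nf = neckmap_forms[OF y0 \<sigma>, folded u_def, folded T_def]
  have "y \<in> A" using ny by (auto simp: A_def)
  hence "bd 2 (neckmap \<sigma>) y (M1 + M2 + 1)" using M \<sigma> by (auto intro: bd_mono)
  note nj = bd2_jet[OF S y nm this, folded n_def]
  have jU: "bounded_jet K U y" unfolding bounded_jet_def
  proof (intro conjI allI)
   have K2: "n\<^sup>2 * (M1 + M2 + 1) + n\<^sup>2 * e0 + 3 * n\<^sup>2 \<le> K" using \<eta>60 nn by (simp add: K_def \<eta>_def algebra_simps)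
   have MM: "0 \<le> M1 + M2 + 1" using M by simp
   have nM: "n * (M1 + M2 + 1) \<le> n\<^sup>2 * (M1 + M2 + 1)" "1 * (M1 + M2 + 1) \<le> n\<^sup>2 * (M1 + M2 + 1)" using nn MM by (intro mult_right_mono; simp)+
   show "norm (U y) \<le> K" using norm_triangle_ineq[of "neckmap \<sigma> y + g y" "- t0"] norm_triangle_ineq[of "neckmap \<sigma> y" "g y"]
     nj(1) gj(1) t0 nM(2) e0n K2 nn unfolding Ug by simp
   show "norm (D U y v) \<le> K * norm v" for v
   proof -
    have "norm (D U y v) \<le> n * (M1 + M2 + 1) * norm v + n\<^sup>2 * e0 * norm v"
     unfolding DU by (rule order_trans[OF norm_triangle_ineq add_mono[OF nj(2) gj(2)]])
    also have "\<dots> = (n * (M1 + M2 + 1) + n\<^sup>2 * e0) * norm v" by (simp add: distrib_right)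
    also have "\<dots> \<le> K * norm v" using nM K2 nn by (intro mult_right_mono) auto
    finally show ?thesis .
   qed
   show "norm (D2 U w y v) \<le> K * norm v * norm w" for v w
   proof -
    have "norm (D2 U w y v) \<le> n\<^sup>2 * (M1 + M2 + 1) * norm v * norm w + n\<^sup>2 * e0 * norm v * norm w"
     unfolding DDU by (rule order_trans[OF norm_triangle_ineq add_mono[OF nj(3) gj(3)]])
    also have "\<dots> = (n\<^sup>2 * (M1 + M2 + 1) + n\<^sup>2 * e0) * (norm v * norm w)" by (simp add: distrib_right mult.assoc)
    also have "\<dots> \<le> K * (norm v * norm w)" using K2 nn by (intro mult_right_mono) auto
    finally show ?thesis by (simp add: mult.assoc)
   qed
  qed (use S y U in auto)
  have tU: "transversal (1/60) U y (u, 0)" unfolding transversal_def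
  proof (intro conjI allI)
   show "norm (u, 0::real) = 1" using u1 by (simp add: norm_Pair)
   fix v t
   have t1: "transversal (1/30) (neckmap \<sigma>) y (u, 0)"
    by (rule transversal_of_normal) (use u1 nf(2) neckmap_D_lower[OF y0 \<sigma> ny(2)] in \<open>auto simp: norm_Pair\<close>)
   hence "1/30 * norm (v, t) \<le> norm (D (neckmap \<sigma>) y v + t *\<^sub>R (u, 0))" by (simp add: transversal_def)
   moreover have "norm (D (neckmap \<sigma>) y v + t *\<^sub>R (u, 0)) \<le> norm (D U y v + t *\<^sub>R (u, 0)) + norm (D g y v)"
    using norm_triangle_ineq4[of "D U y v + t *\<^sub>R (u, 0)" "D g y v"] by (simp add: DU)
   moreover have "norm (D g y v) \<le> 1/60 * norm (v, t)"
   proof -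
    have "norm (D g y v) \<le> \<eta> * norm v" using gj(2) by (simp add: \<eta>_def)
    also have "\<dots> \<le> 1/60 * norm (v, t)" using \<eta>60 \<eta> norm_fst_le[of v t] by (intro mult_mono) auto
    finally show ?thesis .
   qed
   ultimately show "1/60 * norm (v, t) \<le> norm (D U y v + t *\<^sub>R (u, 0))" by linarith
  qed
  have aU: "almost_normal \<eta> U y (u, 0)" unfolding almost_normal_def
  proof
   fix v show "\<bar>(u, 0) \<bullet> D U y v\<bar> \<le> \<eta> * norm v"
    using Cauchy_Schwarz_ineq2[of "(u, 0)" "D g y v"] gj(2)[of v] u1 nf(2) unfolding DU inner_add_right by (simp add: norm_Pair \<eta>_def)
  qed
  have jok: "jet_ok K (1/60) \<eta> U y (u, 0)" using jU tU aU by (simp add: jet_ok_def)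
  have rC: "(r + \<eta>) * (4 * (C + Cn)) \<le> \<eta>1"
  proof -
   have "(r + \<eta>) * (4 * (C + Cn)) \<le> (r + \<eta>) * H" using H r \<eta> by (intro mult_left_mono) auto
   also have "\<dots> \<le> \<eta>1" using rH \<eta>(2) \<eta>1 by (simp add: distrib_right)
   finally show ?thesis .
  qed
  have rpos: "0 \<le> (r + \<eta>) * C" "0 \<le> (r + \<eta>) * Cn" using r \<eta> C Cn by auto
  have rC': "4 * ((r + \<eta>) * C) + 4 * ((r + \<eta>) * Cn) \<le> \<eta>1" using rC by (simp add: algebra_simps)
  have rC1: "(r + \<eta>) * C \<le> 1" "(r + \<eta>) * Cn \<le> 1" using rC' rpos \<eta>1 by linarith+
  note cf = cf[OF jok r(1) \<eta>(1) rC1(2)]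
  show "controlled S (hsurf r U) y (y /\<^sub>R norm y, 0) 1 (\<lambda>m lam. almost_two_convex \<eta>0 2 (1/4) m (\<lambda>i. r * lam i))"
   unfolding controlled_def u_def[symmetric] almost_two_convex_def
  proof (intro conjI allI impI; (elim conjE)?)
  show "\<nu> = 0" if "hnormal (hsurf r U) y \<nu>" "fst \<nu> \<bullet> (u, 0) = 0" for \<nu> by (rule close_formsD(2)[OF cf that])
  show "norm (\<nu> - ((u, 0), 0)) \<le> 1" if "good_normal (hsurf r U) y (u, 0) \<nu>" for \<nu>
   using close_formsD(3)[OF cf that] rC1(2) by (simp add: mult.commute)
  fix \<nu> m lam
  assume sc: "surface_curvatures S (hsurf r U) (u, 0) \<nu> y m lam"
  have P: "inj (D (hsurf r U) y) \<and> (\<exists>e. almost_principal K (1/60) (C * r) (C * (r + \<eta>)) U y (u, 0) m (\<lambda>i. r * lam i) e)"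
   by (rule pf[rule_format, of S y U \<eta> "(u, 0)" r \<nu> m lam]) (intro conjI S y U jok r(1) \<eta>(1) rC1(1) sc)
  thus "inj (D (hsurf r U) y)" by blast
  obtain e where E: "almost_principal K (1/60) (C * r) (C * (r + \<eta>)) U y (u, 0) m (\<lambda>i. r * lam i) e" using P by blast
  note E = E[unfolded almost_principal_def]
  have e: "norm (e i) \<le> 120" if "i < m" for i using E that by simp
  have G0: "\<bar>D U y (e i) \<bullet> D U y (e j) - (if i = j then 1 else 0)\<bar> \<le> C * r"
   and H0: "\<bar>- ((u, 0) \<bullet> D2 U (e j) y (e i)) - (if i = j then r * lam i else 0)\<bar> \<le> C * (r + \<eta>)"
   if "i < m" "j < m" for i j using E that by blast+
  have Cr: "C * r \<le> \<eta>1 / 4" "C * (r + \<eta>) \<le> \<eta>1 / 4"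
  proof -
   have "0 \<le> \<eta> * C" using \<eta> C by simp
   thus "C * r \<le> \<eta>1 / 4" "C * (r + \<eta>) \<le> \<eta>1 / 4" using rC' rpos(2) by (simp_all add: algebra_simps)
  qed
  have err: "3 * K * \<eta> * (norm (e i) * norm (e j)) \<le> \<eta>1 / 4" if ij: "i < m" "j < m" for i j
  proof -
   have "norm (e i) * norm (e j) \<le> 120 * 120" using e[OF ij(1)] e[OF ij(2)] by (intro mult_mono) auto
   hence "3 * K * \<eta> * (norm (e i) * norm (e j)) \<le> 3 * K * \<eta> * (120 * 120)" using K1 \<eta> by (intro mult_left_mono) auto
   also have "\<dots> = \<eta> * (2 * (120\<^sup>2 * (3 * K))) / 2" by simp
   also have "\<dots> \<le> \<eta> * H / 2" using H(2) \<eta> mult_left_mono[of "2 * (120\<^sup>2 * (3 * K))" H \<eta>] by (simp add: mult_ac)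
   finally show ?thesis using \<eta>(2) by linarith
  qed
  have g0: "\<bar>T (e i) (e j) + (e i \<bullet> u) * (e j \<bullet> u) - (if i = j then 1 else 0)\<bar> \<le> \<eta>1 / 2" if ij: "i < m" "j < m" for i j
  proof -
   have "D U y (e i) \<bullet> D U y (e j) - (T (e i) (e j) + (e i \<bullet> u) * (e j \<bullet> u)) = D U y (e i) \<bullet> D g y (e j) + D g y (e i) \<bullet> D (neckmap \<sigma>) y (e j)"
    unfolding nf(1)[symmetric] DU by (simp add: inner_add_left inner_add_right)
   moreover have "\<bar>D U y (e i) \<bullet> D g y (e j)\<bar> \<le> K * \<eta> * (norm (e i) * norm (e j))"
   proof -
    have "norm (D U y (e i)) * norm (D g y (e j)) \<le> (K * norm (e i)) * (\<eta> * norm (e j))"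
     using jU gj(2)[of "e j"] K1 unfolding bounded_jet_def \<eta>_def by (intro mult_mono) auto
    thus ?thesis using Cauchy_Schwarz_ineq2[of "D U y (e i)" "D g y (e j)"] by (simp add: mult_ac)
   qed
   moreover have "\<bar>D g y (e i) \<bullet> D (neckmap \<sigma>) y (e j)\<bar> \<le> 2 * K * \<eta> * (norm (e i) * norm (e j))"
   proof -
    have "norm (D (neckmap \<sigma>) y (e j)) \<le> norm (D U y (e j)) + norm (D g y (e j))"
     using norm_triangle_ineq4[of "D U y (e j)" "D g y (e j)"] by (simp add: DU)
    also have "\<dots> \<le> K * norm (e j) + K * norm (e j)"
    proof (rule add_mono)
     show "norm (D U y (e j)) \<le> K * norm (e j)" using jU unfolding bounded_jet_def by blast
     show "norm (D g y (e j)) \<le> K * norm (e j)" using \<eta>60 K1 by (intro order_trans[OF gj(2)] mult_right_mono) (auto simp: \<eta>_def)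
    qed
    finally have "norm (D g y (e i)) * norm (D (neckmap \<sigma>) y (e j)) \<le> (\<eta> * norm (e i)) * (2 * K * norm (e j))"
     using gj(2)[of "e i"] \<eta> unfolding \<eta>_def by (intro mult_mono) auto
    thus ?thesis using Cauchy_Schwarz_ineq2[of "D g y (e i)" "D (neckmap \<sigma>) y (e j)"] by (simp add: mult_ac)
   qed
   ultimately have "\<bar>D U y (e i) \<bullet> D U y (e j) - (T (e i) (e j) + (e i \<bullet> u) * (e j \<bullet> u))\<bar> \<le> 3 * K * \<eta> * (norm (e i) * norm (e j))" by (simp add: abs_le_iff)
   thus ?thesis using err[OF ij] G0[OF ij] Cr(1) by linarith
  qed
  have h0: "\<bar>T (e i) (e j) - (if i = j then r * lam i else 0)\<bar> \<le> \<eta>1 / 2" if ij: "i < m" "j < m" for i j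
  proof -
   have "\<bar>(u, 0) \<bullet> D2 g (e j) y (e i)\<bar> \<le> \<eta> * norm (e i) * norm (e j)"
    using Cauchy_Schwarz_ineq2[of "(u, 0)" "D2 g (e j) y (e i)"] gj(3)[of "e j" "e i"] u1 by (simp add: norm_Pair \<eta>_def)
   also have "\<dots> \<le> 3 * K * \<eta> * (norm (e i) * norm (e j))"
   proof -
    have "1 * (\<eta> * (norm (e i) * norm (e j))) \<le> 3 * K * (\<eta> * (norm (e i) * norm (e j)))" using K1 \<eta> by (intro mult_right_mono) auto
    thus ?thesis by (simp add: mult_ac)
   qed
   finally have "\<bar>- ((u, 0) \<bullet> D2 U (e j) y (e i)) - T (e i) (e j)\<bar> \<le> \<eta>1 / 4"
    using err[OF ij] unfolding DDU nf(3)[symmetric] inner_add_right by linarith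
   thus ?thesis using H0[OF ij] Cr(2) by linarith
  qed
  have T0: "0 \<le> T v v" for v by (simp add: T_def)
  show "- \<eta>0 \<le> r * lam i" "r * lam i \<le> 2" if i: "i < m" for i
  proof -
   have "\<bar>T (e i) (e i) - r * lam i\<bar> \<le> \<eta>1 / 2" "\<bar>T (e i) (e i) + (e i \<bullet> u)\<^sup>2 - 1\<bar> \<le> \<eta>1 / 2"
    using h0[OF i i] g0[OF i i] by (simp_all add: power2_eq_square)
   thus "- \<eta>0 \<le> r * lam i" "r * lam i \<le> 2" using T0[of "e i"] \<eta>1 zero_le_power2[of "e i \<bullet> u"] by linarith+
  qed
  show "1 / 4 \<le> r * lam i \<or> 1 / 4 \<le> r * lam j" if i: "i < m" and j: "j < m" and ij: "i \<noteq> j" for i j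
  proof (rule ccontr)
   \<comment> \<open>Two such directions would both be close to the axis, hence not orthogonal.\<close>
   assume "\<not> ?thesis"
   hence s: "r * lam i < 1 / 4" "r * lam j < 1 / 4" by auto
   have a: "1 / 2 \<le> (e k \<bullet> u)\<^sup>2" if "k < m" "r * lam k < 1/4" for k
   proof -
    have "\<bar>T (e k) (e k) - r * lam k\<bar> \<le> \<eta>1 / 2" "\<bar>T (e k) (e k) + (e k \<bullet> u)\<^sup>2 - 1\<bar> \<le> \<eta>1 / 2"
     using h0[OF that(1) that(1)] g0[OF that(1) that(1)] by (simp_all add: power2_eq_square)
    thus ?thesis using that(2) \<eta>1 by linarith
   qed
   have "\<bar>T (e i) (e j)\<bar> \<le> \<eta>1 / 2" "\<bar>T (e i) (e j) + (e i \<bullet> u) * (e j \<bullet> u)\<bar> \<le> \<eta>1 / 2" using h0[OF i j] g0[OF i j] ij by simp_all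
   hence "\<bar>(e i \<bullet> u) * (e j \<bullet> u)\<bar> \<le> 1 / 32" using \<eta>1 by linarith
   hence "((e i \<bullet> u) * (e j \<bullet> u))\<^sup>2 \<le> (1 / 32)\<^sup>2" using power_mono[of "\<bar>(e i \<bullet> u) * (e j \<bullet> u)\<bar>" "1/32" 2] by simp
   moreover have "1 / 2 * (1 / 2) \<le> (e i \<bullet> u)\<^sup>2 * (e j \<bullet> u)\<^sup>2" using a[OF i s(1)] a[OF j s(2)] by (intro mult_mono) auto
   moreover have "(1 / 32 :: real)\<^sup>2 = 1 / 1024" by (simp add: power2_eq_square)
   ultimately show False by (simp add: power_mult_distrib)
  qed
  qed
 qed
qed

text \<open>A lower bound for the Euclidean second form passes to the principal curvatures, since the frame vectors are not short.\<close>

lemma near_cap: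
 assumes K: "1 \<le> K" and c: "0 < c" "c \<le> 1" and \<kappa>: "0 < \<kappa>" and \<theta>: "0 < \<theta>"
 shows "\<exists>r0>0. \<forall>(U :: 'a::euclidean_space => 'a \<times> real) S y n r. open S \<and> Ck 2 S U \<and> y \<in> S \<and> jet_ok K c 0 U y n \<and>
  (\<forall>v. \<kappa> * (norm v)\<^sup>2 \<le> - (n \<bullet> D2 U v y v)) \<and> 0 < r \<and> r \<le> r0 -->
  controlled S (hsurf r U) y n \<theta> (\<lambda>m lam. \<forall>i<m. \<kappa> / (8 * K\<^sup>2) \<le> r * lam i \<and> r * lam i \<le> 4 * K / c\<^sup>2 + 1)"
proof -
 obtain Cn where Cn: "Cn \<ge> 1" and cf: "\<And>(U :: 'a => 'a \<times> real) y n r \<eta>. jet_ok K c \<eta> U y n ==> 0 < r ==> 0 \<le> \<eta> ==>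
   (r + \<eta>) * Cn \<le> 1 ==> close_forms Cn r \<eta> U y n"
  using forms_close[OF K c, where ?'a = 'a] by auto
 obtain C where C: "C \<ge> 1" and pf: "\<forall>(U :: 'a => 'a \<times> real) S n r \<eta> \<nu> y m lam. open S \<and> y \<in> S \<and> Ck 2 S U \<and>
  jet_ok K c \<eta> U y n \<and> 0 < r \<and> 0 \<le> \<eta> \<and> (r + \<eta>) * C \<le> 1 \<and> surface_curvatures S (hsurf r U) n \<nu> y m lam -->
  inj (D (hsurf r U) y) \<and> (\<exists>e. almost_principal K c (C * r) (C * (r + \<eta>)) U y n m (\<lambda>i. r * lam i) e)"
  using principal_frame[OF K c, where ?'a = 'a] by auto
 define b where "b = \<kappa> / (8 * K\<^sup>2)"
 have K2: "1 \<le> K\<^sup>2" using K by (simp add: one_le_power)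
 have b: "0 < b" using \<kappa> K by (simp add: b_def)
 define s where "s = min (min 1 b) \<theta>"
 have s: "0 < s" "s \<le> 1" "s \<le> b" "s \<le> \<theta>" using b \<theta> by (auto simp: s_def)
 define r0 where "r0 = s / (C + Cn)"
 have r0: "0 < r0" using s C Cn by (simp add: r0_def)
 show ?thesis
 proof (rule exI[of _ r0], rule conjI[OF r0], intro allI impI, elim conjE)
  fix U :: "'a => 'a \<times> real" and S :: "'a set" and y n r
  assume S: "open S" and U: "Ck 2 S U" and y: "y \<in> S" and j: "jet_ok K c 0 U y n"
   and cv: "\<forall>v. \<kappa> * (norm v)\<^sup>2 \<le> - (n \<bullet> D2 U v y v)" and r: "0 < r" "r \<le> r0"
  have "r * (C + Cn) \<le> s" using r(2) C Cn by (simp add: r0_def pos_le_divide_eq)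
  moreover have "0 \<le> r * C" "0 \<le> r * Cn" using r C Cn by auto
  ultimately have rC: "r * C \<le> s" "r * Cn \<le> s" by (auto simp: distrib_left)
  have rC1: "(r + 0) * C \<le> 1" "(r + 0) * Cn \<le> 1" using rC s by auto
  note cf = cf[OF j r(1) order_refl rC1(2)]
  show "controlled S (hsurf r U) y n \<theta> (\<lambda>m lam. \<forall>i<m. \<kappa> / (8 * K\<^sup>2) \<le> r * lam i \<and> r * lam i \<le> 4 * K / c\<^sup>2 + 1)"
   unfolding controlled_def
  proof (intro conjI allI impI; (elim conjE)?)
   show "\<nu> = 0" if "hnormal (hsurf r U) y \<nu>" "fst \<nu> \<bullet> n = 0" for \<nu> by (rule close_formsD(2)[OF cf that])
   show "norm (\<nu> - (n, 0)) \<le> \<theta>" if "good_normal (hsurf r U) y n \<nu>" for \<nu>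
    using close_formsD(3)[OF cf that] rC(2) s(4) by (simp add: mult.commute)
   fix \<nu> m lam
   assume sc: "surface_curvatures S (hsurf r U) n \<nu> y m lam"
   have P: "inj (D (hsurf r U) y) \<and> (\<exists>e. almost_principal K c (C * r) (C * (r + 0)) U y n m (\<lambda>i. r * lam i) e)"
    by (rule pf[rule_format, of S y U 0 n r \<nu> m lam]) (intro conjI S y U j r(1) order_refl rC1(1) sc)
   thus "inj (D (hsurf r U) y)" by blast
   fix i assume i: "i < m"
   obtain e' where "almost_principal K c (C * r) (C * (r + 0)) U y n m (\<lambda>i. r * lam i) e'" using P by blast
   note E = this[unfolded almost_principal_def]
   define e where "e = e' i"
   have e: "norm e \<le> 2 / c" "1 / (2 * K) \<le> norm e" using E i unfolding e_def by blast+
   have "\<bar>- (n \<bullet> D2 U (e' i) y (e' i)) - (if i = i then r * lam i else 0)\<bar> \<le> C * (r + 0)" using E i by blast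
   hence h: "\<bar>- (n \<bullet> D2 U e y e) - r * lam i\<bar> \<le> C * r" by (simp add: e_def)
   have h': "\<bar>- (n \<bullet> D2 U e y e) - r * lam i\<bar> \<le> s" using h rC(1) by (simp add: mult.commute)
   have "(1 / (2 * K))\<^sup>2 \<le> (norm e)\<^sup>2" using e K by (intro power_mono) auto
   hence "\<kappa> * (1 / (2 * K))\<^sup>2 \<le> \<kappa> * (norm e)\<^sup>2" using \<kappa> by (intro mult_left_mono) auto
   moreover have "\<kappa> * (1 / (2 * K))\<^sup>2 = 2 * b" by (simp add: b_def power2_eq_square)
   ultimately show "\<kappa> / (8 * K\<^sup>2) \<le> r * lam i" using cv[rule_format, of e] h' s(3) unfolding b_def[symmetric] by linarith
   have "norm n = 1" "norm (D2 U e y e) \<le> K * norm e * norm e"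
    using j unfolding jet_ok_def transversal_def bounded_jet_def by blast+
   hence "\<bar>n \<bullet> D2 U e y e\<bar> \<le> K * (norm e * norm e)"
    using Cauchy_Schwarz_ineq2[of n "D2 U e y e"] by (simp add: mult.assoc)
   also have "\<dots> \<le> K * (2 / c * (2 / c))" using e c K by (intro mult_left_mono mult_mono) auto
   also have "\<dots> = 4 * K / c\<^sup>2" by (simp add: power2_eq_square)
   finally show "r * lam i \<le> 4 * K / c\<^sup>2 + 1" using h' s(2) by linarith
  qed
 qed
qed

section \<open>The surface after the replacement\<close>

text \<open>Both the center and the rigid motion of the approximating cylinder are as close to the standard ones as desired.\<close>

lemma best_fit_close:
 assumes e: "0 < e" "e \<le> 1"
 shows "\<exists>\<epsilon>1>0. \<forall>R (p :: ('a::euclidean_space \<times> real) \<times> real) W a r \<epsilon> L A. neck_chart R p W a r \<epsilon> L \<and> \<epsilon> \<le> \<epsilon>1 \<and> best_cylinder p r W A -->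
  norm (neck_chart.shift R W a r) \<le> e \<and> linear (\<lambda>v. R (A v)) \<and> (\<forall>v. norm (R (A v)) = norm v) \<and>
  (\<forall>v. norm (R (A v) - v) \<le> e * norm v)"
proof -
 define n1 where "n1 = real DIM('a \<times> real)"
 have n1: "1 \<le> n1" using DIM_positive[where 'a="'a \<times> real"] by (simp add: n1_def)
 obtain C where C0: "0 \<le> C" and C: "\<forall>G t. 0 \<le> t \<and> t \<le> 1 \<and> (\<forall>i<DIM('a) - 1. \<forall>j<DIM('a) - 1. \<bar>G i j - (if i = j then 1 else 0)\<bar> \<le> t) --> \<bar>gram_det (DIM('a) - 1) G - 1\<bar> \<le> C * t"
  using gram_det_close[of "DIM('a) - 1"] by blast
 define k where "k = (8::real) ^ DIM('a)"
 have k: "1 \<le> k" by (simp add: k_def)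
 define H where "H = 6 * k * 50 + 100 + 3 * C"
 define d where "d = e / (6 * k * 10)"
 define \<epsilon>1 where "\<epsilon>1 = d / (n1 * H)"
 have H: "1 \<le> H" "3 * C \<le> H" "100 \<le> H" "300 * k \<le> H" using k C0 by (auto simp: H_def)
 have d: "0 < d" "60 * (k * d) = e" using e k by (auto simp: d_def)
 have kd: "1 * d \<le> k * d" using k d by (intro mult_right_mono) auto
 have \<epsilon>1: "0 < \<epsilon>1" using d n1 H by (simp add: \<epsilon>1_def)
 have \<epsilon>1H: "n1 * \<epsilon>1 * H = d" using n1 H by (simp add: \<epsilon>1_def)
 show ?thesis
 proof (rule exI[of _ \<epsilon>1], rule conjI[OF \<epsilon>1], intro allI impI, elim conjE)
  fix R and p :: "('a \<times> real) \<times> real" and W a r \<epsilon> L A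
  assume nc: "neck_chart R p W a r \<epsilon> L" and \<epsilon>: "\<epsilon> \<le> \<epsilon>1" and A: "best_cylinder p r W A"
  interpret neck_chart R p W a r \<epsilon> L by (rule nc)
  have e1: "e1 \<le> n1 * \<epsilon>1" using \<epsilon> n1 by (simp add: e1_def n1_def)
  have eH: "e1 * H \<le> d" using mult_right_mono[OF e1, of H] H \<epsilon>1H by simp
  have eH': "e1 * (3 * C) \<le> d" "e1 * 100 \<le> d" "e1 * (300 * k) \<le> d"
   using mult_left_mono[OF H(2) e1_nonneg] mult_left_mono[OF H(3) e1_nonneg] mult_left_mono[OF H(4) e1_nonneg] eH by linarith+
  have d3: "0 \<le> d" "3 * d \<le> 1" "d \<le> 1" using d kd e by linarith+
  have s: "20 * e1 \<le> 1" "3 * e1 \<le> 1" using eH'(2) e1_nonneg d3 by linarith+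
  have w: "\<bar>w \<omega> - \<rho>\<bar> \<le> d * \<rho>" if "\<omega> \<in> sphere 0 1" for \<omega>
   by (rule w_close[OF C[folded m_def] s(2) _ d3(3) that]) (use eH'(1) in \<open>simp add: mult_ac\<close>)
  note cs = d3(1,2) s(1) w
  have sh: "norm shift \<le> 2 * d + 2 * \<epsilon>" by (rule shift_small[OF cs])
  have \<epsilon>d: "\<epsilon> \<le> d / 100" using \<epsilon>_le_e1 eH'(2) by linarith
  hence sh': "norm shift \<le> e" using sh d kd by linarith
  define Qv where "Qv v = R (A v)" for v
  have Qeq: "neck_chart.Q R A = Qv" by (rule ext) (unfold Qv_def, rule Q_def[OF cs A])
  have lin: "linear Qv" using Q_lin[OF cs A] by (simp add: Qeq)
  have nQ: "norm (Qv v) = norm v" for v using Q_norm[OF cs A, of v] by (simp add: Qeq)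
  have "norm (Qv v - v) \<le> e * norm v" for v
  proof -
   obtain x s where v: "v = (x, s)" by force
   have "Qv v - v = (Qv (x, 0) - (x, 0)) + s *\<^sub>R (Qv e3 - e3)"
    unfolding v scaleR_diff_right linear_scale[OF lin, symmetric]
    using linear_add[OF lin, of "(x, 0)" "(0, s)"] by simp
   hence "norm (Qv v - v) \<le> norm (Qv (x, 0) - (x, 0)) + \<bar>s\<bar> * norm (Qv e3 - e3)"
    using norm_triangle_ineq[of "Qv (x, 0) - (x, 0)" "s *\<^sub>R (Qv e3 - e3)"] by simp
   also have "\<dots> \<le> (2 * k * (3 * (40 * e1 + (\<epsilon> + 2 * d + 2 * \<epsilon>)))) * norm v + norm v * (20 * e1)"
   proof (rule add_mono)
    have "norm (Qv (x, 0) - (x, 0)) \<le> (2 * k * (3 * (40 * e1 + (\<epsilon> + 2 * d + 2 * \<epsilon>)))) * norm x"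
     using rotation_close[OF cs A, of x] by (simp add: Qeq norm_minus_commute k_def)
    also have "\<dots> \<le> (2 * k * (3 * (40 * e1 + (\<epsilon> + 2 * d + 2 * \<epsilon>)))) * norm v"
     using k e1_nonneg \<epsilon>_nonneg d3 norm_fst_le[of x s] by (intro mult_left_mono mult_nonneg_nonneg) (auto simp: v)
    finally show "norm (Qv (x, 0) - (x, 0)) \<le> \<dots>" .
    show "\<bar>s\<bar> * norm (Qv e3 - e3) \<le> norm v * (20 * e1)"
     using axis_close[OF cs A] norm_snd_le[of s x] by (intro mult_mono) (auto simp: v Qeq)
   qed
   also have "\<dots> = (6 * k * (40 * e1 + (\<epsilon> + 2 * d + 2 * \<epsilon>)) + 20 * e1) * norm v" by (simp add: algebra_simps)
   also have "\<dots> \<le> e * norm v"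
   proof (rule mult_right_mono)
    have "6 * k * (40 * e1 + (\<epsilon> + 2 * d + 2 * \<epsilon>)) = 240 * (k * e1) + 18 * (k * \<epsilon>) + 12 * (k * d)" by (simp add: algebra_simps)
    moreover have "k * \<epsilon> \<le> k * e1" using k \<epsilon>_le_e1 by (intro mult_left_mono) auto
    moreover have "300 * (k * e1) \<le> d" using eH'(3) by (simp add: mult_ac)
    ultimately show "6 * k * (40 * e1 + (\<epsilon> + 2 * d + 2 * \<epsilon>)) + 20 * e1 \<le> e"
     using d kd eH'(2) e1_nonneg d3 by linarith
   qed simp
   finally show ?thesis .
  qed
  thus "norm (neck_chart.shift R W a r) \<le> e \<and> linear (\<lambda>v. R (A v)) \<and> (\<forall>v. norm (R (A v)) = norm v) \<and>
   (\<forall>v. norm (R (A v) - v) \<le> e * norm v)"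
   using sh' lin nQ unfolding Qv_def[abs_def] by blast
 qed
qed

lemma orthogonal_vector:
 fixes y :: "'a::euclidean_space"
 assumes "2 \<le> DIM('a)" obtains w where "w \<bullet> y = 0" "norm w = 1"
proof -
 have "dim {y} < DIM('a)" using assms dim_le_card[of "{y}" "{y}"] by (simp add: span_base)
 from orthogonal_to_subspace_exists[OF this] obtain x where x: "x \<noteq> 0" "\<And>z. z \<in> span {y} ==> Linear_Algebra.orthogonal x z" by blast
 have "x \<bullet> y = 0" using x(2)[of y] by (simp add: span_base Linear_Algebra.orthogonal_def)
 thus thesis using that[of "x /\<^sub>R norm x"] x(1) by simp
qed

text \<open>Where the cap begins, the great circles of the parallel sphere force its normal outward: their curvature
 vector points to the axis, while the cap is convex with respect to its normal.\<close>

lemma cap_boundary_normal: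
 fixes Kf \<nu> :: "'a::euclidean_space => 'a \<times> real"
 assumes dim: "2 \<le> DIM('a)" and y: "norm y = R" and R: "0 < R" and q: "0 < q" "q \<le> 1"
  and Kc: "\<And>z. norm z = R ==> Kf z = ((q / R) *\<^sub>R z, h)"
  and d: "\<And>z. norm z = R ==> Kf differentiable (at z)" "\<nu> differentiable (at y)"
  and o: "\<And>z v. norm z = R ==> \<nu> z \<bullet> D Kf z v = 0"
  and \<kappa>: "\<And>v. \<kappa> * (norm v)\<^sup>2 \<le> second_form (\<bullet>) Kf \<nu> y v v"
  and \<kappa>0: "0 \<le> \<kappa>"
 shows "\<kappa> * R\<^sup>2 \<le> \<nu> y \<bullet> (y /\<^sub>R norm y, 0)"
proof -
 obtain w1 where w1: "w1 \<bullet> y = 0" "norm w1 = 1" using orthogonal_vector[OF dim] .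
 define w where "w = R *\<^sub>R w1"
 have w: "w \<bullet> y = 0" "y \<bullet> w = 0" "norm w = R" using w1 R by (simp_all add: w_def inner_commute[of y w1])
 define c where "c s = cos s *\<^sub>R y + sin s *\<^sub>R w" for s :: real
 define c' where "c' s = (- sin s) *\<^sub>R y + cos s *\<^sub>R w" for s :: real
 have dc: "(c has_vector_derivative c' s) (at s)" for s
  unfolding c_def c'_def by (auto intro!: derivative_eq_intros)
 have dc': "(c' has_vector_derivative - c s) (at s)" for s
  unfolding c_def c'_def by (auto intro!: derivative_eq_intros simp: algebra_simps)
 have nc: "norm (c s) = R" for s
 proof -
  have "(norm (c s))\<^sup>2 = ((cos s)\<^sup>2 + (sin s)\<^sup>2) * R\<^sup>2"
  proof -
   have "y \<bullet> y = R * R" "w \<bullet> w = R * R" using y w(3) by (simp_all add: dot_square_norm power2_eq_square)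
   thus ?thesis unfolding power2_norm_eq_inner c_def inner_add_left inner_add_right inner_scaleR_left inner_scaleR_right
    by (simp only: w mult_zero_right add_0_left add_0_right) (simp only: power2_eq_square distrib_right mult.assoc)
  qed
  hence "(norm (c s))\<^sup>2 = R\<^sup>2" by (simp only: sin_cos_squared_add2 mult_1)
  thus ?thesis by (rule power2_eq_imp_eq) (use R in simp_all)
 qed
 have c0: "c 0 = y" "c' 0 = w" by (simp_all add: c_def c'_def)
 have chain: "((\<lambda>s. g (c s)) has_vector_derivative D g (c s) (c' s)) (at s)" if "g differentiable (at (c s))" for g :: "'a => 'a \<times> real" and s
 proof -
  have "((\<lambda>s. g (c s)) has_derivative (\<lambda>t. D g (c s) (t *\<^sub>R c' s))) (at s)"
   by (rule has_derivative_compose[OF dc[unfolded has_vector_derivative_def] D_works[OF that]])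
  thus ?thesis by (simp add: has_vector_derivative_def linear_scale[OF D_linear[OF that]])
 qed
 have DK: "D Kf (c s) (c' s) = ((q / R) *\<^sub>R c' s, 0)" for s
 proof (rule vector_derivative_unique_at[OF chain[OF d(1)[OF nc]]])
  have "((\<lambda>s. ((q / R) *\<^sub>R c s, h)) has_vector_derivative ((q / R) *\<^sub>R c' s, 0)) (at s)"
   by (intro has_vector_derivative_Pair bounded_linear.has_vector_derivative[OF bounded_linear_scaleR_right dc] has_vector_derivative_const) 
  thus "((\<lambda>s. Kf (c s)) has_vector_derivative ((q / R) *\<^sub>R c' s, 0)) (at s)" by (simp add: Kc[OF nc])
 qed
 have "\<nu> (c s) \<bullet> (c' s, 0) = 0" for s
 proof -
  have "((q / R) *\<^sub>R c' s, 0) = (q / R) *\<^sub>R (c' s, 0 :: real)" by simp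
  hence "\<nu> (c s) \<bullet> ((q / R) *\<^sub>R (c' s, 0)) = 0" using o[OF nc, of s "c' s"] by (simp only: DK)
  thus ?thesis using q R unfolding inner_scaleR_right by simp
 qed
 hence z: "((\<lambda>s. \<nu> (c s) \<bullet> (c' s, 0)) has_vector_derivative 0) (at 0)" by simp
 have "((\<lambda>s. \<nu> (c s) \<bullet> (c' s, 0)) has_vector_derivative (\<nu> (c 0) \<bullet> (- c 0, 0) + D \<nu> (c 0) (c' 0) \<bullet> (c' 0, 0))) (at 0)"
  by (rule bounded_bilinear.has_vector_derivative[OF bounded_bilinear_inner chain has_vector_derivative_Pair[OF dc' has_vector_derivative_const]])
   (use d(2) c0 in simp)
 from vector_derivative_unique_at[OF this z] have e1: "D \<nu> y w \<bullet> (w, 0) = \<nu> y \<bullet> (y, 0)" by (simp add: c0 inner_prod_def)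
 have e2: "D Kf y w = (q / R) *\<^sub>R (w, 0)" using DK[of 0] by (simp only: c0) simp
 have "second_form (\<bullet>) Kf \<nu> y w w = q / R * (\<nu> y \<bullet> (y, 0))" by (simp only: second_form_def e2 inner_scaleR_right e1)
 hence "\<kappa> * R\<^sup>2 \<le> q / R * (\<nu> y \<bullet> (y, 0))" using \<kappa>[of w] w by simp
 also have "\<nu> y \<bullet> (y, 0) = R * (\<nu> y \<bullet> (y /\<^sub>R norm y, 0))" using R y by (simp add: inner_prod_def)
 finally have *: "\<kappa> * R\<^sup>2 \<le> q * (\<nu> y \<bullet> (y /\<^sub>R norm y, 0))" using R by simp
 hence "0 \<le> q * (\<nu> y \<bullet> (y /\<^sub>R norm y, 0))" using \<kappa>0 by (meson order_trans mult_nonneg_nonneg zero_le_power2)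
 hence "0 \<le> \<nu> y \<bullet> (y /\<^sub>R norm y, 0)" using q(1) by (simp only: zero_le_mult_iff) linarith
 hence "q * (\<nu> y \<bullet> (y /\<^sub>R norm y, 0)) \<le> 1 * (\<nu> y \<bullet> (y /\<^sub>R norm y, 0))" using q(2) by (intro mult_right_mono)
 thus ?thesis using * by simp
qed

text \<open>The changed part of the neck outside the cap, extended across the sphere \<open>norm y = 10\<close> where the cap begins.\<close>

definition annulus :: "'a::real_normed_vector set" where
 "annulus = {y. 9 < norm y \<and> norm y < 30}"

text \<open>The rescaled difference of the bent neck, and below of the bent approximating cylinder, to the standard cylinder.\<close>

definition bent_part :: "(('a::euclidean_space \<times> real) \<times> real => 'a \<times> real) => ('a \<times> real => ('a \<times> real) \<times> real) => 'a \<times> real => real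
  => ('a \<times> real => ('a \<times> real) \<times> real) => real => real => real => 'a => 'a \<times> real" where
 "bent_part R W a r \<nu>' \<sigma> B \<delta> y = a + R (radial W (neckmap \<sigma> y)) /\<^sub>R r - neckmap \<sigma> y
  - (\<delta> * bend B (40 - norm y)) *\<^sub>R R (radial \<nu>' (neckmap \<sigma> y))"

definition model_part :: "('a::euclidean_space \<times> real => 'a \<times> real) => 'a \<times> real => real => real => real => 'a => 'a \<times> real" where
 "model_part Q s \<sigma> B \<delta> y = s + (Q (neckmap \<sigma> y) - neckmap \<sigma> y) - (\<delta> * bend B (40 - norm y)) *\<^sub>R Q (y /\<^sub>R norm y, 0)"

text \<open>The bending normal is orthogonal to the neck and hence has bounded derivatives, so bending
 by the small multiple \<open>\<delta>\<close> of it is a small perturbation, whichever side the normal points to. The constant does not depend on the parameters of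
 the bending.\<close>

lemma annulus_error:
 assumes \<phi>: "cutoff \<phi>"
 shows "\<exists>C\<ge>1. \<forall>R (p :: ('a::euclidean_space \<times> real) \<times> real) W a r \<epsilon> L \<nu>' \<sigma> B \<delta> s t e' Q h bent model.
  neck_chart R p W a r \<epsilon> L \<and> C * \<epsilon> \<le> 1 \<and>
  unit_normal_field lor (cyl L) cyl_tangent (\<lambda>_. htangent p) (radial W) (radial \<nu>') \<and>
  \<sigma> \<in> {1, -1} \<and> 1 \<le> B \<and> 0 \<le> \<delta> \<and> linear Q \<and> (\<forall>v. norm (Q v) = norm v) \<and>
  (\<forall>v. norm (Q v - v) \<le> t * norm v) \<and> 0 \<le> t \<and> norm s \<le> e' \<and> h = (\<lambda>y. \<phi> (40 - norm y)) \<and>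
  bent = bent_part R W a r \<nu>' \<sigma> B \<delta> \<and> model = model_part Q s \<sigma> B \<delta> -->
  (\<forall>k. Ck k annulus bent \<and> Ck k annulus model \<and> Ck k annulus h) \<and>
  (\<forall>y\<in>annulus. bd 2 (\<lambda>y. h y *\<^sub>R bent y + (1 - h y) *\<^sub>R model y) y (C * (\<epsilon> + \<delta> + t + e')))"
proof -
 define n where "n = real DIM('a)"
 have n1: "1 \<le> n" using DIM_positive[where 'a='a] by (simp add: n_def)
 define A where "A = cball 0 30 - ball (0::'a) 9"
 define S0 where "S0 = {y :: 'a. 9 < norm y \<and> norm y < 30}"
 have S0: "open S0" unfolding S0_def by (intro open_Collect_conj open_Collect_less continuous_intros)
 have S0A: "S0 \<subseteq> A" "S0 \<subseteq> - {0}" by (auto simp: A_def S0_def)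
 have o: "open (- {0 :: 'a})" by (simp add: open_Compl)
 have cA: "compact A" "A \<subseteq> - {0}" unfolding A_def by (auto intro: compact_diff)
 have qu: "Ck k (- {0}) (\<lambda>y::'a. (y /\<^sub>R norm y, 0 :: real))" for k by (intro Ck_Pair[OF o Ck_unit] Ck_const)
 have d40: "Ck k (- {0}) (\<lambda>y::'a. 40 - norm y)" for k by (intro Ck_diff_fun[OF o] Ck_const Ck_norm)
 have hC: "Ck k (- {0}) (\<lambda>y::'a. \<phi> (40 - norm y))" for k
  by (rule Ck_compose[OF o d40, of k UNIV]) (use \<phi> in \<open>auto simp: cutoff_def intro: smooth_on_Ck\<close>)
 have "\<exists>M\<ge>0. \<forall>y\<in>A. bd 3 (neckmap \<sigma>) y M" for \<sigma> by (rule bd_compact[OF cA neckmap_Ck])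
 then obtain Ma Mb where Mab: "0 \<le> Ma" "\<forall>y\<in>A. bd 3 (neckmap 1) y Ma" "0 \<le> Mb" "\<forall>y\<in>A. bd 3 (neckmap (-1)) y Mb" by meson
 obtain Mq where Mq: "0 \<le> Mq" "\<forall>y\<in>A. bd 2 (\<lambda>y::'a. (y /\<^sub>R norm y, 0 :: real)) y Mq" using bd_compact[OF cA qu] by blast
 obtain Mh where Mh: "0 \<le> Mh" "\<forall>y\<in>A. bd 2 (\<lambda>y::'a. \<phi> (40 - norm y)) y Mh" using bd_compact[OF cA hC] by blast
 obtain Md where Md: "0 \<le> Md" "\<forall>y\<in>A. bd 2 (\<lambda>y::'a. 40 - norm y) y Md" using bd_compact[OF cA d40] by blast
 define M0 where "M0 = Ma + Mb + 1"
 have M0: "1 \<le> M0" "bd 3 (neckmap \<sigma>) y M0" if "\<sigma> \<in> {1, -1}" "y \<in> A" for \<sigma> y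
  using Mab that by (auto simp: M0_def intro: bd_mono)
 have M0': "0 \<le> M0" using Mab by (simp add: M0_def)
 obtain Cb where Cb: "1 \<le> Cb" "\<forall>(f :: 'a => real) (g :: real => real) S T x e.
  open S \<and> Ck 2 S f \<and> Ck 2 T g \<and> (\<forall>x\<in>S. f x \<in> T) \<and> x \<in> S \<and> bd 2 f x Md \<and> bd 2 g (f x) e
  --> bd 2 (\<lambda>x. g (f x)) x (Cb * e)"
  using bd_compose[OF Md(1), of 2] by blast
 obtain C1 where C1: "1 \<le> C1" "\<forall>(f :: 'a => 'a \<times> real) (g :: 'a \<times> real => 'a \<times> real) S T x e.
  open S \<and> Ck 3 S f \<and> Ck 3 T g \<and> (\<forall>x\<in>S. f x \<in> T) \<and> x \<in> S \<and> bd 3 f x M0 \<and> bd 3 g (f x) e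
  --> bd 3 (\<lambda>x. g (f x)) x (C1 * e)"
  using bd_compose[OF M0', of 3] by blast
 define K1 where "K1 = n * (M0 + 1) / (1/60)"
 define M\<mu> where "M\<mu> = 1 + K1 + (n * (2 * K1 * (M0 + 1) + (M0 + 1)) + K1\<^sup>2) / (1/60)"
 have K1: "0 \<le> K1" using n1 M0' by (simp add: K1_def)
 hence M\<mu>: "0 \<le> M\<mu>" using n1 M0' by (simp add: M\<mu>_def)
 define M where "M = M0 + Mq + Mh + Cb * 310 + M\<mu> + 1"
 have M: "1 \<le> M" "M0 \<le> M" "Mq \<le> M" "Mh \<le> M" "Cb * 310 \<le> M" "M\<mu> \<le> M"
  using M0' Mq(1) Mh(1) Cb(1) M\<mu> by (auto simp: M_def)
 define C where "C = 4 * M * C1 + 48 * M ^ 3 + 8 * M + 8 * M\<^sup>2 + 60 * n * C1"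
 have MC: "0 \<le> 4 * M * C1" "0 \<le> 48 * M ^ 3" "0 \<le> 8 * M" "0 \<le> 8 * M\<^sup>2" "1 \<le> 60 * n * C1"
  using M(1) C1 mult_mono[of 1 n 1 C1] n1 by auto
 have Cge: "4 * M * C1 \<le> C" "48 * M ^ 3 \<le> C" "8 * M \<le> C" "8 * M\<^sup>2 \<le> C" "60 * n * C1 \<le> C" "1 \<le> C"
  using MC unfolding C_def by linarith+
 show ?thesis
 proof (rule exI[of _ C], rule conjI[OF Cge(6)], intro allI impI, elim conjE)
  fix R and p :: "('a \<times> real) \<times> real" and W a r \<epsilon> L \<nu>' \<sigma> and B \<delta> t e' :: real and s :: "'a \<times> real"
   and Q :: "'a \<times> real => 'a \<times> real" and h :: "'a => real" and bent model
  assume nc: "neck_chart R p W a r \<epsilon> L" and \<epsilon>: "C * \<epsilon> \<le> 1"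
   and un: "unit_normal_field lor (cyl L) cyl_tangent (\<lambda>_. htangent p) (radial W) (radial \<nu>')"
   and \<sigma>: "\<sigma> \<in> {1, -1 :: real}" and B: "1 \<le> B" and \<delta>: "0 \<le> \<delta>" and Q: "linear Q" "\<forall>v. norm (Q v) = norm v"
   "\<forall>v. norm (Q v - v) \<le> t * norm v" and t: "0 \<le> t" and s: "norm s \<le> e'" and h: "h = (\<lambda>y. \<phi> (40 - norm y))"
   and bent: "bent = bent_part R W a r \<nu>' \<sigma> B \<delta>" and model: "model = model_part Q s \<sigma> B \<delta>"
  define u where "u = (\<lambda>y :: 'a. bend B (40 - norm y))"
  define \<mu> where "\<mu> = (\<lambda>y. R (radial \<nu>' (neckmap \<sigma> y)))"
  define g1 where "g1 = (\<lambda>y. a + R (radial W (neckmap \<sigma> y)) /\<^sub>R r - neckmap \<sigma> y)"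
  note u = u_def and \<mu> = \<mu>_def and g1 = g1_def
  define S where "S = (annulus :: 'a set)"
  have bent: "bent = (\<lambda>y. g1 y - (\<delta> * u y) *\<^sub>R \<mu> y)" and model: "model = (\<lambda>y. s + (Q (neckmap \<sigma> y) - neckmap \<sigma> y) - (\<delta> * u y) *\<^sub>R Q (y /\<^sub>R norm y, 0))"
   unfolding bent model by (rule ext, simp add: bent_part_def model_part_def u \<mu> g1)+
  interpret neck_chart R p W a r \<epsilon> L by (rule nc)
  have S: "S = S0" by (simp add: S_def annulus_def S0_def)
  have oS: "open S" using S0 by (simp add: S)
  have SA: "y \<in> A" "y \<noteq> 0" "9 < norm y" "norm y < 30" if "y \<in> S" for y using that S0A by (auto simp: S S0_def)
  have nmC: "Ck k S (neckmap \<sigma>)" for k by (rule Ck_subset[OF neckmap_Ck]) (use SA in auto)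
  have nmc: "neckmap \<sigma> y \<in> cyl L" if "y \<in> S" for y
   using SA[OF that] \<sigma> L by (auto simp: neckmap_def cyl_def)
  have nmp: "neckmap \<sigma> y \<in> punctured L" if "y \<in> S" for y using nmc[OF that] cyl_punctured by blast
  have cm: "cylmap (neckmap \<sigma> y) = neckmap \<sigma> y" for y :: 'a
   by (cases "y = 0") (simp_all add: cylmap_def neckmap_def)
  have g1f: "g1 = (\<lambda>y. f (neckmap \<sigma> y))" by (rule ext) (simp add: g1 f_def Z_def cm)
  have g1C: "Ck k S g1" for k unfolding g1f by (rule Ck_compose[OF oS nmC f_Ck nmp])
  have g1b: "bd 3 g1 y (C1 * \<epsilon>)" if y: "y \<in> S" for y
   unfolding g1f by (rule C1(2)[rule_format, of S _ "punctured L"]) (use y oS nmC f_Ck nmp M0(2)[OF \<sigma> SA(1)[OF y]] f_bd[OF nmc[OF y]] in blast)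
  have \<epsilon>1: "60 * n * C1 * \<epsilon> \<le> 1" using mult_right_mono[OF Cge(5) \<epsilon>_nonneg] \<epsilon> by linarith
  have C1\<epsilon>: "0 \<le> C1 * \<epsilon>" using C1 \<epsilon>_nonneg by simp
  hence "1 * (C1 * \<epsilon>) \<le> n * (C1 * \<epsilon>)" using n1 by (intro mult_right_mono) auto
  hence C1\<epsilon>1: "C1 * \<epsilon> \<le> 1" using \<epsilon>1 C1\<epsilon> by (simp add: mult.assoc)
  define Y where "Y y = Z (neckmap \<sigma> y)" for y
  have Yg: "Y = (\<lambda>y. neckmap \<sigma> y + g1 y)" by (rule ext) (simp add: Y_def g1f f_def cm)
  have YC: "Ck k S Y" for k unfolding Y_def[abs_def] by (rule Ck_compose[OF oS nmC Z_Ck nmp])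
  have Yb: "bd 3 Y y (M0 + 1)" if y: "y \<in> S" for y unfolding Yg
   by (rule bd_mono[OF bd_add[OF oS y nmC g1C M0(2)[OF \<sigma> SA(1)[OF y]] g1b[OF y]]]) (use C1\<epsilon>1 in simp)
  have dnm: "neckmap \<sigma> differentiable (at y)" if "y \<in> S" for y using Ck_diff[OF nmC that] .
  have DY: "D Y y v = D Z (neckmap \<sigma> y) (D (neckmap \<sigma>) y v)" if y: "y \<in> S" for y v
   unfolding Y_def[abs_def] by (rule D_compose(1)[OF dnm[OF y] Z_diff[OF nmp[OF y]]])
  have tan: "D (neckmap \<sigma>) y v \<in> cyl_tangent (neckmap \<sigma> y)" if y: "y \<in> S" for y v
  proof -
   have "(y /\<^sub>R norm y) \<bullet> (y /\<^sub>R norm y) = 1" using norm_eq_1[of "y /\<^sub>R norm y"] SA(2)[OF y] by simp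
   hence "(v - (v \<bullet> (y /\<^sub>R norm y)) *\<^sub>R (y /\<^sub>R norm y)) \<bullet> (y /\<^sub>R norm y) = 0"
    unfolding inner_diff_left inner_scaleR_left[of "v \<bullet> (y /\<^sub>R norm y)"] by simp
   thus ?thesis unfolding neckmap_D[OF SA(2)[OF y]] cyl_tangent_def mem_Collect_eq fst_conv
    by (simp only: neckmap_def fst_conv inner_scaleR_left[of "inverse (norm y)"])
  qed
  have \<nu>d: "radial \<nu>' differentiable (at x)" and \<nu>t: "radial \<nu>' x \<in> htangent p" and \<nu>u: "lor (radial \<nu>' x) (radial \<nu>' x) = 1"
   and \<nu>o: "\<And>v. v \<in> cyl_tangent x ==> lor (radial \<nu>' x) (D X x v) = 0" if "x \<in> cyl L" for x
   using un that unfolding unit_normal_field_def by blast+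
  have \<mu>d: "\<mu> differentiable (at y)" if y: "y \<in> S" for y
   unfolding \<mu> by (rule D_bounded_linear(2)[OF R_bl D_compose(2)[OF dnm[OF y] \<nu>d[OF nmc[OF y]]]])
  have \<mu>u: "\<mu> y \<bullet> \<mu> y = 1" if y: "y \<in> S" for y
   unfolding \<mu> using R_lor[OF \<nu>t \<nu>t, OF nmc nmc, OF y y] \<nu>u[OF nmc[OF y]] by simp
  have \<mu>o: "\<mu> y \<bullet> D Y y v = 0" if y: "y \<in> S" for y v
  proof -
   have "\<mu> y \<bullet> (r *\<^sub>R D Y y v) = lor (radial \<nu>' (neckmap \<sigma> y)) (D X (neckmap \<sigma> y) (D (neckmap \<sigma>) y v))"
    unfolding \<mu> DY[OF y] R_DX[OF nmp[OF y], symmetric] by (rule R_lor[OF \<nu>t[OF nmc[OF y]] DX_tan[OF nmp[OF y]]])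
   also have "\<dots> = 0" by (rule \<nu>o[OF nmc[OF y] tan[OF y]])
   finally show ?thesis using r by simp
  qed
  have low: "1/60 * norm v \<le> norm (D Y y v)" if y: "y \<in> S" for y v
  proof -
   have g3: "norm (D g1 y b) \<le> C1 * \<epsilon>" if "b \<in> Basis" for b
    using g1b[OF y] that by (auto simp: numeral_3_eq_3 dest: bd_norm)
   have "norm (D g1 y v) \<le> n * (C1 * \<epsilon>) * norm v"
    unfolding n_def by (rule bd_D_norm[OF Ck_diff[OF g1C y] g3])
   also have "\<dots> \<le> 1/60 * norm v" using \<epsilon>1 by (intro mult_right_mono) (auto simp: mult_ac)
   finally have "norm (D g1 y v) \<le> 1/60 * norm v" .
   moreover have "norm v / 30 \<le> norm (D (neckmap \<sigma>) y v)" using SA[OF y] by (intro neckmap_D_lower \<sigma>) auto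
   moreover have "D (neckmap \<sigma>) y v = D Y y v - D g1 y v"
    unfolding Yg using D_add[OF dnm[OF y] Ck_diff[OF g1C y], of v] by simp
   moreover have "norm (D Y y v - D g1 y v) \<le> norm (D Y y v) + norm (D g1 y v)" by (rule norm_triangle_ineq4)
   ultimately have "norm v / 30 \<le> norm (D Y y v) + 1/60 * norm v" by simp
   thus ?thesis by linarith
  qed
  have \<mu>C: "Ck k S \<mu>" for k
   by (rule unit_normal_bounds(1)[OF oS YC \<mu>d \<mu>u \<mu>o _ _ low]) auto
  have \<mu>b: "bd 2 \<mu> y M\<mu>" if y: "y \<in> S" for y
   unfolding M\<mu>_def n_def
   by (rule unit_normal_bounds(2)[OF oS YC \<mu>d \<mu>u \<mu>o _ _ low y Yb[OF y]]) (use M0' Mab in \<open>auto simp: K1_def n_def M0_def\<close>)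
  have hS: "Ck k S h" for k unfolding h by (rule Ck_subset[OF hC]) (use SA in auto)
  have dS: "Ck k S (\<lambda>y. 40 - norm y)" for k by (rule Ck_subset[OF d40]) (use SA in auto)
  have uC: "Ck k S u" for k unfolding u
   by (rule Ck_compose[OF oS dS bend_bd(2)[OF B, of 11]]) (use SA in auto)
  have ub: "bd 2 u y (Cb * 310)" if y: "y \<in> S" for y
  proof -
   have "bd 2 (bend B) (40 - norm y) 310" by (rule bend_bd(1)[OF B]) (use SA[OF y] in simp)
   moreover have "\<forall>x\<in>S. 40 - norm x \<in> {10<..}" using SA by auto
   moreover have "bd 2 (\<lambda>y::'a. 40 - norm y) y Md" using Md(2) SA(1)[OF y] by blast
   ultimately show ?thesis unfolding u
    using Cb(2)[rule_format, of S "\<lambda>y. 40 - norm y" "{10<..}" "bend B" y 310] oS dS bend_bd(2)[OF B, of 11] y by simp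
  qed
  have bQ: "bounded_linear Q" using Q(1) linear_conv_bounded_linear by blast
  have quS: "Ck k S (\<lambda>y::'a. (y /\<^sub>R norm y, 0 :: real))" for k by (rule Ck_subset[OF qu]) (use SA in auto)
  have qC: "Ck k S (\<lambda>y. Q (y /\<^sub>R norm y, 0))" for k by (rule Ck_blin[OF oS bQ quS])
  have qb: "bd 2 (\<lambda>y. Q (y /\<^sub>R norm y, 0)) y Mq" if y: "y \<in> S" for y
   using bd_blin[OF oS y bQ _ _ quS, of 1 2 Mq] Q(2) Mq(2) SA(1)[OF y] by simp
  have bT: "bounded_linear (\<lambda>v. Q v - v)" by (intro bounded_linear_sub bQ bounded_linear_ident)
  have du: "Ck k S (\<lambda>y. \<delta> * u y)" for k by (intro Ck_mult[OF oS] Ck_const uC)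
  show "(\<forall>k. Ck k annulus bent \<and> Ck k annulus model \<and> Ck k annulus h) \<and>
   (\<forall>y\<in>annulus. bd 2 (\<lambda>y. h y *\<^sub>R bent y + (1 - h y) *\<^sub>R model y) y (C * (\<epsilon> + \<delta> + t + e')))"
   unfolding S_def[symmetric]
  proof (intro conjI allI ballI hS)
   show "Ck k S bent" for k unfolding bent
    by (rule Ck_diff_fun[OF oS g1C Ck_scaleR[OF oS du \<mu>C]])
   show "Ck k S model" for k unfolding model
    by (rule Ck_diff_fun[OF oS Ck_add[OF oS Ck_const Ck_blin[OF oS bT nmC]] Ck_scaleR[OF oS du qC]])
   fix y assume y: "y \<in> S"
   have g1b2: "bd 2 g1 y (C1 * \<epsilon>)" by (rule bd_le[OF g1b[OF y]]) simp
   have nmb: "bd 2 (neckmap \<sigma>) y M" by (rule bd_le[OF bd_mono[OF M0(2)[OF \<sigma> SA(1)[OF y]] M(2)]]) simp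
   have hb: "bd 2 h y M" unfolding h by (rule bd_mono[OF _ M(4)]) (use Mh(2) SA(1)[OF y] in blast)
   have "bd 2 (\<lambda>y. h y *\<^sub>R bent y + (1 - h y) *\<^sub>R model y) y
    (4 * M * (C1 * \<epsilon> + 4 * \<delta> * M\<^sup>2) + 8 * M * (e' + t * M + 4 * \<delta> * M\<^sup>2))"
    unfolding bent model by (rule blend_bd[OF oS y g1C \<mu>C nmC qC hS uC g1b2 bd_mono[OF \<mu>b[OF y] M(6)] nmb bd_mono[OF qb[OF y] M(3)] hb
      bd_mono[OF ub[OF y] M(5)] M(1) bT _ t s \<delta>]) (use Q(3) in blast)
   moreover have "4 * M * (C1 * \<epsilon> + 4 * \<delta> * M\<^sup>2) + 8 * M * (e' + t * M + 4 * \<delta> * M\<^sup>2) \<le> C * (\<epsilon> + \<delta> + t + e')"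
   proof -
    have "4 * M * (C1 * \<epsilon> + 4 * \<delta> * M\<^sup>2) + 8 * M * (e' + t * M + 4 * \<delta> * M\<^sup>2)
     = (4 * M * C1) * \<epsilon> + (48 * M ^ 3) * \<delta> + (8 * M\<^sup>2) * t + (8 * M) * e'"
     by (simp add: algebra_simps power2_eq_square power3_eq_cube)
    also have "\<dots> \<le> C * \<epsilon> + C * \<delta> + C * t + C * e'"
     using order_trans[OF norm_ge_zero s] t \<delta> \<epsilon>_nonneg by (intro add_mono mult_right_mono Cge) auto
    finally show ?thesis by (simp add: distrib_left)
   qed
   ultimately show "bd 2 (\<lambda>y. h y *\<^sub>R bent y + (1 - h y) *\<^sub>R model y) y (C * (\<epsilon> + \<delta> + t + e'))"
    by (rule bd_mono)
  qed
 qed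
qed

lemma (in neck_chart) slice_center_tangent: "slice_center W \<in> htangent p"
proof -
 have c: "continuous_on (sphere 0 1) (\<lambda>\<omega>. w \<omega> *\<^sub>R W (\<omega>, 0))"
  by (intro continuous_intros w_continuous W0_continuous)
 have "lor p (sphere_integral (\<lambda>\<omega>. w \<omega> *\<^sub>R W (\<omega>, 0))) = sphere_integral (\<lambda>\<omega>. lor p (w \<omega> *\<^sub>R W (\<omega>, 0)))"
  by (rule sphere_integral_linear[OF sphere_integrable[OF c] bounded_bilinear.bounded_linear_right[OF lor_bb]])
 also have "\<dots> = sphere_integral (\<lambda>\<omega>::'a. 0 :: real)"
  by (rule sphere_integral_cong) (use W_tan slice0 in \<open>auto simp: lor_simps htangent_def\<close>)
 also have "\<dots> = 0" using sphere_integral_const[of "0 :: real", where 'a='a] by simp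
 finally have "lor p (sphere_integral (\<lambda>\<omega>. slice_density X (\<omega>, 0) *\<^sub>R W (\<omega>, 0))) = 0" by (simp only: w_def)
 thus ?thesis by (simp add: slice_center_def htangent_def lor_simps)
qed

text \<open>The chart at the center is a Lorentz isometry and preserves all quantities of the hypersurface.\<close>

lemma transport_normal:
 fixes F G :: "'a::euclidean_space => ('a \<times> real) \<times> real"
 assumes iso: "tangent_isometry R p" and S: "open S" and FG: "\<And>y. y \<in> S ==> lchart R p (F y) = G y"
  and dG: "\<And>y. y \<in> S ==> G differentiable (at y)" and inj: "\<And>y. y \<in> S ==> inj (D G y)"
  and d\<nu>: "\<And>y. y \<in> S ==> \<nu> differentiable (at y)" and u: "\<And>y. y \<in> S ==> lor (\<nu> y) (\<nu> y) = 1"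
  and hn: "\<And>y. y \<in> S ==> hnormal G y (\<nu> y)"
 shows "\<exists>\<nu>'. unit_normal_field lor S (\<lambda>_. UNIV) (\<lambda>y. htangent (F y)) F \<nu>' \<and>
  (\<forall>y\<in>S. \<forall>m lam. principal_curvatures lor (\<lambda>_. UNIV) F \<nu>' y m lam --> principal_curvatures lor (\<lambda>_. UNIV) G \<nu> y m lam)"
proof -
 define P where "P = lchart R p"
 have P: "linear P" "inj P" using lchart_linear[OF iso] lchart_inj[OF iso] by (simp_all add: P_def)
 obtain I where I: "linear I" and PI: "\<And>v. P (I v) = v" "\<And>v. I (P v) = v" using linear_injective_isomorphism[OF P] by blast
 have lI: "lor (I v) (I w) = lor v w" for v w using lchart_lor[OF iso, of "I v" "I w"] by (simp add: P_def[symmetric] PI)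
 have bI: "bounded_linear I" using I linear_conv_bounded_linear by blast
 have FI: "F y = I (G y)" if "y \<in> S" for y using FG[OF that] by (metis PI(2) P_def)
 have dF: "F differentiable (at y)" if y: "y \<in> S" for y
  by (rule differentiable_cong_open[OF S y _ D_bounded_linear(2)[OF bI dG[OF y]]]) (use FI in simp)
 have DF: "D F y v = I (D G y v)" if y: "y \<in> S" for y v
  using D_cong[OF S y FI] D_bounded_linear(1)[OF bI dG[OF y]] by simp
 define \<nu>' where "\<nu>' y = I (\<nu> y)" for y
 have d\<nu>': "\<nu>' differentiable (at y)" and D\<nu>: "D \<nu>' y v = I (D \<nu> y v)" if y: "y \<in> S" for y v
  unfolding \<nu>'_def[abs_def] using D_bounded_linear[OF bI d\<nu>[OF y]] by simp_all
 have "unit_normal_field lor S (\<lambda>_. UNIV) (\<lambda>y. htangent (F y)) F \<nu>'"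
  unfolding unit_normal_field_def
 proof (intro ballI conjI)
  fix y assume y: "y \<in> S"
  show "F differentiable (at y)" "\<nu>' differentiable (at y)" using dF d\<nu>' y by auto
  show "inj (D F y)"
  proof (rule injI)
   fix v w assume "D F y v = D F y w"
   hence "P (I (D G y v)) = P (I (D G y w))" by (simp only: DF[OF y])
   hence "D G y v = D G y w" by (simp only: PI)
   thus "v = w" using injD[OF inj[OF y]] by blast
  qed
  show "\<nu>' y \<in> htangent (F y)" using hn[OF y] lor_commute[of "G y" "\<nu> y"] by (simp add: hnormal_def htangent_def FI[OF y] \<nu>'_def lI)
  show "lor (\<nu>' y) (\<nu>' y) = 1" using u[OF y] by (simp add: \<nu>'_def lI)
  fix v show "lor (\<nu>' y) (D F y v) = 0" using hn[OF y] by (simp add: hnormal_def DF[OF y] \<nu>'_def lI)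
 qed
 moreover have "principal_curvatures lor (\<lambda>_. UNIV) G \<nu> y m lam"
  if y: "y \<in> S" and pc: "principal_curvatures lor (\<lambda>_. UNIV) F \<nu>' y m lam" for y m lam
 proof -
  have "first_form lor F y = first_form lor G y"
   by (intro ext) (simp add: first_form_def DF[OF y] lI)
  moreover have "second_form lor F \<nu>' y = second_form lor G \<nu> y"
   by (intro ext) (simp add: second_form_def DF[OF y] D\<nu>[OF y] lI)
  ultimately show ?thesis using pc unfolding principal_curvatures_def by simp
 qed
 ultimately show ?thesis by blast
qed

text \<open>One half of the neck after the replacement, in the tangent space at the center.\<close>

definition replaced_half :: "(real => real) => ('a::euclidean_space \<times> real => ('a \<times> real) \<times> real) => real => ('a \<times> real => ('a \<times> real) \<times> real)
  => ('a \<times> real => ('a \<times> real) \<times> real) => real => real => real => (real => real \<times> real) => 'a => ('a \<times> real) \<times> real" where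
 "replaced_half \<phi> W r A \<nu>' \<sigma> B \<delta> \<gamma> y = (let z = 40 - norm y;
   x = (y /\<^sub>R norm y, \<sigma> * norm y);
   bent = W x - (\<delta> * (r * bend B z)) *\<^sub>R \<nu>' x;
   m = revolve (profile B \<delta> \<gamma>) y;
   model = slice_center W + r *\<^sub>R A (fst m, \<sigma> * (40 - snd m))
  in if z \<le> 20 then bent
    else if z \<le> 30 then \<phi> z *\<^sub>R bent + (1 - \<phi> z) *\<^sub>R model
    else model)"

text \<open>In the chart at the center the new surface is the model plus a correction supported in the
 annulus; equivalently it is the exact cylinder plus an error made of the neck error, the bending
 and the mismatch of the approximating cylinder.\<close>

lemma replacement_formula:
 fixes W :: "'a::euclidean_space \<times> real => ('a \<times> real) \<times> real"
 assumes nc: "neck_chart R p W a r \<epsilon> L" and A: "linear A" "range A \<subseteq> htangent p" and \<phi>: "cutoff \<phi>" and \<sigma>: "\<sigma> \<in> {1, -1 :: real}"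
  and \<nu>t: "\<forall>x\<in>cyl L. \<nu>' x \<in> htangent p"
  and G: "G = replaced_half \<phi> W r A \<nu>' \<sigma> B \<delta> \<gamma>"
  and Q: "Q = (\<lambda>v. R (A v))" and s: "s = neck_chart.shift R W a r"
  and h: "h = (\<lambda>y. \<phi> (40 - norm y))" and U: "U = (\<lambda>y. R (G y) /\<^sub>R r)" and K: "K = revolve (profile B \<delta> \<gamma>)"
  and bent: "bent = bent_part R W a r \<nu>' \<sigma> B \<delta>" and model: "model = model_part Q s \<sigma> B \<delta>"
 shows "y \<in> ball 0 40 ==> G y \<in> htangent p"
  and "norm y \<le> 10 ==> U y = (s - a + Q (0, 40 * \<sigma>)) + Q (fst (K y), - \<sigma> * snd (K y))"
  and "10 \<le> norm y ==> norm y < 30 ==> U y = (s - a + Q (0, 40 * \<sigma>)) + Q (fst (K y), - \<sigma> * snd (K y)) + h y *\<^sub>R (bent y - model y)"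
  and "10 \<le> norm y ==> norm y < 30 ==> U y + a - neckmap \<sigma> y = h y *\<^sub>R bent y + (1 - h y) *\<^sub>R model y"
proof -
 interpret neck_chart R p W a r \<epsilon> L by (rule nc)
 have tl: "v + v' \<in> htangent p" "v - v' \<in> htangent p" if "v \<in> htangent p" "v' \<in> htangent p" for v v'
  using that by (auto simp: htangent_def lor_simps)
 have ts: "c *\<^sub>R v \<in> htangent p" if "v \<in> htangent p" for v c using that by (auto simp: htangent_def lor_simps)
 define u where "u = (\<lambda>y :: 'a. bend B (40 - norm y))"
 note u = u_def
 define bt where "bt y = W (neckmap \<sigma> y) - (\<delta> * (r * u y)) *\<^sub>R \<nu>' (neckmap \<sigma> y)" for y
 define ml where "ml y = slice_center W + r *\<^sub>R A (fst (K y), \<sigma> * (40 - snd (K y)))" for y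
 have \<phi>1: "\<phi> z = 1" if "z \<le> 20" for z using \<phi> that by (simp add: cutoff_def)
 have \<phi>0: "\<phi> z = 0" if "30 \<le> z" for z using \<phi> that by (simp add: cutoff_def)
 have G': "G y = h y *\<^sub>R bt y + (1 - h y) *\<^sub>R ml y" for y
  using \<phi>1[of "40 - norm y"] \<phi>0[of "40 - norm y"]
  unfolding G replaced_half_def Let_def bt_def ml_def neckmap_def h u K by auto
 have nmc: "neckmap \<sigma> y \<in> cyl L" if "y \<noteq> 0" "norm y < 40" for y
 proof -
  have "norm y < L" "- L < norm y" using that(2) L norm_ge_zero[of y] by linarith+
  thus ?thesis using that(1) \<sigma> by (auto simp: neckmap_def cyl_def)
 qed
 have mlt: "ml y \<in> htangent p" for y using slice_center_tangent A(2) unfolding ml_def by (intro tl ts) auto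
 show "G y \<in> htangent p" if y: "y \<in> ball 0 40" for y
 proof (cases "y = 0")
  case True
  thus ?thesis unfolding G' using \<phi>0[of 40] mlt by (simp add: h)
 next
  case False
  hence "neckmap \<sigma> y \<in> cyl L" using nmc y by simp
  hence "bt y \<in> htangent p" unfolding bt_def by (intro tl ts W_tan \<nu>t[rule_format])
  thus ?thesis unfolding G' by (intro tl ts mlt)
 qed
 have Ql: "linear Q" using linear_compose[OF A(1) R_lin] by (simp add: Q comp_def)
 have RU: "U y = h y *\<^sub>R (R (bt y) /\<^sub>R r) + (1 - h y) *\<^sub>R (R (ml y) /\<^sub>R r)" for y
  unfolding U G' linear_add[OF R_lin] linear_scale[OF R_lin] scaleR_add_right by (simp add: mult.commute)
 have Rm: "R (ml y) /\<^sub>R r = (s - a + Q (0, 40 * \<sigma>)) + Q (fst (K y), - \<sigma> * snd (K y))" for y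
 proof -
  have "Q (fst (K y), \<sigma> * (40 - snd (K y))) = Q (0, 40 * \<sigma>) + Q (fst (K y), - \<sigma> * snd (K y))"
   unfolding linear_add[OF Ql, symmetric] by (simp add: algebra_simps)
  moreover have "s - a = R (slice_center W) /\<^sub>R r" by (simp add: s shift_def)
  ultimately show ?thesis using r unfolding ml_def linear_add[OF R_lin] linear_scale[OF R_lin] scaleR_add_right by (simp add: Q)
 qed
 show "U y = (s - a + Q (0, 40 * \<sigma>)) + Q (fst (K y), - \<sigma> * snd (K y))" if "norm y \<le> 10" for y
  unfolding RU Rm using \<phi>0[of "40 - norm y"] that by (simp add: h)
 fix y :: 'a assume y: "10 \<le> norm y" "norm y < 30"
 hence y0: "y \<noteq> 0" "norm y < 40" by auto
 have cm: "cylmap (neckmap \<sigma> y) = neckmap \<sigma> y" by (rule cylmap_id[OF nmc[OF y0]])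
 have rad: "radial f (neckmap \<sigma> y) = f (neckmap \<sigma> y)" for f :: "'a \<times> real => 'z"
  using cm by (simp add: radial_def cylmap_def case_prod_beta)
 have Rb: "R (bt y) /\<^sub>R r = bent y + (neckmap \<sigma> y - a)"
  using r unfolding bt_def bent bent_part_def rad linear_diff[OF R_lin] linear_scale[OF R_lin] by (simp add: scaleR_diff_right u)
 have Ky: "K y = ((1 - \<delta> * u y) *\<^sub>R (y /\<^sub>R norm y), 40 - norm y)" using y by (simp add: K revolve_def profile_def u)
 have Rm': "R (ml y) /\<^sub>R r = model y + (neckmap \<sigma> y - a)"
 proof -
  have "(fst (K y), \<sigma> * (40 - snd (K y))) = neckmap \<sigma> y - (\<delta> * u y) *\<^sub>R (y /\<^sub>R norm y, 0)"
   by (simp add: Ky neckmap_def scaleR_diff_left left_diff_distrib)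
  hence eA: "A (fst (K y), \<sigma> * (40 - snd (K y))) = A (neckmap \<sigma> y) - (\<delta> * u y) *\<^sub>R A (y /\<^sub>R norm y, 0)"
   by (simp only: linear_diff[OF A(1)] linear_scale[OF A(1)])
  have "R (ml y) /\<^sub>R r = R (slice_center W) /\<^sub>R r + (Q (neckmap \<sigma> y) - (\<delta> * u y) *\<^sub>R Q (y /\<^sub>R norm y, 0))"
   using r unfolding ml_def eA linear_add[OF R_lin] linear_scale[OF R_lin] linear_diff[OF R_lin] scaleR_add_right Q by simp
  thus ?thesis by (simp add: model model_part_def u s shift_def)
 qed
 show "U y = (s - a + Q (0, 40 * \<sigma>)) + Q (fst (K y), - \<sigma> * snd (K y)) + h y *\<^sub>R (bent y - model y)"
  unfolding Rm[symmetric] RU unfolding Rb Rm' by (simp add: algebra_simps)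
 show "U y + a - neckmap \<sigma> y = h y *\<^sub>R bent y + (1 - h y) *\<^sub>R model y"
  unfolding RU Rb Rm' by (simp add: algebra_simps)
qed

lemma Ck_Un: "Ck k S f ==> Ck k T f ==> Ck k (S \<union> T) f"
 by (induction k arbitrary: f) auto

lemma jet_ok_congruent:
 fixes \<Theta> :: "'a::euclidean_space \<times> real => 'a \<times> real"
 assumes j: "jet_ok K c 0 f y n" and S: "open S" "y \<in> S" "Ck 2 S f" "Ck 2 S U" and \<Theta>: "linear \<Theta>" "\<And>v. norm (\<Theta> v) = norm v" "\<And>v w. \<Theta> v \<bullet> \<Theta> w = v \<bullet> w"
  and DU: "\<And>v. D U y v = \<Theta> (D f y v)" and D2U: "\<And>v w. D2 U w y v = \<Theta> (D2 f w y v)"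
  and Uy: "norm (U y) \<le> K'" and KK: "K \<le> K'"
 shows "jet_ok K' c 0 U y (\<Theta> n)" and "\<Theta> n \<bullet> D2 U v y v = n \<bullet> D2 f v y v"
proof -
 show "\<Theta> n \<bullet> D2 U v y v = n \<bullet> D2 f v y v" by (simp add: D2U \<Theta>(3))
 have b: "bounded_jet K f y" and t: "transversal c f y n" and a: "almost_normal 0 f y n" using j by (auto simp: jet_ok_def)
 have "bounded_jet K' U y" unfolding bounded_jet_def
 proof (intro conjI allI Uy)
  show "norm (D U y v) \<le> K' * norm v" for v
   using b mult_right_mono[OF KK norm_ge_zero[of v]] unfolding bounded_jet_def DU \<Theta>(2) by (meson order_trans)
  show "norm (D2 U w y v) \<le> K' * norm v * norm w" for v w
  proof -
   have "norm (D2 U w y v) \<le> K * norm v * norm w" using b unfolding bounded_jet_def D2U \<Theta>(2) by blast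
   also have "\<dots> \<le> K' * norm v * norm w" using KK by (intro mult_right_mono) auto
   finally show ?thesis .
  qed
 qed (use S in blast)
 moreover have "transversal c U y (\<Theta> n)" unfolding transversal_def
 proof (intro conjI allI)
  show "norm (\<Theta> n) = 1" using t by (simp add: \<Theta>(2) transversal_def)
  show "c * norm (v, t) \<le> norm (D U y v + t *\<^sub>R \<Theta> n)" for v t
   using t unfolding transversal_def DU linear_scale[OF \<Theta>(1), symmetric] linear_add[OF \<Theta>(1), symmetric] \<Theta>(2) by blast
 qed
 moreover have "almost_normal 0 U y (\<Theta> n)" using a by (simp add: almost_normal_def DU \<Theta>(3))
 ultimately show "jet_ok K' c 0 U y (\<Theta> n)" by (simp add: jet_ok_def)
qed

lemma eventually_ge_pos:
 fixes g :: "'a::t2_space => real"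
 assumes "isCont g y" "0 < g y"
 shows "\<exists>t>0. \<forall>\<^sub>F z in nhds y. t \<le> g z"
proof -
 have "(g \<longlongrightarrow> g y) (nhds y)" using assms(1) unfolding isCont_def tendsto_at_iff_tendsto_nhds .
 from order_tendstoD(1)[OF this, of "g y / 2"] assms(2)
 have "\<forall>\<^sub>F z in nhds y. g y / 2 < g z" by simp
 hence "\<forall>\<^sub>F z in nhds y. g y / 2 \<le> g z" by (rule eventually_mono) simp
 thus ?thesis using assms(2) by (intro exI[of _ "g y / 2"]) simp
qed

text \<open>Gluing the two regions. On the sphere where the cap begins both reference normals are available,
 and they point to the same side.\<close>

lemma glue_regions:
 fixes F Fh :: "'a::euclidean_space => ('a \<times> real) \<times> real" and n0 :: "'a => 'a \<times> real"
 assumes iso: "tangent_isometry R p" and S: "S = ball 0 30" and U: "Ck 2 S U" and Fh: "Fh = (hsurf r U)"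
  and FF: "\<And>y. y \<in> S ==> lchart R p (F y) = Fh y"
  and n0c: "\<And>y. y \<in> cball 0 10 ==> isCont n0 y" and n0n: "\<And>y. y \<in> cball 0 10 ==> norm (n0 y) = 1"
  and cap: "\<And>y. y \<in> cball 0 10 ==> controlled S Fh y (n0 y) \<theta> PA"
  and cyl: "\<And>y. 10 < norm y ==> norm y < 30 ==> controlled S Fh y (y /\<^sub>R norm y, 0) 1 PB"
  and cross: "\<And>y. norm y = 10 ==> \<theta> < n0 y \<bullet> (y /\<^sub>R norm y, 0)"
 shows "\<exists>\<nu>'. unit_normal_field lor S (\<lambda>_. UNIV) (\<lambda>y. htangent (F y)) F \<nu>' \<and>
  (\<forall>y\<in>S. \<forall>m lam. principal_curvatures lor (\<lambda>_. UNIV) F \<nu>' y m lam --> PA m lam \<or> PB m lam)"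
proof -
 have oS: "open S" by (simp add: S)
 define N where "N y = (if norm y \<le> 10 then n0 y else (y /\<^sub>R norm y, 0))" for y :: 'a
 have nd: "\<nu> = 0" if "y \<in> S" "hnormal Fh y \<nu>" "fst \<nu> \<bullet> N y = 0" for y \<nu>
  using that controlledD(1)[OF cap, of y \<nu>] controlledD(1)[OF cyl, of y \<nu>] by (cases "norm y \<le> 10") (auto simp: N_def S)
 have nN: "norm (N y) \<le> 1" for y using n0n[of y] by (cases "y = 0") (auto simp: N_def norm_Pair)
 have side: "\<exists>\<theta>>0. \<exists>T. open T \<and> y \<in> T \<and> (\<forall>z\<in>T. z \<in> S --> \<theta> \<le> fst \<nu> \<bullet> N z)" if y: "y \<in> S" and gd: "good_normal Fh y (N y) \<nu>" for y \<nu>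
 proof -
  have ev1: "\<exists>t>0. \<forall>\<^sub>F z in nhds y. t \<le> fst \<nu> \<bullet> n0 z" if n: "norm y \<le> 10"
  proof -
   have p: "0 < fst \<nu> \<bullet> n0 y" using gd n by (simp add: good_normal_def N_def)
   have "isCont (\<lambda>z. fst \<nu> \<bullet> n0 z) y" using n0c[of y] n by (intro continuous_intros) auto
   from eventually_ge_pos[OF this p] show ?thesis .
  qed
  have ev2: "\<exists>t>0. \<forall>\<^sub>F z in nhds y. t \<le> fst \<nu> \<bullet> (z /\<^sub>R norm z, 0)" if n: "10 \<le> norm y"
  proof -
   have p: "0 < fst \<nu> \<bullet> (y /\<^sub>R norm y, 0)"
   proof (cases "norm y = 10")
    case True
    hence "norm (\<nu> - (n0 y, 0)) \<le> \<theta>" using gd by (intro controlledD(2)[OF cap]) (auto simp: N_def)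
    hence "norm (fst \<nu> - n0 y) \<le> \<theta>" using norm_fst_le[of "fst (\<nu> - (n0 y, 0))" "snd (\<nu> - (n0 y, 0))"]
     unfolding prod.collapse by simp
    moreover have "\<bar>(fst \<nu> - n0 y) \<bullet> (y /\<^sub>R norm y, 0)\<bar> \<le> norm (fst \<nu> - n0 y) * 1"
     using Cauchy_Schwarz_ineq2[of "fst \<nu> - n0 y" "(y /\<^sub>R norm y, 0)"] True by (simp add: norm_Pair)
    ultimately show ?thesis using cross[OF True] by (simp add: inner_diff_left)
   next
    case False
    thus ?thesis using gd n by (simp add: good_normal_def N_def)
   qed
   have "isCont (\<lambda>z. fst \<nu> \<bullet> (z /\<^sub>R norm z, 0)) y" using n by (intro continuous_intros) auto
   from eventually_ge_pos[OF this p] show ?thesis .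
  qed
  have "\<exists>t>0. \<forall>\<^sub>F z in nhds y. t \<le> fst \<nu> \<bullet> N z"
  proof (cases "norm y" "10 :: real" rule: linorder_cases)
   case less
   have "\<forall>\<^sub>F z in nhds y. z \<in> ball 0 10" by (rule eventually_nhds_in_open) (use less in auto)
   moreover obtain t where "t > 0" "\<forall>\<^sub>F z in nhds y. t \<le> fst \<nu> \<bullet> n0 z" using ev1 less by auto
   ultimately show ?thesis by (intro exI[of _ t] conjI) (auto elim: eventually_elim2 simp: N_def)
  next
   case greater
   have "\<forall>\<^sub>F z in nhds y. z \<in> - cball 0 10" by (rule eventually_nhds_in_open) (use greater in auto)
   moreover obtain t where "t > 0" "\<forall>\<^sub>F z in nhds y. t \<le> fst \<nu> \<bullet> (z /\<^sub>R norm z, 0)" using ev2 greater by auto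
   ultimately show ?thesis by (intro exI[of _ t] conjI) (auto elim: eventually_elim2 simp: N_def)
  next
   case equal
   obtain t where t: "t > 0" "\<forall>\<^sub>F z in nhds y. t \<le> fst \<nu> \<bullet> (z /\<^sub>R norm z, 0)" using ev2 equal by auto
   obtain t' where t': "t' > 0" "\<forall>\<^sub>F z in nhds y. t' \<le> fst \<nu> \<bullet> n0 z" using ev1 equal by auto
   have "\<forall>\<^sub>F z in nhds y. min t t' \<le> fst \<nu> \<bullet> N z"
    using t(2) t'(2) by (rule eventually_elim2) (simp add: N_def min_le_iff_disj)
   thus ?thesis using t(1) t'(1) by (intro exI[of _ "min t t'"]) simp
  qed
  then obtain t T where "t > 0" "open T" "y \<in> T" "\<forall>z\<in>T. t \<le> fst \<nu> \<bullet> N z" unfolding eventually_nhds by blast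
  thus ?thesis by (intro exI[of _ t] conjI) auto
 qed
 have "\<exists>\<nu>. \<forall>y\<in>S. \<nu> differentiable (at y) \<and> good_normal Fh y (N y) (\<nu> y)"
  by (rule global_normal[OF oS U Fh]) (rule nd nN side, assumption+ | rule nN)+
 then obtain \<nu> where d\<nu>: "\<And>y. y \<in> S ==> \<nu> differentiable (at y)" and gd: "\<And>y. y \<in> S ==> good_normal Fh y (N y) (\<nu> y)" by blast
 have hn: "hnormal Fh y (\<nu> y)" and un: "lor (\<nu> y) (\<nu> y) = 1" if "y \<in> S" for y using gd[OF that] by (auto simp: good_normal_def)
 have curv: "inj (D Fh y) \<and> (PA m lam \<or> PB m lam)" if y: "y \<in> S" and pc: "principal_curvatures lor (\<lambda>_. UNIV) Fh \<nu> y m lam" for y m lam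
 proof (cases "norm y \<le> 10")
  case True
  thus ?thesis using controlledD(3)[OF cap, of y \<nu> m lam] pc d\<nu>[OF y] hn gd[OF y] by (simp add: surface_curvatures_def N_def)
 next
  case False
  thus ?thesis using controlledD(3)[OF cyl, of y \<nu> m lam] pc d\<nu>[OF y] hn gd[OF y] y by (simp add: surface_curvatures_def N_def S)
 qed
 have inj: "inj (D Fh y)" if y: "y \<in> S" for y
  using curv[OF y, of 0 "\<lambda>_. 0"] by (simp add: principal_curvatures_def orthonormal_frame_def)
 have dF: "Fh differentiable (at y)" if "y \<in> S" for y
  unfolding Fh by (rule Ck2_differentiable(1)[OF oS expm_scaled_Ck[OF oS U] that])
 obtain \<nu>' where "unit_normal_field lor S (\<lambda>_. UNIV) (\<lambda>y. htangent (F y)) F \<nu>'"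
  "\<forall>y\<in>S. \<forall>m lam. principal_curvatures lor (\<lambda>_. UNIV) F \<nu>' y m lam --> principal_curvatures lor (\<lambda>_. UNIV) Fh \<nu> y m lam"
  using transport_normal[OF iso oS FF dF inj d\<nu> un hn] by blast
 thus ?thesis using curv by blast
qed

theorem lemma5p2:
 fixes \<tau> \<alpha>_in :: real
  and \<phi> :: "real \<Rightarrow> real"
  and cap :: "real \<Rightarrow> real \<Rightarrow> real \<Rightarrow> real \<times> real"
 assumes "DIM('a::euclidean_space) \<ge> 3"
  and "\<tau> \<in> tau_range DIM('a)"
  and "\<alpha>_in > 0"
  and "cutoff \<phi>"
  and "standard_cap TYPE('a) cap"
 shows "\<exists>B \<delta>\<^sub>0 \<epsilon>\<^sub>b (k\<^sub>b::nat) L\<^sub>b r\<^sub>b \<alpha> c\<^sub>b.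
  B > 1 \<and> 0 < \<delta>\<^sub>0 \<and> \<delta>\<^sub>0 < 1 \<and> closes_off TYPE('a) B \<delta>\<^sub>0 (cap B \<delta>\<^sub>0) \<and>
  \<epsilon>\<^sub>b > 0 \<and> k\<^sub>b \<ge> 2 \<and> L\<^sub>b \<ge> 40 \<and> r\<^sub>b > 0 \<and> 0 < \<alpha> \<and> \<alpha> \<le> \<alpha>_in \<and> c\<^sub>b > 0 \<and>
  (\<forall>\<epsilon> k L r (\<omega>\<^sub>0::'a) N \<nu> F.
   immersed_cylinder L N \<nu> \<and> neck_at \<omega>\<^sub>0 \<epsilon> k L r N \<and>
   standard_replacement B \<delta>\<^sub>0 \<phi> (cap B \<delta>\<^sub>0) \<omega>\<^sub>0 L r N F \<and>
   \<epsilon> \<le> \<epsilon>\<^sub>b \<and> k \<ge> k\<^sub>b \<and> L \<ge> L\<^sub>b \<and> r \<le> r\<^sub>b \<and>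
   (\<forall>x\<in>cyl L. \<forall>lam. principal_curvatures lor cyl_tangent (radial N) (radial \<nu>) x DIM('a) lam
     \<longrightarrow> pinched DIM('a) \<tau> \<alpha> lam)
   \<longrightarrow>
   (\<forall>\<sigma>\<in>{1, -1}. \<exists>\<nu>'.
    unit_normal_field lor changed_region (\<lambda>_. UNIV) (\<lambda>y. htangent (F \<sigma> y)) (F \<sigma>) \<nu>' \<and>
    (\<forall>y\<in>changed_region. \<forall>lam.
     principal_curvatures lor (\<lambda>_. UNIV) (F \<sigma>) \<nu>' y DIM('a) lam \<longrightarrow>
      pinched DIM('a) \<tau> \<alpha> lam \<and>
      (\<forall>i<DIM('a). \<forall>j<DIM('a). i \<noteq> j \<longrightarrow> P DIM('a) \<tau> lam i j \<ge> c\<^sub>b / r\<^sup>2) \<and>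
      mean_curv DIM('a) lam \<ge> c\<^sub>b / r)))"
proof -
 note n3 = assms(1) and \<tau> = assms(2) and \<alpha>_in = assms(3) and \<phi> = assms(4)
 obtain B1 \<delta>1 where \<delta>1: "0 < \<delta>1" and capc: "\<And>B \<delta>. B1 \<le> B ==> 0 < \<delta> ==> \<delta> \<le> \<delta>1 ==> closes_off TYPE('a) B \<delta> (cap B \<delta>)"
  using assms(5) unfolding standard_cap_def by blast
 define B where "B = max B1 2"
 have B: "B1 \<le> B" "2 \<le> B" by (auto simp: B_def)
 \<comment> \<open>Constants of the bent part of the neck; they do not depend on the bending parameter.\<close>
 obtain \<eta>0 \<kappa>1 \<rho>1 where \<eta>0: "0 < \<eta>0" and \<kappa>1: "0 < \<kappa>1" and \<rho>1: "0 < \<rho>1" and pB: "\<And>r lam. 0 < r \<and> r \<le> \<rho>1 \<and>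
   almost_two_convex \<eta>0 2 (1/4) DIM('a) (\<lambda>i. r * lam i) ==> pinched_at_scale DIM('a) \<tau> \<kappa>1 r lam"
  using pinching_at_scale[OF n3 \<tau>, of "1/4" 2] by auto
 obtain e0 r1 where e0: "0 < e0" and r1: "0 < r1" and cyl: "\<forall>(U :: 'a => 'a \<times> real) S \<sigma> t0 y r. open S \<and> 0 \<notin> S \<and> Ck 2 S U \<and> y \<in> S \<and>
  10 \<le> norm y \<and> norm y \<le> 30 \<and> \<sigma> \<in> {1, -1} \<and> norm t0 \<le> 3 \<and> bd 2 (\<lambda>z. U z + t0 - neckmap \<sigma> z) y e0 \<and> 0 < r \<and> r \<le> r1 -->
  controlled S (hsurf r U) y (y /\<^sub>R norm y, 0) 1 (\<lambda>m lam. almost_two_convex \<eta>0 2 (1/4) m (\<lambda>i. r * lam i))"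
  using near_cylinder[OF \<eta>0, where ?'a = 'a] by (elim exE conjE) (rule that)
 obtain Ca where Ca: "1 \<le> Ca" and ann: "\<forall>R (p :: ('a \<times> real) \<times> real) W a r \<epsilon> L \<nu>' \<sigma> B \<delta> s t e' Q h bent model.
  neck_chart R p W a r \<epsilon> L \<and> Ca * \<epsilon> \<le> 1 \<and>
  unit_normal_field lor (cyl L) cyl_tangent (\<lambda>_. htangent p) (radial W) (radial \<nu>') \<and>
  \<sigma> \<in> {1, -1} \<and> 1 \<le> B \<and> 0 \<le> \<delta> \<and> linear Q \<and> (\<forall>v. norm (Q v) = norm v) \<and>
  (\<forall>v. norm (Q v - v) \<le> t * norm v) \<and> 0 \<le> t \<and> norm s \<le> e' \<and> h = (\<lambda>y. \<phi> (40 - norm y)) \<and>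
  bent = bent_part R W a r \<nu>' \<sigma> B \<delta> \<and> model = model_part Q s \<sigma> B \<delta> -->
  (\<forall>k. Ck k annulus bent \<and> Ck k annulus model \<and> Ck k annulus h) \<and>
  (\<forall>y\<in>annulus. bd 2 (\<lambda>y. h y *\<^sub>R bent y + (1 - h y) *\<^sub>R model y) y (Ca * (\<epsilon> + \<delta> + t + e')))"
  using annulus_error[OF \<phi>, where ?'a = 'a] by (elim exE conjE) (rule that)
 \<comment> \<open>Each of the four contributions to the error in the annulus gets a quarter of the total.\<close>
 define e4 where "e4 = e0 / (4 * Ca)"
 have e4: "0 < e4" "Ca * (e4 + e4 + e4 + e4) \<le> e0" using e0 Ca by (auto simp: e4_def)
 define \<delta> where "\<delta> = min \<delta>1 (min (1/2) e4)"
 have \<delta>: "0 < \<delta>" "\<delta> \<le> \<delta>1" "\<delta> \<le> 1/2" "\<delta> \<le> e4" using \<delta>1 e4 by (auto simp: \<delta>_def)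
 have co: "closes_off TYPE('a) B \<delta> (cap B \<delta>)" by (rule capc[OF B(1) \<delta>(1,2)])
 \<comment> \<open>The constants of the cap depend on \<open>\<delta>\<close>, which is fixed by now.\<close>
 define Kf where "Kf = (revolve (profile B \<delta> (cap B \<delta>)) :: 'a => 'a \<times> real)"
 obtain \<nu>0 where smK: "smooth_on (ball 0 40) Kf" and un0: "unit_normal_field (\<bullet>) (cball 0 10) (\<lambda>_. UNIV) (\<lambda>_. UNIV) Kf \<nu>0"
  and cv0: "\<And>y v. y \<in> cball 0 10 ==> v \<noteq> 0 ==> second_form (\<bullet>) Kf \<nu>0 y v v > 0"
  using co unfolding closes_off_def Let_def Kf_def by auto
 have KC: "Ck k (ball 0 40) Kf" for k using smooth_on_Ck[OF smK] .
 obtain K c \<kappa> where K: "1 \<le> K" and c: "0 < c" "c \<le> 1" and \<kappa>: "0 < \<kappa>" and cd: "\<And>y. y \<in> cball 0 10 ==>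
   jet_ok K c 0 Kf y (\<nu>0 y) \<and> (\<forall>v. \<kappa> * (norm v)\<^sup>2 \<le> - (\<nu>0 y \<bullet> D2 Kf v y v))
    \<and> (\<forall>v. second_form (\<bullet>) Kf \<nu>0 y v v = - (\<nu>0 y \<bullet> D2 Kf v y v))"
  by (rule cap_data[OF _ _ _ KC un0 cv0]) auto
 have d0: "\<nu>0 differentiable (at y)" and o0: "\<nu>0 y \<bullet> D Kf y v = 0" and dK: "Kf differentiable (at y)" if "y \<in> cball 0 10" for y v
  using un0 that unfolding unit_normal_field_def by auto
 have cross0: "\<kappa> * 10\<^sup>2 \<le> \<nu>0 y \<bullet> (y /\<^sub>R norm y, 0)" if y: "norm y = 10" for y
 proof (rule cap_boundary_normal[where q = "1 - \<delta> * bend B 30" and h = 30 and Kf = Kf])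
  have b: "0 \<le> bend B 30" "bend B 30 \<le> 1" using bend_bd(3,4)[of B 30] B by auto
  have "\<delta> * bend B 30 \<le> 1/2 * 1" using \<delta> b by (intro mult_mono) auto
  thus "0 < 1 - \<delta> * bend B 30" "1 - \<delta> * bend B 30 \<le> 1" using b \<delta> by auto
  show "Kf z = (((1 - \<delta> * bend B 30) / 10) *\<^sub>R z, 30)" if "norm z = 10" for z
   using that by (simp add: Kf_def revolve_def profile_def)
  show "\<kappa> * (norm v)\<^sup>2 \<le> second_form (\<bullet>) Kf \<nu>0 y v v" for v
  proof -
   have "y \<in> cball 0 10" using y by simp
   from cd[OF this] have "\<kappa> * (norm v)\<^sup>2 \<le> - (\<nu>0 y \<bullet> D2 Kf v y v)"
    and e: "second_form (\<bullet>) Kf \<nu>0 y v v = - (\<nu>0 y \<bullet> D2 Kf v y v)" by blast+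
   thus ?thesis by (simp only: e)
  qed
 qed (use n3 y d0 o0 dK \<kappa> in auto)
 \<comment> \<open>The cap is moved by a translation of length at most 50 in the rescaled coordinates.\<close>
 define K' where "K' = K + 60"
 have K': "1 \<le> K'" "K \<le> K'" using K by (auto simp: K'_def)
 obtain r2 where r2: "0 < r2" and capn: "\<forall>(U :: 'a => 'a \<times> real) S y n r. open S \<and> Ck 2 S U \<and> y \<in> S \<and> jet_ok K' c 0 U y n \<and>
  (\<forall>v. \<kappa> * (norm v)\<^sup>2 \<le> - (n \<bullet> D2 U v y v)) \<and> 0 < r \<and> r \<le> r2 -->
  controlled S (hsurf r U) y n (25 * \<kappa>) (\<lambda>m lam. \<forall>i<m. \<kappa> / (8 * K'\<^sup>2) \<le> r * lam i \<and> r * lam i \<le> 4 * K' / c\<^sup>2 + 1)"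
 proof -
  have "0 < 25 * \<kappa>" using \<kappa> by simp
  from near_cap[OF K'(1) c \<kappa> this, where ?'a = 'a] show thesis by (elim exE conjE) (rule that)
 qed
 define c0 where "c0 = min 1 (\<kappa> / (8 * K'\<^sup>2))"
 have "0 < K'\<^sup>2" using K' by simp
 hence c0: "0 < c0" "c0 \<le> \<kappa> / (8 * K'\<^sup>2)" "c0 \<le> 4 * K' / c\<^sup>2 + 1" using \<kappa> K' c by (auto simp: c0_def intro: min.coboundedI1)
 obtain \<eta>2 \<kappa>2 \<rho>2 where \<eta>2: "0 < \<eta>2" and \<kappa>2: "0 < \<kappa>2" and \<rho>2: "0 < \<rho>2" and pA: "\<And>r lam. 0 < r \<and> r \<le> \<rho>2 \<and>
   almost_two_convex \<eta>2 (4 * K' / c\<^sup>2 + 1) c0 DIM('a) (\<lambda>i. r * lam i) ==> pinched_at_scale DIM('a) \<tau> \<kappa>2 r lam"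
  using pinching_at_scale[OF n3 \<tau> c0(1,3)] by auto
 \<comment> \<open>The size of the neck error is chosen last.\<close>
 define e' where "e' = min 1 (min e4 (50 * \<kappa>))"
 have e': "0 < e'" "e' \<le> 1" "e' \<le> e4" "e' \<le> 50 * \<kappa>" using e4 \<kappa> by (auto simp: e'_def)
 obtain \<epsilon>1 where \<epsilon>1: "0 < \<epsilon>1" and fit: "\<forall>R (p :: ('a \<times> real) \<times> real) W a r \<epsilon> L A. neck_chart R p W a r \<epsilon> L \<and> \<epsilon> \<le> \<epsilon>1 \<and> best_cylinder p r W A -->
  norm (neck_chart.shift R W a r) \<le> e' \<and> linear (\<lambda>v. R (A v)) \<and> (\<forall>v. norm (R (A v)) = norm v) \<and>
  (\<forall>v. norm (R (A v) - v) \<le> e' * norm v)"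
  using best_fit_close[OF e'(1,2), where ?'a = 'a] by blast
 define \<epsilon>b where "\<epsilon>b = min \<epsilon>1 (min e4 (1 / Ca))"
 have \<epsilon>b: "0 < \<epsilon>b" using \<epsilon>1 e4 Ca by (simp add: \<epsilon>b_def)
 define rb where "rb = min (min \<rho>1 \<rho>2) (min r1 r2)"
 define \<alpha> where "\<alpha> = min \<alpha>_in (min \<kappa>1 \<kappa>2)"
 define cb where "cb = min \<kappa>1 \<kappa>2"
 have pos: "0 < rb" "0 < \<alpha>" "\<alpha> \<le> \<alpha>_in" "0 < cb" using \<rho>1 \<rho>2 r1 r2 \<alpha>_in \<kappa>1 \<kappa>2 by (auto simp: rb_def \<alpha>_def cb_def)
 have main: "\<exists>\<nu>'.
    unit_normal_field lor changed_region (\<lambda>_. UNIV) (\<lambda>y. htangent (F \<sigma> y)) (F \<sigma>) \<nu>' \<and>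
    (\<forall>y\<in>changed_region. \<forall>lam.
     principal_curvatures lor (\<lambda>_. UNIV) (F \<sigma>) \<nu>' y DIM('a) lam -->
      pinched DIM('a) \<tau> \<alpha> lam \<and>
      (\<forall>i<DIM('a). \<forall>j<DIM('a). i \<noteq> j --> P DIM('a) \<tau> lam i j \<ge> cb / r\<^sup>2) \<and>
      mean_curv DIM('a) lam \<ge> cb / r)"
  if im: "immersed_cylinder L N \<nu>" and nk: "neck_at \<omega>\<^sub>0 \<epsilon> k L r N"
   and sr: "standard_replacement B \<delta> \<phi> (cap B \<delta>) \<omega>\<^sub>0 L r N F"
   and \<epsilon>: "\<epsilon> \<le> \<epsilon>b" and k: "3 \<le> k" and L: "40 \<le> L" and rb: "r \<le> rb" and \<sigma>: "\<sigma> \<in> {1, -1}"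
  for \<epsilon> k L r and \<omega>\<^sub>0 :: 'a and N \<nu> F and \<sigma> :: real
 proof -
  define p where "p = N (\<omega>\<^sub>0, 0)"
  define W where "W = (\<lambda>x. hlog p (N x))"
  define G0 where "G0 \<nu>' A = replaced_half \<phi> W r A \<nu>' \<sigma> B \<delta> (cap B \<delta>)" for \<nu>' A
  obtain \<nu>' A where un: "unit_normal_field lor (cyl L) cyl_tangent (\<lambda>_. htangent p) (radial W) (radial \<nu>')"
   and A: "best_cylinder p r W A" and F: "\<And>y. y \<in> ball 0 40 ==> F \<sigma> y = hexp p (G0 \<nu>' A y)"
  proof -
   have "\<exists>\<nu>' A. unit_normal_field lor (cyl L) cyl_tangent (\<lambda>_. htangent p) (radial W) (radial \<nu>') \<and>
    best_cylinder p r W A \<and> (\<forall>y\<in>ball 0 40. F \<sigma> y = hexp p (G0 \<nu>' A y))"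
    using sr[unfolded standard_replacement_def Let_def, folded p_def] \<sigma> unfolding G0_def replaced_half_def Let_def W_def by blast
   thus thesis using that by blast
  qed
  define G where "G = G0 \<nu>' A"
  note G = G_def[unfolded G0_def]
  obtain R a where nc: "neck_chart R p W a r \<epsilon> L" and a: "norm a \<le> 1 + \<epsilon>"
   using neck_chart_of_neck[OF im nk k L, of \<nu>'] un unfolding p_def W_def by blast
  interpret neck_chart R p W a r \<epsilon> L by (rule nc)
  have \<epsilon>s: "\<epsilon> \<le> \<epsilon>1" "\<epsilon> \<le> e4" "\<epsilon> \<le> 1" "Ca * \<epsilon> \<le> 1"
  proof -
   show "\<epsilon> \<le> \<epsilon>1" "\<epsilon> \<le> e4" using \<epsilon> by (auto simp: \<epsilon>b_def)
   have "\<epsilon> \<le> 1 / Ca" using \<epsilon> by (auto simp: \<epsilon>b_def)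
   thus "Ca * \<epsilon> \<le> 1" using Ca by (simp add: pos_le_divide_eq mult.commute)
   moreover have "1 * \<epsilon> \<le> Ca * \<epsilon>" using Ca \<epsilon>_nonneg by (intro mult_right_mono)
   ultimately show "\<epsilon> \<le> 1" by linarith
  qed
  have rs: "r \<le> \<rho>1" "r \<le> \<rho>2" "r \<le> r1" "r \<le> r2" using rb by (auto simp: rb_def)
  have rad: "radial f x = f x" if "x \<in> cyl L" for f :: "'a \<times> real => 'z" and x
   using cylmap_id[OF that] by (simp add: radial_def cylmap_def case_prod_beta)
  have \<nu>'t: "\<forall>x\<in>cyl L. \<nu>' x \<in> htangent p"
  proof
   fix x :: "'a \<times> real" assume x: "x \<in> cyl L"
   hence "radial \<nu>' x \<in> htangent p" using un unfolding unit_normal_field_def by blast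
   thus "\<nu>' x \<in> htangent p" by (simp only: rad[OF x])
  qed
  have Af: "linear A" "range A \<subseteq> htangent p" using A unfolding best_cylinder_def cylinder_frame_def by blast+
  define Q where "Q = (\<lambda>v. R (A v))"
  define s where "s = neck_chart.shift R W a r"
  define h where "h = (\<lambda>y :: 'a. \<phi> (40 - norm y))"
  define U where "U = (\<lambda>y. R (G y) /\<^sub>R r)"
  define bent where "bent = bent_part R W a r \<nu>' \<sigma> B \<delta>"
  define model where "model = model_part Q s \<sigma> B \<delta>"
  note rf = replacement_formula[OF nc Af \<phi> \<sigma> \<nu>'t G Q_def s_def h_def U_def Kf_def bent_def model_def]
  have fq: "norm s \<le> e' \<and> linear Q \<and> (\<forall>v. norm (Q v) = norm v) \<and> (\<forall>v. norm (Q v - v) \<le> e' * norm v)"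
   unfolding s_def Q_def by (rule fit[rule_format]) (use nc \<epsilon>s(1) A in blast)
  hence s: "norm s \<le> e'" and Q: "linear Q" "\<And>v. norm (Q v) = norm v" "\<And>v. norm (Q v - v) \<le> e' * norm v" by blast+
  define \<Theta> where "\<Theta> v = Q (fst v, - \<sigma> * snd v)" for v :: "'a \<times> real"
  have \<sigma>2: "\<sigma> * \<sigma> = 1" "\<sigma>\<^sup>2 = 1" "\<bar>\<sigma>\<bar> = 1" using \<sigma> by auto
  have \<Theta>l: "linear \<Theta>" unfolding \<Theta>_def[abs_def]
   by (rule linear_compose[OF _ Q(1), unfolded comp_def]) (auto intro!: linearI simp: algebra_simps)
  have fl: "norm (fst v, - \<sigma> * snd v) = norm v" for v :: "'a \<times> real" using \<sigma>2 by (simp add: norm_prod_def power_mult_distrib)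
  have \<Theta>n: "norm (\<Theta> v) = norm v" for v unfolding \<Theta>_def Q(2) fl ..
  have \<Theta>i: "\<Theta> v \<bullet> \<Theta> w = v \<bullet> w" for v w
   using \<Theta>l \<Theta>n orthogonal_transformation[of \<Theta>] unfolding orthogonal_transformation_def by blast
  have \<Theta>b: "bounded_linear \<Theta>" using \<Theta>l linear_conv_bounded_linear by blast
  define \<tau>0 where "\<tau>0 = s - a + Q (0, 40 * \<sigma>)"
  define S1 where "S1 = (annulus :: 'a set)"
  note S1_def = S1_def[unfolded annulus_def]
  have oS1: "open S1" unfolding S1_def by (intro open_Collect_conj open_Collect_less continuous_intros)
  have an: "(\<forall>k. Ck k annulus bent \<and> Ck k annulus model \<and> Ck k annulus h) \<and>
   (\<forall>y\<in>annulus. bd 2 (\<lambda>y. h y *\<^sub>R bent y + (1 - h y) *\<^sub>R model y) y (Ca * (\<epsilon> + \<delta> + e' + e')))"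
   by (rule ann[rule_format, where p = p and B = B]) (use nc \<epsilon>s un \<sigma> B(2) \<delta>(1) Q s e' h_def bent_def model_def in auto)
  note an = an[unfolded annulus_def, folded S1_def]
  define f1 where "f1 y = h y *\<^sub>R (bent y - model y)" for y
  have f1C: "Ck k S1 f1" for k unfolding f1_def[abs_def] using an by (intro Ck_scaleR[OF oS1] Ck_diff_fun[OF oS1]) auto
  have h0: "h y = 0" if "norm y \<le> 10" for y using \<phi> that by (simp add: h_def cutoff_def)
  define P0 where "P0 y = \<tau>0 + \<Theta> (Kf y)" for y
  have U1: "U y = P0 y + f1 y" if "y \<in> S1" for y
  proof (cases "norm y \<le> 10")
   case True
   thus ?thesis using rf(2)[OF True] h0[OF True] by (simp add: P0_def \<tau>0_def \<Theta>_def f1_def)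
  next
   case False
   thus ?thesis using rf(3)[of y] that by (simp add: P0_def \<tau>0_def \<Theta>_def f1_def S1_def)
  qed
  have U0: "U y = P0 y + 0" if "y \<in> ball 0 10" for y using rf(2)[of y] that by (simp add: P0_def \<tau>0_def \<Theta>_def)
  have b40: "open (ball (0::'a) 40)" by simp
  have P0C: "Ck k (ball 0 40) P0" for k unfolding P0_def[abs_def] by (intro Ck_add[OF b40] Ck_const Ck_blin[OF b40 \<Theta>b KC])
  have UC: "Ck k (ball 0 30) U" for k
  proof -
   have "Ck k (ball 0 10) U"
    by (rule Ck_cong[OF _ Ck_subset[OF P0C]]) (use U0 in auto)
   moreover have "Ck k S1 U"
    by (rule Ck_cong[OF oS1 Ck_add[OF oS1 Ck_subset[OF P0C] f1C]]) (use U1 in \<open>auto simp: S1_def\<close>)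
   moreover have "ball 0 10 \<union> S1 = ball 0 30" by (auto simp: S1_def)
   ultimately show ?thesis using Ck_Un by metis
  qed
  have jets: "D U y v = \<Theta> (D Kf y v) \<and> D2 U w y v = \<Theta> (D2 Kf w y v)"
   if T: "open T" "y \<in> T" "T \<subseteq> ball 0 40" and f: "Ck 2 T f" "bd 2 f y 0" and Uf: "\<And>z. z \<in> T ==> U z = P0 z + f z" for T y f v w
  proof -
   have DP: "D P0 z v = \<Theta> (D Kf z v)" if "z \<in> ball 0 40" for z v
    using D_add[OF differentiable_const D_bounded_linear(2)[OF \<Theta>b Ck_diff[OF KC that]], of \<tau>0 v]
     D_bounded_linear(1)[OF \<Theta>b Ck_diff[OF KC that], of v] by (simp add: P0_def[abs_def])
   note P2 = Ck_subset[OF P0C T(3), of 2] and K2 = Ck_subset[OF KC T(3), of 2]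
   have DU: "D U z v = D P0 z v + D f z v" if z: "z \<in> T" for z v
    using D_cong[OF T(1) z Uf] D_add[OF Ck2_differentiable(1)[OF T(1) P2 z] Ck2_differentiable(1)[OF T(1) f(1) z], of v] by simp
   have DDU: "D2 U w y v = D2 P0 w y v + D2 f w y v"
   proof -
    have "D2 U w y = D (\<lambda>z. D P0 z w + D f z w) y" by (rule D_cong[OF T(1,2)]) (rule DU)
    thus ?thesis using D_add[OF Ck2_differentiable(2)[OF T(1) P2 T(2)] Ck2_differentiable(2)[OF T(1) f(1) T(2)], of w w v] by simp
   qed
   have "D2 P0 w y v = \<Theta> (D2 Kf w y v)"
   proof -
    have "D2 P0 w y = D (\<lambda>z. \<Theta> (D Kf z w)) y" by (rule D_cong[OF T(1,2)]) (use DP T(3) in blast)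
    thus ?thesis using D_bounded_linear(1)[OF \<Theta>b Ck2_differentiable(2)[OF T(1) K2 T(2)], of w v] by simp
   qed
   moreover have "D f y v = 0" "D2 f w y v = 0"
    using bd2_jet(2)[OF T(1,2) f, of v] bd2_jet(3)[OF T(1,2) f, of w v] by simp_all
   ultimately show ?thesis using DU[OF T(2)] DDU DP[of y] T(2,3) by auto
  qed
  have jet: "D U y v = \<Theta> (D Kf y v)" "D2 U w y v = \<Theta> (D2 Kf w y v)" if y: "y \<in> cball 0 10" for y v w
  proof -
   have "D U y v = \<Theta> (D Kf y v) \<and> D2 U w y v = \<Theta> (D2 Kf w y v)"
   proof (cases "norm y < 10")
    case True
    show ?thesis by (rule jets[of "ball 0 10" y "\<lambda>_. 0"]) (use True U0 in \<open>auto intro: Ck_const bd_zero\<close>)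
   next
    case False
    hence y10: "norm y = 10" using y by simp
    hence yS: "y \<in> S1" by (simp add: S1_def)
    \<comment> \<open>The correction vanishes on the inner side of this sphere, hence to second order on it.\<close>
    have "y \<in> closure {z. 9 < norm z \<and> norm z < 10}" unfolding closure_approachable
    proof (intro allI impI)
     fix e :: real assume e: "0 < e"
     define t where "t = min (1/20) (e/20)"
     have t: "0 < t" "t \<le> 1/20" "t \<le> e/20" using e by (auto simp: t_def)
     have "norm ((1 - t) *\<^sub>R y) = (1 - t) * 10" using t y10 by simp
     moreover have "dist ((1 - t) *\<^sub>R y) y = t * 10" using t y10 by (simp add: dist_norm scaleR_diff_left)
     ultimately show "\<exists>z\<in>{z. 9 < norm z \<and> norm z < 10}. dist z y < e"
      using t e by (intro bexI[of _ "(1 - t) *\<^sub>R y"]) auto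
    qed
    hence "bd 2 f1 y 0"
     by (rule bd_zero_closure[OF oS1 f1C, rotated 4])
      (auto simp: S1_def f1_def h0 y10 intro!: open_Collect_conj open_Collect_less continuous_intros)
    thus ?thesis by (intro jets[of S1 y f1] oS1 yS f1C U1) (auto simp: S1_def)
   qed
   thus "D U y v = \<Theta> (D Kf y v)" "D2 U w y v = \<Theta> (D2 Kf w y v)" by blast+
  qed
  \<comment> \<open>The normal of the cap, with product at least \<open>100 * \<kappa>\<close> with the outward direction where the cap begins; the
   rotation may change it by \<open>50 * \<kappa>\<close>, the ambient curvature by \<open>25 * \<kappa>\<close>.\<close>
  define n0 where "n0 y = \<Theta> (\<nu>0 y)" for y
  have nu1: "norm (\<nu>0 y) = 1" if "y \<in> cball 0 10" for y using cd[OF that] by (simp add: jet_ok_def transversal_def)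
  have Uy: "norm (U y) \<le> K'" if y: "y \<in> cball 0 10" for y
  proof -
   have "norm (Kf y) \<le> K" using cd[OF y] by (simp add: jet_ok_def bounded_jet_def)
   moreover have "norm (s - a) \<le> 1 + 2" using norm_triangle_ineq4[of s a] s a e' \<epsilon>s by linarith
   moreover have "norm (Q (0, 40 * \<sigma>)) = 40" unfolding Q(2) using \<sigma>2 by (simp add: norm_Pair abs_mult)
   moreover have "norm (U y) = norm ((s - a) + Q (0, 40 * \<sigma>) + \<Theta> (Kf y))" using rf(2)[of y] y by (simp add: \<Theta>_def)
   ultimately show ?thesis
    using norm_triangle_ineq[of "(s - a) + Q (0, 40 * \<sigma>)" "\<Theta> (Kf y)"] norm_triangle_ineq[of "s - a" "Q (0, 40 * \<sigma>)"] \<Theta>n[of "Kf y"]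
    unfolding K'_def by linarith
  qed
  have cj: "jet_ok K' c 0 U y (n0 y)" "\<kappa> * (norm v)\<^sup>2 \<le> - (n0 y \<bullet> D2 U v y v)" if y: "y \<in> cball 0 10" for y v
  proof -
   have yb: "y \<in> ball 0 30" using y by auto
   note jc = jet_ok_congruent[OF conjunct1[OF cd[OF y]] open_ball yb Ck_subset[OF KC] UC \<Theta>l \<Theta>n \<Theta>i jet[OF y] Uy[OF y] K'(2)]
   show "jet_ok K' c 0 U y (n0 y)" unfolding n0_def by (rule jc(1)) auto
   have "n0 y \<bullet> D2 U v y v = \<nu>0 y \<bullet> D2 Kf v y v" unfolding n0_def by (rule jc(2)) auto
   thus "\<kappa> * (norm v)\<^sup>2 \<le> - (n0 y \<bullet> D2 U v y v)" using cd[OF y] by simp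
  qed
  define Fh where "Fh = (hsurf r U)"
  define PA where "PA m lam \<longleftrightarrow> (\<forall>i<m. \<kappa> / (8 * K'\<^sup>2) \<le> r * lam i \<and> r * lam i \<le> 4 * K' / c\<^sup>2 + 1)" for m :: nat and lam
  define PB where "PB m lam \<longleftrightarrow> almost_two_convex \<eta>0 2 (1/4) m (\<lambda>i. r * lam i)" for m :: nat and lam
  have capf: "controlled (ball 0 30) Fh y (n0 y) (25 * \<kappa>) PA" if y: "y \<in> cball 0 10" for y
   unfolding Fh_def PA_def[abs_def]
  proof (rule capn[rule_format])
   show "open (ball 0 30) \<and> Ck 2 (ball 0 30) U \<and> y \<in> ball 0 30 \<and> jet_ok K' c 0 U y (n0 y) \<and>
    (\<forall>v. \<kappa> * (norm v)\<^sup>2 \<le> - (n0 y \<bullet> D2 U v y v)) \<and> 0 < r \<and> r \<le> r2"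
    using UC cj[OF y] r rs y by auto
  qed
  have cylf: "controlled (ball 0 30) Fh y (y /\<^sub>R norm y, 0) 1 PB" if y: "10 < norm y" "norm y < 30" for y
  proof -
   have "controlled (ball 0 30 - {0}) Fh y (y /\<^sub>R norm y, 0) 1 PB"
   unfolding Fh_def PB_def[abs_def]
  proof (rule cyl[rule_format])
   define T where "T = {y :: 'a. 10 < norm y \<and> norm y < 30}"
   have oT: "open T" unfolding T_def by (intro open_Collect_conj open_Collect_less continuous_intros)
   have "bd 2 (\<lambda>z. U z + a - neckmap \<sigma> z) y (Ca * (\<epsilon> + \<delta> + e' + e'))"
   proof -
    have "y \<in> S1" using y by (simp add: S1_def)
    with an have "bd 2 (\<lambda>y. h y *\<^sub>R bent y + (1 - h y) *\<^sub>R model y) y (Ca * (\<epsilon> + \<delta> + e' + e'))" by blast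
    thus ?thesis by (rule bd_cong[OF oT, rotated]) (use y rf(4) in \<open>auto simp: T_def\<close>)
   qed
   moreover have "Ca * (\<epsilon> + \<delta> + e' + e') \<le> Ca * (e4 + e4 + e4 + e4)" using \<epsilon>s \<delta> e' Ca by (intro mult_left_mono add_mono) auto
   ultimately have "bd 2 (\<lambda>z. U z + a - neckmap \<sigma> z) y e0" using e4(2) bd_mono by (meson order_trans)
   moreover have "norm a \<le> 3" using a \<epsilon>s by linarith
   moreover have "Ck 2 (ball 0 30 - {0}) U" by (rule Ck_subset[OF UC]) auto
   ultimately show "open (ball 0 30 - {0 :: 'a}) \<and> 0 \<notin> ball 0 30 - {0 :: 'a} \<and> Ck 2 (ball 0 30 - {0}) U \<and> y \<in> ball 0 30 - {0} \<and>
    10 \<le> norm y \<and> norm y \<le> 30 \<and> \<sigma> \<in> {1, -1} \<and> norm a \<le> 3 \<and> bd 2 (\<lambda>z. U z + a - neckmap \<sigma> z) y e0 \<and> 0 < r \<and> r \<le> r1"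
    using y r rs \<sigma> by (auto simp: open_delete)
   qed
   thus ?thesis unfolding controlled_def surface_curvatures_def by blast
  qed
  have "\<exists>\<nu>'. unit_normal_field lor (ball 0 30) (\<lambda>_. UNIV) (\<lambda>y. htangent (F \<sigma> y)) (F \<sigma>) \<nu>' \<and>
   (\<forall>y\<in>ball 0 30. \<forall>m lam. principal_curvatures lor (\<lambda>_. UNIV) (F \<sigma>) \<nu>' y m lam --> PA m lam \<or> PB m lam)"
  proof (rule glue_regions[OF iso HOL.refl UC Fh_def, where ?n0.0 = n0 and \<theta> = "25 * \<kappa>"])
   show "lchart R p (F \<sigma> y) = Fh y" if "y \<in> ball 0 30" for y
   proof -
    have y: "y \<in> ball 0 40" using that by auto
    have "lchart R p (hexp p (G y)) = expm (R (G y))" by (rule lchart_hexp[OF iso rf(1)[OF y]])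
    thus ?thesis using F[OF y] r by (simp add: G_def Fh_def U_def)
   qed
   show "isCont n0 y" if "y \<in> cball 0 10" for y unfolding n0_def
    by (rule bounded_linear.isCont[OF \<Theta>b]) (use d0[OF that] differentiable_imp_continuous_within in blast)
   show "norm (n0 y) = 1" if "y \<in> cball 0 10" for y using nu1[OF that] by (simp add: n0_def \<Theta>n)
   show "25 * \<kappa> < n0 y \<bullet> (y /\<^sub>R norm y, 0)" if y: "norm y = 10" for y
   proof -
    define w where "w = (fst (\<nu>0 y), - \<sigma> * snd (\<nu>0 y))"
    have w: "norm w = 1" unfolding w_def fl using nu1[of y] y by simp
    have "\<bar>(Q w - w) \<bullet> (y /\<^sub>R norm y, 0)\<bar> \<le> norm (Q w - w) * 1"
     using Cauchy_Schwarz_ineq2[of "Q w - w" "(y /\<^sub>R norm y, 0)"] y by (simp add: norm_Pair)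
    also have "\<dots> \<le> e'" using Q(3)[of w] w by simp
    finally have qw: "\<bar>(Q w - w) \<bullet> (y /\<^sub>R norm y, 0)\<bar> \<le> e'" .
    have "w \<bullet> (y /\<^sub>R norm y, 0) - e' \<le> n0 y \<bullet> (y /\<^sub>R norm y, 0)"
    proof -
     have "n0 y = Q w" unfolding n0_def \<Theta>_def w_def ..
     thus ?thesis using qw by (simp add: inner_diff_left abs_le_iff)
    qed
    moreover have "w \<bullet> (y /\<^sub>R norm y, 0) = \<nu>0 y \<bullet> (y /\<^sub>R norm y, 0)" by (simp add: w_def inner_prod_def)
    ultimately show ?thesis using cross0[OF y] e'(4) \<kappa> by simp
   qed
  qed (use capf cylf in blast)+
  then obtain \<nu>'' where \<nu>'': "unit_normal_field lor (ball 0 30) (\<lambda>_. UNIV) (\<lambda>y. htangent (F \<sigma> y)) (F \<sigma>) \<nu>''"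
   and AB: "\<And>y lam. y \<in> ball 0 30 ==> principal_curvatures lor (\<lambda>_. UNIV) (F \<sigma>) \<nu>'' y DIM('a) lam ==> PA DIM('a) lam \<or> PB DIM('a) lam" by blast
  have cr: "changed_region = ball (0 :: 'a) 30" by (auto simp: changed_region_def)
  have conc: "pinched DIM('a) \<tau> \<alpha> lam \<and>
      (\<forall>i<DIM('a). \<forall>j<DIM('a). i \<noteq> j --> P DIM('a) \<tau> lam i j \<ge> cb / r\<^sup>2) \<and>
      mean_curv DIM('a) lam \<ge> cb / r" if AB: "PA DIM('a) lam \<or> PB DIM('a) lam" for lam
  proof -
   obtain \<kappa> where \<kappa>: "\<kappa> \<in> {\<kappa>1, \<kappa>2}" and p: "pinched_at_scale DIM('a) \<tau> \<kappa> r lam"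
    using AB
   proof
    assume A: "PA DIM('a) lam"
    hence "almost_two_convex \<eta>2 (4 * K' / c\<^sup>2 + 1) c0 DIM('a) (\<lambda>i. r * lam i)"
     using c0 \<eta>2 unfolding PA_def almost_two_convex_def by (smt (verit))
    thus thesis using that pA[of r lam] r rs by blast
   next
    assume "PB DIM('a) lam"
    thus thesis using that pB[of r lam] r rs unfolding PB_def by blast
   qed
   have "cb / r \<le> \<kappa> / r" "cb / r\<^sup>2 \<le> \<kappa> / r\<^sup>2" "0 < \<alpha> \<and> \<alpha> \<le> \<kappa>"
    using \<kappa> r pos by (auto simp: cb_def \<alpha>_def intro!: divide_right_mono)
   thus ?thesis using p unfolding pinched_at_scale_def by (meson order_trans)
  qed
  show ?thesis unfolding cr using \<nu>'' AB conc by blast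
 qed
 \<comment> \<open>Three derivatives of the neck are used, since the bending normal contains one.\<close>
 show ?thesis
 proof (rule exI[of _ B], rule exI[of _ \<delta>], rule exI[of _ \<epsilon>b], rule exI[of _ 3], rule exI[of _ 40], rule exI[of _ rb],
   rule exI[of _ \<alpha>], rule exI[of _ cb], intro conjI)
  show "1 < B" "0 < \<delta>" "\<delta> < 1" "closes_off TYPE('a) B \<delta> (cap B \<delta>)" "0 < \<epsilon>b" "(2::nat) \<le> 3" "(40::real) \<le> 40" "0 < rb" "0 < \<alpha>" "\<alpha> \<le> \<alpha>_in" "0 < cb"
   using B \<delta> co \<epsilon>b pos by auto
 qed (intro allI impI ballI, elim conjE, rule main)
qed

end
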